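(* Let $\eta$ be a Poisson process on a Polish space $(\mathbb{X},\mathcal{X})$ with locally finite, non-atomic intensity measure $\lambda$. Let $F:\mathbf{N}\to\mathbb{R}$ be measurable with $0<\mathbb{E}[F(\eta)^2]<\infty$, and let $\gamma_F$ be its spectral point process. Assume that for some integer $m\ge1$ and some measurable set $C\subseteq\mathbb{X}$, $$\int_{C^m}\mathbb{E}\big[(D^m_{x_1,\dots,x_m}F(\eta))^2\big]\,\lambda^m(\mathrm{d}x_1,\dots,\mathrm{d}x_m)<\infty .$$ Then for all integers $1\le\ell\le m$ and all measurable and bounded $h:C^\ell\to\mathbb{R}_+$, $$\begin{aligned}\mathbb{E}[F^2]\;\mathbb{E}\Big[\int_{C^\ell}h\,\mathrm{d}\gamma_F^{(\ell)}\Big]&=\mathbb{E}\Big[\int_{C^\ell}h(z_1,\dots,z_\ell)\,(D^-_{z_1}\cdots D^-_{z_\ell}F)^2\,\eta^{(\ell)}(\mathrm{d}z_1,\dots,\mathrm{d}z_\ell)\Big]\\&=\mathbb{E}\Big[\int_{C^\ell}h(z_1,\dots,z_\ell)\,(D^\ell_{z_1,\dots,z_\ell}F)^2\,\lambda^\ell(\mathrm{d}z_1,\dots,\mathrm{d}z_\ell)\Big]\\&=\mathbb{E}\Big[\int_{C^\ell}h(z_1,\dots,z_\ell)\,(D^\ell_{z_1,\dots,z_\ell}F)^2\,\eta_0^{(\ell)}(\mathrm{d}z_1,\dots,\mathrm{d}z_\ell)\Big],\end{aligned}$$ where $F\equiv F(\eta)$ and $\eta_0$ is an independent copy of $\eta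$.
   Context: $\mathbf{N}=\mathbf{N}(\mathbb{X})$ is the set of measures on $(\mathbb{X},\mathcal{X})$ that take values in $\mathbb{N}_0$ on bounded sets, with the smallest $\sigma$-field making $\mu\mapsto\mu(B)$ measurable for all $B\in\mathcal{X}$. Locally finite means finite on bounded sets. For a simple $\mu\in\mathbf{N}$ the $\ell$-th factorial measure $\mu^{(\ell)}$ is the measure on $\mathbb{X}^\ell$ obtained from the product $\mu^\ell$ by removing all points $(x_1,\dots,x_\ell)$ with $x_i=x_j$ for some $i\neq j$. Difference operators: $D_xF(\eta)=F(\eta+\delta_x)-F(\eta)$; $D^-_xF(\eta)=(F(\eta)-F(\eta-\delta_x))\mathbf{1}\{\eta(\{x\})>0\}$; $D^\ell_{x_1,\dots,x_\ell}F(\eta)=\sum_{A\subseteq\{1,\dots,\ell\}}(-1)^{\ell-|A|}F(\eta+\sum_{i\in A}\delta_{x_i})$ (iterated add-one cost). Chaos expansion: every $F$ with $\mathbb{E}[F(\eta)^2]<\infty$ can be written uniquely as $F(\eta)=\sum_{k\ge0}I_k(u_k)$ in $L^2(\mathbb{P})$, with $I_k$ the $k$-fold Wiener-It\^o integral with respect to $\eta-\lambda$, $u_0=\mathbb{E}[F(\eta)]$, and $u_k(x_1,\dots,x_k)=\frac1{k!}\mathbb{E}[D^k_{x_1,\dots,x_k}F(\eta)]\in L^2(\lambda^k)$ symmetric; moreover $\mathbb{E}[F(\eta)^2]=\sum_k k!\|u_k\|^2_{L^2(\lambda^k)}$. Spectral point process: $\gamma_F=\sum_{i=1}^{N}\delta_{X_i^{(N)}}$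 (with an empty sum equal to $0$), where $N$ is $\mathbb{N}_0$-valued with $\mathbb{P}[N=k]=k!\|u_k\|^2_{L^2(\lambda^k)}/\mathbb{E}[F^2]$; for $k\ge1$ the random vector $X^{(k)}=(X^{(k)}_1,\dots,X^{(k)}_k)$ has density $u_k^2/\|u_k\|^2_{L^2(\lambda^k)}$ with respect to $\lambda^k$ (for $u_k\neq 0$); and $N$ is independent of $\{X^{(k)}:k\ge1\}$. *)

theory Defs
  imports "HOL-Probability.Probability"
begin

section \<open>Configurations\<close>

text \<open>
  The state space is a type of class \<open>polish_space\<close> with its Borel sets; \<open>bounded\<close> refers to the
  complete metric of that type class.
\<close>

definition config_space :: "'a::polish_space measure set" where
  "config_space = {\<mu>. sets \<mu> = sets borel \<and>
     (\<forall>B\<in>sets borel. bounded B \<longrightarrow> (\<exists>n::nat. emeasure \<mu> B = of_nat n))}"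

definition config_algebra :: "'a::polish_space measure measure" where
  "config_algebra =
     (SUP B \<in> sets borel. vimage_algebra config_space (\<lambda>\<mu>. emeasure \<mu> B) borel)"

definition sum_measure :: "'a measure \<Rightarrow> 'a measure \<Rightarrow> 'a measure" where
  "sum_measure \<mu> \<nu> = measure_of (space \<mu>) (sets \<mu>) (\<lambda>B. emeasure \<mu> B + emeasure \<nu> B)"

text \<open>\<open>dirac_sum I x\<close> is the sum over \<open>i \<in> I\<close> of the Dirac measures at \<open>x i\<close>, with multiplicities
  (see \<open>emeasure_dirac_sum\<close> below).\<close>

definition dirac_sum :: "'i set \<Rightarrow> ('i \<Rightarrow> 'a::topological_space) \<Rightarrow> 'a measure" where
  "dirac_sum I x = distr (count_space I) borel x"

lemma emeasure_sum_measure: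
  assumes "sets \<nu> = sets \<mu>" and "B \<in> sets \<mu>"
  shows "emeasure (sum_measure \<mu> \<nu>) B = emeasure \<mu> B + emeasure \<nu> B"
  unfolding sum_measure_def
proof (rule emeasure_measure_of_sigma[OF sets.sigma_algebra_axioms])
  show "countably_additive (sets \<mu>) (\<lambda>B. emeasure \<mu> B + emeasure \<nu> B)"
    using assms(1) by (auto simp: countably_additive_def suminf_add[symmetric] suminf_emeasure)
qed (auto simp: assms positive_def)

lemma emeasure_dirac_sum:
  assumes "finite I" and "B \<in> sets borel"
  shows "emeasure (dirac_sum I x) B = (\<Sum>i\<in>I. emeasure (return borel (x i)) B)"
proof -
  have "emeasure (dirac_sum I x) B = of_nat (card (x -` B \<inter> I))"
    using assms by (simp add: dirac_sum_def emeasure_distr emeasure_count_space_finite)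
  also have "\<dots> = (\<Sum>i\<in>I. indicator B (x i))"
    using assms by (simp add: indicator_def sum.If_cases Int_def vimage_def conj_commute)
  finally show ?thesis using assms by simp
qed

text \<open>The \<open>l\<close>-fold power space and power measure; coordinates are indexed by \<open>0, \<dots>, l - 1\<close>.\<close>

abbreviation pow_measure :: "nat \<Rightarrow> 'a measure \<Rightarrow> (nat \<Rightarrow> 'a) measure" where
  "pow_measure l \<mu> \<equiv> PiM {..<l} (\<lambda>_. \<mu>)"

abbreviation pow_set :: "nat \<Rightarrow> 'a set \<Rightarrow> (nat \<Rightarrow> 'a) set" where
  "pow_set l C \<equiv> PiE {..<l} (\<lambda>_. C)"

text \<open>The next definition gives the factorial measure of a \<^emph>\<open>simple\<close> \<open>\<mu>\<close>: the restriction of the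
  power measure to tuples of pairwise distinct points.  For configurations with multiple points it is
  not the usual factorial measure; Poisson processes with diffuse intensity and their spectral point
  processes almost surely have no multiple points.\<close>

definition factorial_measure :: "nat \<Rightarrow> 'a measure \<Rightarrow> (nat \<Rightarrow> 'a) measure" where
  "factorial_measure l \<mu> = density (pow_measure l \<mu>) (indicator {x. inj_on x {..<l}})"

section \<open>Difference operators\<close>

definition add_cost ::
  "nat \<Rightarrow> ('a::polish_space measure \<Rightarrow> real) \<Rightarrow> 'a measure \<Rightarrow> (nat \<Rightarrow> 'a) \<Rightarrow> real" where
  "add_cost l F \<mu> x =
     (\<Sum>A\<in>Pow {..<l}. (- 1) ^ (l - card A) * F (sum_measure \<mu> (dirac_sum A x)))"

definition sub_cost ::
  "'a::polish_space \<Rightarrow> ('a measure \<Rightarrow> real) \<Rightarrow> 'a measure \<Rightarrow> real" where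
  "sub_cost x F \<mu> =
     (F \<mu> - F (diff_measure \<mu> (return borel x))) * (if emeasure \<mu> {x} > 0 then 1 else 0)"

text \<open>\<open>sub_cost_iter l z F\<close> is the composition of \<open>sub_cost (z 0), \<dots>, sub_cost (z (l - 1))\<close>, the last
  of these being applied to \<open>F\<close> first.\<close>

primrec sub_cost_iter ::
  "nat \<Rightarrow> (nat \<Rightarrow> 'a::polish_space) \<Rightarrow> ('a measure \<Rightarrow> real) \<Rightarrow> 'a measure \<Rightarrow> real" where
  "sub_cost_iter 0 z F = F"
| "sub_cost_iter (Suc l) z F = sub_cost_iter l z (sub_cost (z l) F)"

section \<open>Poisson processes\<close>

definition locally_finite :: "'a::polish_space measure \<Rightarrow> bool" where
  "locally_finite \<mu> \<longleftrightarrow> (\<forall>B\<in>sets borel. bounded B \<longrightarrow> emeasure \<mu> B < \<infinity>)"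

definition non_atomic :: "'a::polish_space measure \<Rightarrow> bool" where
  "non_atomic \<mu> \<longleftrightarrow> (\<forall>x. emeasure \<mu> {x} = 0)"

text \<open>The formula for the counting probabilities is the Poisson distribution with mean
  \<open>\<lambda>(B)\<close>, including the degenerate cases \<open>\<lambda>(B) = 0\<close> and \<open>\<lambda>(B) = \<infinity>\<close>.\<close>

definition poisson_process ::
  "'w measure \<Rightarrow> ('w \<Rightarrow> 'a::polish_space measure) \<Rightarrow> 'a measure \<Rightarrow> bool" where
  "poisson_process P \<eta> \<Lambda> \<longleftrightarrow>
     prob_space P \<and> sets \<Lambda> = sets borel \<and> \<eta> \<in> measurable P config_algebra \<and>
     (\<forall>B\<in>sets borel. emeasure \<Lambda> B < \<infinity> \<longrightarrow>
        (\<forall>k::nat. measure P {\<omega>\<in>space P. emeasure (\<eta> \<omega>) B = of_nat k} =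
           measure \<Lambda> B ^ k / fact k * exp (- measure \<Lambda> B))) \<and>
     (\<forall>B\<in>sets borel. emeasure \<Lambda> B = \<infinity> \<longrightarrow> (AE \<omega> in P. emeasure (\<eta> \<omega>) B = \<infinity>)) \<and>
     (\<forall>(n::nat) B. (\<forall>i<n. B i \<in> sets borel) \<longrightarrow> disjoint_family_on B {..<n} \<longrightarrow>
        prob_space.indep_vars P (\<lambda>_. borel) (\<lambda>i \<omega>. emeasure (\<eta> \<omega>) (B i)) {..<n})"

definition independent_copy ::
  "'w measure \<Rightarrow> ('w \<Rightarrow> 'a::polish_space measure) \<Rightarrow> ('w \<Rightarrow> 'a measure) \<Rightarrow> bool" where
  "independent_copy P \<eta> \<eta>' \<longleftrightarrow>
     prob_space.indep_var P config_algebra \<eta> config_algebra \<eta>' \<and>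
     distr P config_algebra \<eta>' = distr P config_algebra \<eta>"

section \<open>Spectral point process\<close>

text \<open>The kernels \<open>u\<^sub>k\<close> of the Wiener-Ito chaos expansion of \<open>F(\<eta>)\<close>, given by
  \<open>u\<^sub>k = \<bbbE>[D\<^sup>k F(\<eta>)] / k!\<close>; in particular \<open>u\<^sub>0 = \<bbbE>[F(\<eta>)]\<close>.\<close>

definition chaos_kernel ::
  "'w measure \<Rightarrow> ('w \<Rightarrow> 'a::polish_space measure) \<Rightarrow> ('a measure \<Rightarrow> real) \<Rightarrow> nat \<Rightarrow> (nat \<Rightarrow> 'a) \<Rightarrow> real"
  where
  "chaos_kernel P \<eta> F k x = (1 / fact k) * (\<integral>\<omega>. add_cost k F (\<eta> \<omega>) x \<partial>P)"

definition kernel_norm2 ::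
  "'w measure \<Rightarrow> ('w \<Rightarrow> 'a::polish_space measure) \<Rightarrow> 'a measure \<Rightarrow> ('a measure \<Rightarrow> real) \<Rightarrow> nat \<Rightarrow> ennreal"
  where
  "kernel_norm2 P \<eta> \<Lambda> F k =
     (\<integral>\<^sup>+x. ennreal ((chaos_kernel P \<eta> F k x)\<^sup>2) \<partial>pow_measure k \<Lambda>)"

text \<open>The spectral point process \<open>\<gamma>\<close> may live on a probability space \<open>Q\<close> different from \<open>P\<close>.  The vector
  \<open>X k\<close> is unconstrained if \<open>u\<^sub>k = 0\<close> in \<open>L\<^sup>2\<close>; in that case \<open>N = k\<close> has probability zero.  The number
  \<open>N\<close> is independent of the whole family \<open>(X k)\<close>, \<open>k \<ge> 1\<close>, seen as one random element of a product
  space.\<close>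

definition spectral_point_process ::
  "'w measure \<Rightarrow> ('w \<Rightarrow> 'a::polish_space measure) \<Rightarrow> 'a measure \<Rightarrow> ('a measure \<Rightarrow> real) \<Rightarrow>
   'v measure \<Rightarrow> ('v \<Rightarrow> 'a measure) \<Rightarrow> bool" where
  "spectral_point_process P \<eta> \<Lambda> F Q \<gamma> \<longleftrightarrow>
     prob_space Q \<and>
     (\<exists>(N :: 'v \<Rightarrow> nat) (X :: nat \<Rightarrow> 'v \<Rightarrow> nat \<Rightarrow> 'a).
        N \<in> measurable Q (count_space UNIV) \<and>
        (\<forall>k. emeasure Q {\<omega>\<in>space Q. N \<omega> = k} =
           fact k * kernel_norm2 P \<eta> \<Lambda> F k / (\<integral>\<^sup>+\<omega>. ennreal ((F (\<eta> \<omega>))\<^sup>2) \<partial>P)) \<and>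
        (\<forall>k\<ge>1. X k \<in> measurable Q (pow_measure k borel)) \<and>
        (\<forall>k\<ge>1. kernel_norm2 P \<eta> \<Lambda> F k \<noteq> 0 \<longrightarrow>
           distributed Q (pow_measure k \<Lambda>) (X k)
             (\<lambda>x. ennreal ((chaos_kernel P \<eta> F k x)\<^sup>2) / kernel_norm2 P \<eta> \<Lambda> F k)) \<and>
        prob_space.indep_set Q
          (sets (vimage_algebra (space Q) N (count_space UNIV)))
          (sets (vimage_algebra (space Q) (\<lambda>\<omega>. \<lambda>k\<in>{1..}. X k \<omega>)
             (PiM {1..} (\<lambda>k. pow_measure k borel)))) \<and>
        (\<forall>\<omega>\<in>space Q. \<gamma> \<omega> = dirac_sum {..<N \<omega>} (X (N \<omega>) \<omega>)))"

end

theory Submission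
  imports Defs "HOL-Real_Asymp.Real_Asymp"
begin

text \<open>
  All four expressions equal one series.  Write \<open>T\<^sub>k F(x) = \<bbbE>[D\<^sup>k\<^sub>x F(\<eta>)] = k! u\<^sub>k(x)\<close> for the kernels of
  \<open>F\<close>; in the theory \<open>T\<^sub>k F\<close> is called \<open>dmean\<close>.  The series is
  \<open>\<Sum>\<^sub>k 1/k! \<integral> h(z) (T\<^bsub>l+k\<^esub> F(z, y))\<^sup>2 \<Lambda>\<^sup>l(dz) \<Lambda>\<^sup>k(dy)\<close>, with \<open>h\<close> extended by \<open>0\<close> outside of \<open>C\<^sup>l\<close>.

  \<^item> The factorial measure of the spectral process sums over injective choices of \<open>l\<close> of its \<open>N\<close>
    points.  Given \<open>N = k\<close>, the symmetry of \<open>u\<^sub>k\<close> makes each of the \<open>k!/(k - l)!\<close> choices contribute equally,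
    and the normalisation by \<open>\<bbbE>[F\<^sup>2]\<close> cancels; this is the series with \<open>l + k\<close> in place of \<open>k\<close>
    (\<open>nn_integral_tuple_sum\<close>, \<open>nn_integral_mixture\<close>).

  \<^item> The multivariate Mecke equation (\<open>mecke_multi\<close>) replaces the sum over distinct points of \<open>\<eta>\<close> by the
    integral over \<open>\<Lambda>\<^sup>l\<close> and adds these points to \<open>\<eta>\<close>.  Removing points that were just added turns
    the iterated remove-one cost into \<open>D\<^sup>l\<^sub>z F(\<eta>)\<close>, whence the equality of the second and the third
    expression.  For the independent copy the same equation is applied to \<open>\<eta>\<^sub>0\<close> with \<open>\<eta>\<close> held fixed.

  \<^item> It remains to expand \<open>\<bbbE>[(D\<^sup>l\<^sub>z F(\<eta>))\<^sup>2]\<close> for almost every \<open>z\<close>.  As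
    \<open>T\<^sub>k(D\<^sup>l\<^sub>z F)(y) = T\<^bsub>l+k\<^esub> F(z, y)\<close>, this is the Fock space representation
    \<open>\<bbbE>[H\<^sup>2] = \<Sum>\<^sub>k 1/k! \<parallel>T\<^sub>k H\<parallel>\<^sup>2\<close> of \<open>H = D\<^sup>l\<^sub>z F\<close> (\<open>fock_isometry\<close>).

  The functional \<open>D\<^sup>l\<^sub>z F\<close> need not be square integrable a priori, so the Fock space representation is
  established as an identity in \<open>[0, \<infinity>]\<close> for all \<open>H\<close> that are integrable against \<open>exp(\<eta>(B))\<close> for bounded \<open>B\<close>.
  Iterated differences of \<open>F \<in> L\<^sup>2\<close> have this property for almost every \<open>z\<close>, because \<open>exp(\<eta>(B))\<close> has moments
  of all orders and the Mecke equation trades added points for powers of \<open>\<eta>(B)\<close>.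

  The test functionals are linear combinations of \<open>exp(- \<eta>(v))\<close>, \<open>v\<close> simple, nonnegative, of bounded
  support.  They form an algebra that is dense in \<open>L\<^sup>2\<close> and in weighted \<open>L\<^sup>1\<close> spaces (\<open>laplace_alg_dense\<close>).
  On this algebra everything is explicit, since a Poisson process has the Laplace functional
  \<open>\<bbbE> exp(- \<eta>(v)) = exp(- \<integral> (1 - exp(- v)) d\<Lambda>)\<close>.  Density then gives the Mecke equation, by comparing two
  measures on configurations through their Laplace functionals, and the pairing formula
  \<open>\<bbbE>[H G] = \<Sum>\<^sub>k 1/k! \<langle>T\<^sub>k H, T\<^sub>k G\<rangle>\<close> for \<open>G\<close> in the algebra (\<open>dmean_pairing_sums\<close>).  The isometry follows
  from the pairing formula by duality, in both directions.
\<close>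

section \<open>Configurations and their measurable structure\<close>

lemma config_space_sets [simp]: "\<mu> \<in> config_space \<Longrightarrow> sets \<mu> = sets borel"
  by (auto simp: config_space_def)

lemma config_space_space [simp]: "\<mu> \<in> config_space \<Longrightarrow> space \<mu> = UNIV"
  using sets_eq_imp_space_eq[of \<mu> borel] by simp

lemma space_config_algebra [simp]: "space config_algebra = config_space"
proof -
  have "space (config_algebra :: 'a measure measure) =
      (\<Union>B\<in>sets (borel :: 'a measure). space (vimage_algebra config_space (\<lambda>\<mu>. emeasure \<mu> B) (borel :: ennreal measure)))"
    unfolding config_algebra_def by (subst space_Sup_eq_UN) auto
  also have "\<dots> = config_space"
    by auto
  finally show ?thesis .
qed

lemma measurable_emeasure_config [measurable]:
  assumes "B \<in> sets borel"
  shows "(\<lambda>\<mu>. emeasure \<mu> B) \<in> borel_measurable config_algebra"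
  unfolding config_algebra_def
  by (rule measurable_SUP1[OF assms measurable_vimage_algebra1]) auto

lemma measurable_configI:
  assumes "\<And>x. x \<in> space M \<Longrightarrow> f x \<in> config_space"
    and "\<And>B. B \<in> sets borel \<Longrightarrow> (\<lambda>x. emeasure (f x) B) \<in> borel_measurable M"
  shows "f \<in> measurable M config_algebra"
  unfolding config_algebra_def
  by (rule measurable_SUP2, force, rule measurable_vimage_algebra2) (use assms in auto)

text \<open>Balls around an arbitrary fixed point, a countable exhaustion of the space by bounded sets.\<close>

definition loc_ball :: "nat \<Rightarrow> 'a::polish_space set" where
  "loc_ball n = ball undefined (real n)"

lemma loc_ball_borel [measurable, simp]: "loc_ball n \<in> sets borel"
  by (simp add: loc_ball_def)

lemma bounded_loc_ball [simp]: "bounded (loc_ball n)"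
  by (simp add: loc_ball_def)

lemma loc_ball_mono: "m \<le> n \<Longrightarrow> loc_ball m \<subseteq> loc_ball n"
  by (auto simp: loc_ball_def)

lemma bounded_subset_loc_ball: "bounded B \<Longrightarrow> \<exists>n. B \<subseteq> loc_ball n"
proof -
  assume "bounded B"
  then obtain e where e: "\<forall>y\<in>B. dist undefined y \<le> e"
    using bounded_any_center by blast
  obtain n :: nat where "e < real n"
    using reals_Archimedean2 by blast
  with e show ?thesis
    by (intro exI[of _ n]) (fastforce simp: loc_ball_def)
qed

lemma UN_loc_ball [simp]: "(\<Union>n. loc_ball n) = UNIV"
  using bounded_subset_loc_ball[of "{x}" for x] by auto

lemma SUP_indicator_loc_ball: "(SUP n. indicator (loc_ball n) x :: ennreal) = 1"
proof -
  obtain n where "x \<in> loc_ball n" using UN_loc_ball by blast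
  then show ?thesis
    by (intro antisym SUP_least SUP_upper2[of n]) (auto split: split_indicator)
qed

lemma locally_finiteD: "locally_finite \<mu> \<Longrightarrow> B \<in> sets borel \<Longrightarrow> bounded B \<Longrightarrow> emeasure \<mu> B < \<infinity>"
  by (auto simp: locally_finite_def)

lemma sigma_finite_locally_finite:
  assumes "sets \<mu> = sets borel" and "locally_finite \<mu>"
  shows "sigma_finite_measure \<mu>"
  apply standard
  apply (rule exI[of _ "range loc_ball"])
  using assms sets_eq_imp_space_eq[OF assms(1)] locally_finiteD[OF assms(2)] by (auto simp: less_top)

lemma config_nat: "\<mu> \<in> config_space \<Longrightarrow> B \<in> sets borel \<Longrightarrow> bounded B \<Longrightarrow> \<exists>n::nat. emeasure \<mu> B = of_nat n"
  unfolding config_space_def by blast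

lemma config_locally_finite: "\<mu> \<in> config_space \<Longrightarrow> locally_finite \<mu>"
  unfolding locally_finite_def
proof (intro ballI impI)
  fix B :: "'a set" assume "\<mu> \<in> config_space" "B \<in> sets borel" "bounded B"
  then obtain n :: nat where "emeasure \<mu> B = of_nat n" using config_nat by blast
  then show "emeasure \<mu> B < \<infinity>" by (simp add: of_nat_less_top)
qed

lemma config_finite: "\<mu> \<in> config_space \<Longrightarrow> B \<in> sets borel \<Longrightarrow> bounded B \<Longrightarrow> emeasure \<mu> B < \<infinity>"
  using config_locally_finite locally_finiteD by blast

lemma sigma_finite_config: "\<mu> \<in> config_space \<Longrightarrow> sigma_finite_measure \<mu>"
  by (intro sigma_finite_locally_finite config_locally_finite) auto

lemma product_sigma_finite_config: "\<mu> \<in> config_space \<Longrightarrow> product_sigma_finite (\<lambda>_. \<mu>)"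
  by (simp add: product_sigma_finite_def sigma_finite_config)

text \<open>On a ball a configuration is finite, so that dividing by one plus its mass there turns the
  restriction into a subprobability kernel, for which measurability of integrals is known.  The balls
  exhaust the space.\<close>

lemma measurable_nn_integral_config:
  fixes \<kappa> :: "'m \<Rightarrow> 'a::polish_space measure"
  assumes \<kappa> [measurable]: "\<kappa> \<in> measurable M config_algebra"
    and f [measurable]: "case_prod f \<in> borel_measurable (M \<Otimes>\<^sub>M borel)"
  shows "(\<lambda>m. \<integral>\<^sup>+x. f m x \<partial>\<kappa> m) \<in> borel_measurable M"
proof -
  have cfg: "m \<in> space M \<Longrightarrow> \<kappa> m \<in> config_space" for m
    using measurable_space[OF \<kappa>] by simp
  define c where "c n m = 1 + emeasure (\<kappa> m) (loc_ball n)" for n m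
  have c_fin: "m \<in> space M \<Longrightarrow> c n m \<noteq> \<infinity> \<and> c n m \<noteq> 0" for n m
    using config_finite[OF cfg, of m "loc_ball n"] by (auto simp: c_def)
  have c_meas [measurable]: "c n \<in> borel_measurable M" for n
    unfolding c_def by measurable
  define K where "K n m = density (\<kappa> m) (\<lambda>x. indicator (loc_ball n) x / c n m)" for n m
  have emK: "emeasure (K n m) A = emeasure (\<kappa> m) (A \<inter> loc_ball n) / c n m"
    if "m \<in> space M" "A \<in> sets borel" for n m A
  proof -
    note [measurable_cong] = config_space_sets[OF cfg[OF that(1)]]
    have "emeasure (K n m) A = (\<integral>\<^sup>+x. indicator (A \<inter> loc_ball n) x / c n m \<partial>\<kappa> m)"
      unfolding K_def using that
      by (subst emeasure_density) (auto intro!: nn_integral_cong split: split_indicator)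
    also have "\<dots> = emeasure (\<kappa> m) (A \<inter> loc_ball n) / c n m"
      using that by (subst nn_integral_divide) auto
    finally show ?thesis .
  qed
  have K [measurable]: "K n \<in> measurable M (subprob_algebra borel)" for n
  proof (rule measurable_subprob_algebra)
    fix m assume m: "m \<in> space M"
    show "sets (K n m) = sets borel" using cfg[OF m] by (simp add: K_def)
    have "emeasure (K n m) (space (K n m)) = emeasure (\<kappa> m) (loc_ball n) / c n m"
      using emK[OF m, of UNIV n] cfg[OF m] by (simp add: K_def)
    also have "\<dots> \<le> 1"
      using c_fin[OF m, of n] by (simp add: c_def divide_le_posI_ennreal zero_less_iff_neq_zero)
    finally show "subprob_space (K n m)"
      by (intro subprob_spaceI) (use cfg[OF m] in \<open>auto simp: K_def\<close>)
  next
    fix A :: "'a set" assume A [measurable]: "A \<in> sets borel"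
    have "(\<lambda>m. emeasure (\<kappa> m) (A \<inter> loc_ball n) / c n m) \<in> borel_measurable M" by measurable
    then show "(\<lambda>m. emeasure (K n m) A) \<in> borel_measurable M"
      by (subst measurable_cong[OF emK]) auto
  qed
  have "(\<lambda>m. (SUP n. c n m * (\<integral>\<^sup>+x. f m x \<partial>K n m))) \<in> borel_measurable M"
    by (intro borel_measurable_SUP borel_measurable_times_ennreal c_meas
        nn_integral_measurable_subprob_algebra2[OF f K]) auto
  also have "?this \<longleftrightarrow> ?thesis"
  proof (rule measurable_cong)
    fix m assume m: "m \<in> space M"
    note [measurable_cong] = config_space_sets[OF cfg[OF m]]
    have fm [measurable]: "f m \<in> borel_measurable borel"
      using measurable_Pair2[OF f m] by simp
    have "c n m * (\<integral>\<^sup>+x. f m x \<partial>K n m) = (\<integral>\<^sup>+x. f m x * indicator (loc_ball n) x \<partial>\<kappa> m)" for n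
    proof -
      have "(\<integral>\<^sup>+x. f m x \<partial>K n m) = (\<integral>\<^sup>+x. f m x * indicator (loc_ball n) x / c n m \<partial>\<kappa> m)"
        unfolding K_def by (subst nn_integral_density)
          (auto intro!: nn_integral_cong simp: mult.commute ennreal_times_divide split: split_indicator)
      also have "\<dots> = (\<integral>\<^sup>+x. f m x * indicator (loc_ball n) x \<partial>\<kappa> m) / c n m"
        by (rule nn_integral_divide) measurable
      finally show ?thesis using c_fin[OF m, of n]
        by (simp add: ennreal_divide_times ennreal_times_divide mult.commute)
           (metis ennreal_mult_divide_eq infinity_ennreal_def mult.commute)
    qed
    then have "(SUP n. c n m * (\<integral>\<^sup>+x. f m x \<partial>K n m)) = (SUP n. \<integral>\<^sup>+x. f m x * indicator (loc_ball n) x \<partial>\<kappa> m)"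
      by simp
    also have "\<dots> = (\<integral>\<^sup>+x. (SUP n. f m x * indicator (loc_ball n) x) \<partial>\<kappa> m)"
      by (intro nn_integral_monotone_convergence_SUP[symmetric])
         (use loc_ball_mono in \<open>fastforce simp: incseq_def le_fun_def split: split_indicator\<close>, measurable)
    also have "\<dots> = (\<integral>\<^sup>+x. f m x \<partial>\<kappa> m)"
      by (intro nn_integral_cong) (simp add: SUP_mult_left_ennreal[symmetric] SUP_indicator_loc_ball)
    finally show "(SUP n. c n m * (\<integral>\<^sup>+x. f m x \<partial>K n m)) = (\<integral>\<^sup>+x. f m x \<partial>\<kappa> m)" .
  qed
  finally show ?thesis .
qed

section \<open>Adding and removing points\<close>

lemma sets_sum_measure [simp]: "sets (sum_measure \<mu> \<nu>) = sets \<mu>"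
  by (simp add: sum_measure_def)

lemma space_sum_measure [simp]: "space (sum_measure \<mu> \<nu>) = space \<mu>"
  by (simp add: sum_measure_def)

lemma sets_dirac_sum [simp]: "sets (dirac_sum I x) = sets borel"
  by (simp add: dirac_sum_def)

lemma return_in_config [simp]: "return borel x \<in> config_space"
proof -
  have "\<exists>n::nat. indicator B x = (of_nat n :: ennreal)" for B
    by (rule exI[of _ "if x \<in> B then 1 else 0"]) (simp add: indicator_def)
  then show ?thesis unfolding config_space_def by simp
qed

lemma sum_measure_in_config [simp]:
  "\<mu> \<in> config_space \<Longrightarrow> \<nu> \<in> config_space \<Longrightarrow> sum_measure \<mu> \<nu> \<in> config_space"
  unfolding config_space_def by (simp add: emeasure_sum_measure) (metis of_nat_add)

lemma dirac_sum_in_config [simp]: "finite I \<Longrightarrow> dirac_sum I x \<in> config_space"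
  unfolding config_space_def
  by (simp add: dirac_sum_def emeasure_distr emeasure_count_space_finite)

lemma nn_integral_sum_measure:
  assumes \<nu>: "sets \<nu> = sets \<mu>" and f: "f \<in> borel_measurable \<mu>"
  shows "(\<integral>\<^sup>+x. f x \<partial>sum_measure \<mu> \<nu>) = (\<integral>\<^sup>+x. f x \<partial>\<mu>) + (\<integral>\<^sup>+x. f x \<partial>\<nu>)"
  using f
proof induction
  case (cong f g)
  have e: "integral\<^sup>N \<mu> f = integral\<^sup>N \<mu> g" "integral\<^sup>N \<nu> f = integral\<^sup>N \<nu> g"
    "integral\<^sup>N (sum_measure \<mu> \<nu>) f = integral\<^sup>N (sum_measure \<mu> \<nu>) g"
    by (rule nn_integral_cong, simp add: cong(3) sets_eq_imp_space_eq[OF \<nu>])+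
  show ?case unfolding e by (rule cong(4))
next
  case (set A)
  then show ?case using \<nu> by (simp add: emeasure_sum_measure)
next
  case (mult u c)
  have [measurable]: "u \<in> borel_measurable \<nu>" "u \<in> borel_measurable (sum_measure \<mu> \<nu>)"
    using mult(2) \<nu> by (auto cong: measurable_cong_sets)
  show ?case using mult by (simp add: nn_integral_cmult distrib_left)
next
  case (add u v)
  have [measurable]: "u \<in> borel_measurable \<nu>" "u \<in> borel_measurable (sum_measure \<mu> \<nu>)"
    "v \<in> borel_measurable \<nu>" "v \<in> borel_measurable (sum_measure \<mu> \<nu>)"
    using add \<nu> by (auto cong: measurable_cong_sets)
  show ?case using add by (simp add: nn_integral_add)
next
  case (seq U)
  have [measurable]: "\<And>i. U i \<in> borel_measurable \<nu>" "\<And>i. U i \<in> borel_measurable (sum_measure \<mu> \<nu>)"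
    using seq(1) \<nu> by (auto cong: measurable_cong_sets)
  have inc: "incseq (\<lambda>i. \<integral>\<^sup>+x. U i x \<partial>\<mu>)" "incseq (\<lambda>i. \<integral>\<^sup>+x. U i x \<partial>\<nu>)"
    using seq(3) by (auto intro!: nn_integral_mono simp: incseq_def le_fun_def)
  show ?case
    using seq inc
    by (simp add: nn_integral_monotone_convergence_SUP image_image ennreal_SUP_add[symmetric] SUP_apply[abs_def])
qed

definition add_point :: "'a::polish_space \<Rightarrow> 'a measure \<Rightarrow> 'a measure" where
  "add_point x \<mu> = sum_measure \<mu> (return borel x)"

definition add_points :: "'i set \<Rightarrow> ('i \<Rightarrow> 'a::polish_space) \<Rightarrow> 'a measure \<Rightarrow> 'a measure" where
  "add_points I x \<mu> = sum_measure \<mu> (dirac_sum I x)"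

lemma add_point_config [simp]: "\<mu> \<in> config_space \<Longrightarrow> add_point x \<mu> \<in> config_space"
  by (simp add: add_point_def)

lemma add_points_config [simp]: "finite I \<Longrightarrow> \<mu> \<in> config_space \<Longrightarrow> add_points I x \<mu> \<in> config_space"
  by (simp add: add_points_def)

lemma emeasure_add_point:
  "\<mu> \<in> config_space \<Longrightarrow> B \<in> sets borel \<Longrightarrow> emeasure (add_point x \<mu>) B = emeasure \<mu> B + indicator B x"
  by (simp add: add_point_def emeasure_sum_measure)

lemma emeasure_add_points:
  "finite I \<Longrightarrow> \<mu> \<in> config_space \<Longrightarrow> B \<in> sets borel \<Longrightarrow>
    emeasure (add_points I x \<mu>) B = emeasure \<mu> B + (\<Sum>i\<in>I. indicator B (x i))"
  by (simp add: add_points_def emeasure_sum_measure emeasure_dirac_sum)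

lemma config_eqI:
  "\<mu> \<in> config_space \<Longrightarrow> \<nu> \<in> config_space \<Longrightarrow> (\<And>B. B \<in> sets borel \<Longrightarrow> emeasure \<mu> B = emeasure \<nu> B) \<Longrightarrow> \<mu> = \<nu>"
  by (rule measure_eqI) auto

lemma add_points_empty [simp]: "\<mu> \<in> config_space \<Longrightarrow> add_points {} x \<mu> = \<mu>"
  by (rule config_eqI) (auto simp: emeasure_add_points)

lemma add_points_insert:
  "finite I \<Longrightarrow> i \<notin> I \<Longrightarrow> \<mu> \<in> config_space \<Longrightarrow>
    add_points (insert i I) x \<mu> = add_points I x (add_point (x i) \<mu>)"
  by (rule config_eqI) (auto simp: emeasure_add_points emeasure_add_point add_ac)

lemma add_points_insert':
  "finite I \<Longrightarrow> i \<notin> I \<Longrightarrow> \<mu> \<in> config_space \<Longrightarrow>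
    add_points (insert i I) x \<mu> = add_point (x i) (add_points I x \<mu>)"
  by (rule config_eqI) (auto simp: emeasure_add_points emeasure_add_point add_ac)

lemma add_points_add_point:
  "finite I \<Longrightarrow> \<mu> \<in> config_space \<Longrightarrow> add_points I x (add_point y \<mu>) = add_point y (add_points I x \<mu>)"
  by (rule config_eqI) (auto simp: emeasure_add_points emeasure_add_point add_ac)

lemma add_points_cong: "finite I \<Longrightarrow> (\<And>i. i \<in> I \<Longrightarrow> x i = y i) \<Longrightarrow> \<mu> \<in> config_space \<Longrightarrow>
    add_points I x \<mu> = add_points I y \<mu>"
  by (rule config_eqI) (auto simp: emeasure_add_points intro!: sum.cong)

lemma measurable_add_point [measurable]:
  fixes \<kappa> :: "'m \<Rightarrow> 'a::polish_space measure"
  assumes [measurable]: "p \<in> measurable M borel" "\<kappa> \<in> measurable M config_algebra"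
  shows "(\<lambda>m. add_point (p m) (\<kappa> m)) \<in> measurable M config_algebra"
proof (rule measurable_configI)
  have cfg: "m \<in> space M \<Longrightarrow> \<kappa> m \<in> config_space" for m
    using measurable_space[OF assms(2)] by simp
  then show "m \<in> space M \<Longrightarrow> add_point (p m) (\<kappa> m) \<in> config_space" for m by simp
  fix B :: "'a set" assume [measurable]: "B \<in> sets borel"
  have "(\<lambda>m. emeasure (\<kappa> m) B + indicator B (p m)) \<in> borel_measurable M" by measurable
  then show "(\<lambda>m. emeasure (add_point (p m) (\<kappa> m)) B) \<in> borel_measurable M"
    by (rule measurable_cong[THEN iffD1, rotated]) (simp add: emeasure_add_point cfg)
qed

lemma measurable_add_points [measurable]:
  fixes \<kappa> :: "'m \<Rightarrow> 'a::polish_space measure"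
  assumes "finite I" and p: "\<And>i. i \<in> I \<Longrightarrow> (\<lambda>m. p m i) \<in> measurable M borel"
    and [measurable]: "\<kappa> \<in> measurable M config_algebra"
  shows "(\<lambda>m. add_points I (p m) (\<kappa> m)) \<in> measurable M config_algebra"
proof (rule measurable_configI)
  have cfg: "m \<in> space M \<Longrightarrow> \<kappa> m \<in> config_space" for m
    using measurable_space[OF assms(3)] by simp
  then show "m \<in> space M \<Longrightarrow> add_points I (p m) (\<kappa> m) \<in> config_space" for m using assms(1) by simp
  fix B :: "'a set" assume [measurable]: "B \<in> sets borel"
  have "(\<lambda>m. emeasure (\<kappa> m) B + (\<Sum>i\<in>I. indicator B (p m i))) \<in> borel_measurable M"
    using p by (intro borel_measurable_add borel_measurable_sum) measurable
  then show "(\<lambda>m. emeasure (add_points I (p m) (\<kappa> m)) B) \<in> borel_measurable M"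
    by (rule measurable_cong[THEN iffD1, rotated]) (simp add: emeasure_add_points cfg assms(1))
qed

lemma nn_integral_add_point:
  assumes "\<mu> \<in> config_space" and "f \<in> borel_measurable borel"
  shows "(\<integral>\<^sup>+y. f y \<partial>add_point x \<mu>) = (\<integral>\<^sup>+y. f y \<partial>\<mu>) + f x"
  using assms unfolding add_point_def
  by (subst nn_integral_sum_measure) (auto simp: nn_integral_return cong: measurable_cong_sets)

text \<open>The total mass of a configuration may be infinite.  Subtracting \<open>\<delta>\<^sub>x\<close> still gives a measure,
  since \<open>\<delta>\<^sub>x\<close> is finite and is dominated by a configuration that charges \<open>x\<close>.\<close>

lemma emeasure_remove_point:
  assumes \<mu>: "\<mu> \<in> config_space" and x: "emeasure \<mu> {x} > 0" and B: "B \<in> sets borel"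
  shows "emeasure (diff_measure \<mu> (return borel x)) B = emeasure \<mu> B - indicator B x"
proof -
  obtain k :: nat where k: "emeasure \<mu> {x} = of_nat k"
    using config_nat[OF \<mu>, of "{x}"] by auto
  with x have k1: "1 \<le> k" by (cases k) auto
  have ge: "indicator A x \<le> emeasure \<mu> A" if "A \<in> sets borel" for A
  proof (cases "x \<in> A")
    case True
    then have "emeasure \<mu> {x} \<le> emeasure \<mu> A" using that \<mu> by (intro emeasure_mono) auto
    moreover have "(1::ennreal) \<le> of_nat k" using k1 by (metis of_nat_1 of_nat_mono)
    ultimately have "1 \<le> emeasure \<mu> A" unfolding k by (rule order_trans[rotated])
    then show ?thesis using True by simp
  qed simp
  have "emeasure (diff_measure \<mu> (return borel x)) B = emeasure \<mu> B - emeasure (return borel x) B"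
    unfolding diff_measure_def
  proof (rule emeasure_measure_of_sigma[OF sets.sigma_algebra_axioms])
    show "positive (sets \<mu>) (\<lambda>A. emeasure \<mu> A - emeasure (return borel x) A)"
      by (simp add: positive_def)
    show "countably_additive (sets \<mu>) (\<lambda>A. emeasure \<mu> A - emeasure (return borel x) A)"
    proof (rule countably_additiveI)
      fix A :: "nat \<Rightarrow> _" assume A: "range A \<subseteq> sets \<mu>" "disjoint_family A"
      have Ab: "A i \<in> sets borel" for i using A \<mu> by auto
      have "(\<Sum>i. emeasure \<mu> (A i) - emeasure (return borel x) (A i)) =
          (\<Sum>i. emeasure \<mu> (A i)) - (\<Sum>i. emeasure (return borel x) (A i))"
      proof -
        have "(\<Sum>i. emeasure (return borel x) (A i)) = emeasure (return borel x) (\<Union>i. A i)"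
          using A Ab by (subst suminf_emeasure) auto
        then have fin: "(\<Sum>i. emeasure (return borel x) (A i)) \<noteq> \<top>"
          using Ab by (simp add: sets.countable_UN indicator_def)
        have "(\<Sum>i. emeasure \<mu> (A i)) =
            (\<Sum>i. (emeasure \<mu> (A i) - emeasure (return borel x) (A i)) + emeasure (return borel x) (A i))"
          using ge[OF Ab] Ab by (intro suminf_cong) (simp add: diff_add_cancel_ennreal)
        also have "\<dots> = (\<Sum>i. emeasure \<mu> (A i) - emeasure (return borel x) (A i)) +
            (\<Sum>i. emeasure (return borel x) (A i))"
          by (rule suminf_add[symmetric]) auto
        finally show ?thesis using fin by simp
      qed
      also have "\<dots> = emeasure \<mu> (\<Union>i. A i) - emeasure (return borel x) (\<Union>i. A i)"
        using A Ab by (subst (1 2) suminf_emeasure) auto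
      finally show "(\<Sum>i. emeasure \<mu> (A i) - emeasure (return borel x) (A i)) =
        emeasure \<mu> (\<Union> (range A)) - emeasure (return borel x) (\<Union> (range A))" .
    qed
  qed (use B \<mu> in auto)
  then show ?thesis using B by simp
qed

lemma remove_point_config:
  assumes \<mu>: "\<mu> \<in> config_space" and x: "emeasure \<mu> {x} > 0"
  shows "diff_measure \<mu> (return borel x) \<in> config_space"
proof -
  have "\<exists>n::nat. emeasure \<mu> B - indicator B x = of_nat n" if B: "B \<in> sets borel" "bounded B" for B
  proof -
    obtain k :: nat where k: "emeasure \<mu> B = of_nat k" using config_nat[OF \<mu> B] by auto
    have "(of_nat k :: ennreal) - 1 = of_nat (k - 1)"
      by (simp add: ennreal_of_nat_eq_real_of_nat of_nat_diff_real flip: ennreal_1 ennreal_minus)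
    then have "emeasure \<mu> B - indicator B x = of_nat (if x \<in> B then k - 1 else k)"
      unfolding k by (simp add: indicator_def)
    then show ?thesis by blast
  qed
  then have "\<exists>n::nat. emeasure (diff_measure \<mu> (return borel x)) B = of_nat n"
    if "B \<in> sets borel" "bounded B" for B
    using emeasure_remove_point[OF \<mu> x that(1)] that by simp
  then show ?thesis using \<mu> unfolding config_space_def by simp
qed

lemma remove_add_point:
  assumes \<mu>: "\<mu> \<in> config_space"
  shows "diff_measure (add_point x \<mu>) (return borel x) = \<mu>" and "emeasure (add_point x \<mu>) {x} > 0"
proof -
  show *: "emeasure (add_point x \<mu>) {x} > 0"
    using \<mu> by (simp add: emeasure_add_point add_nonneg_pos)
  have 1: "(a + 1) - 1 = a" for a :: ennreal by simp
  show "diff_measure (add_point x \<mu>) (return borel x) = \<mu>"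
    by (rule config_eqI[OF remove_point_config])
       (use \<mu> * in \<open>auto simp: emeasure_remove_point emeasure_add_point 1 split: split_indicator\<close>)
qed

section \<open>Laplace functionals are dense\<close>

definition test_fun :: "('a::polish_space \<Rightarrow> real) \<Rightarrow> bool" where
  "test_fun v \<longleftrightarrow> simple_function borel v \<and> (\<forall>x. 0 \<le> v x) \<and> bounded {x. v x \<noteq> 0}"

definition lexp :: "('a::polish_space \<Rightarrow> real) \<Rightarrow> 'a measure \<Rightarrow> real" where
  "lexp v \<mu> = exp (- enn2real (\<integral>\<^sup>+x. ennreal (v x) \<partial>\<mu>))"

text \<open>The span of the exponential functionals.  On configurations it is an algebra, because the functionals
  of \<open>v\<close> and of \<open>w\<close> multiply to the functional of \<open>v + w\<close>.\<close>

inductive laplace_alg :: "('a::polish_space measure \<Rightarrow> real) \<Rightarrow> bool" where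
  base: "test_fun v \<Longrightarrow> laplace_alg (\<lambda>\<mu>. c * lexp v \<mu>)"
| add: "laplace_alg f \<Longrightarrow> laplace_alg g \<Longrightarrow> laplace_alg (\<lambda>\<mu>. f \<mu> + g \<mu>)"

lemma test_fun_measurable: "test_fun v \<Longrightarrow> v \<in> borel_measurable borel"
  by (auto simp: test_fun_def intro: borel_measurable_simple_function)

lemma test_fun_nonneg: "test_fun v \<Longrightarrow> 0 \<le> v x"
  by (auto simp: test_fun_def)

lemma test_fun_bound:
  assumes "test_fun v"
  obtains c n where "0 \<le> c" and "\<And>x. v x \<le> c * indicator (loc_ball n) x"
proof -
  have "finite (range v)"
    using assms simple_functionD(1)[of borel v] by (simp add: test_fun_def)
  then obtain c where c: "\<And>x. v x \<le> c"
    by (metis Max_ge UNIV_I imageI)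
  obtain n where n: "{x. v x \<noteq> 0} \<subseteq> loc_ball n"
    using assms bounded_subset_loc_ball unfolding test_fun_def by blast
  show ?thesis
  proof (rule that[of "max 0 c" n])
    fix x show "v x \<le> max 0 c * indicator (loc_ball n) x"
      using c[of x] n by (cases "v x = 0") (auto simp: indicator_def)
  qed simp
qed

lemma test_fun_nn_integral_finite:
  assumes v: "test_fun v" and \<mu>: "locally_finite \<mu>" "sets \<mu> = sets borel"
  shows "(\<integral>\<^sup>+x. ennreal (v x) \<partial>\<mu>) < \<infinity>"
proof -
  obtain c n where c: "0 \<le> c" and v': "\<And>x. v x \<le> c * indicator (loc_ball n) x"
    using test_fun_bound[OF v] by blast
  have "(\<integral>\<^sup>+x. ennreal (v x) \<partial>\<mu>) \<le> (\<integral>\<^sup>+x. ennreal c * indicator (loc_ball n) x \<partial>\<mu>)"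
    using v' c by (intro nn_integral_mono) (metis ennreal_indicator ennreal_leI ennreal_mult' )
  also have "\<dots> = ennreal c * emeasure \<mu> (loc_ball n)"
    using \<mu> by (simp add: nn_integral_cmult_indicator)
  also have "\<dots> < \<infinity>"
    using locally_finiteD[OF \<mu>(1), of "loc_ball n"] by (simp add: ennreal_mult_less_top)
  finally show ?thesis .
qed

lemma test_fun_add: "test_fun v \<Longrightarrow> test_fun w \<Longrightarrow> test_fun (\<lambda>x. v x + w x)"
  unfolding test_fun_def
  by (auto intro: simple_function_add bounded_subset[of "{x. v x \<noteq> 0} \<union> {x. w x \<noteq> 0}"])

lemma test_fun_zero: "test_fun (\<lambda>x. 0)"
  by (simp add: test_fun_def)

lemma test_fun_indicator:
  assumes "B \<in> sets borel" "bounded B" "0 \<le> t"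
  shows "test_fun (\<lambda>x. t * indicator B x)"
proof -
  have "bounded {x. t * indicator B x \<noteq> 0}"
    by (rule bounded_subset[OF assms(2)]) (auto simp: indicator_def)
  then show ?thesis
    unfolding test_fun_def using assms by (auto intro!: simple_function_mult simple_function_indicator)
qed

lemma lexp_add:
  assumes "test_fun v" "test_fun w" "\<mu> \<in> config_space"
  shows "lexp (\<lambda>x. v x + w x) \<mu> = lexp v \<mu> * lexp w \<mu>"
proof -
  have [measurable]: "v \<in> borel_measurable \<mu>" "w \<in> borel_measurable \<mu>"
    using assms test_fun_measurable by (auto cong: measurable_cong_sets)
  have "(\<integral>\<^sup>+x. ennreal (v x + w x) \<partial>\<mu>) = (\<integral>\<^sup>+x. ennreal (v x) \<partial>\<mu>) + (\<integral>\<^sup>+x. ennreal (w x) \<partial>\<mu>)"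
    by (subst nn_integral_add[symmetric])
      (auto intro!: nn_integral_cong simp: test_fun_nonneg[OF assms(1)] test_fun_nonneg[OF assms(2)])
  moreover have "(\<integral>\<^sup>+x. ennreal (v x) \<partial>\<mu>) < \<infinity>" "(\<integral>\<^sup>+x. ennreal (w x) \<partial>\<mu>) < \<infinity>"
    using assms by (auto intro!: test_fun_nn_integral_finite[OF _ config_locally_finite, simplified])
  ultimately show ?thesis
    by (simp add: lexp_def enn2real_plus exp_add[symmetric])
qed

lemma lexp_zero [simp]: "lexp (\<lambda>x. 0) \<mu> = 1"
  by (simp add: lexp_def)

lemma lexp_indicator:
  assumes "\<mu> \<in> config_space" "B \<in> sets borel" "0 \<le> t"
  shows "lexp (\<lambda>x. t * indicator B x) \<mu> = exp (- t * measure \<mu> B)"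
proof -
  have "(\<integral>\<^sup>+x. ennreal (t * indicator B x) \<partial>\<mu>) = (\<integral>\<^sup>+x. ennreal t * indicator B x \<partial>\<mu>)"
    using assms by (intro nn_integral_cong) (auto simp: indicator_def)
  also have "\<dots> = ennreal t * emeasure \<mu> B"
    using assms by (simp add: nn_integral_cmult_indicator)
  finally show ?thesis
    using assms by (simp add: lexp_def enn2real_mult measure_def)
qed

lemma lexp_bounds: "0 < lexp v \<mu>" "lexp v \<mu> \<le> 1"
  by (auto simp: lexp_def)

lemma lexp_add_point:
  assumes "test_fun v" "\<mu> \<in> config_space"
  shows "lexp v (add_point x \<mu>) = exp (- v x) * lexp v \<mu>"
proof -
  have "(\<integral>\<^sup>+x. ennreal (v x) \<partial>\<mu>) < \<infinity>"
    using assms by (auto intro!: test_fun_nn_integral_finite[OF _ config_locally_finite, simplified])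
  then show ?thesis
    using assms test_fun_measurable[OF assms(1)] test_fun_nonneg[OF assms(1)]
    by (simp add: lexp_def nn_integral_add_point enn2real_plus exp_add[symmetric])
qed

lemma lexp_measurable [measurable]:
  assumes "test_fun v"
  shows "lexp v \<in> borel_measurable config_algebra"
proof -
  note [measurable] = test_fun_measurable[OF assms]
  have [measurable]: "(\<lambda>\<mu>. \<integral>\<^sup>+x. ennreal (v x) \<partial>\<mu>) \<in> borel_measurable config_algebra"
    by (rule measurable_nn_integral_config) measurable
  show ?thesis unfolding lexp_def[abs_def] by measurable
qed

lemma laplace_alg_measurable [measurable]: "laplace_alg g \<Longrightarrow> g \<in> borel_measurable config_algebra"
  by (induction rule: laplace_alg.induct) auto

lemma laplace_alg_bounded: "laplace_alg g \<Longrightarrow> \<exists>c. \<forall>\<mu>. \<bar>g \<mu>\<bar> \<le> c"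
proof (induction rule: laplace_alg.induct)
  case (base v c)
  show ?case
    using lexp_bounds[of v] by (intro exI[of _ "\<bar>c\<bar>"]) (auto simp: abs_mult less_imp_le intro!: mult_left_le)
next
  case (add f g)
  then obtain c d where "\<forall>\<mu>. \<bar>f \<mu>\<bar> \<le> c" "\<forall>\<mu>. \<bar>g \<mu>\<bar> \<le> d" by blast
  then show ?case by (intro exI[of _ "c + d"]) (metis abs_triangle_ineq add_mono order_trans)
qed

lemma laplace_alg_lexp: "test_fun v \<Longrightarrow> laplace_alg (lexp v)"
  using laplace_alg.base[of v 1] by simp

lemma laplace_alg_const: "laplace_alg (\<lambda>\<mu>. c)"
  using laplace_alg.base[OF test_fun_zero, of c] by simp

lemma laplace_alg_scale: "laplace_alg g \<Longrightarrow> laplace_alg (\<lambda>\<mu>. c * g \<mu>)"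
proof (induction rule: laplace_alg.induct)
  case (base v d) then show ?case using laplace_alg.base[of v "c * d"] by (simp add: mult.assoc)
qed (auto simp: distrib_left intro: laplace_alg.add)

lemma laplace_alg_mult:
  assumes "laplace_alg f" "laplace_alg g"
  shows "\<exists>h. laplace_alg h \<and> (\<forall>\<mu>\<in>config_space. h \<mu> = f \<mu> * g \<mu>)"
  using assms(1)
proof (induction rule: laplace_alg.induct)
  case (base v c)
  show ?case using assms(2)
  proof (induction rule: laplace_alg.induct)
    case (base w d)
    with \<open>test_fun v\<close> show ?case
      by (intro exI[of _ "\<lambda>\<mu>. (c * d) * lexp (\<lambda>x. v x + w x) \<mu>"])
         (auto simp: lexp_add intro: laplace_alg.base test_fun_add)
  next
    case (add f g)
    then obtain h h' where "laplace_alg h" "\<forall>\<mu>\<in>config_space. h \<mu> = c * lexp v \<mu> * f \<mu>"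
      "laplace_alg h'" "\<forall>\<mu>\<in>config_space. h' \<mu> = c * lexp v \<mu> * g \<mu>" by auto
    then show ?case
      by (intro exI[of _ "\<lambda>\<mu>. h \<mu> + h' \<mu>"]) (auto simp: distrib_left intro: laplace_alg.add)
  qed
next
  case (add f f')
  then obtain h h' where "laplace_alg h" "\<forall>\<mu>\<in>config_space. h \<mu> = f \<mu> * g \<mu>"
    "laplace_alg h'" "\<forall>\<mu>\<in>config_space. h' \<mu> = f' \<mu> * g \<mu>" by auto
  then show ?case
    by (intro exI[of _ "\<lambda>\<mu>. h \<mu> + h' \<mu>"]) (auto simp: distrib_right intro: laplace_alg.add)
qed

lemma laplace_alg_polynomial:
  assumes "real_polynomial_function p" and v: "test_fun v"
  shows "\<exists>g. laplace_alg g \<and> (\<forall>\<mu>\<in>config_space. g \<mu> = p (lexp v \<mu>))"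
  using assms(1)
proof (induction rule: real_polynomial_function.induct)
  case (linear f)
  have "f 1 * x = f x" for x
    using linear_scale[OF bounded_linear.linear[OF linear], of x 1] by (simp add: mult.commute)
  then show ?case
    by (intro exI[of _ "\<lambda>\<mu>. f 1 * lexp v \<mu>"] conjI ballI laplace_alg.base v)
next
  case (const c) then show ?case using laplace_alg_const by blast
next
  case (add f g)
  then obtain h h' where "laplace_alg h" "\<forall>\<mu>\<in>config_space. h \<mu> = f (lexp v \<mu>)"
    "laplace_alg h'" "\<forall>\<mu>\<in>config_space. h' \<mu> = g (lexp v \<mu>)" by auto
  then show ?case
    by (intro exI[of _ "\<lambda>\<mu>. h \<mu> + h' \<mu>"]) (auto intro: laplace_alg.add)
next
  case (mult f g)
  then obtain h h' where h: "laplace_alg h" "\<forall>\<mu>\<in>config_space. h \<mu> = f (lexp v \<mu>)"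
    "laplace_alg h'" "\<forall>\<mu>\<in>config_space. h' \<mu> = g (lexp v \<mu>)" by auto
  obtain k where "laplace_alg k" "\<forall>\<mu>\<in>config_space. k \<mu> = h \<mu> * h' \<mu>"
    using laplace_alg_mult[OF h(1,3)] by blast
  with h show ?case by (intro exI[of _ k]) simp
qed

definition unif_approx :: "('a::polish_space measure \<Rightarrow> real) \<Rightarrow> bool" where
  "unif_approx f \<longleftrightarrow> (\<forall>e>0. \<exists>g. laplace_alg g \<and> (\<forall>\<mu>\<in>config_space. \<bar>f \<mu> - g \<mu>\<bar> < e))"

text \<open>The numbers \<open>exp (- k)\<close> are isolated from each other, so that some continuous function separates
  one of them from all others; by Weierstrass it is nearly a polynomial in \<open>exp (- \<mu> B)\<close>.\<close>

lemma unif_approx_count: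
  assumes B: "B \<in> sets borel" "bounded B"
  shows "unif_approx (\<lambda>\<mu>. if emeasure \<mu> B = of_nat k then 1 else 0)"
  unfolding unif_approx_def
proof (intro allI impI)
  fix e :: real assume "0 < e"
  define q where "q n = exp (- real n)" for n
  have q_mono: "m \<le> n \<Longrightarrow> q n \<le> q m" for m n by (simp add: q_def)
  define d where "d = q k - q (Suc k)"
  have d: "0 < d" by (simp add: d_def q_def)
  (* The sequence q is convex and decreasing: its gaps shrink, so the next one is the smallest so far. *)
  have gap: "d \<le> \<bar>q n - q k\<bar>" if "n \<noteq> k" for n
  proof (cases "n < k")
    case False
    then have "q n \<le> q (Suc k)" using that by (intro q_mono) simp
    then show ?thesis by (simp add: d_def)
  next
    case True
    then have "q (k - 1) \<le> q n" by (intro q_mono) simp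
    moreover have "q (k - 1) - q k \<ge> d"
    proof -
      have *: "exp (- real (k - 1)) = exp 1 * exp (- real k)" "exp (- real (Suc k)) = exp (-1) * exp (- real k)"
        using True by (auto simp: exp_add[symmetric] of_nat_diff_real)
      have "(2::real) \<le> exp 1 + exp (-1)"
        using exp_ge_add_one_self[of 1] exp_ge_zero[of "-1::real"] by linarith
      then have "0 \<le> (exp 1 + exp (-1) - 2) * exp (- real k)" by simp
      also have "\<dots> = (exp 1 * exp (- real k) - exp (- real k)) - (exp (- real k) - exp (-1) * exp (- real k))"
        by (simp add: algebra_simps)
      finally show ?thesis unfolding d_def q_def * by linarith
    qed
    ultimately show ?thesis by linarith
  qed
  define f where "f x = max 0 (1 - \<bar>x - q k\<bar> / d)" for x :: real
  have "continuous_on {0..1} f" unfolding f_def using d by (intro continuous_intros) auto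
  then obtain p where p: "real_polynomial_function p" "\<And>x. x \<in> {0..1} \<Longrightarrow> \<bar>f x - p x\<bar> < e"
    using Stone_Weierstrass_real_polynomial_function[of "{0..1::real}" f e] \<open>0 < e\<close> by auto
  have t: "test_fun (\<lambda>x. 1 * indicator B x)" by (rule test_fun_indicator) (use B in auto)
  obtain g where g: "laplace_alg g" "\<forall>\<mu>\<in>config_space. g \<mu> = p (lexp (\<lambda>x. 1 * indicator B x) \<mu>)"
    using laplace_alg_polynomial[OF p(1) t] by blast
  show "\<exists>g. laplace_alg g \<and> (\<forall>\<mu>\<in>config_space. \<bar>(if emeasure \<mu> B = of_nat k then 1 else 0) - g \<mu>\<bar> < e)"
  proof (intro exI[of _ g] conjI ballI g(1))
    fix \<mu> :: "'a measure" assume \<mu>: "\<mu> \<in> config_space"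
    obtain n :: nat where n: "emeasure \<mu> B = of_nat n" using config_nat[OF \<mu> B] by blast
    have l: "lexp (\<lambda>x. 1 * indicator B x) \<mu> = q n"
      using lexp_indicator[OF \<mu> B(1), of 1] n by (simp add: q_def measure_def)
    have "(if emeasure \<mu> B = of_nat k then 1 else 0) = f (q n)"
      unfolding n f_def using gap[of n] d by (auto simp: max_def field_simps)
    moreover have "q n \<in> {0..1}" by (simp add: q_def)
    ultimately show "\<bar>(if emeasure \<mu> B = of_nat k then 1 else 0) - g \<mu>\<bar> < e"
      using p(2)[of "q n"] g(2) \<mu> l by simp
  qed
qed

lemma unif_approx_mult:
  assumes f: "unif_approx f" and f': "unif_approx f'"
    and b: "\<And>\<mu>. \<bar>f \<mu>\<bar> \<le> 1" "\<And>\<mu>. \<bar>f' \<mu>\<bar> \<le> 1"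
  shows "unif_approx (\<lambda>\<mu>. f \<mu> * f' \<mu>)"
  unfolding unif_approx_def
proof (intro allI impI)
  fix e :: real assume e: "0 < e"
  define d where "d = min 1 (e / 3)"
  have d: "0 < d" "d \<le> 1" "3 * d \<le> e" using e by (auto simp: d_def)
  obtain g g' where g: "laplace_alg g" "\<forall>\<mu>\<in>config_space. \<bar>f \<mu> - g \<mu>\<bar> < d"
    and g': "laplace_alg g'" "\<forall>\<mu>\<in>config_space. \<bar>f' \<mu> - g' \<mu>\<bar> < d"
    using f f' d(1) unfolding unif_approx_def by meson
  obtain h where h: "laplace_alg h" "\<forall>\<mu>\<in>config_space. h \<mu> = g \<mu> * g' \<mu>"
    using laplace_alg_mult[OF g(1) g'(1)] by blast
  show "\<exists>g. laplace_alg g \<and> (\<forall>\<mu>\<in>config_space. \<bar>f \<mu> * f' \<mu> - g \<mu>\<bar> < e)"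
  proof (intro exI[of _ h] conjI ballI h(1))
    fix \<mu> :: "'a measure" assume \<mu>: "\<mu> \<in> config_space"
    have "f \<mu> * f' \<mu> - h \<mu> = f \<mu> * (f' \<mu> - g' \<mu>) + g' \<mu> * (f \<mu> - g \<mu>)"
      using h \<mu> by (simp add: algebra_simps)
    then have "\<bar>f \<mu> * f' \<mu> - h \<mu>\<bar> \<le> \<bar>f \<mu>\<bar> * \<bar>f' \<mu> - g' \<mu>\<bar> + \<bar>g' \<mu>\<bar> * \<bar>f \<mu> - g \<mu>\<bar>"
      using abs_triangle_ineq by (metis abs_mult)
    also have "\<bar>f \<mu>\<bar> * \<bar>f' \<mu> - g' \<mu>\<bar> \<le> 1 * \<bar>f' \<mu> - g' \<mu>\<bar>" using b by (intro mult_right_mono) auto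
    also have "\<bar>g' \<mu>\<bar> * \<bar>f \<mu> - g \<mu>\<bar> \<le> 2 * \<bar>f \<mu> - g \<mu>\<bar>"
    proof (intro mult_right_mono)
      have "\<bar>f' \<mu> - g' \<mu>\<bar> < d" using g' \<mu> by blast
      then show "\<bar>g' \<mu>\<bar> \<le> 2" using b(2)[of \<mu>] d by linarith
    qed auto
    finally have "\<bar>f \<mu> * f' \<mu> - h \<mu>\<bar> \<le> 1 * \<bar>f' \<mu> - g' \<mu>\<bar> + 2 * \<bar>f \<mu> - g \<mu>\<bar>" by simp
    then show "\<bar>f \<mu> * f' \<mu> - h \<mu>\<bar> < e"
    proof (rule le_less_trans)
      have "1 * x + 2 * y < e" if "x < d" "y < d" for x y using that d by linarith
      then show "1 * \<bar>f' \<mu> - g' \<mu>\<bar> + 2 * \<bar>f \<mu> - g \<mu>\<bar> < e"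
        using bspec[OF g(2) \<mu>] bspec[OF g'(2) \<mu>] by blast
    qed
  qed
qed

text \<open>Events that prescribe finitely many counts are stable under intersection and generate the
  \<open>\<sigma>\<close>-algebra, so that approximability passes from them to all events.\<close>

definition count_event :: "('a::polish_space set \<times> nat) set \<Rightarrow> 'a measure set" where
  "count_event S = {\<mu>\<in>config_space. \<forall>(B, k)\<in>S. emeasure \<mu> B = of_nat k}"

definition count_events :: "'a::polish_space measure set set" where
  "count_events = {count_event S | S. finite S \<and> (\<forall>(B, k)\<in>S. B \<in> sets borel \<and> bounded B)}"

lemma unif_approx_count_event:
  assumes "finite S" "\<forall>(B, k)\<in>S. B \<in> sets borel \<and> bounded B"
  shows "unif_approx (\<lambda>\<mu>. if \<forall>(B, k)\<in>S. emeasure \<mu> B = of_nat k then 1 else 0)"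
  using assms
proof (induction S)
  case empty
  then show ?case using laplace_alg_const[of 1] by (force simp: unif_approx_def)
next
  case (insert p S)
  obtain B k where p: "p = (B, k)" by force
  have "unif_approx (\<lambda>\<mu>. (if emeasure \<mu> B = of_nat k then 1 else 0) *
      (if \<forall>(B, k)\<in>S. emeasure \<mu> B = of_nat k then 1 else 0))"
    using insert p by (intro unif_approx_mult unif_approx_count) auto
  also have "(\<lambda>\<mu>. (if emeasure \<mu> B = of_nat k then 1 else 0) *
      (if \<forall>(B, k)\<in>S. emeasure \<mu> B = of_nat k then 1 else 0)) =
      (\<lambda>\<mu>. if \<forall>(B, k)\<in>insert p S. emeasure \<mu> B = of_nat k then 1 else (0::real))"
    unfolding p by (auto simp: fun_eq_iff)
  finally show ?case .
qed

lemma Int_stable_count_events: "Int_stable count_events"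
proof (rule Int_stableI)
  fix a b :: "'a measure set" assume "a \<in> count_events" "b \<in> count_events"
  then obtain S T where "a = count_event S" "b = count_event T" "finite S" "finite T"
    "\<forall>(B, k)\<in>S. B \<in> sets borel \<and> bounded B" "\<forall>(B, k)\<in>T. B \<in> sets borel \<and> bounded B"
    unfolding count_events_def by blast
  then show "a \<inter> b \<in> count_events"
    unfolding count_events_def by (intro CollectI exI[of _ "S \<union> T"]) (auto simp: count_event_def)
qed

lemma count_events_subset: "count_events \<subseteq> Pow config_space"
  by (auto simp: count_events_def count_event_def)

text \<open>On a bounded set there are only countably many possible counts; an unbounded set is the
  increasing union of its bounded parts.\<close>

lemma sets_config_algebra: "sets config_algebra = sigma_sets config_space count_events"
proof
  let ?S = "sigma config_space (count_events :: 'a measure set set)"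
  have [simp]: "space ?S = config_space" "sets ?S = sigma_sets config_space count_events"
    using space_measure_of[OF count_events_subset] sets_measure_of[OF count_events_subset] by auto
  have bdd: "(\<lambda>\<mu>. emeasure \<mu> B) \<in> borel_measurable ?S" if B: "B \<in> sets borel" "bounded B" for B :: "'a set"
  proof -
    have ev: "{\<mu>\<in>config_space. emeasure \<mu> B = of_nat k} \<in> sets ?S" for k
    proof -
      have "{\<mu>\<in>config_space. emeasure \<mu> B = of_nat k} = count_event {(B, k)}" by (auto simp: count_event_def)
      moreover have "count_event {(B, k)} \<in> count_events"
        using B by (auto simp: count_events_def intro!: exI[of _ "{(B, k)}"])
      ultimately show ?thesis by simp
    qed
    show ?thesis
    proof (rule measurableI)
      fix A :: "ennreal set" assume "A \<in> sets borel"
      have "(\<lambda>\<mu>. emeasure \<mu> B) -` A \<inter> space ?S = (\<Union>k\<in>{k. of_nat k \<in> A}. {\<mu>\<in>config_space. emeasure \<mu> B = of_nat k})"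
        using config_nat[OF _ B] by fastforce
      also have "\<dots> \<in> sets ?S" using ev by (intro sets.countable_UN') auto
      finally show "(\<lambda>\<mu>. emeasure \<mu> B) -` A \<inter> space ?S \<in> sets ?S" .
    qed auto
  qed
  have "(\<lambda>\<mu>. \<mu>) \<in> measurable ?S config_algebra"
  proof (rule measurable_configI)
    fix B :: "'a set" assume B: "B \<in> sets borel"
    have "(\<lambda>\<mu>. SUP n. emeasure \<mu> (B \<inter> loc_ball n)) \<in> borel_measurable ?S"
      by (intro borel_measurable_SUP bdd) (use B in \<open>auto intro: bounded_subset[OF bounded_loc_ball]\<close>)
    moreover have "(SUP n. emeasure \<mu> (B \<inter> loc_ball n)) = emeasure \<mu> B" if "\<mu> \<in> config_space" for \<mu>
    proof -
      have "(SUP n. emeasure \<mu> (B \<inter> loc_ball n)) = emeasure \<mu> (\<Union>n. B \<inter> loc_ball n)"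
        using that B loc_ball_mono by (intro SUP_emeasure_incseq) (auto simp: incseq_def)
      also have "(\<Union>n. B \<inter> loc_ball n) = B" using UN_loc_ball by blast
      finally show ?thesis .
    qed
    ultimately show "(\<lambda>\<mu>. emeasure \<mu> B) \<in> borel_measurable ?S"
      by (subst measurable_cong[where g="\<lambda>\<mu>. SUP n. emeasure \<mu> (B \<inter> loc_ball n)"]) auto
  qed auto
  then show "sets (config_algebra :: 'a measure measure) \<subseteq> sigma_sets config_space count_events"
  proof (intro subsetI)
    fix A :: "'a measure set" assume A: "A \<in> sets config_algebra"
    from measurable_sets[OF \<open>(\<lambda>\<mu>. \<mu>) \<in> measurable ?S config_algebra\<close> A]
    have "(\<lambda>\<mu>. \<mu>) -` A \<inter> space ?S \<in> sets ?S" .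
    moreover have "(\<lambda>\<mu>. \<mu>) -` A \<inter> space ?S = A" using sets.sets_into_space[OF A] by auto
    ultimately show "A \<in> sigma_sets config_space count_events" by simp
  qed
next
  show "sigma_sets config_space count_events \<subseteq> sets (config_algebra :: 'a measure measure)"
  proof -
    have "count_event S \<in> sets config_algebra"
      if "finite S" "\<forall>(B, k)\<in>S. B \<in> sets borel \<and> bounded B" for S :: "('a set \<times> nat) set"
      using that
    proof (induction S)
      case empty
      then show ?case using sets.top[of "config_algebra :: 'a measure measure"] by (simp add: count_event_def)
    next
      case (insert p S)
      obtain B k where p: "p = (B, k)" by force
      have [measurable]: "B \<in> sets borel" using insert p by simp
      have "{\<mu>\<in>space config_algebra. emeasure \<mu> B = of_nat k} \<in> sets config_algebra" by measurable
      moreover have "count_event (insert p S) = {\<mu>\<in>space config_algebra. emeasure \<mu> B = of_nat k} \<inter> count_event S"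
        by (auto simp: count_event_def p)
      ultimately show ?case using insert by auto
    qed
    then have "count_events \<subseteq> sets (config_algebra :: 'a measure measure)"
      by (auto simp: count_events_def)
    then show ?thesis by (metis sets.sigma_sets_subset space_config_algebra)
  qed
qed

text \<open>The error functional \<open>err\<close> below measures a weighted \<open>L\<^sup>1\<close> distance for \<open>q = 0\<close>, and a weighted \<open>L\<^sup>1\<close>
  distance together with an \<open>L\<^sup>2\<close> distance for \<open>q = 1\<close>.  Both are needed, and one density argument serves
  both.\<close>

locale config_weight = finite_measure L
  for L :: "'a::polish_space measure measure" and W :: "'a measure \<Rightarrow> real" and q :: real +
  assumes sets_law [measurable_cong, simp]: "sets L = sets config_algebra"
    and W [measurable]: "W \<in> borel_measurable config_algebra" and W0: "\<And>\<mu>. 0 \<le> W \<mu>" and q0: "0 \<le> q"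
    and W_fin: "(\<integral>\<^sup>+\<mu>. ennreal (W \<mu>) \<partial>L) < \<infinity>"
begin

lemma space_law [simp]: "space L = config_space"
  using sets_eq_imp_space_eq[OF sets_law] by simp

lemma law_finite: "emeasure L config_space < \<infinity>"
  using emeasure_finite[of config_space] by (simp add: less_top[symmetric])

definition err :: "('a measure \<Rightarrow> real) \<Rightarrow> ennreal" where
  "err h = (\<integral>\<^sup>+\<mu>. ennreal (\<bar>h \<mu>\<bar> * W \<mu> + q * (h \<mu>)\<^sup>2) \<partial>L)"

definition approximable :: "('a measure \<Rightarrow> real) \<Rightarrow> bool" where
  "approximable f \<longleftrightarrow> f \<in> borel_measurable config_algebra \<and>
     (\<forall>e>0. \<exists>g. laplace_alg g \<and> err (\<lambda>\<mu>. f \<mu> - g \<mu>) < ennreal e)"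

lemma err_add:
  assumes [measurable]: "f \<in> borel_measurable config_algebra" "g \<in> borel_measurable config_algebra"
  shows "err (\<lambda>\<mu>. f \<mu> + g \<mu>) \<le> 2 * err f + 2 * err g"
proof -
  have "err (\<lambda>\<mu>. f \<mu> + g \<mu>) \<le> (\<integral>\<^sup>+\<mu>. 2 * ennreal (\<bar>f \<mu>\<bar> * W \<mu> + q * (f \<mu>)\<^sup>2) + 2 * ennreal (\<bar>g \<mu>\<bar> * W \<mu> + q * (g \<mu>)\<^sup>2) \<partial>L)"
    unfolding err_def
  proof (rule nn_integral_mono)
    fix \<mu>
    have "\<bar>f \<mu> + g \<mu>\<bar> * W \<mu> \<le> 2 * (\<bar>f \<mu>\<bar> * W \<mu>) + 2 * (\<bar>g \<mu>\<bar> * W \<mu>)"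
      using mult_right_mono[OF abs_triangle_ineq[of "f \<mu>" "g \<mu>"] W0[of \<mu>]]
        mult_nonneg_nonneg[OF abs_ge_zero W0, of "f \<mu>" \<mu>] mult_nonneg_nonneg[OF abs_ge_zero W0, of "g \<mu>" \<mu>]
      by (simp add: distrib_right)
    moreover have "q * (f \<mu> + g \<mu>)\<^sup>2 \<le> q * (2 * (f \<mu>)\<^sup>2 + 2 * (g \<mu>)\<^sup>2)"
      using sum_squares_bound[of "f \<mu>" "g \<mu>"] q0 by (intro mult_left_mono) (auto simp: power2_sum)
    ultimately have "\<bar>f \<mu> + g \<mu>\<bar> * W \<mu> + q * (f \<mu> + g \<mu>)\<^sup>2 \<le>
        2 * (\<bar>f \<mu>\<bar> * W \<mu> + q * (f \<mu>)\<^sup>2) + 2 * (\<bar>g \<mu>\<bar> * W \<mu> + q * (g \<mu>)\<^sup>2)"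
      by (simp add: algebra_simps)
    then have "ennreal (\<bar>f \<mu> + g \<mu>\<bar> * W \<mu> + q * (f \<mu> + g \<mu>)\<^sup>2) \<le>
        ennreal (2 * (\<bar>f \<mu>\<bar> * W \<mu> + q * (f \<mu>)\<^sup>2) + 2 * (\<bar>g \<mu>\<bar> * W \<mu> + q * (g \<mu>)\<^sup>2))"
      by (rule ennreal_leI)
    also have "\<dots> = 2 * ennreal (\<bar>f \<mu>\<bar> * W \<mu> + q * (f \<mu>)\<^sup>2) + 2 * ennreal (\<bar>g \<mu>\<bar> * W \<mu> + q * (g \<mu>)\<^sup>2)"
      using W0 q0 by (subst ennreal_plus) (auto simp: ennreal_mult)
    finally show "ennreal (\<bar>f \<mu> + g \<mu>\<bar> * W \<mu> + q * (f \<mu> + g \<mu>)\<^sup>2) \<le> \<dots>" .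
  qed
  also have "\<dots> = 2 * err f + 2 * err g"
    unfolding err_def by (simp add: nn_integral_add nn_integral_cmult)
  finally show ?thesis .
qed

lemma approximable_limit:
  assumes [measurable]: "f \<in> borel_measurable config_algebra"
    and *: "\<And>e. 0 < e \<Longrightarrow> \<exists>f'. approximable f' \<and> err (\<lambda>\<mu>. f \<mu> - f' \<mu>) < ennreal e"
  shows "approximable f"
  unfolding approximable_def
proof (intro conjI assms(1) allI impI)
  fix e :: real assume e: "0 < e"
  obtain f' where f': "approximable f'" "err (\<lambda>\<mu>. f \<mu> - f' \<mu>) < ennreal (e/4)" using *[of "e/4"] e by auto
  then obtain g where g: "laplace_alg g" "err (\<lambda>\<mu>. f' \<mu> - g \<mu>) < ennreal (e/4)"
    unfolding approximable_def using e by (metis divide_pos_pos zero_less_numeral)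
  have [measurable]: "f' \<in> borel_measurable config_algebra" "g \<in> borel_measurable config_algebra"
    using f'(1) g(1) by (auto simp: approximable_def)
  have "err (\<lambda>\<mu>. (f \<mu> - f' \<mu>) + (f' \<mu> - g \<mu>)) \<le> 2 * err (\<lambda>\<mu>. f \<mu> - f' \<mu>) + 2 * err (\<lambda>\<mu>. f' \<mu> - g \<mu>)"
    by (rule err_add) auto
  also have "\<dots> < 2 * ennreal (e/4) + 2 * ennreal (e/4)"
    using f' g by (intro add_strict_mono ennreal_mult_strict_left_mono) auto
  also have "\<dots> = ennreal (2 * (e/4) + 2 * (e/4))"
    using e by (simp only: ennreal_plus ennreal_mult) simp
  also have "2 * (e/4) + 2 * (e/4) = e" by simp
  finally show "\<exists>g. laplace_alg g \<and> err (\<lambda>\<mu>. f \<mu> - g \<mu>) < ennreal e" using g(1) by auto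
qed

lemma approximable_add:
  assumes f: "approximable f" and g: "approximable g"
  shows "approximable (\<lambda>\<mu>. f \<mu> + g \<mu>)"
  unfolding approximable_def
proof (intro conjI allI impI)
  have [measurable]: "f \<in> borel_measurable config_algebra" "g \<in> borel_measurable config_algebra"
    using f g by (auto simp: approximable_def)
  show "(\<lambda>\<mu>. f \<mu> + g \<mu>) \<in> borel_measurable config_algebra" by measurable
  fix e :: real assume e: "0 < e"
  then obtain f' g' where f': "laplace_alg f'" "err (\<lambda>\<mu>. f \<mu> - f' \<mu>) < ennreal (e/4)"
    and g': "laplace_alg g'" "err (\<lambda>\<mu>. g \<mu> - g' \<mu>) < ennreal (e/4)"
    using f g unfolding approximable_def by (metis divide_pos_pos zero_less_numeral)
  have "err (\<lambda>\<mu>. (f \<mu> - f' \<mu>) + (g \<mu> - g' \<mu>)) \<le> 2 * err (\<lambda>\<mu>. f \<mu> - f' \<mu>) + 2 * err (\<lambda>\<mu>. g \<mu> - g' \<mu>)"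
    using f'(1) g'(1) by (intro err_add) auto
  also have "\<dots> < 2 * ennreal (e/4) + 2 * ennreal (e/4)"
    using f' g' by (intro add_strict_mono ennreal_mult_strict_left_mono) auto
  also have "\<dots> = ennreal (2 * (e/4) + 2 * (e/4))"
    using e by (simp only: ennreal_plus ennreal_mult) simp
  also have "2 * (e/4) + 2 * (e/4) = e" by simp
  finally show "\<exists>h. laplace_alg h \<and> err (\<lambda>\<mu>. f \<mu> + g \<mu> - h \<mu>) < ennreal e"
    using f'(1) g'(1) by (intro exI[of _ "\<lambda>\<mu>. f' \<mu> + g' \<mu>"]) (auto simp: algebra_simps intro: laplace_alg.add)
qed

lemma err_scale:
  assumes [measurable]: "f \<in> borel_measurable config_algebra"
  shows "err (\<lambda>\<mu>. c * f \<mu>) \<le> ennreal (\<bar>c\<bar> + c\<^sup>2) * err f"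
proof -
  have "err (\<lambda>\<mu>. c * f \<mu>) \<le> (\<integral>\<^sup>+\<mu>. ennreal (\<bar>c\<bar> + c\<^sup>2) * ennreal (\<bar>f \<mu>\<bar> * W \<mu> + q * (f \<mu>)\<^sup>2) \<partial>L)"
    unfolding err_def
  proof (rule nn_integral_mono)
    fix \<mu>
    have "0 \<le> \<bar>f \<mu>\<bar> * W \<mu>" "0 \<le> q * (f \<mu>)\<^sup>2" using W0 q0 by auto
    then have "0 \<le> c\<^sup>2 * (\<bar>f \<mu>\<bar> * W \<mu>)" "0 \<le> \<bar>c\<bar> * (q * (f \<mu>)\<^sup>2)" by auto
    then have "\<bar>c * f \<mu>\<bar> * W \<mu> + q * (c * f \<mu>)\<^sup>2 \<le> (\<bar>c\<bar> + c\<^sup>2) * (\<bar>f \<mu>\<bar> * W \<mu> + q * (f \<mu>)\<^sup>2)"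
      by (simp add: algebra_simps abs_mult power_mult_distrib)
    then show "ennreal (\<bar>c * f \<mu>\<bar> * W \<mu> + q * (c * f \<mu>)\<^sup>2) \<le> ennreal (\<bar>c\<bar> + c\<^sup>2) * ennreal (\<bar>f \<mu>\<bar> * W \<mu> + q * (f \<mu>)\<^sup>2)"
      using W0 q0 by (subst ennreal_mult[symmetric]) (auto intro!: ennreal_leI simp del: ennreal_plus)
  qed
  also have "\<dots> = ennreal (\<bar>c\<bar> + c\<^sup>2) * err f"
    unfolding err_def by (simp add: nn_integral_cmult)
  finally show ?thesis .
qed

lemma approximable_scale:
  assumes f: "approximable f"
  shows "approximable (\<lambda>\<mu>. c * f \<mu>)"
  unfolding approximable_def
proof (intro conjI allI impI)
  have [measurable]: "f \<in> borel_measurable config_algebra"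
    using f by (auto simp: approximable_def)
  show "(\<lambda>\<mu>. c * f \<mu>) \<in> borel_measurable config_algebra" by measurable
  fix e :: real assume e: "0 < e"
  define k where "k = 1 + \<bar>c\<bar> + c\<^sup>2"
  have k: "0 < k" unfolding k_def by (smt (verit) zero_le_power2)
  obtain f' where f': "laplace_alg f'" "err (\<lambda>\<mu>. f \<mu> - f' \<mu>) < ennreal (e/k)"
    using f e k unfolding approximable_def by (metis divide_pos_pos)
  have "err (\<lambda>\<mu>. c * (f \<mu> - f' \<mu>)) \<le> ennreal (\<bar>c\<bar> + c\<^sup>2) * err (\<lambda>\<mu>. f \<mu> - f' \<mu>)"
    using f'(1) by (intro err_scale) auto
  also have "\<dots> \<le> ennreal k * err (\<lambda>\<mu>. f \<mu> - f' \<mu>)"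
    by (intro mult_right_mono ennreal_leI) (auto simp: k_def)
  also have "\<dots> < ennreal k * ennreal (e/k)"
    using f' k by (intro ennreal_mult_strict_left_mono) auto
  also have "\<dots> = ennreal e" using e k by (simp add: ennreal_mult[symmetric])
  finally show "\<exists>h. laplace_alg h \<and> err (\<lambda>\<mu>. c * f \<mu> - h \<mu>) < ennreal e"
    using f'(1) by (intro exI[of _ "\<lambda>\<mu>. c * f' \<mu>"]) (auto simp: algebra_simps intro: laplace_alg_scale)
qed

lemma approximable_alg: "laplace_alg g \<Longrightarrow> approximable g"
  unfolding approximable_def by (auto intro!: exI[of _ g] simp: err_def)

lemma approximable_unif:
  assumes f: "unif_approx f" and [measurable]: "f \<in> borel_measurable config_algebra"
  shows "approximable f"
proof (rule approximable_limit)
  fix e :: real assume e: "0 < e"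
  obtain K where K: "(\<integral>\<^sup>+\<mu>. ennreal (W \<mu> + q) \<partial>L) = ennreal K" "0 \<le> K"
  proof -
    have "(\<integral>\<^sup>+\<mu>. ennreal (W \<mu> + q) \<partial>L) = (\<integral>\<^sup>+\<mu>. ennreal (W \<mu>) + ennreal q \<partial>L)"
      using W0 q0 by (intro nn_integral_cong) simp
    also have "\<dots> = (\<integral>\<^sup>+\<mu>. ennreal (W \<mu>) \<partial>L) + ennreal q * emeasure L (space L)"
      by (subst nn_integral_add) (auto simp: nn_integral_const)
    also have "\<dots> < \<infinity>" using W_fin law_finite by (auto simp: ennreal_mult_less_top)
    finally show ?thesis using that by (metis ennreal_cases less_irrefl infinity_ennreal_def)
  qed
  define d where "d = min 1 (e / (2 * (K + 1)))"
  have d: "0 < d" "d \<le> 1" "d * K < e"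
  proof -
    show "0 < d" "d \<le> 1" using e K by (auto simp: d_def)
    have "d * K \<le> e / (2 * (K + 1)) * K" using K by (intro mult_right_mono) (auto simp: d_def)
    also have "\<dots> < e" using e K by (simp add: field_simps add_nonneg_pos)
    finally show "d * K < e" .
  qed
  obtain g where g: "laplace_alg g" "\<forall>\<mu>\<in>config_space. \<bar>f \<mu> - g \<mu>\<bar> < d"
    using f d unfolding unif_approx_def by blast
  have "err (\<lambda>\<mu>. f \<mu> - g \<mu>) \<le> (\<integral>\<^sup>+\<mu>. ennreal d * ennreal (W \<mu> + q) \<partial>L)"
    unfolding err_def
  proof (rule nn_integral_mono)
    fix \<mu> assume "\<mu> \<in> space L"
    then have h: "\<bar>f \<mu> - g \<mu>\<bar> < d" using g by auto
    have "(f \<mu> - g \<mu>)\<^sup>2 = \<bar>f \<mu> - g \<mu>\<bar> * \<bar>f \<mu> - g \<mu>\<bar>" by (simp add: power2_eq_square)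
    also have "\<dots> \<le> d * 1" using h d by (intro mult_mono) auto
    finally have "q * (f \<mu> - g \<mu>)\<^sup>2 \<le> q * d" using q0 by (intro mult_left_mono) auto
    moreover have "\<bar>f \<mu> - g \<mu>\<bar> * W \<mu> \<le> d * W \<mu>" using h W0 by (intro mult_right_mono) auto
    ultimately show "ennreal (\<bar>f \<mu> - g \<mu>\<bar> * W \<mu> + q * (f \<mu> - g \<mu>)\<^sup>2) \<le> ennreal d * ennreal (W \<mu> + q)"
      using d q0 W0 by (subst ennreal_mult[symmetric]) (auto intro!: ennreal_leI simp: algebra_simps simp del: ennreal_plus)
  qed
  also have "\<dots> = ennreal (d * K)"
    using d K by (simp add: nn_integral_cmult ennreal_mult)
  also have "\<dots> < ennreal e" using d e by (simp add: ennreal_lessI)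
  finally show "\<exists>f'. approximable f' \<and> err (\<lambda>\<mu>. f \<mu> - f' \<mu>) < ennreal e"
    using approximable_alg[OF g(1)] by blast
qed fact

lemma approximable_dominated:
  assumes f [measurable]: "f \<in> borel_measurable config_algebra" and fin: "err f < \<infinity>"
    and s: "\<And>i::nat. approximable (s i)"
    and lim: "\<And>\<mu>. \<mu> \<in> config_space \<Longrightarrow> (\<lambda>i. s i \<mu>) \<longlonglongrightarrow> f \<mu>"
    and dom: "\<And>i \<mu>. \<mu> \<in> config_space \<Longrightarrow> \<bar>s i \<mu>\<bar> \<le> 2 * \<bar>f \<mu>\<bar>"
  shows "approximable f"
proof (rule approximable_limit)
  have [measurable]: "s i \<in> borel_measurable config_algebra" for i using s by (auto simp: approximable_def)
  (* The domination gives |f - s i| <= 3 |f|, hence an integrand of at most 9 times that of err f. *)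
  have "(\<lambda>i. err (\<lambda>\<mu>. f \<mu> - s i \<mu>)) \<longlonglongrightarrow> (\<integral>\<^sup>+\<mu>. 0 \<partial>L)"
    unfolding err_def
  proof (rule nn_integral_dominated_convergence[where w="\<lambda>\<mu>. 9 * ennreal (\<bar>f \<mu>\<bar> * W \<mu> + q * (f \<mu>)\<^sup>2)"])
    show "(\<integral>\<^sup>+\<mu>. 9 * ennreal (\<bar>f \<mu>\<bar> * W \<mu> + q * (f \<mu>)\<^sup>2) \<partial>L) < \<infinity>"
      using fin by (simp add: nn_integral_cmult err_def[symmetric] ennreal_mult_less_top)
    show "AE \<mu> in L. ennreal (\<bar>f \<mu> - s i \<mu>\<bar> * W \<mu> + q * (f \<mu> - s i \<mu>)\<^sup>2) \<le> 9 * ennreal (\<bar>f \<mu>\<bar> * W \<mu> + q * (f \<mu>)\<^sup>2)" for i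
    proof (rule AE_I2)
      fix \<mu> assume "\<mu> \<in> space L"
      then have "\<bar>s i \<mu>\<bar> \<le> 2 * \<bar>f \<mu>\<bar>" by (intro dom) simp
      then have h: "\<bar>f \<mu> - s i \<mu>\<bar> \<le> 3 * \<bar>f \<mu>\<bar>" by linarith
      then have "\<bar>f \<mu> - s i \<mu>\<bar>\<^sup>2 \<le> (3 * \<bar>f \<mu>\<bar>)\<^sup>2" by (intro power_mono) auto
      then have "q * (f \<mu> - s i \<mu>)\<^sup>2 \<le> q * (9 * (f \<mu>)\<^sup>2)" using q0 by (intro mult_left_mono) (auto simp: power_mult_distrib)
      moreover have "\<bar>f \<mu> - s i \<mu>\<bar> * W \<mu> \<le> (3 * \<bar>f \<mu>\<bar>) * W \<mu>" using h W0 by (intro mult_right_mono)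
      moreover have "0 \<le> \<bar>f \<mu>\<bar> * W \<mu>" using W0 by simp
      ultimately have "\<bar>f \<mu> - s i \<mu>\<bar> * W \<mu> + q * (f \<mu> - s i \<mu>)\<^sup>2 \<le> 9 * (\<bar>f \<mu>\<bar> * W \<mu> + q * (f \<mu>)\<^sup>2)"
        by (simp add: algebra_simps)
      then have "ennreal (\<bar>f \<mu> - s i \<mu>\<bar> * W \<mu> + q * (f \<mu> - s i \<mu>)\<^sup>2) \<le> ennreal (9 * (\<bar>f \<mu>\<bar> * W \<mu> + q * (f \<mu>)\<^sup>2))"
        by (rule ennreal_leI)
      also have "\<dots> = 9 * ennreal (\<bar>f \<mu>\<bar> * W \<mu> + q * (f \<mu>)\<^sup>2)" using W0 q0 by (subst ennreal_mult) auto
      finally show "ennreal (\<bar>f \<mu> - s i \<mu>\<bar> * W \<mu> + q * (f \<mu> - s i \<mu>)\<^sup>2) \<le> \<dots>" .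
    qed
    show "AE \<mu> in L. (\<lambda>i. ennreal (\<bar>f \<mu> - s i \<mu>\<bar> * W \<mu> + q * (f \<mu> - s i \<mu>)\<^sup>2)) \<longlonglongrightarrow> 0"
    proof (rule AE_I2)
      fix \<mu> assume "\<mu> \<in> space L"
      then have d: "(\<lambda>i. f \<mu> - s i \<mu>) \<longlonglongrightarrow> f \<mu> - f \<mu>" by (intro tendsto_diff tendsto_const lim) simp
      have "(\<lambda>i. \<bar>f \<mu> - s i \<mu>\<bar> * W \<mu> + q * (f \<mu> - s i \<mu>)\<^sup>2) \<longlonglongrightarrow> \<bar>f \<mu> - f \<mu>\<bar> * W \<mu> + q * (f \<mu> - f \<mu>)\<^sup>2"
        by (intro tendsto_add tendsto_mult tendsto_rabs tendsto_power tendsto_const d)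
      then show "(\<lambda>i. ennreal (\<bar>f \<mu> - s i \<mu>\<bar> * W \<mu> + q * (f \<mu> - s i \<mu>)\<^sup>2)) \<longlonglongrightarrow> 0"
        using tendsto_ennrealI[of _ 0] by (simp del: ennreal_plus)
    qed
  qed measurable
  then have lim0: "(\<lambda>i. err (\<lambda>\<mu>. f \<mu> - s i \<mu>)) \<longlonglongrightarrow> 0" by simp
  fix e :: real assume "0 < e"
  then have "eventually (\<lambda>i. err (\<lambda>\<mu>. f \<mu> - s i \<mu>) < ennreal e) sequentially"
    by (intro order_tendstoD[OF lim0]) simp
  then show "\<exists>f'. approximable f' \<and> err (\<lambda>\<mu>. f \<mu> - f' \<mu>) < ennreal e"
    using s by (auto simp: eventually_sequentially)
qed fact

lemma err_indicator_finite: "err (indicator A) < \<infinity>"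
proof -
  have "err (indicator A) \<le> (\<integral>\<^sup>+\<mu>. ennreal (W \<mu>) + ennreal q \<partial>L)"
    unfolding err_def using W0 q0 by (intro nn_integral_mono) (auto split: split_indicator)
  also have "\<dots> = (\<integral>\<^sup>+\<mu>. ennreal (W \<mu>) \<partial>L) + ennreal q * emeasure L (space L)"
    by (subst nn_integral_add) (auto simp: nn_integral_const)
  also have "\<dots> < \<infinity>" using W_fin law_finite by (auto simp: ennreal_mult_less_top)
  finally show ?thesis .
qed

lemma approximable_cong: "approximable f \<Longrightarrow> (\<And>\<mu>. \<mu> \<in> config_space \<Longrightarrow> f \<mu> = g \<mu>) \<Longrightarrow> approximable g"
proof -
  assume f: "approximable f" and eq: "\<And>\<mu>. \<mu> \<in> config_space \<Longrightarrow> f \<mu> = g \<mu>"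
  have m: "g \<in> borel_measurable config_algebra"
    using f eq measurable_cong[of config_algebra f g borel] by (auto simp: approximable_def)
  have "err (\<lambda>\<mu>. f \<mu> - h \<mu>) = err (\<lambda>\<mu>. g \<mu> - h \<mu>)" for h
    unfolding err_def using eq by (intro nn_integral_cong) simp
  with f m show ?thesis by (simp add: approximable_def)
qed

lemma approximable_indicator:
  assumes "A \<in> sets config_algebra"
  shows "approximable (indicator A)"
  using Int_stable_count_events count_events_subset assms[unfolded sets_config_algebra]
proof (induction rule: sigma_sets_induct_disjoint)
  case (basic A)
  then obtain S where S: "A = count_event S" "finite S" "\<forall>(B, k)\<in>S. B \<in> sets borel \<and> bounded B"
    unfolding count_events_def by blast
  have m: "count_event S \<in> sets config_algebra"
    unfolding sets_config_algebra using basic S by auto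
  let ?f = "\<lambda>\<mu>. if \<forall>(B, k)\<in>S. emeasure \<mu> B = of_nat k then 1 else 0 :: real"
  have eq: "?f \<mu> = indicator A \<mu>" if "\<mu> \<in> config_space" for \<mu>
    using that by (auto simp: S count_event_def)
  have "?f \<in> borel_measurable config_algebra"
    using measurable_cong[of config_algebra ?f "indicator A" borel] eq m S by simp
  from approximable_unif[OF unif_approx_count_event[OF S(2,3)] this] show ?case
    by (rule approximable_cong) (rule eq)
next
  case empty then show ?case using approximable_alg[OF laplace_alg_const[of 0]] by (simp add: indicator_def[abs_def])
next
  case (compl A)
  have "approximable (\<lambda>\<mu>. 1 + (-1) * indicator A \<mu>)"
    by (intro approximable_add approximable_scale compl approximable_alg laplace_alg_const)
  then show ?case by (rule approximable_cong) (auto split: split_indicator)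
next
  case (union A)
  have m: "A i \<in> sets config_algebra" for i using union by (auto simp: sets_config_algebra)
  have fin: "approximable (\<lambda>\<mu>. \<Sum>i<n. indicator (A i) \<mu>)" for n :: nat
  proof (induction n)
    case 0 then show ?case using approximable_alg[OF laplace_alg_const[of 0]] by simp
  next
    case (Suc n) then show ?case using approximable_add[OF Suc union(3)] by simp
  qed
  have eq: "(\<Sum>i<n. indicator (A i) \<mu>) = (indicator (\<Union>i<n. A i) \<mu> :: real)" for n \<mu>
    using union(1) by (subst indicator_UN_disjoint) (auto simp: disjoint_family_on_def)
  show ?case
  proof (rule approximable_dominated[OF _ err_indicator_finite fin])
    show "indicator (\<Union> (range A)) \<in> borel_measurable config_algebra" using m by auto
    fix \<mu>
    show "\<bar>\<Sum>i<n. indicator (A i) \<mu>\<bar> \<le> 2 * \<bar>indicator (\<Union> (range A)) \<mu> :: real\<bar>" for n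
      unfolding eq by (auto split: split_indicator)
    show "(\<lambda>n. \<Sum>i<n. indicator (A i) \<mu>) \<longlonglongrightarrow> (indicator (\<Union> (range A)) \<mu> :: real)"
      unfolding eq by (rule LIMSEQ_indicator_UN)
  qed
qed

text \<open>Indicators are approximable by the Dynkin argument, and every measurable function is a limit of
  simple functions that it dominates up to a factor.\<close>

theorem laplace_alg_dense:
  assumes f [measurable]: "f \<in> borel_measurable config_algebra" and fin: "err f < \<infinity>" and e: "0 < e"
  obtains g where "laplace_alg g" and "err (\<lambda>\<mu>. f \<mu> - g \<mu>) < ennreal e"
proof -
  obtain s where s: "\<And>i. simple_function config_algebra (s i)"
    "\<And>\<mu>. \<mu> \<in> space config_algebra \<Longrightarrow> (\<lambda>i. s i \<mu>) \<longlonglongrightarrow> f \<mu>"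
    "\<And>i \<mu>. \<mu> \<in> space config_algebra \<Longrightarrow> dist (s i \<mu>) 0 \<le> 2 * dist (f \<mu>) 0"
    using borel_measurable_implies_sequence_metric[OF f, of 0] by metis
  have "approximable (s i)" for i
  proof -
    have fin: "finite (s i ` config_space)" using simple_functionD(1)[OF s(1)[of i]] by simp
    have "approximable (\<lambda>\<mu>. \<Sum>y\<in>Y. y * indicator (s i -` {y} \<inter> config_space) \<mu>)" if "finite Y" for Y
      using that
    proof (induction Y)
      case empty then show ?case using approximable_alg[OF laplace_alg_const[of 0]] by simp
    next
      case (insert y Y)
      have "approximable (\<lambda>\<mu>. y * indicator (s i -` {y} \<inter> config_space) \<mu>)"
        using simple_functionD(2)[OF s(1)[of i], of "{y}"]
        by (intro approximable_scale approximable_indicator) simp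
      from approximable_add[OF this insert(3)] show ?case by (simp only: sum.insert[OF insert(1,2)])
    qed
    from this[OF fin] show ?thesis
    proof (rule approximable_cong)
      fix \<mu> :: "'a measure" assume \<mu>: "\<mu> \<in> config_space"
      have "(\<Sum>y\<in>s i ` config_space. y * indicator (s i -` {y} \<inter> config_space) \<mu>) =
          (\<Sum>y\<in>s i ` config_space. if y = s i \<mu> then y else 0)"
        using \<mu> by (intro sum.cong) (auto simp: indicator_def)
      then show "(\<Sum>y\<in>s i ` config_space. y * indicator (s i -` {y} \<inter> config_space) \<mu>) = s i \<mu>"
        using \<mu> fin by simp
    qed
  qed
  then have "approximable f"
    by (rule approximable_dominated[OF f fin]) (use s(2,3) in auto)
  then show ?thesis using e that unfolding approximable_def by blast
qed

end

lemma laplace_alg_integrable: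
  assumes "finite_measure M" "sets M = sets config_algebra" "laplace_alg g"
  shows "integrable M g"
proof -
  obtain c where "\<forall>\<mu>. \<bar>g \<mu>\<bar> \<le> c" using laplace_alg_bounded[OF assms(3)] by blast
  moreover have "g \<in> borel_measurable M" using assms laplace_alg_measurable by (auto cong: measurable_cong_sets)
  ultimately show ?thesis
    by (intro finite_measure.integrable_const_bound[OF assms(1), of g c]) simp_all
qed

text \<open>Indicators are limits of functionals in the algebra, simultaneously for both measures: the density
  theorem is applied to their sum.\<close>

theorem measure_eqI_laplace:
  fixes M N :: "'a::polish_space measure measure"
  assumes M: "finite_measure M" "sets M = sets config_algebra"
    and N: "finite_measure N" "sets N = sets config_algebra"
    and eq: "\<And>v. test_fun v \<Longrightarrow> (\<integral>\<^sup>+\<mu>. ennreal (lexp v \<mu>) \<partial>M) = (\<integral>\<^sup>+\<mu>. ennreal (lexp v \<mu>) \<partial>N)"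
  shows "M = N"
proof (rule measure_eqI)
  interpret M: finite_measure M by fact
  interpret N: finite_measure N by fact
  have sp: "space M = config_space" "space N = config_space"
    using sets_eq_imp_space_eq[OF M(2)] sets_eq_imp_space_eq[OF N(2)] by auto
  let ?S = "sum_measure M N"
  have S: "sets ?S = sets config_algebra" using M by simp
  interpret S: config_weight ?S "\<lambda>_. 1" 0
  proof (intro config_weight.intro finite_measureI config_weight_axioms.intro)
    have *: "emeasure ?S (space ?S) < \<infinity>"
      using sets.top[of M] sets.top[of N] sp M N M.emeasure_finite[of config_space] N.emeasure_finite[of config_space]
      by (simp add: emeasure_sum_measure less_top[symmetric])
    show "emeasure ?S (space ?S) \<noteq> \<infinity>" using * by simp
    show "(\<integral>\<^sup>+\<mu>. ennreal 1 \<partial>?S) < \<infinity>" using * by simp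
  qed (use S in auto)
  have alg: "(\<integral>\<mu>. g \<mu> \<partial>M) = (\<integral>\<mu>. g \<mu> \<partial>N)" if "laplace_alg g" for g
    using that
  proof (induction rule: laplace_alg.induct)
    case (base v c)
    have "(\<integral>\<mu>. lexp v \<mu> \<partial>M) = (\<integral>\<mu>. lexp v \<mu> \<partial>N)"
      using M(2) N(2) eq[OF base] lexp_measurable[OF base]
      by (subst (1 2) integral_eq_nn_integral)
        (auto cong: measurable_cong_sets simp: less_imp_le[OF lexp_bounds(1)])
    then show ?case by simp
  next
    case (add f g)
    have "(\<integral>\<mu>. f \<mu> + g \<mu> \<partial>K) = (\<integral>\<mu>. f \<mu> \<partial>K) + (\<integral>\<mu>. g \<mu> \<partial>K)"
      if "finite_measure K" "sets K = sets config_algebra" for K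
      using laplace_alg_integrable[OF that] add.hyps by (intro Bochner_Integration.integral_add) auto
    from this[OF M] this[OF N] show ?case by (simp only: add.IH)
  qed
  fix A assume "A \<in> sets M"
  then have A [measurable]: "A \<in> sets config_algebra" "A \<in> sets M" "A \<in> sets N" using M N by auto
  have "\<bar>measure M A - measure N A\<bar> \<le> e" if e: "0 < e" for e
  proof -
    obtain g where g: "laplace_alg g" "S.err (\<lambda>\<mu>. indicator A \<mu> - g \<mu>) < ennreal e"
      using S.laplace_alg_dense[OF borel_measurable_indicator[OF A(1)] S.err_indicator_finite e] by blast
    have gm [measurable]: "g \<in> borel_measurable M" "g \<in> borel_measurable N"
      using laplace_alg_measurable[OF g(1)] M N by (auto cong: measurable_cong_sets)
    have "(\<integral>\<^sup>+\<mu>. ennreal \<bar>indicator A \<mu> - g \<mu>\<bar> \<partial>M) + (\<integral>\<^sup>+\<mu>. ennreal \<bar>indicator A \<mu> - g \<mu>\<bar> \<partial>N) < ennreal e"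
      using g(2) M N nn_integral_sum_measure[of N M "\<lambda>\<mu>. ennreal \<bar>indicator A \<mu> - g \<mu>\<bar>"]
      unfolding S.err_def by simp
    moreover have d: "ennreal \<bar>measure L A - (\<integral>\<mu>. g \<mu> \<partial>L)\<bar> \<le> (\<integral>\<^sup>+\<mu>. ennreal \<bar>indicator A \<mu> - g \<mu>\<bar> \<partial>L)"
      if L: "finite_measure L" "sets L = sets config_algebra" for L :: "'a measure measure"
    proof -
      interpret L: finite_measure L by fact
      have [measurable]: "A \<in> sets L" using L by simp
      have i: "integrable L g" "integrable L (indicator A :: _ \<Rightarrow> real)"
        using laplace_alg_integrable[OF L g(1)] by (auto simp: less_top[symmetric])
      have "ennreal (norm (\<integral>\<mu>. indicator A \<mu> - g \<mu> \<partial>L)) \<le> (\<integral>\<^sup>+\<mu>. ennreal (norm (indicator A \<mu> - g \<mu>)) \<partial>L)"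
        using i by (intro integral_norm_bound_ennreal) auto
      then show ?thesis using i sets.sets_into_space[of A L] by (simp add: Int_absorb2)
    qed
    ultimately have "ennreal \<bar>measure M A - (\<integral>\<mu>. g \<mu> \<partial>M)\<bar> + ennreal \<bar>measure N A - (\<integral>\<mu>. g \<mu> \<partial>N)\<bar> < ennreal e"
      using add_mono[OF d[OF M] d[OF N]] by simp
    then have "\<bar>measure M A - (\<integral>\<mu>. g \<mu> \<partial>M)\<bar> + \<bar>measure N A - (\<integral>\<mu>. g \<mu> \<partial>N)\<bar> < e"
      using e by (simp add: ennreal_plus[symmetric] ennreal_less_iff del: ennreal_plus)
    with alg[OF g(1)] show ?thesis by linarith
  qed
  then have "\<bar>measure M A - measure N A\<bar> \<le> 0" by (rule field_le_epsilon) simp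
  then show "emeasure M A = emeasure N A" by (simp add: M.emeasure_eq_measure N.emeasure_eq_measure)
qed (use M N in simp)

section \<open>Poisson processes: Laplace functional and Mecke equation\<close>

lemma config_space_in_sets [simp, measurable]: "config_space \<in> sets config_algebra"
  using sets.top[of config_algebra] by simp

text \<open>The same level sets serve every function \<open>f\<close> of \<open>v\<close> with \<open>f 0 = 0\<close>: with \<open>f y = y\<close> they give the integral of
  \<open>v\<close>, with \<open>f y = 1 - exp (- y)\<close> the exponent in the Laplace functional.\<close>

lemma test_fun_level_sets:
  fixes v :: "'a::polish_space \<Rightarrow> real"
  assumes v: "test_fun v"
  obtains n :: nat and a :: "nat \<Rightarrow> real" and B :: "nat \<Rightarrow> 'a set" where
    "\<And>i. B i \<in> sets borel" "\<And>i. i < n \<Longrightarrow> bounded (B i)" "disjoint_family_on B {..<n}"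
    "\<And>i. i < n \<Longrightarrow> 0 \<le> a i"
    "\<And>f x. f 0 = (0::real) \<Longrightarrow> f (v x) = (\<Sum>i<n. f (a i) * indicator (B i) x)"
proof -
  have [measurable]: "v \<in> borel_measurable borel" by (rule test_fun_measurable[OF v])
  define V where "V = range v - {0}"
  have "finite V"
    using v simple_functionD(1)[of borel v] by (simp add: test_fun_def V_def)
  then obtain a where a: "bij_betw a {..<card V} V"
    using ex_bij_betw_nat_finite[of V] by (auto simp: lessThan_atLeast0)
  define B where "B i = {x. v x = a i}" for i
  have aV: "i < card V \<Longrightarrow> a i \<in> V" for i using a by (auto simp: bij_betw_def)
  show ?thesis
  proof (rule that[of B "card V" a])
    show "B i \<in> sets borel" for i unfolding B_def by measurable
    show "bounded (B i)" if "i < card V" for i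
    proof -
      have "B i \<subseteq> {x. v x \<noteq> 0}" using aV[OF that] by (auto simp: B_def V_def)
      then show ?thesis using v by (auto simp: test_fun_def intro: bounded_subset)
    qed
    show "disjoint_family_on B {..<card V}"
      using a by (auto simp: disjoint_family_on_def B_def bij_betw_def inj_on_def)
    show "0 \<le> a i" if "i < card V" for i
      using aV[OF that] test_fun_nonneg[OF v] by (auto simp: V_def)
    fix f :: "real \<Rightarrow> real" and x assume f: "f 0 = 0"
    have "(\<Sum>i<card V. f (a i) * indicator (B i) x) = (\<Sum>i<card V. if v x = a i then f (a i) else 0)"
      by (intro sum.cong) (auto simp: B_def)
    also have "\<dots> = (\<Sum>y\<in>V. if v x = y then f y else 0)"
      by (rule sum.reindex_bij_betw[OF a])
    also have "\<dots> = f (v x)"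
      using \<open>finite V\<close> f by (auto simp: V_def sum.delta' sum.delta)
    finally show "f (v x) = (\<Sum>i<card V. f (a i) * indicator (B i) x)" ..
  qed
qed

text \<open>The law of a Poisson process enters all later arguments through its Laplace functional and through
  the exponential moments of its counts.\<close>

locale poisson_law = prob_space L
  for L :: "'a::polish_space measure measure" +
  fixes \<Lambda> :: "'a measure"
  assumes sets_law [measurable_cong, simp]: "sets L = sets config_algebra"
    and sets_int [measurable_cong, simp]: "sets \<Lambda> = sets borel"
    and int_locally_finite: "locally_finite \<Lambda>"
    and laplace: "test_fun v \<Longrightarrow>
      (\<integral>\<^sup>+\<mu>. ennreal (lexp v \<mu>) \<partial>L) = ennreal (exp (- (\<integral>x. 1 - exp (- v x) \<partial>\<Lambda>)))"
    and exp_moment: "B \<in> sets borel \<Longrightarrow> bounded B \<Longrightarrow>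
      (\<integral>\<^sup>+\<mu>. ennreal (exp (c * measure \<mu> B)) \<partial>L) < \<infinity>"
begin

lemma sets_pow [measurable_cong]: "sets (PiM I (\<lambda>_. \<Lambda>)) = sets (PiM I (\<lambda>_. borel))"
  by (intro sets_PiM_cong) auto

lemma space_law [simp]: "space L = config_space"
  using sets_eq_imp_space_eq[OF sets_law] by simp

lemma space_int [simp]: "space \<Lambda> = UNIV"
  using sets_eq_imp_space_eq[OF sets_int] by simp

lemma sigma_finite_int: "sigma_finite_measure \<Lambda>"
  by (intro sigma_finite_locally_finite int_locally_finite) simp

sublocale int: sigma_finite_measure \<Lambda>
  by (rule sigma_finite_int)

sublocale pow: product_sigma_finite "\<lambda>_. \<Lambda>"
  by (simp add: product_sigma_finite_def sigma_finite_int)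

lemma int_finite: "B \<in> sets borel \<Longrightarrow> bounded B \<Longrightarrow> emeasure \<Lambda> B < \<infinity>"
  using int_locally_finite by (rule locally_finiteD)

end

lemma (in prob_space) nn_integral_poisson_count:
  fixes N :: "'a \<Rightarrow> ennreal"
  assumes N [measurable]: "N \<in> borel_measurable M"
    and nat: "\<And>\<omega>. \<omega> \<in> space M \<Longrightarrow> \<exists>k::nat. N \<omega> = of_nat k"
    and pois: "\<And>k::nat. measure M {\<omega>\<in>space M. N \<omega> = of_nat k} = r ^ k / fact k * exp (- r)"
    and r: "0 \<le> r"
  shows "(\<integral>\<^sup>+\<omega>. ennreal (exp (c * enn2real (N \<omega>))) \<partial>M) = ennreal (exp (r * (exp c - 1)))"
proof -
  have "(\<integral>\<^sup>+\<omega>. ennreal (exp (c * enn2real (N \<omega>))) \<partial>M) =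
      (\<integral>\<^sup>+\<omega>. (\<Sum>k. ennreal (exp (c * real k)) * indicator {\<omega>\<in>space M. N \<omega> = of_nat k} \<omega>) \<partial>M)"
  proof (rule nn_integral_cong)
    fix \<omega> assume w: "\<omega> \<in> space M"
    obtain k :: nat where k: "N \<omega> = of_nat k" using nat[OF w] by blast
    have "(\<Sum>j. ennreal (exp (c * real j)) * indicator {\<omega>\<in>space M. N \<omega> = of_nat j} \<omega>) =
        (\<Sum>j\<in>{k}. ennreal (exp (c * real j)) * indicator {\<omega>\<in>space M. N \<omega> = of_nat j} \<omega>)"
      by (rule suminf_finite) (auto simp: k)
    then show "ennreal (exp (c * enn2real (N \<omega>))) =
        (\<Sum>j. ennreal (exp (c * real j)) * indicator {\<omega>\<in>space M. N \<omega> = of_nat j} \<omega>)"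
      using w k by simp
  qed
  also have "\<dots> = (\<Sum>k. ennreal (exp (c * real k)) * emeasure M {\<omega>\<in>space M. N \<omega> = of_nat k})"
    by (subst nn_integral_suminf) (auto intro!: suminf_cong nn_integral_cmult_indicator)
  also have "\<dots> = (\<Sum>k. ennreal (exp (- r) * ((r * exp c) ^ k / fact k)))"
    using r by (intro suminf_cong)
      (simp add: emeasure_eq_measure pois ennreal_mult[symmetric] power_mult_distrib exp_of_nat_mult[symmetric] mult_ac)
  also have "\<dots> = ennreal (exp (- r) * exp (r * exp c))"
  proof (intro suminf_ennreal_eq sums_mult)
    show "(\<lambda>k. (r * exp c) ^ k / fact k) sums exp (r * exp c)"
      using exp_converges[of "r * exp c"] by (simp add: divide_inverse mult.commute)
  qed (use r in auto)
  also have "exp (- r) * exp (r * exp c) = exp (r * (exp c - 1))"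
    by (simp add: exp_add[symmetric] algebra_simps)
  finally show ?thesis .
qed

text \<open>A test function is constant on finitely many disjoint bounded sets, so that its exponential functional
  is a product of independent exponentials of Poisson variables.\<close>

lemma poisson_law_of_process:
  fixes \<eta> :: "'w \<Rightarrow> 'a::polish_space measure"
  assumes pp: "poisson_process P \<eta> \<Lambda>" and lf: "locally_finite \<Lambda>"
  shows "poisson_law (distr P config_algebra \<eta>) \<Lambda>"
proof -
  interpret P: prob_space P using pp by (simp add: poisson_process_def)
  have \<eta> [measurable]: "\<eta> \<in> measurable P config_algebra" and sL: "sets \<Lambda> = sets borel"
    using pp by (auto simp: poisson_process_def)
  have cfg: "\<omega> \<in> space P \<Longrightarrow> \<eta> \<omega> \<in> config_space" for \<omega>
    using measurable_space[OF \<eta>] by simp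
  have count: "(\<integral>\<^sup>+\<omega>. ennreal (exp (c * measure (\<eta> \<omega>) B)) \<partial>P) = ennreal (exp (measure \<Lambda> B * (exp c - 1)))"
    if B [measurable]: "B \<in> sets borel" "bounded B" for B c
    unfolding measure_def
  proof (rule P.nn_integral_poisson_count)
    show "\<omega> \<in> space P \<Longrightarrow> \<exists>k::nat. emeasure (\<eta> \<omega>) B = of_nat k" for \<omega>
      using config_nat[OF cfg B] by blast
    have "emeasure \<Lambda> B < \<infinity>" using locally_finiteD[OF lf B] .
    then show "measure P {\<omega> \<in> space P. emeasure (\<eta> \<omega>) B = of_nat k} =
         enn2real (emeasure \<Lambda> B) ^ k / fact k * exp (- enn2real (emeasure \<Lambda> B))" for k
      using pp B unfolding poisson_process_def measure_def by blast
  qed auto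
  show ?thesis
  proof (intro poisson_law.intro poisson_law_axioms.intro P.prob_space_distr \<eta> sL lf)
    show "(\<integral>\<^sup>+\<mu>. ennreal (exp (c * measure \<mu> B)) \<partial>distr P config_algebra \<eta>) < \<infinity>"
      if B [measurable]: "B \<in> sets borel" "bounded B" for B c
    proof -
      have "(\<integral>\<^sup>+\<mu>. ennreal (exp (c * measure \<mu> B)) \<partial>distr P config_algebra \<eta>) =
          (\<integral>\<^sup>+\<omega>. ennreal (exp (c * measure (\<eta> \<omega>) B)) \<partial>P)"
        unfolding measure_def by (rule nn_integral_distr) measurable
      then show ?thesis using count[OF B, of c] by simp
    qed
    fix v :: "'a \<Rightarrow> real" assume v: "test_fun v"
    obtain n :: nat and a B where Bm [measurable]: "\<And>i. B i \<in> sets (borel :: 'a measure)"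
      and Bb: "\<And>i. i < n \<Longrightarrow> bounded (B i)" and Bd: "disjoint_family_on B {..<n}"
      and a: "\<And>i. i < n \<Longrightarrow> 0 \<le> a i"
      and rep: "\<And>f x. f 0 = (0::real) \<Longrightarrow> f (v x) = (\<Sum>i<n. f (a i) * indicator (B i) x)"
      by (rule test_fun_level_sets[OF v]) blast
    have le: "lexp v \<mu> = (\<Prod>i<n. exp (- a i * measure \<mu> (B i)))" if \<mu>: "\<mu> \<in> config_space" for \<mu>
    proof -
      note [measurable_cong] = config_space_sets[OF \<mu>]
      have "(\<integral>\<^sup>+x. ennreal (v x) \<partial>\<mu>) = (\<integral>\<^sup>+x. (\<Sum>i<n. ennreal (a i) * indicator (B i) x) \<partial>\<mu>)"
      proof (rule nn_integral_cong)
        fix x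
        have "v x = (\<Sum>i<n. a i * indicator (B i) x)" using rep[of "\<lambda>y. y" x] by simp
        also have "ennreal \<dots> = (\<Sum>i<n. ennreal (a i * indicator (B i) x))"
          using a by (intro sum_ennreal[symmetric]) auto
        also have "\<dots> = (\<Sum>i<n. ennreal (a i) * indicator (B i) x)"
          by (intro sum.cong) (auto simp: indicator_def)
        finally show "ennreal (v x) = (\<Sum>i<n. ennreal (a i) * indicator (B i) x)" .
      qed
      also have "\<dots> = (\<Sum>i<n. ennreal (a i) * emeasure \<mu> (B i))"
        using \<mu> by (subst nn_integral_sum) (auto simp: nn_integral_cmult_indicator)
      also have "\<dots> = (\<Sum>i<n. ennreal (a i * measure \<mu> (B i)))"
      proof (intro sum.cong refl)
        fix i assume i: "i \<in> {..<n}"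
        then have "emeasure \<mu> (B i) < \<infinity>" using config_finite[OF \<mu> Bm] Bb by auto
        then have "emeasure \<mu> (B i) = ennreal (measure \<mu> (B i))"
          by (simp add: emeasure_eq_ennreal_measure)
        then show "ennreal (a i) * emeasure \<mu> (B i) = ennreal (a i * measure \<mu> (B i))"
          using a i by (simp add: ennreal_mult)
      qed
      also have "\<dots> = ennreal (\<Sum>i<n. a i * measure \<mu> (B i))"
        using a by (intro sum_ennreal) auto
      finally have "lexp v \<mu> = exp (- (\<Sum>i<n. a i * measure \<mu> (B i)))"
        unfolding lexp_def using a
        by (simp, subst enn2real_ennreal) (auto intro!: sum_nonneg mult_nonneg_nonneg)
      then show ?thesis by (simp add: exp_sum sum_negf[symmetric])
    qed
    have ind: "P.indep_vars (\<lambda>_. borel) (\<lambda>i \<omega>. emeasure (\<eta> \<omega>) (B i)) {..<n}"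
      using pp Bm Bd unfolding poisson_process_def by blast
    have ind': "P.indep_vars (\<lambda>_. borel) (\<lambda>i \<omega>. ennreal (exp (- a i * enn2real (emeasure (\<eta> \<omega>) (B i))))) {..<n}"
      by (rule P.indep_vars_compose2[OF ind, where Y="\<lambda>i y. ennreal (exp (- a i * enn2real y))"]) measurable
    have "(\<integral>\<^sup>+\<mu>. ennreal (lexp v \<mu>) \<partial>distr P config_algebra \<eta>) = (\<integral>\<^sup>+\<omega>. ennreal (lexp v (\<eta> \<omega>)) \<partial>P)"
      using lexp_measurable[OF v] by (intro nn_integral_distr) auto
    also have "\<dots> = (\<integral>\<^sup>+\<omega>. (\<Prod>i<n. ennreal (exp (- a i * enn2real (emeasure (\<eta> \<omega>) (B i))))) \<partial>P)"
      using cfg by (intro nn_integral_cong) (simp add: le prod_ennreal measure_def)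
    also have "\<dots> = (\<Prod>i<n. \<integral>\<^sup>+\<omega>. ennreal (exp (- a i * enn2real (emeasure (\<eta> \<omega>) (B i)))) \<partial>P)"
      by (rule P.indep_vars_nn_integral[OF _ ind']) auto
    also have "\<dots> = (\<Prod>i<n. ennreal (exp (measure \<Lambda> (B i) * (exp (- a i) - 1))))"
      using count[OF Bm Bb, of _ "- a i" for i] by (intro prod.cong) (auto simp: measure_def)
    also have "\<dots> = ennreal (exp (\<Sum>i<n. measure \<Lambda> (B i) * (exp (- a i) - 1)))"
      by (simp add: prod_ennreal exp_sum)
    also have "(\<Sum>i<n. measure \<Lambda> (B i) * (exp (- a i) - 1)) = - (\<integral>x. 1 - exp (- v x) \<partial>\<Lambda>)"
    proof -
      have "(\<integral>x. 1 - exp (- v x) \<partial>\<Lambda>) = (\<integral>x. (\<Sum>i<n. (1 - exp (- a i)) * indicator (B i) x) \<partial>\<Lambda>)"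
        using rep[of "\<lambda>y. 1 - exp (- y)"] by simp
      also have "\<dots> = (\<Sum>i<n. (1 - exp (- a i)) * measure \<Lambda> (B i))"
      proof (subst Bochner_Integration.integral_sum)
        show "integrable \<Lambda> (\<lambda>x. (1 - exp (- a i)) * indicator (B i) x)" if "i \<in> {..<n}" for i
          using that locally_finiteD[OF lf Bm Bb] sL by (intro integrable_mult_right integrable_real_indicator) auto
        show "(\<Sum>i<n. \<integral>x. (1 - exp (- a i)) * indicator (B i) x \<partial>\<Lambda>) = (\<Sum>i<n. (1 - exp (- a i)) * measure \<Lambda> (B i))"
          using sets_eq_imp_space_eq[OF sL] sL by (intro sum.cong) auto
      qed
      finally show ?thesis by (simp add: sum_negf[symmetric] algebra_simps sum_subtractf)
    qed
    finally show "(\<integral>\<^sup>+\<mu>. ennreal (lexp v \<mu>) \<partial>distr P config_algebra \<eta>) =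
        ennreal (exp (- (\<integral>x. 1 - exp (- v x) \<partial>\<Lambda>)))" .
  qed simp
qed

context poisson_law begin

lemma expectation_lexp: "test_fun v \<Longrightarrow> (\<integral>\<mu>. lexp v \<mu> \<partial>L) = exp (- (\<integral>x. 1 - exp (- v x) \<partial>\<Lambda>))"
  by (subst integral_eq_nn_integral) (auto simp: laplace less_imp_le lexp_bounds)

lemma count_measurable [measurable]: "B \<in> sets borel \<Longrightarrow> (\<lambda>\<mu>. measure \<mu> B) \<in> borel_measurable config_algebra"
  unfolding measure_def by (intro borel_measurable_enn2real measurable_emeasure_config)

lemma count_eq: "\<mu> \<in> config_space \<Longrightarrow> B \<in> sets borel \<Longrightarrow> bounded B \<Longrightarrow> emeasure \<mu> B = ennreal (measure \<mu> B)"
  using config_finite[of \<mu> B] by (simp add: emeasure_eq_ennreal_measure)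

lemma integrable_count_exp:
  assumes "B \<in> sets borel" "bounded B"
  shows "integrable L (\<lambda>\<mu>. exp (c * measure \<mu> B))"
  by (rule integrableI_nonneg) (use assms exp_moment[OF assms, of c] in auto)

lemma integrable_count:
  assumes [measurable]: "B \<in> sets borel" and "bounded B"
  shows "integrable L (\<lambda>\<mu>. measure \<mu> B)"
proof (rule Bochner_Integration.integrable_bound[OF integrable_count_exp[OF assms, of 1]])
  show "AE \<mu> in L. norm (measure \<mu> B) \<le> norm (exp (1 * measure \<mu> B))"
    by (rule AE_I2) (use exp_ge_add_one_self in \<open>simp add: add_increasing order_trans[OF _ exp_ge_add_one_self]\<close>)
qed measurable

lemma integrable_test_fun:
  assumes v: "test_fun v"
  shows "integrable \<Lambda> (\<lambda>x. 1 - exp (- v x))"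
proof -
  have [measurable]: "v \<in> borel_measurable borel" by (rule test_fun_measurable[OF v])
  have "integrable \<Lambda> v"
    using test_fun_nn_integral_finite[OF v int_locally_finite sets_int] test_fun_nonneg[OF v]
    by (intro integrableI_nonneg) auto
  then show ?thesis
  proof (rule Bochner_Integration.integrable_bound)
    show "AE x in \<Lambda>. norm (1 - exp (- v x)) \<le> norm (v x)"
      using test_fun_nonneg[OF v] exp_ge_add_one_self[of "- v x" for x]
      by (intro AE_I2) (simp add: abs_of_nonneg algebra_simps)
  qed measurable
qed

lemma integrable_indicator_exp:
  assumes v: "test_fun v" and B [measurable]: "B \<in> sets borel" and Bb: "bounded B"
  shows "integrable \<Lambda> (\<lambda>x. indicator B x * exp (- v x))"
proof (rule Bochner_Integration.integrable_bound)
  show "integrable \<Lambda> (indicator B :: 'a \<Rightarrow> real)"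
    using int_finite[OF B Bb] by (intro integrable_real_indicator) auto
  show "AE x in \<Lambda>. norm (indicator B x * exp (- v x)) \<le> norm (indicator B x :: real)"
    using test_fun_nonneg[OF v] by (intro AE_I2) (auto split: split_indicator)
qed (use test_fun_measurable[OF v] in measurable)

text \<open>The mean of \<open>\<eta>(B) exp (- \<eta>(v))\<close> is minus the derivative of the Laplace functional at \<open>v\<close> in the
  direction of the indicator of \<open>B\<close>; the difference quotients are
  dominated by \<open>\<eta>(B)\<close>.\<close>

lemma expectation_count_lexp:
  assumes v: "test_fun v" and B [measurable]: "B \<in> sets borel" and Bb: "bounded B"
  shows "(\<integral>\<mu>. measure \<mu> B * lexp v \<mu> \<partial>L) = (\<integral>x. indicator B x * exp (- v x) \<partial>\<Lambda>) * (\<integral>\<mu>. lexp v \<mu> \<partial>L)"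
proof -
  have [measurable]: "v \<in> borel_measurable borel" by (rule test_fun_measurable[OF v])
  note [measurable] = lexp_measurable[OF v]
  define c where "c = (\<integral>x. indicator B x * exp (- v x) \<partial>\<Lambda>)"
  define f where "f n \<mu> = real n * (1 - exp (- measure \<mu> B / real n)) * lexp v \<mu>" for n \<mu>
  have "(\<lambda>n. \<integral>\<mu>. f n \<mu> \<partial>L) \<longlonglongrightarrow> (\<integral>\<mu>. measure \<mu> B * lexp v \<mu> \<partial>L)"
  proof (rule integral_dominated_convergence[where w="\<lambda>\<mu>. measure \<mu> B"])
    show "integrable L (\<lambda>\<mu>. measure \<mu> B)" by (rule integrable_count[OF B Bb])
    show "AE \<mu> in L. (\<lambda>n. f n \<mu>) \<longlonglongrightarrow> measure \<mu> B * lexp v \<mu>"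
    proof (rule AE_I2)
      fix \<mu>
      have "(\<lambda>n. real n * (1 - exp (- m / real n))) \<longlonglongrightarrow> m" for m :: real
        by real_asymp
      then show "(\<lambda>n. f n \<mu>) \<longlonglongrightarrow> measure \<mu> B * lexp v \<mu>"
        unfolding f_def by (intro tendsto_mult tendsto_const)
    qed
    show "AE \<mu> in L. norm (f n \<mu>) \<le> measure \<mu> B" for n
    proof (rule AE_I2)
      fix \<mu>
      have "real n * (1 - exp (- measure \<mu> B / real n)) \<le> measure \<mu> B"
      proof (cases "n = 0")
        case False
        have "1 - exp (- measure \<mu> B / real n) \<le> measure \<mu> B / real n"
          using exp_ge_add_one_self[of "- measure \<mu> B / real n"] by simp
        then have "real n * (1 - exp (- measure \<mu> B / real n)) \<le> real n * (measure \<mu> B / real n)"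
          by (intro mult_left_mono) auto
        then show ?thesis using False by simp
      qed simp
      moreover have "0 \<le> real n * (1 - exp (- measure \<mu> B / real n))" by simp
      ultimately have "real n * (1 - exp (- measure \<mu> B / real n)) * lexp v \<mu> \<le> measure \<mu> B * 1"
        using lexp_bounds[of v \<mu>] by (intro mult_mono) auto
      moreover have "0 \<le> f n \<mu>" using lexp_bounds(1)[of v \<mu>] by (simp add: f_def less_imp_le)
      ultimately show "norm (f n \<mu>) \<le> measure \<mu> B" by (simp add: f_def)
    qed
  qed (unfold f_def, measurable)
  moreover have "(\<lambda>n. \<integral>\<mu>. f n \<mu> \<partial>L) \<longlonglongrightarrow> c * (\<integral>\<mu>. lexp v \<mu> \<partial>L)"
  proof -
    have fn: "(\<integral>\<mu>. f n \<mu> \<partial>L) = (\<integral>\<mu>. lexp v \<mu> \<partial>L) * (real n * (1 - exp (- ((1 - exp (- 1 / real n)) * c))))"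
      if n: "0 < n" for n
    proof -
      let ?w = "\<lambda>x. 1 / real n * indicator B x"
      have w: "test_fun ?w" by (rule test_fun_indicator) (use Bb in auto)
      have vw: "test_fun (\<lambda>x. v x + ?w x)" by (rule test_fun_add[OF v w])
      have int: "integrable L (lexp (\<lambda>x. v x + ?w x))" "integrable L (lexp v)"
        using laplace_alg_integrable[OF finite_measure_axioms sets_law laplace_alg_lexp] vw v by auto
      have "f n \<mu> = real n * (lexp v \<mu> - lexp (\<lambda>x. v x + ?w x) \<mu>)" if "\<mu> \<in> config_space" for \<mu>
        unfolding f_def lexp_add[OF v w that] using lexp_indicator[OF that B, of "1 / real n"] n
        by (simp add: algebra_simps)
      then have "(\<integral>\<mu>. f n \<mu> \<partial>L) = (\<integral>\<mu>. real n * (lexp v \<mu> - lexp (\<lambda>x. v x + ?w x) \<mu>) \<partial>L)"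
        by (intro Bochner_Integration.integral_cong) auto
      also have "\<dots> = real n * ((\<integral>\<mu>. lexp v \<mu> \<partial>L) - (\<integral>\<mu>. lexp (\<lambda>x. v x + ?w x) \<mu> \<partial>L))"
        using int by simp
      also have "(\<integral>\<mu>. lexp (\<lambda>x. v x + ?w x) \<mu> \<partial>L) = (\<integral>\<mu>. lexp v \<mu> \<partial>L) * exp (- ((1 - exp (- 1 / real n)) * c))"
      proof -
        have iB: "integrable \<Lambda> (\<lambda>x. indicator B x * exp (- v x))"
          by (rule integrable_indicator_exp[OF v B Bb])
        have "1 - exp (- (v x + ?w x)) = (1 - exp (- v x)) + (1 - exp (- 1 / real n)) * (indicator B x * exp (- v x))" for x
          by (cases "x \<in> B") (auto simp: algebra_simps exp_add[symmetric])
        then have "(\<integral>x. 1 - exp (- (v x + ?w x)) \<partial>\<Lambda>) = (\<integral>x. (1 - exp (- v x)) + (1 - exp (- 1 / real n)) * (indicator B x * exp (- v x)) \<partial>\<Lambda>)"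
          by (intro Bochner_Integration.integral_cong) auto
        also have "\<dots> = (\<integral>x. 1 - exp (- v x) \<partial>\<Lambda>) + (1 - exp (- 1 / real n)) * c"
          unfolding c_def using integrable_test_fun[OF v] iB by (subst Bochner_Integration.integral_add) auto
        finally have eq: "(\<integral>x. 1 - exp (- (v x + ?w x)) \<partial>\<Lambda>) = (\<integral>x. 1 - exp (- v x) \<partial>\<Lambda>) + (1 - exp (- 1 / real n)) * c" .
        show ?thesis
          unfolding expectation_lexp[OF v] expectation_lexp[OF vw] eq by (simp add: exp_add[symmetric])
      qed
      finally show ?thesis by (simp add: algebra_simps)
    qed
    have "(\<lambda>n. real n * (1 - exp (- ((1 - exp (- 1 / real n)) * c)))) \<longlonglongrightarrow> c"
      by real_asymp
    then have "(\<lambda>n. (\<integral>\<mu>. lexp v \<mu> \<partial>L) * (real n * (1 - exp (- ((1 - exp (- 1 / real n)) * c))))) \<longlonglongrightarrow> (\<integral>\<mu>. lexp v \<mu> \<partial>L) * c"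
      by (intro tendsto_mult tendsto_const)
    then show ?thesis
      by (subst tendsto_cong[OF eventually_mono[OF eventually_gt_at_top[of 0] fn]]) (auto simp: mult.commute)
  qed
  ultimately show ?thesis unfolding c_def by (rule LIMSEQ_unique)
qed

text \<open>For fixed \<open>B\<close> both sides are finite measures in \<open>A\<close>; their Laplace functionals agree by the derivative
  formula.\<close>

lemma mecke_rectangle:
  assumes B [measurable]: "B \<in> sets borel" and Bb: "bounded B" and A [measurable]: "A \<in> sets config_algebra"
  shows "(\<integral>\<^sup>+\<mu>. indicator A \<mu> * emeasure \<mu> B \<partial>L) =
    (\<integral>\<^sup>+x. \<integral>\<^sup>+\<mu>. indicator B x * indicator A (add_point x \<mu>) \<partial>L \<partial>\<Lambda>)"
proof -
  let ?M = "density L (\<lambda>\<mu>. emeasure \<mu> B)"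
  let ?R = "density \<Lambda> (indicator B)"
  let ?N = "distr (?R \<Otimes>\<^sub>M L) config_algebra (\<lambda>(x, \<mu>). add_point x \<mu>)"
  interpret R: finite_measure ?R
    by (rule finite_measureI) (use int_finite[OF B Bb] in \<open>simp add: emeasure_density\<close>)
  have N: "(\<integral>\<^sup>+\<mu>. f \<mu> \<partial>?N) = (\<integral>\<^sup>+x. \<integral>\<^sup>+\<mu>. indicator B x * f (add_point x \<mu>) \<partial>L \<partial>\<Lambda>)"
    if [measurable]: "f \<in> borel_measurable config_algebra" for f :: "'a measure \<Rightarrow> ennreal"
  proof -
    have "(\<integral>\<^sup>+\<mu>. f \<mu> \<partial>?N) = (\<integral>\<^sup>+(x, \<mu>). f (add_point x \<mu>) \<partial>(?R \<Otimes>\<^sub>M L))"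
      by (subst nn_integral_distr) (auto simp: split_beta')
    also have "\<dots> = (\<integral>\<^sup>+x. \<integral>\<^sup>+\<mu>. f (add_point x \<mu>) \<partial>L \<partial>?R)"
      by (subst nn_integral_fst[symmetric]) auto
    also have "\<dots> = (\<integral>\<^sup>+x. indicator B x * (\<integral>\<^sup>+\<mu>. f (add_point x \<mu>) \<partial>L) \<partial>\<Lambda>)"
      by (subst nn_integral_density) auto
    also have "\<dots> = (\<integral>\<^sup>+x. \<integral>\<^sup>+\<mu>. indicator B x * f (add_point x \<mu>) \<partial>L \<partial>\<Lambda>)"
      by (intro nn_integral_cong nn_integral_cmult[symmetric]) auto
    finally show ?thesis .
  qed
  have M: "(\<integral>\<^sup>+\<mu>. f \<mu> \<partial>?M) = (\<integral>\<^sup>+\<mu>. f \<mu> * emeasure \<mu> B \<partial>L)"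
    if [measurable]: "f \<in> borel_measurable config_algebra" for f :: "'a measure \<Rightarrow> ennreal"
    by (subst nn_integral_density) (auto simp: mult.commute)
  have "?M = ?N"
  proof (rule measure_eqI_laplace)
    show "finite_measure ?M"
    proof (rule finite_measureI)
      have "emeasure ?M (space ?M) = (\<integral>\<^sup>+\<mu>. ennreal (measure \<mu> B) \<partial>L)"
        by (subst emeasure_density) (auto simp: count_eq[OF _ B Bb] intro!: nn_integral_cong)
      also have "\<dots> \<noteq> \<infinity>"
        using integrable_count[OF B Bb] by (simp add: integrable_iff_bounded)
      finally show "emeasure ?M (space ?M) \<noteq> \<infinity>" .
    qed
    show "finite_measure ?N"
    proof (rule finite_measure.finite_measure_distr)
      show "finite_measure (?R \<Otimes>\<^sub>M L)"
      proof (rule finite_measureI)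
        have "emeasure (?R \<Otimes>\<^sub>M L) (space ?R \<times> space L) = emeasure ?R (space ?R) * emeasure L (space L)"
          by (rule emeasure_pair_measure_Times) auto
        also have "\<dots> \<noteq> \<infinity>" using R.emeasure_finite[of UNIV] emeasure_space_1 by simp
        finally show "emeasure (?R \<Otimes>\<^sub>M L) (space (?R \<Otimes>\<^sub>M L)) \<noteq> \<infinity>" by (simp add: space_pair_measure)
      qed
    qed auto
    fix v :: "'a \<Rightarrow> real" assume v: "test_fun v"
    note [measurable] = lexp_measurable[OF v] test_fun_measurable[OF v]
    have "(\<integral>\<^sup>+\<mu>. ennreal (lexp v \<mu>) \<partial>?M) = (\<integral>\<^sup>+\<mu>. ennreal (measure \<mu> B * lexp v \<mu>) \<partial>L)"
      by (subst M) (auto intro!: nn_integral_cong simp: count_eq[OF _ B Bb] ennreal_mult[symmetric] less_imp_le lexp_bounds mult.commute)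
    also have "\<dots> = ennreal (\<integral>\<mu>. measure \<mu> B * lexp v \<mu> \<partial>L)"
    proof (rule nn_integral_eq_integral)
      show "integrable L (\<lambda>\<mu>. measure \<mu> B * lexp v \<mu>)"
        by (rule Bochner_Integration.integrable_bound[OF integrable_count[OF B Bb]])
          (auto simp: abs_mult lexp_bounds less_imp_le intro!: AE_I2 mult_left_le)
    qed (simp add: less_imp_le lexp_bounds)
    also have "\<dots> = ennreal (\<integral>x. indicator B x * exp (- v x) \<partial>\<Lambda>) * ennreal (\<integral>\<mu>. lexp v \<mu> \<partial>L)"
      by (simp add: expectation_count_lexp[OF v B Bb] ennreal_mult' less_imp_le lexp_bounds)
    also have "ennreal (\<integral>\<mu>. lexp v \<mu> \<partial>L) = (\<integral>\<^sup>+\<mu>. ennreal (lexp v \<mu>) \<partial>L)"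
      by (simp add: expectation_lexp[OF v] laplace[OF v])
    also have "ennreal (\<integral>x. indicator B x * exp (- v x) \<partial>\<Lambda>) = (\<integral>\<^sup>+x. ennreal (indicator B x * exp (- v x)) \<partial>\<Lambda>)"
    proof (rule nn_integral_eq_integral[symmetric])
      show "integrable \<Lambda> (\<lambda>x. indicator B x * exp (- v x))"
        by (rule integrable_indicator_exp[OF v B Bb])
    qed simp
    also have "\<dots> * (\<integral>\<^sup>+\<mu>. ennreal (lexp v \<mu>) \<partial>L) =
        (\<integral>\<^sup>+x. ennreal (indicator B x * exp (- v x)) * (\<integral>\<^sup>+\<mu>. ennreal (lexp v \<mu>) \<partial>L) \<partial>\<Lambda>)"
      by (rule nn_integral_multc[symmetric]) auto
    also have "\<dots> = (\<integral>\<^sup>+x. \<integral>\<^sup>+\<mu>. ennreal (indicator B x * exp (- v x)) * ennreal (lexp v \<mu>) \<partial>L \<partial>\<Lambda>)"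
      by (intro nn_integral_cong nn_integral_cmult[symmetric]) auto
    also have "\<dots> = (\<integral>\<^sup>+\<mu>. ennreal (lexp v \<mu>) \<partial>?N)"
      by (subst N) (auto intro!: nn_integral_cong simp: lexp_add_point[OF v] ennreal_mult' less_imp_le lexp_bounds split: split_indicator)
    finally show "(\<integral>\<^sup>+\<mu>. ennreal (lexp v \<mu>) \<partial>?M) = (\<integral>\<^sup>+\<mu>. ennreal (lexp v \<mu>) \<partial>?N)" .
  qed auto
  then have "(\<integral>\<^sup>+\<mu>. indicator A \<mu> \<partial>?M) = (\<integral>\<^sup>+\<mu>. indicator A \<mu> \<partial>?N)" by simp
  then show ?thesis by (simp only: M[OF borel_measurable_indicator[OF A]] N[OF borel_measurable_indicator[OF A]])
qed

end

context poisson_law begin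

text \<open>The Mecke equation extends from rectangles to all measurable functions: restricted to a ball in
  the first variable, both sides are finite measures in the indicated set.\<close>

theorem mecke:
  assumes f [measurable]: "case_prod f \<in> borel_measurable (borel \<Otimes>\<^sub>M config_algebra)"
  shows "(\<integral>\<^sup>+\<mu>. \<integral>\<^sup>+x. f x \<mu> \<partial>\<mu> \<partial>L) = (\<integral>\<^sup>+x. \<integral>\<^sup>+\<mu>. f x (add_point x \<mu>) \<partial>L \<partial>\<Lambda>)"
proof -
  let ?P = "borel \<Otimes>\<^sub>M config_algebra :: ('a \<times> 'a measure) measure"
  define I where "I n F = (\<integral>\<^sup>+\<mu>. \<integral>\<^sup>+x. F (x, \<mu>) * indicator (loc_ball n) x \<partial>\<mu> \<partial>L)"
    for n and F :: "'a \<times> 'a measure \<Rightarrow> ennreal"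
  define J where "J n F = (\<integral>\<^sup>+x. \<integral>\<^sup>+\<mu>. F (x, add_point x \<mu>) * indicator (loc_ball n) x \<partial>L \<partial>\<Lambda>)"
    for n and F :: "'a \<times> 'a measure \<Rightarrow> ennreal"
  have m1 [measurable]: "(\<lambda>x. F (x, \<mu>)) \<in> borel_measurable \<mu>"
    if [measurable]: "F \<in> borel_measurable ?P" and \<mu>: "\<mu> \<in> config_space" for F :: "_ \<Rightarrow> ennreal" and \<mu>
  proof -
    have [measurable]: "\<mu> \<in> space config_algebra" using \<mu> by simp
    have "(\<lambda>x. F (x, \<mu>)) \<in> borel_measurable borel" by measurable
    then show ?thesis using \<mu> by (auto cong: measurable_cong_sets)
  qed
  have mb [measurable]: "indicator (loc_ball n) \<in> borel_measurable \<mu>" if "\<mu> \<in> config_space" for n \<mu>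
    using that by (auto cong: measurable_cong_sets)
  have m2 [measurable]: "(\<lambda>\<mu>. \<integral>\<^sup>+x. F (x, \<mu>) * indicator (loc_ball n) x \<partial>\<mu>) \<in> borel_measurable config_algebra"
    if [measurable]: "F \<in> borel_measurable ?P" for F :: "_ \<Rightarrow> ennreal" and n
    by (rule measurable_nn_integral_config) measurable
  have I_cong: "I n F = I n G" and J_cong: "J n F = J n G"
    if "\<And>p. p \<in> space ?P \<Longrightarrow> F p = G p" for n F G
    unfolding I_def J_def using that by (auto intro!: nn_integral_cong simp: space_pair_measure)
  have I_add: "I n (\<lambda>p. F p + G p) = I n F + I n G"
    if [measurable]: "F \<in> borel_measurable ?P" "G \<in> borel_measurable ?P" for n F G
  proof -
    have "I n (\<lambda>p. F p + G p) = (\<integral>\<^sup>+\<mu>. (\<integral>\<^sup>+x. F (x, \<mu>) * indicator (loc_ball n) x \<partial>\<mu>) +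
        (\<integral>\<^sup>+x. G (x, \<mu>) * indicator (loc_ball n) x \<partial>\<mu>) \<partial>L)"
      unfolding I_def
      by (intro nn_integral_cong) (simp add: distrib_right nn_integral_add m1 mb)
    also have "\<dots> = I n F + I n G" unfolding I_def by (subst nn_integral_add) auto
    finally show ?thesis .
  qed
  have J_add: "J n (\<lambda>p. F p + G p) = J n F + J n G"
    if [measurable]: "F \<in> borel_measurable ?P" "G \<in> borel_measurable ?P" for n F G
  proof -
    have "J n (\<lambda>p. F p + G p) = (\<integral>\<^sup>+x. (\<integral>\<^sup>+\<mu>. F (x, add_point x \<mu>) * indicator (loc_ball n) x \<partial>L) +
        (\<integral>\<^sup>+\<mu>. G (x, add_point x \<mu>) * indicator (loc_ball n) x \<partial>L) \<partial>\<Lambda>)"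
      unfolding J_def by (intro nn_integral_cong) (simp add: distrib_right nn_integral_add)
    also have "\<dots> = J n F + J n G" unfolding J_def by (subst nn_integral_add) auto
    finally show ?thesis .
  qed
  have I_mult: "I n (\<lambda>p. c * F p) = c * I n F" and J_mult: "J n (\<lambda>p. c * F p) = c * J n F"
    if [measurable]: "F \<in> borel_measurable ?P" for n F c
  proof -
    have "I n (\<lambda>p. c * F p) = (\<integral>\<^sup>+\<mu>. c * (\<integral>\<^sup>+x. F (x, \<mu>) * indicator (loc_ball n) x \<partial>\<mu>) \<partial>L)"
      unfolding I_def by (intro nn_integral_cong) (simp add: mult.assoc nn_integral_cmult m1 mb)
    also have "\<dots> = c * I n F" unfolding I_def by (rule nn_integral_cmult) measurable
    finally show "I n (\<lambda>p. c * F p) = c * I n F" .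
    have "J n (\<lambda>p. c * F p) = (\<integral>\<^sup>+x. c * (\<integral>\<^sup>+\<mu>. F (x, add_point x \<mu>) * indicator (loc_ball n) x \<partial>L) \<partial>\<Lambda>)"
      unfolding J_def by (intro nn_integral_cong) (simp add: mult.assoc nn_integral_cmult)
    also have "\<dots> = c * J n F" unfolding J_def by (rule nn_integral_cmult) measurable
    finally show "J n (\<lambda>p. c * F p) = c * J n F" .
  qed
  have I_sup: "I n (\<lambda>p. SUP i. F i p) = (SUP i. I n (F i))" and J_sup: "J n (\<lambda>p. SUP i. F i p) = (SUP i. J n (F i))"
    if m [measurable]: "\<And>i::nat. F i \<in> borel_measurable ?P" and inc: "incseq F" for n F
  proof -
    have inc': "F i p \<le> F j p" if "i \<le> j" for i j p using incseqD[OF inc that] by (rule le_funD)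
    have "I n (\<lambda>p. SUP i. F i p) = (\<integral>\<^sup>+\<mu>. (SUP i. \<integral>\<^sup>+x. F i (x, \<mu>) * indicator (loc_ball n) x \<partial>\<mu>) \<partial>L)"
      unfolding I_def
    proof (intro nn_integral_cong)
      fix \<mu> assume "\<mu> \<in> space L"
      then have \<mu>: "\<mu> \<in> config_space" by simp
      have "(\<integral>\<^sup>+x. (SUP i. F i (x, \<mu>)) * indicator (loc_ball n) x \<partial>\<mu>) = (\<integral>\<^sup>+x. (SUP i. F i (x, \<mu>) * indicator (loc_ball n) x) \<partial>\<mu>)"
        by (intro nn_integral_cong) (simp add: SUP_mult_right_ennreal)
      also have "\<dots> = (SUP i. \<integral>\<^sup>+x. F i (x, \<mu>) * indicator (loc_ball n) x \<partial>\<mu>)"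
        using inc' by (intro nn_integral_monotone_convergence_SUP borel_measurable_times_ennreal m1[OF m \<mu>] mb[OF \<mu>])
          (auto simp: incseq_def le_fun_def intro!: mult_right_mono)
      finally show "(\<integral>\<^sup>+x. (SUP i. F i (x, \<mu>)) * indicator (loc_ball n) x \<partial>\<mu>) = \<dots>" .
    qed
    also have "\<dots> = (SUP i. I n (F i))"
      unfolding I_def using inc'
      by (intro nn_integral_monotone_convergence_SUP) (auto simp: incseq_def le_fun_def intro!: nn_integral_mono mult_right_mono)
    finally show "I n (\<lambda>p. SUP i. F i p) = (SUP i. I n (F i))" .
    have "J n (\<lambda>p. SUP i. F i p) = (\<integral>\<^sup>+x. (SUP i. \<integral>\<^sup>+\<mu>. F i (x, add_point x \<mu>) * indicator (loc_ball n) x \<partial>L) \<partial>\<Lambda>)"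
      unfolding J_def
    proof (intro nn_integral_cong)
      fix x
      have "(\<integral>\<^sup>+\<mu>. (SUP i. F i (x, add_point x \<mu>)) * indicator (loc_ball n) x \<partial>L) = (\<integral>\<^sup>+\<mu>. (SUP i. F i (x, add_point x \<mu>) * indicator (loc_ball n) x) \<partial>L)"
        by (intro nn_integral_cong) (simp add: SUP_mult_right_ennreal)
      also have "\<dots> = (SUP i. \<integral>\<^sup>+\<mu>. F i (x, add_point x \<mu>) * indicator (loc_ball n) x \<partial>L)"
        using inc' by (intro nn_integral_monotone_convergence_SUP) (auto simp: incseq_def le_fun_def intro!: mult_right_mono)
      finally show "(\<integral>\<^sup>+\<mu>. (SUP i. F i (x, add_point x \<mu>)) * indicator (loc_ball n) x \<partial>L) = \<dots>" .
    qed
    also have "\<dots> = (SUP i. J n (F i))"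
      unfolding J_def using inc'
      by (intro nn_integral_monotone_convergence_SUP) (auto simp: incseq_def le_fun_def intro!: nn_integral_mono mult_right_mono)
    finally show "J n (\<lambda>p. SUP i. F i p) = (SUP i. J n (F i))" .
  qed
  have rect: "I n (indicator (a \<times> b)) = J n (indicator (a \<times> b))" "I n (indicator (a \<times> b)) < \<infinity>"
    if [measurable]: "a \<in> sets borel" "b \<in> sets config_algebra" for n a b
  proof -
    have B: "a \<inter> loc_ball n \<in> sets borel" "bounded (a \<inter> loc_ball n)" by (auto intro: bounded_subset[OF bounded_loc_ball])
    have I1: "I n (indicator (a \<times> b)) = (\<integral>\<^sup>+\<mu>. indicator b \<mu> * emeasure \<mu> (a \<inter> loc_ball n) \<partial>L)"
      unfolding I_def
    proof (intro nn_integral_cong)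
      fix \<mu> assume "\<mu> \<in> space L"
      then have [simp]: "sets \<mu> = sets borel" by simp
      have "(\<integral>\<^sup>+x. indicator (a \<times> b) (x, \<mu>) * indicator (loc_ball n) x \<partial>\<mu>) = (\<integral>\<^sup>+x. indicator b \<mu> * indicator (a \<inter> loc_ball n) x \<partial>\<mu>)"
        by (intro nn_integral_cong) (auto split: split_indicator)
      also have "\<dots> = indicator b \<mu> * emeasure \<mu> (a \<inter> loc_ball n)" by (rule nn_integral_cmult_indicator) auto
      finally show "(\<integral>\<^sup>+x. indicator (a \<times> b) (x, \<mu>) * indicator (loc_ball n) x \<partial>\<mu>) = \<dots>" .
    qed
    also have "\<dots> = J n (indicator (a \<times> b))"
      unfolding mecke_rectangle[OF B that(2)] J_def by (intro nn_integral_cong) (auto split: split_indicator)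
    finally show "I n (indicator (a \<times> b)) = J n (indicator (a \<times> b))" .
    have "I n (indicator (a \<times> b)) \<le> (\<integral>\<^sup>+\<mu>. ennreal (measure \<mu> (a \<inter> loc_ball n)) \<partial>L)"
      unfolding I1 using B by (intro nn_integral_mono) (auto simp: count_eq split: split_indicator)
    also have "\<dots> < \<infinity>" using integrable_count[OF B] by (simp add: integrable_iff_bounded)
    finally show "I n (indicator (a \<times> b)) < \<infinity>" .
  qed
  have sets: "I n (indicator U) = J n (indicator U)" if U: "U \<in> sets ?P" for n U
    using Int_stable_pair_measure_generator pair_measure_closed U[unfolded sets_pair_measure]
  proof (induction rule: sigma_sets_induct_disjoint)
    case (basic U) then show ?case using rect(1) by auto
  next
    case empty then show ?case by (simp add: I_def J_def)
  next
    case (compl U)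
    then have [measurable]: "U \<in> sets ?P" by (simp add: sets_pair_measure)
    let ?W = "space borel \<times> space config_algebra :: ('a \<times> 'a measure) set"
    have D [measurable]: "?W - U \<in> sets ?P" by (metis sets.compl_sets space_pair_measure \<open>U \<in> sets ?P\<close>)
    have eq: "indicator ?W p = indicator (?W - U) p + (indicator U p :: ennreal)" if "p \<in> space ?P" for p
      using that by (auto simp: space_pair_measure split: split_indicator)
    have i: "I n (indicator ?W) = I n (indicator (?W - U)) + I n (indicator U)"
      using I_cong[of "indicator ?W" "\<lambda>p. indicator (?W - U) p + indicator U p", OF eq] I_add by simp
    have j: "J n (indicator ?W) = J n (indicator (?W - U)) + J n (indicator U)"
      using J_cong[of "indicator ?W" "\<lambda>p. indicator (?W - U) p + indicator U p", OF eq] J_add by simp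
    have r: "I n (indicator ?W) = J n (indicator ?W)" "I n (indicator ?W) < \<infinity>"
      using rect[of "space borel" "space config_algebra" n] by (auto simp del: space_borel space_config_algebra)
    have "I n (indicator U) \<le> I n (indicator ?W)" unfolding i by simp
    with r(2) have "I n (indicator U) < \<infinity>" by (rule le_less_trans[rotated])
    then show ?case using i j r compl(2)
      by (metis ennreal_add_diff_cancel_right infinity_ennreal_def less_irrefl)
  next
    case (union A)
    then have [measurable]: "A i \<in> sets ?P" for i by (auto simp: sets_pair_measure)
    define S where "S k p = (\<Sum>i<k. indicator (A i) p :: ennreal)" for k p
    have S [measurable]: "S k \<in> borel_measurable ?P" for k unfolding S_def by measurable
    have inc: "incseq S" unfolding S_def incseq_def le_fun_def by (auto intro!: sum_mono2)
    have sup: "indicator (\<Union> (range A)) = (\<lambda>p. SUP k. S k p)"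
      unfolding S_def using union(1) by (simp add: fun_eq_iff suminf_indicator[symmetric] suminf_eq_SUP)
    have "I n (S k) = J n (S k)" for k
    proof (induction k)
      case 0 then show ?case by (simp add: S_def I_def J_def)
    next
      case (Suc k)
      have "S (Suc k) = (\<lambda>p. S k p + indicator (A k) p)" by (simp add: S_def fun_eq_iff)
      then show ?case using Suc union(3) I_add J_add by simp
    qed
    then show ?case unfolding sup I_sup[OF S inc] J_sup[OF S inc] by simp
  qed
  have all: "I n F = J n F" if "F \<in> borel_measurable ?P" for n F
    using that
  proof (induction rule: borel_measurable_induct)
    case (cong f g) then show ?case using I_cong[of f g] J_cong[of f g] by simp
  next
    case (set A) then show ?case by (rule sets)
  next
    case (mult u c) then show ?case by (simp add: I_mult J_mult)
  next
    case (add u v) then show ?case by (simp add: I_add J_add)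
  next
    case (seq U)
    have "(SUP i. U i) = (\<lambda>p. SUP i. U i p)" by (rule ext) (simp only: SUP_apply)
    then show ?case using seq I_sup[of U n] J_sup[of U n] by simp
  qed
  let ?F = "case_prod f"
  define FF where "FF n p = ?F p * indicator (loc_ball n) (fst p)" for n p
  have [measurable]: "FF n \<in> borel_measurable ?P" for n unfolding FF_def by measurable
  have inc: "incseq FF"
    using loc_ball_mono by (fastforce simp: FF_def incseq_def le_fun_def split: split_indicator)
  have inc': "FF i p \<le> FF j p" if "i \<le> j" for i j p using incseqD[OF inc that] by (rule le_funD)
  have sup: "(SUP n. FF n p) = ?F p" for p
    unfolding FF_def by (simp add: SUP_mult_left_ennreal[symmetric] SUP_indicator_loc_ball)
  have FI: "(\<integral>\<^sup>+\<mu>. \<integral>\<^sup>+x. FF n (x, \<mu>) \<partial>\<mu> \<partial>L) = I n ?F" "(\<integral>\<^sup>+x. \<integral>\<^sup>+\<mu>. FF n (x, add_point x \<mu>) \<partial>L \<partial>\<Lambda>) = J n ?F" for n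
    by (simp_all add: I_def J_def FF_def)
  have "(\<integral>\<^sup>+\<mu>. \<integral>\<^sup>+x. f x \<mu> \<partial>\<mu> \<partial>L) = (\<integral>\<^sup>+\<mu>. (SUP n. \<integral>\<^sup>+x. FF n (x, \<mu>) \<partial>\<mu>) \<partial>L)"
  proof (intro nn_integral_cong)
    fix \<mu> assume "\<mu> \<in> space L"
    then have \<mu>: "\<mu> \<in> config_space" by simp
    have "(\<integral>\<^sup>+x. f x \<mu> \<partial>\<mu>) = (\<integral>\<^sup>+x. (SUP n. FF n (x, \<mu>)) \<partial>\<mu>)" by (simp add: sup)
    also have "\<dots> = (SUP n. \<integral>\<^sup>+x. FF n (x, \<mu>) \<partial>\<mu>)"
      using m1[OF _ \<mu>] inc' by (intro nn_integral_monotone_convergence_SUP) (auto simp: incseq_def le_fun_def)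
    finally show "(\<integral>\<^sup>+x. f x \<mu> \<partial>\<mu>) = \<dots>" .
  qed
  also have "\<dots> = (SUP n. \<integral>\<^sup>+\<mu>. \<integral>\<^sup>+x. FF n (x, \<mu>) \<partial>\<mu> \<partial>L)"
    using inc' by (intro nn_integral_monotone_convergence_SUP)
      (auto simp: incseq_def le_fun_def intro!: nn_integral_mono measurable_nn_integral_config)
  also have "\<dots> = (SUP n. \<integral>\<^sup>+x. \<integral>\<^sup>+\<mu>. FF n (x, add_point x \<mu>) \<partial>L \<partial>\<Lambda>)"
    unfolding FI by (simp add: all[OF f])
  also have "\<dots> = (\<integral>\<^sup>+x. (SUP n. \<integral>\<^sup>+\<mu>. FF n (x, add_point x \<mu>) \<partial>L) \<partial>\<Lambda>)"
    using inc' by (intro nn_integral_monotone_convergence_SUP[symmetric])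
      (auto simp: incseq_def le_fun_def intro!: nn_integral_mono)
  also have "\<dots> = (\<integral>\<^sup>+x. \<integral>\<^sup>+\<mu>. (SUP n. FF n (x, add_point x \<mu>)) \<partial>L \<partial>\<Lambda>)"
    using inc' by (intro nn_integral_cong nn_integral_monotone_convergence_SUP[symmetric])
      (auto simp: incseq_def le_fun_def)
  also have "\<dots> = (\<integral>\<^sup>+x. \<integral>\<^sup>+\<mu>. f x (add_point x \<mu>) \<partial>L \<partial>\<Lambda>)" by (simp add: sup)
  finally show ?thesis .
qed

end

section \<open>Powers of a configuration and the multivariate Mecke equation\<close>

lemma sets_PiM_config [measurable_cong]:
  "\<mu> \<in> config_space \<Longrightarrow> sets (PiM I (\<lambda>_. \<mu>)) = sets (PiM I (\<lambda>_. borel))"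
  by (intro sets_PiM_cong) auto

lemma measurable_nn_integral_PiM_config:
  fixes \<kappa> :: "'m \<Rightarrow> 'a::polish_space measure"
  assumes "finite I" and \<kappa>: "\<kappa> \<in> measurable M config_algebra"
    and "case_prod f \<in> borel_measurable (M \<Otimes>\<^sub>M PiM I (\<lambda>_. borel))"
  shows "(\<lambda>m. \<integral>\<^sup>+z. f m z \<partial>PiM I (\<lambda>_. \<kappa> m)) \<in> borel_measurable M"
  using assms(1,3)
proof (induction I arbitrary: f)
  case empty
  have "(\<lambda>m. f m (\<lambda>_. undefined)) \<in> borel_measurable M"
    by (rule measurable_compose[OF _ empty, of "\<lambda>m. (m, \<lambda>_. undefined)", simplified])
      (auto intro!: measurable_Pair simp: space_PiM)
  then show ?case by (simp add: PiM_empty nn_integral_count_space_finite)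
next
  case (insert i I)
  note [measurable] = \<kappa> and f [measurable] = insert.prems
  have cfg: "m \<in> space M \<Longrightarrow> \<kappa> m \<in> config_space" for m
    using measurable_space[OF \<kappa>] by simp
  have "(\<lambda>(m, z). \<integral>\<^sup>+y. f m (z(i := y)) \<partial>\<kappa> m) \<in> borel_measurable (M \<Otimes>\<^sub>M PiM I (\<lambda>_. borel))"
    unfolding split_beta'
    by (rule measurable_nn_integral_config) measurable
  from insert.IH[OF this]
  have "(\<lambda>m. \<integral>\<^sup>+z. \<integral>\<^sup>+y. f m (z(i := y)) \<partial>\<kappa> m \<partial>PiM I (\<lambda>_. \<kappa> m)) \<in> borel_measurable M" .
  also have "?this \<longleftrightarrow> ?case"
  proof (rule measurable_cong)
    fix m assume m: "m \<in> space M"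
    interpret product_sigma_finite "\<lambda>_. \<kappa> m" by (rule product_sigma_finite_config[OF cfg[OF m]])
    have "f m \<in> borel_measurable (PiM (insert i I) (\<lambda>_. borel))"
      using measurable_Pair2[OF f m] by simp
    then have "f m \<in> borel_measurable (PiM (insert i I) (\<lambda>_. \<kappa> m))"
      using sets_PiM_config[OF cfg[OF m], of "insert i I"] by (auto cong: measurable_cong_sets)
    from product_nn_integral_insert[OF insert(1,2) this]
    show "(\<integral>\<^sup>+z. \<integral>\<^sup>+y. f m (z(i := y)) \<partial>\<kappa> m \<partial>PiM I (\<lambda>_. \<kappa> m)) = (\<integral>\<^sup>+z. f m z \<partial>PiM (insert i I) (\<lambda>_. \<kappa> m))"
      by simp
  qed
  finally show ?case .
qed

text \<open>Tuples that avoid \<open>x\<close> do not see an additional point at \<open>x\<close>.\<close>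

lemma nn_integral_PiM_add_point_avoiding:
  assumes "finite I" and \<mu>: "\<mu> \<in> config_space"
    and "g \<in> borel_measurable (PiM I (\<lambda>_. borel))"
    and "\<And>z i. i \<in> I \<Longrightarrow> z i = x \<Longrightarrow> g z = 0"
  shows "(\<integral>\<^sup>+z. g z \<partial>PiM I (\<lambda>_. add_point x \<mu>)) = (\<integral>\<^sup>+z. g z \<partial>PiM I (\<lambda>_. \<mu>))"
  using assms(1,3,4)
proof (induction I arbitrary: g)
  case empty then show ?case by (simp add: PiM_empty)
next
  case (insert i I)
  note g [measurable] = insert.prems(1)
  have *: "(\<integral>\<^sup>+z. g z \<partial>PiM (insert i I) (\<lambda>_. \<nu>)) = (\<integral>\<^sup>+z. \<integral>\<^sup>+y. g (z(i := y)) \<partial>\<nu> \<partial>PiM I (\<lambda>_. \<nu>))"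
    if \<nu>: "\<nu> \<in> config_space" for \<nu>
  proof -
    interpret product_sigma_finite "\<lambda>_. \<nu>" by (rule product_sigma_finite_config[OF \<nu>])
    show ?thesis
      by (rule product_nn_integral_insert[OF insert(1,2)])
        (use g sets_PiM_config[OF \<nu>, of "insert i I"] in \<open>auto cong: measurable_cong_sets\<close>)
  qed
  have "(\<integral>\<^sup>+z. g z \<partial>PiM (insert i I) (\<lambda>_. add_point x \<mu>)) =
      (\<integral>\<^sup>+z. \<integral>\<^sup>+y. g (z(i := y)) \<partial>\<mu> \<partial>PiM I (\<lambda>_. add_point x \<mu>))"
    unfolding *[OF add_point_config[OF \<mu>]]
  proof (intro nn_integral_cong)
    fix z assume "z \<in> space (PiM I (\<lambda>_. add_point x \<mu>))"
    then have [measurable]: "z \<in> space (PiM I (\<lambda>_. borel))" using \<mu> by (simp add: space_PiM)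
    have "(\<integral>\<^sup>+y. g (z(i := y)) \<partial>add_point x \<mu>) = (\<integral>\<^sup>+y. g (z(i := y)) \<partial>\<mu>) + g (z(i := x))"
      by (rule nn_integral_add_point[OF \<mu>]) measurable
    also have "g (z(i := x)) = 0" by (rule insert.prems(2)[of i]) auto
    finally show "(\<integral>\<^sup>+y. g (z(i := y)) \<partial>add_point x \<mu>) = (\<integral>\<^sup>+y. g (z(i := y)) \<partial>\<mu>)"
      by (simp only: add_0_right)
  qed
  also have "\<dots> = (\<integral>\<^sup>+z. \<integral>\<^sup>+y. g (z(i := y)) \<partial>\<mu> \<partial>PiM I (\<lambda>_. \<mu>))"
  proof (rule insert.IH)
    have [measurable]: "\<mu> \<in> space config_algebra" using \<mu> by simp
    show "(\<lambda>z. \<integral>\<^sup>+y. g (z(i := y)) \<partial>\<mu>) \<in> borel_measurable (PiM I (\<lambda>_. borel))"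
      by (rule measurable_nn_integral_config) measurable
    fix z j assume "j \<in> I" "z j = x"
    then have "g (z(i := y)) = 0" for y using insert(2) by (intro insert.prems(2)[of j]) auto
    then show "(\<integral>\<^sup>+y. g (z(i := y)) \<partial>\<mu>) = 0" by simp
  qed
  also have "\<dots> = (\<integral>\<^sup>+z. g z \<partial>PiM (insert i I) (\<lambda>_. \<mu>))" by (rule *[OF \<mu>, symmetric])
  finally show ?case .
qed

lemma measurable_inj_on [measurable]:
  "finite I \<Longrightarrow> {z \<in> space (PiM I (\<lambda>_. borel :: 'a::polish_space measure)). inj_on z I} \<in> sets (PiM I (\<lambda>_. borel))"
proof -
  assume I: "finite I"
  let ?M = "PiM I (\<lambda>_. borel :: 'a measure)"
  have "{z \<in> space ?M. z i = z j} \<in> sets ?M" if "i \<in> I" "j \<in> I" for i j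
    by (intro measurable_equality_set measurable_component_singleton that)
  then have "space ?M - (\<Union>i\<in>I. \<Union>j\<in>I - {i}. {z \<in> space ?M. z i = z j}) \<in> sets ?M"
    using I by (intro sets.Diff sets.top sets.finite_UN) auto
  moreover have "{z \<in> space ?M. inj_on z I} = space ?M - (\<Union>i\<in>I. \<Union>j\<in>I - {i}. {z \<in> space ?M. z i = z j})"
    by (auto simp: inj_on_def)
  ultimately show ?thesis by simp
qed

lemma borel_measurable_indicator_inj:
  assumes "finite I"
  shows "(indicator {z. inj_on z I} :: _ \<Rightarrow> ennreal) \<in> borel_measurable (PiM I (\<lambda>_. borel :: 'a::polish_space measure))"
  using borel_measurable_indicator[OF measurable_inj_on[OF assms]]
  by (rule measurable_cong[THEN iffD1, rotated]) (auto simp: indicator_def)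

locale diffuse_poisson_law = poisson_law L \<Lambda> for L :: "'a::polish_space measure measure" and \<Lambda> +
  assumes diffuse: "emeasure \<Lambda> {x} = 0"
begin

lemma AE_not_in_finite: "finite S \<Longrightarrow> AE x in \<Lambda>. x \<notin> S"
proof -
  assume "finite S"
  then have "S \<in> null_sets \<Lambda>"
  proof induction
    case (insert x S)
    have "{x} \<in> null_sets \<Lambda>" using diffuse by auto
    then have "{x} \<union> S \<in> null_sets \<Lambda>" by (intro null_sets.Un insert)
    then show ?case by simp
  qed auto
  then show ?thesis by (rule AE_not_in)
qed

text \<open>One coordinate is split off and the univariate equation is applied to it.  Since the tuple has
  distinct entries, the remaining coordinates avoid the new point and do not see it.  Afterwards the
  condition that they avoid it is dropped, because a diffuse measure does not charge finite sets.\<close>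

theorem mecke_multi:
  assumes "finite I" and "case_prod f \<in> borel_measurable (PiM I (\<lambda>_. borel) \<Otimes>\<^sub>M config_algebra)"
  shows "(\<integral>\<^sup>+\<mu>. \<integral>\<^sup>+z. indicator {z. inj_on z I} z * f z \<mu> \<partial>PiM I (\<lambda>_. \<mu>) \<partial>L) =
    (\<integral>\<^sup>+z. \<integral>\<^sup>+\<mu>. f z (add_points I z \<mu>) \<partial>L \<partial>PiM I (\<lambda>_. \<Lambda>))"
  using assms
proof (induction I arbitrary: f)
  case empty
  have "(\<integral>\<^sup>+z. indicator {z. inj_on z {}} z * f z \<mu> \<partial>PiM {} (\<lambda>_. \<mu>)) = f (\<lambda>_. undefined) \<mu>" for \<mu>
    by (simp add: PiM_empty nn_integral_count_space_finite)
  moreover have "(\<integral>\<^sup>+\<mu>. f z (add_points {} z \<mu>) \<partial>L) = (\<integral>\<^sup>+\<mu>. f z \<mu> \<partial>L)" for z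
    by (intro nn_integral_cong) simp
  ultimately show ?case by (simp add: PiM_empty nn_integral_count_space_finite)
next
  case (insert i I)
  note f [measurable] = insert.prems
  note inj_m [measurable] = borel_measurable_indicator_inj[OF insert(1), where 'a='a]
  (* The indicator that the tuple z avoids the point x. *)
  define r where "r x z = (if \<forall>j\<in>I. z j \<noteq> x then 1 else 0 :: ennreal)" for x :: 'a and z
  have r [measurable]: "(\<lambda>p. r (u p) (w p)) \<in> borel_measurable N"
    if [measurable]: "u \<in> measurable N borel" "w \<in> measurable N (PiM I (\<lambda>_. borel))" for u w and N :: "'n measure"
    unfolding r_def using insert(1) by measurable
  have fin: "finite (insert i I)" using insert(1) by simp
  have R: "(\<lambda>y. \<integral>\<^sup>+\<mu>. f y (add_points (insert i I) y \<mu>) \<partial>L) \<in> borel_measurable (PiM (insert i I) (\<lambda>_. borel))"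
  proof (rule borel_measurable_nn_integral)
    have [measurable]: "(\<lambda>p. add_points (insert i I) (fst p) (snd p)) \<in> measurable (PiM (insert i I) (\<lambda>_. borel) \<Otimes>\<^sub>M config_algebra) config_algebra"
      by (rule measurable_add_points[OF fin]) auto
    have "(\<lambda>p. f (fst p) (add_points (insert i I) (fst p) (snd p))) \<in> borel_measurable (PiM (insert i I) (\<lambda>_. borel) \<Otimes>\<^sub>M config_algebra)"
      by measurable
    then show "(\<lambda>(y, \<mu>). f y (add_points (insert i I) y \<mu>)) \<in> borel_measurable (PiM (insert i I) (\<lambda>_. borel) \<Otimes>\<^sub>M L)"
      by (simp add: split_beta' cong: measurable_cong_sets)
  qed
  note [measurable] = R
  have R': "(\<lambda>y. r (y i) (restrict y I) * (\<integral>\<^sup>+\<mu>. f y (add_points (insert i I) y \<mu>) \<partial>L)) \<in> borel_measurable (PiM (insert i I) (\<lambda>_. borel))"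
    by (intro borel_measurable_times_ennreal r R) (auto intro: measurable_restrict_subset)
  have inj: "indicator {z. inj_on z (insert i I)} (z(i := x)) = r x z * indicator {z. inj_on z I} z" for x z
  proof -
    have "inj_on (z(i := x)) I = inj_on z I" using insert(2) by (intro inj_on_cong) auto
    moreover have "(z(i := x)) ` (I - {i}) = z ` I" using insert(2) by auto
    ultimately show ?thesis using insert(2) by (auto simp: r_def indicator_def inj_on_insert)
  qed
  have sets_cfg: "(g \<in> borel_measurable (PiM J (\<lambda>_. \<mu>))) = (g \<in> borel_measurable (PiM J (\<lambda>_. borel)))"
    if "\<mu> \<in> config_space" for g :: "_ \<Rightarrow> ennreal" and \<mu> :: "'a measure" and J
    using sets_PiM_config[OF that, of J] by (auto cong: measurable_cong_sets)
  define \<Phi> where "\<Phi> x \<mu> = (\<integral>\<^sup>+z. r x z * indicator {z. inj_on z I} z * f (z(i := x)) \<mu> \<partial>PiM I (\<lambda>_. \<mu>))" for x \<mu>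
  have "(\<integral>\<^sup>+\<mu>. \<integral>\<^sup>+z. indicator {z. inj_on z (insert i I)} z * f z \<mu> \<partial>PiM (insert i I) (\<lambda>_. \<mu>) \<partial>L) =
      (\<integral>\<^sup>+\<mu>. \<integral>\<^sup>+x. \<Phi> x \<mu> \<partial>\<mu> \<partial>L)"
  proof (rule nn_integral_cong)
    fix \<mu> assume "\<mu> \<in> space L"
    then have \<mu>: "\<mu> \<in> config_space" by simp
    interpret product_sigma_finite "\<lambda>_. \<mu>" by (rule product_sigma_finite_config[OF \<mu>])
    have "(\<lambda>z. indicator {z. inj_on z (insert i I)} z * f z \<mu>) \<in> borel_measurable (PiM (insert i I) (\<lambda>_. borel))"
      using insert(1) measurable_Pair1[OF f, of \<mu>] \<mu>
      by (intro borel_measurable_times_ennreal borel_measurable_indicator_inj) simp_all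
    then have "(\<integral>\<^sup>+z. indicator {z. inj_on z (insert i I)} z * f z \<mu> \<partial>PiM (insert i I) (\<lambda>_. \<mu>)) =
        (\<integral>\<^sup>+x. \<integral>\<^sup>+z. indicator {z. inj_on z (insert i I)} (z(i := x)) * f (z(i := x)) \<mu> \<partial>PiM I (\<lambda>_. \<mu>) \<partial>\<mu>)"
      by (intro product_nn_integral_insert_rev[OF insert(1,2)]) (simp only: sets_cfg[OF \<mu>])
    then show "(\<integral>\<^sup>+z. indicator {z. inj_on z (insert i I)} z * f z \<mu> \<partial>PiM (insert i I) (\<lambda>_. \<mu>)) = (\<integral>\<^sup>+x. \<Phi> x \<mu> \<partial>\<mu>)"
      unfolding \<Phi>_def inj .
  qed
  also have "\<dots> = (\<integral>\<^sup>+x. \<integral>\<^sup>+\<mu>. \<Phi> x (add_point x \<mu>) \<partial>L \<partial>\<Lambda>)"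
  proof (rule mecke)
    show "case_prod \<Phi> \<in> borel_measurable (borel \<Otimes>\<^sub>M config_algebra)"
      unfolding \<Phi>_def split_beta'
      by (rule measurable_nn_integral_PiM_config[OF insert(1)]) measurable
  qed
  also have "\<dots> = (\<integral>\<^sup>+x. \<integral>\<^sup>+\<mu>. (\<integral>\<^sup>+z. indicator {z. inj_on z I} z * (r x z * f (z(i := x)) (add_point x \<mu>)) \<partial>PiM I (\<lambda>_. \<mu>)) \<partial>L \<partial>\<Lambda>)"
  proof (intro nn_integral_cong)
    fix x \<mu> assume "\<mu> \<in> space L"
    then have \<mu>: "\<mu> \<in> config_space" "add_point x \<mu> \<in> config_space" by auto
    have "\<Phi> x (add_point x \<mu>) = (\<integral>\<^sup>+z. r x z * indicator {z. inj_on z I} z * f (z(i := x)) (add_point x \<mu>) \<partial>PiM I (\<lambda>_. \<mu>))"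
      unfolding \<Phi>_def
    proof (rule nn_integral_PiM_add_point_avoiding[OF insert(1) \<mu>(1)])
      show "(\<lambda>z. r x z * indicator {z. inj_on z I} z * f (z(i := x)) (add_point x \<mu>)) \<in> borel_measurable (PiM I (\<lambda>_. borel))"
      proof -
        have [measurable]: "(\<lambda>z. f z (add_point x \<mu>)) \<in> borel_measurable (PiM (insert i I) (\<lambda>_. borel))"
          using measurable_Pair1[OF f, of "add_point x \<mu>"] \<mu> by simp
        have "r x \<in> borel_measurable (PiM I (\<lambda>_. borel))" by (rule r) auto
        then show ?thesis by (intro borel_measurable_times_ennreal inj_m) measurable
      qed
    qed (auto simp: r_def)
    then show "\<Phi> x (add_point x \<mu>) = (\<integral>\<^sup>+z. indicator {z. inj_on z I} z * (r x z * f (z(i := x)) (add_point x \<mu>)) \<partial>PiM I (\<lambda>_. \<mu>))"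
      by (simp add: mult_ac)
  qed
  also have "\<dots> = (\<integral>\<^sup>+x. \<integral>\<^sup>+z. \<integral>\<^sup>+\<mu>. r x z * f (z(i := x)) (add_point x (add_points I z \<mu>)) \<partial>L \<partial>PiM I (\<lambda>_. \<Lambda>) \<partial>\<Lambda>)"
    by (intro nn_integral_cong insert.IH) measurable
  also have "\<dots> = (\<integral>\<^sup>+x. \<integral>\<^sup>+z. r ((z(i := x)) i) (restrict (z(i := x)) I) * (\<integral>\<^sup>+\<mu>. f (z(i := x)) (add_points (insert i I) (z(i := x)) \<mu>) \<partial>L) \<partial>PiM I (\<lambda>_. \<Lambda>) \<partial>\<Lambda>)"
  proof (intro nn_integral_cong)
    fix x z assume "z \<in> space (PiM I (\<lambda>_. \<Lambda>))"
    then have z: "z \<in> space (PiM I (\<lambda>_. borel))" by (simp add: space_PiM)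
    have rr: "r x (restrict (z(i := x)) I) = r x z" using insert(2) by (auto simp: r_def)
    have "(\<integral>\<^sup>+\<mu>. f (z(i := x)) (add_points (insert i I) (z(i := x)) \<mu>) \<partial>L) = (\<integral>\<^sup>+\<mu>. f (z(i := x)) (add_point x (add_points I z \<mu>)) \<partial>L)"
    proof (intro nn_integral_cong)
      fix \<mu> assume "\<mu> \<in> space L"
      then have \<mu>: "\<mu> \<in> config_space" by simp
      have "add_points (insert i I) (z(i := x)) \<mu> = add_point x (add_points I (z(i := x)) \<mu>)"
        using add_points_insert'[OF insert(1,2) \<mu>, of "z(i := x)"] by simp
      also have "add_points I (z(i := x)) \<mu> = add_points I z \<mu>"
        using insert(1,2) \<mu> by (intro add_points_cong) auto
      finally show "f (z(i := x)) (add_points (insert i I) (z(i := x)) \<mu>) = f (z(i := x)) (add_point x (add_points I z \<mu>))"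
        by (simp only:)
    qed
    then show "(\<integral>\<^sup>+\<mu>. r x z * f (z(i := x)) (add_point x (add_points I z \<mu>)) \<partial>L) =
        r ((z(i := x)) i) (restrict (z(i := x)) I) * (\<integral>\<^sup>+\<mu>. f (z(i := x)) (add_points (insert i I) (z(i := x)) \<mu>) \<partial>L)"
      unfolding fun_upd_same rr using z insert(1) by (subst nn_integral_cmult) auto
  qed
  also have "\<dots> = (\<integral>\<^sup>+y. r (y i) (restrict y I) * (\<integral>\<^sup>+\<mu>. f y (add_points (insert i I) y \<mu>) \<partial>L) \<partial>PiM (insert i I) (\<lambda>_. \<Lambda>))"
    by (intro pow.product_nn_integral_insert_rev[symmetric] insert(1,2))
      (use R' in \<open>simp only: measurable_cong_sets[OF sets_pow refl]\<close>)
  also have "\<dots> = (\<integral>\<^sup>+z. \<integral>\<^sup>+x. r ((z(i := x)) i) (restrict (z(i := x)) I) * (\<integral>\<^sup>+\<mu>. f (z(i := x)) (add_points (insert i I) (z(i := x)) \<mu>) \<partial>L) \<partial>\<Lambda> \<partial>PiM I (\<lambda>_. \<Lambda>))"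
    by (intro pow.product_nn_integral_insert insert(1,2))
      (use R' in \<open>simp only: measurable_cong_sets[OF sets_pow refl]\<close>)
  also have "\<dots> = (\<integral>\<^sup>+z. \<integral>\<^sup>+x. (\<integral>\<^sup>+\<mu>. f (z(i := x)) (add_points (insert i I) (z(i := x)) \<mu>) \<partial>L) \<partial>\<Lambda> \<partial>PiM I (\<lambda>_. \<Lambda>))"
  proof (rule nn_integral_cong, rule nn_integral_cong_AE)
    fix z :: "'b \<Rightarrow> 'a"
    show "AE x in \<Lambda>. r ((z(i := x)) i) (restrict (z(i := x)) I) * (\<integral>\<^sup>+\<mu>. f (z(i := x)) (add_points (insert i I) (z(i := x)) \<mu>) \<partial>L) =
        (\<integral>\<^sup>+\<mu>. f (z(i := x)) (add_points (insert i I) (z(i := x)) \<mu>) \<partial>L)"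
      using AE_not_in_finite[OF finite_imageI[OF insert(1)], of z]
    proof (rule AE_mp, intro AE_I2 impI)
      fix x assume "x \<notin> z ` I"
      then have "r ((z(i := x)) i) (restrict (z(i := x)) I) = 1" using insert(2) by (auto simp: r_def)
      then show "r ((z(i := x)) i) (restrict (z(i := x)) I) * (\<integral>\<^sup>+\<mu>. f (z(i := x)) (add_points (insert i I) (z(i := x)) \<mu>) \<partial>L) =
        (\<integral>\<^sup>+\<mu>. f (z(i := x)) (add_points (insert i I) (z(i := x)) \<mu>) \<partial>L)" by (simp only: mult_1)
    qed
  qed
  also have "\<dots> = (\<integral>\<^sup>+z. \<integral>\<^sup>+\<mu>. f z (add_points (insert i I) z \<mu>) \<partial>L \<partial>PiM (insert i I) (\<lambda>_. \<Lambda>))"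
    by (intro pow.product_nn_integral_insert[symmetric] insert(1,2))
      (use R in \<open>simp only: measurable_cong_sets[OF sets_pow refl]\<close>)
  finally show ?case .
qed

lemma AE_inj_on:
  fixes I :: "'b set"
  assumes "finite I"
  shows "AE z in PiM I (\<lambda>_. \<Lambda>). inj_on z I"
  using assms
proof (induction I)
  case (insert i I)
  have m: "(indicator {z. \<not> inj_on z (insert i I)} :: ('b \<Rightarrow> 'a) \<Rightarrow> ennreal) \<in> borel_measurable (PiM (insert i I) (\<lambda>_. borel :: 'a measure))"
  proof -
    have "(\<lambda>z. 1 - indicator {z. inj_on z (insert i I)} z :: ennreal) \<in> borel_measurable (PiM (insert i I) (\<lambda>_. borel :: 'a measure))"
      using insert(1) by (intro borel_measurable_minus_ennreal borel_measurable_indicator_inj) auto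
    then show ?thesis by (rule measurable_cong[THEN iffD1, rotated]) (auto split: split_indicator)
  qed
  have m': "(indicator {z. \<not> inj_on z (insert i I)} :: ('b \<Rightarrow> 'a) \<Rightarrow> ennreal) \<in> borel_measurable (PiM (insert i I) (\<lambda>_. \<Lambda>))"
    using m by (simp only: measurable_cong_sets[OF sets_pow refl])
  have "(\<integral>\<^sup>+z. indicator {z. \<not> inj_on z (insert i I)} z \<partial>PiM (insert i I) (\<lambda>_. \<Lambda>)) =
      (\<integral>\<^sup>+z. \<integral>\<^sup>+x. indicator {z. \<not> inj_on z (insert i I)} (z(i := x)) \<partial>\<Lambda> \<partial>PiM I (\<lambda>_. \<Lambda>))"
    by (rule pow.product_nn_integral_insert[OF insert(1,2) m'])
  also have "\<dots> = (\<integral>\<^sup>+z. 0 \<partial>PiM I (\<lambda>_. \<Lambda>))"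
  proof (rule nn_integral_cong_AE)
    show "AE z in PiM I (\<lambda>_. \<Lambda>). (\<integral>\<^sup>+x. indicator {z. \<not> inj_on z (insert i I)} (z(i := x)) \<partial>\<Lambda>) = 0"
      using insert.IH
    proof (rule AE_mp, intro AE_I2 impI)
      fix z :: "'b \<Rightarrow> 'a" assume z: "inj_on z I"
      have "(\<integral>\<^sup>+x. indicator {z. \<not> inj_on z (insert i I)} (z(i := x)) \<partial>\<Lambda>) = (\<integral>\<^sup>+x. 0 \<partial>\<Lambda>)"
      proof (rule nn_integral_cong_AE)
        show "AE x in \<Lambda>. indicator {z. \<not> inj_on z (insert i I)} (z(i := x)) = (0::ennreal)"
          using AE_not_in_finite[OF finite_imageI[OF insert(1)], of z]
        proof (rule AE_mp, intro AE_I2 impI)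
          fix x assume "x \<notin> z ` I"
          moreover have "inj_on (z(i := x)) I = inj_on z I" using insert(2) by (intro inj_on_cong) auto
          moreover have "(z(i := x)) ` (I - {i}) = z ` I" using insert(2) by auto
          ultimately have "inj_on (z(i := x)) (insert i I)" using z insert(2) by (auto simp: inj_on_insert)
          then show "indicator {z. \<not> inj_on z (insert i I)} (z(i := x)) = (0::ennreal)" by simp
        qed
      qed
      then show "(\<integral>\<^sup>+x. indicator {z. \<not> inj_on z (insert i I)} (z(i := x)) \<partial>\<Lambda>) = 0" by simp
    qed
  qed
  finally have "(\<integral>\<^sup>+z. indicator {z. \<not> inj_on z (insert i I)} z \<partial>PiM (insert i I) (\<lambda>_. \<Lambda>)) = 0" by simp
  then have "AE z in PiM (insert i I) (\<lambda>_. \<Lambda>). indicator {z. \<not> inj_on z (insert i I)} z = (0::ennreal)"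
    using nn_integral_0_iff_AE[OF m'] by simp
  then show ?case by (rule AE_mp) (auto simp: indicator_def split: if_splits)
qed auto

end

section \<open>Iterated difference operators\<close>

text \<open>The variables are indexed by an arbitrary finite set, so that coordinates can be split off, permuted
  and concatenated.\<close>

definition acost ::
  "'i set \<Rightarrow> ('a::polish_space measure \<Rightarrow> real) \<Rightarrow> 'a measure \<Rightarrow> ('i \<Rightarrow> 'a) \<Rightarrow> real" where
  "acost I F \<mu> x = (\<Sum>A\<in>Pow I. (- 1) ^ card (I - A) * F (add_points A x \<mu>))"

lemma add_cost_eq: "add_cost l F \<mu> x = acost {..<l} F \<mu> x"
  unfolding add_cost_def acost_def add_points_def
  by (intro sum.cong) (auto simp: card_Diff_subset finite_subset)

lemma acost_empty [simp]: "\<mu> \<in> config_space \<Longrightarrow> acost {} F \<mu> x = F \<mu>"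
  by (simp add: acost_def)

lemma acost_insert:
  assumes I: "finite I" "i \<notin> I" and \<mu>: "\<mu> \<in> config_space"
  shows "acost (insert i I) F \<mu> x = acost I F (add_point (x i) \<mu>) x - acost I F \<mu> x"
proof -
  have "acost (insert i I) F \<mu> x =
      (\<Sum>A\<in>Pow I. (- 1) ^ card (insert i I - A) * F (add_points A x \<mu>)) +
      (\<Sum>A\<in>insert i ` Pow I. (- 1) ^ card (insert i I - A) * F (add_points A x \<mu>))"
    unfolding acost_def Pow_insert using I by (intro sum.union_disjoint) auto
  also have "(\<Sum>A\<in>Pow I. (- 1) ^ card (insert i I - A) * F (add_points A x \<mu>)) = - acost I F \<mu> x"
    unfolding acost_def sum_negf[symmetric]
  proof (intro sum.cong refl)
    fix A assume "A \<in> Pow I"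
    then have "insert i I - A = insert i (I - A)" using I by auto
    then show "(- 1) ^ card (insert i I - A) * F (add_points A x \<mu>) = - ((- 1) ^ card (I - A) * F (add_points A x \<mu>))"
      using I by simp
  qed
  also have "(\<Sum>A\<in>insert i ` Pow I. (- 1) ^ card (insert i I - A) * F (add_points A x \<mu>)) =
      (\<Sum>A\<in>Pow I. (- 1) ^ card (insert i I - insert i A) * F (add_points (insert i A) x \<mu>))"
  proof (subst sum.reindex)
    show "inj_on (insert i) (Pow I)" using I by (auto simp: inj_on_def)
  qed simp
  also have "\<dots> = acost I F (add_point (x i) \<mu>) x"
    unfolding acost_def
  proof (intro sum.cong refl)
    fix A assume A: "A \<in> Pow I"
    then have "insert i I - insert i A = I - A" using I by auto
    moreover have "add_points (insert i A) x \<mu> = add_points A x (add_point (x i) \<mu>)"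
      using A I \<mu> finite_subset by (intro add_points_insert) auto
    ultimately show "(- 1) ^ card (insert i I - insert i A) * F (add_points (insert i A) x \<mu>) =
        (- 1) ^ card (I - A) * F (add_points A x (add_point (x i) \<mu>))" by simp
  qed
  finally show ?thesis by simp
qed

text \<open>Difference operators compose: differences in the variables of \<open>J\<close> are taken of differences in the
  variables of \<open>I\<close>.\<close>

lemma acost_Un:
  assumes "finite J" "finite I" "I \<inter> J = {}" and "\<mu> \<in> config_space"
  shows "acost (I \<union> J) F \<mu> x = acost J (\<lambda>\<nu>. acost I F \<nu> x) \<mu> x"
  using assms
proof (induction J arbitrary: \<mu>)
  case (insert j J)
  have "acost (I \<union> insert j J) F \<mu> x = acost (insert j (I \<union> J)) F \<mu> x" by simp
  also have "\<dots> = acost (insert j J) (\<lambda>\<nu>. acost I F \<nu> x) \<mu> x"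
    using insert by (subst (1 2) acost_insert) auto
  finally show ?case .
qed simp

lemma acost_reindex:
  assumes "finite I" "inj_on f I" and "\<mu> \<in> config_space"
  shows "acost (f ` I) F \<mu> x = acost I F \<mu> (x \<circ> f)"
  using assms
proof (induction I arbitrary: \<mu>)
  case (insert i I)
  then have "f i \<notin> f ` I" by (auto simp: inj_on_def)
  with insert show ?case by (simp add: acost_insert)
qed simp

lemma acost_cong:
  assumes "finite I" "\<And>i. i \<in> I \<Longrightarrow> x i = y i" "\<mu> \<in> config_space"
  shows "acost I F \<mu> x = acost I F \<mu> y"
  unfolding acost_def using assms
  by (intro sum.cong refl arg_cong2[where f="(*)"] arg_cong[where f=F] add_points_cong) (auto intro: finite_subset)

lemma acost_lexp:
  assumes "finite I" and v: "test_fun v" and "\<mu> \<in> config_space"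
  shows "acost I (lexp v) \<mu> x = (\<Prod>i\<in>I. exp (- v (x i)) - 1) * lexp v \<mu>"
  using assms(1,3)
proof (induction I arbitrary: \<mu>)
  case (insert i I)
  then show ?case by (simp add: acost_insert lexp_add_point[OF v] algebra_simps)
qed simp

lemma acost_linear:
  "acost I (\<lambda>\<mu>. f \<mu> + g \<mu>) \<mu> x = acost I f \<mu> x + acost I g \<mu> x"
  "acost I (\<lambda>\<mu>. f \<mu> - g \<mu>) \<mu> x = acost I f \<mu> x - acost I g \<mu> x"
  "acost I (\<lambda>\<mu>. c * f \<mu>) \<mu> x = c * acost I f \<mu> x"
  unfolding acost_def
  by (simp_all add: sum.distrib sum_subtractf algebra_simps sum_distrib_left)

lemma acost_abs_le: "\<bar>acost I F \<mu> x\<bar> \<le> (\<Sum>A\<in>Pow I. \<bar>F (add_points A x \<mu>)\<bar>)"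
  unfolding acost_def by (rule order_trans[OF sum_abs]) (simp add: abs_mult power_abs)

lemma measurable_add_points_pair:
  assumes "finite I" "A \<subseteq> I"
  shows "(\<lambda>p. add_points A (fst p) (snd p)) \<in> measurable (PiM I (\<lambda>_. borel) \<Otimes>\<^sub>M config_algebra) config_algebra"
  by (rule measurable_add_points) (use assms in \<open>auto intro: finite_subset\<close>)

lemma measurable_acost_pair:
  assumes "finite I" "F \<in> borel_measurable config_algebra"
  shows "(\<lambda>p. acost I F (snd p) (fst p)) \<in> borel_measurable (PiM I (\<lambda>_. borel) \<Otimes>\<^sub>M config_algebra)"
  unfolding acost_def
  by (intro borel_measurable_sum borel_measurable_times borel_measurable_const
      measurable_compose[OF measurable_add_points_pair assms(2)]) (use assms in auto)

lemma measurable_acost: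
  assumes "finite I" "F \<in> borel_measurable config_algebra" "x \<in> space (PiM I (\<lambda>_. borel))"
  shows "(\<lambda>\<mu>. acost I F \<mu> x) \<in> borel_measurable config_algebra"
  using measurable_Pair2[OF measurable_acost_pair[OF assms(1,2)] assms(3)] by simp

section \<open>Kernels of functionals and their integrability\<close>

context poisson_law begin

lemma space_pow: "space (PiM I (\<lambda>_. \<Lambda>)) = space (PiM I (\<lambda>_. borel))"
  by (rule sets_eq_imp_space_eq[OF sets_pow])

lemma measurable_pow_iff: "(f \<in> measurable (PiM I (\<lambda>_. \<Lambda>)) N) = (f \<in> measurable (PiM I (\<lambda>_. borel)) N)"
  by (simp only: measurable_cong_sets[OF sets_pow refl])

lemma measurable_law_iff: "(f \<in> measurable L N) = (f \<in> measurable config_algebra N)"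
  by (simp only: measurable_cong_sets[OF sets_law refl])

lemma measurable_nn_integral_law:
  assumes "(\<lambda>p. f (fst p) (snd p)) \<in> borel_measurable (N \<Otimes>\<^sub>M config_algebra)"
  shows "(\<lambda>x. \<integral>\<^sup>+\<mu>. f x \<mu> \<partial>L) \<in> borel_measurable N"
  by (rule borel_measurable_nn_integral) (use assms in \<open>simp add: split_beta' cong: measurable_cong_sets\<close>)

lemma measurable_integral_law:
  fixes f :: "'n \<Rightarrow> 'a measure \<Rightarrow> real"
  assumes "(\<lambda>p. f (fst p) (snd p)) \<in> borel_measurable (N \<Otimes>\<^sub>M config_algebra)"
  shows "(\<lambda>x. \<integral>\<mu>. f x \<mu> \<partial>L) \<in> borel_measurable N"
  by (rule borel_measurable_lebesgue_integral) (use assms in \<open>simp add: split_beta' cong: measurable_cong_sets\<close>)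

text \<open>The indicator of the power \<open>B\<^sup>I\<close>, as a product that splits coordinatewise.\<close>

definition box :: "'a set \<Rightarrow> 'i set \<Rightarrow> ('i \<Rightarrow> 'a) \<Rightarrow> ennreal" where
  "box B I z = (\<Prod>i\<in>I. indicator B (z i))"

lemma box_measurable: "finite I \<Longrightarrow> B \<in> sets borel \<Longrightarrow> box B I \<in> borel_measurable (PiM I (\<lambda>_. borel))"
  unfolding box_def[abs_def]
  by (intro borel_measurable_prod_ennreal measurable_compose[OF measurable_component_singleton borel_measurable_indicator]) auto

text \<open>Each added point costs one factor \<open>\<eta>(B)\<close> by the Mecke equation, each point that is integrated
  without being added a factor \<open>\<Lambda>(B)\<close>.\<close>

lemma nn_integral_add_points_le:
  fixes I :: "'i set"
  assumes "finite I" and B [measurable]: "B \<in> sets borel" and "A \<subseteq> I"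
    and "g \<in> borel_measurable config_algebra"
  shows "(\<integral>\<^sup>+z. box B I z * (\<integral>\<^sup>+\<mu>. g (add_points A z \<mu>) \<partial>L) \<partial>PiM I (\<lambda>_. \<Lambda>)) \<le>
    emeasure \<Lambda> B ^ card (I - A) * (\<integral>\<^sup>+\<mu>. g \<mu> * emeasure \<mu> B ^ card A \<partial>L)"
  using assms(1,3,4)
proof (induction I arbitrary: A g)
  case empty
  have "(\<integral>\<^sup>+\<mu>. g (add_points {} z \<mu>) \<partial>L) = (\<integral>\<^sup>+\<mu>. g \<mu> \<partial>L)" for z :: "'i \<Rightarrow> 'a"
    by (intro nn_integral_cong) simp
  then show ?case using empty by (simp add: PiM_empty nn_integral_count_space_finite box_def)
next
  case (insert i I)
  note g [measurable] = insert.prems(2)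
  have fin: "finite (insert i I)" using insert by simp
  have m1: "(\<lambda>z. \<integral>\<^sup>+\<mu>. h (add_points A' z \<mu>) \<partial>L) \<in> borel_measurable (PiM I' (\<lambda>_. borel))"
    if "finite I'" "A' \<subseteq> I'" "h \<in> borel_measurable config_algebra" for h :: "'a measure \<Rightarrow> ennreal" and A' I' :: "'i set"
    by (intro measurable_nn_integral_law measurable_compose[OF measurable_add_points_pair[OF that(1,2)] that(3)])
  have m: "(\<lambda>z. box B I' z * (\<integral>\<^sup>+\<mu>. h (add_points A' z \<mu>) \<partial>L)) \<in> borel_measurable (PiM I' (\<lambda>_. borel))"
    if "finite I'" "A' \<subseteq> I'" "h \<in> borel_measurable config_algebra" for h :: "'a measure \<Rightarrow> ennreal" and A' I' :: "'i set"
    by (intro borel_measurable_times_ennreal box_measurable m1 B that)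
  have bx: "box B (insert i I) (z(i := x)) = indicator B x * box B I z" for z x
    unfolding box_def prod.insert[OF insert(1,2)] using insert(2) by (auto intro!: arg_cong2[where f="(*)"] prod.cong)
  have "(\<integral>\<^sup>+z. box B (insert i I) z * (\<integral>\<^sup>+\<mu>. g (add_points A z \<mu>) \<partial>L) \<partial>PiM (insert i I) (\<lambda>_. \<Lambda>)) =
      (\<integral>\<^sup>+x. \<integral>\<^sup>+z. box B (insert i I) (z(i := x)) * (\<integral>\<^sup>+\<mu>. g (add_points A (z(i := x)) \<mu>) \<partial>L) \<partial>PiM I (\<lambda>_. \<Lambda>) \<partial>\<Lambda>)"
    by (intro pow.product_nn_integral_insert_rev[OF insert(1,2)])
      (use m[OF fin insert.prems(1) g] in \<open>simp only: measurable_pow_iff\<close>)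
  also have "\<dots> = (\<integral>\<^sup>+x. indicator B x * (\<integral>\<^sup>+z. box B I z * (\<integral>\<^sup>+\<mu>. g (add_points A (z(i := x)) \<mu>) \<partial>L) \<partial>PiM I (\<lambda>_. \<Lambda>)) \<partial>\<Lambda>)"
  proof (intro nn_integral_cong)
    fix x
    have "(\<lambda>z. z(i := x)) \<in> measurable (PiM I (\<lambda>_. borel)) (PiM (insert i I) (\<lambda>_. borel :: 'a measure))" by measurable
    from measurable_compose[OF this m1[OF fin insert.prems(1) g]]
    have "(\<lambda>z. box B I z * (\<integral>\<^sup>+\<mu>. g (add_points A (z(i := x)) \<mu>) \<partial>L)) \<in> borel_measurable (PiM I (\<lambda>_. \<Lambda>))"
      unfolding measurable_pow_iff by (intro borel_measurable_times_ennreal box_measurable insert(1) B)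
    then show "(\<integral>\<^sup>+z. box B (insert i I) (z(i := x)) * (\<integral>\<^sup>+\<mu>. g (add_points A (z(i := x)) \<mu>) \<partial>L) \<partial>PiM I (\<lambda>_. \<Lambda>)) =
      indicator B x * (\<integral>\<^sup>+z. box B I z * (\<integral>\<^sup>+\<mu>. g (add_points A (z(i := x)) \<mu>) \<partial>L) \<partial>PiM I (\<lambda>_. \<Lambda>))"
      unfolding bx mult.assoc by (rule nn_integral_cmult)
  qed
  also have "\<dots> \<le> emeasure \<Lambda> B ^ card (insert i I - A) * (\<integral>\<^sup>+\<mu>. g \<mu> * emeasure \<mu> B ^ card A \<partial>L)"
  proof (cases "i \<in> A")
    case False
    then have AI: "A \<subseteq> I" using insert.prems by auto
    then have fA: "finite A" using insert(1) finite_subset by blast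
    have "(\<integral>\<^sup>+\<mu>. g (add_points A (z(i := x)) \<mu>) \<partial>L) = (\<integral>\<^sup>+\<mu>. g (add_points A z \<mu>) \<partial>L)" for z x
      using False fA by (intro nn_integral_cong arg_cong[where f=g] add_points_cong) auto
    then have "(\<integral>\<^sup>+x. indicator B x * (\<integral>\<^sup>+z. box B I z * (\<integral>\<^sup>+\<mu>. g (add_points A (z(i := x)) \<mu>) \<partial>L) \<partial>PiM I (\<lambda>_. \<Lambda>)) \<partial>\<Lambda>) =
        emeasure \<Lambda> B * (\<integral>\<^sup>+z. box B I z * (\<integral>\<^sup>+\<mu>. g (add_points A z \<mu>) \<partial>L) \<partial>PiM I (\<lambda>_. \<Lambda>))"
      by (simp add: nn_integral_multc)
    also have "\<dots> \<le> emeasure \<Lambda> B * (emeasure \<Lambda> B ^ card (I - A) * (\<integral>\<^sup>+\<mu>. g \<mu> * emeasure \<mu> B ^ card A \<partial>L))"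
      by (intro mult_left_mono insert.IH AI g) simp
    also have "insert i I - A = insert i (I - A)" using False by auto
    then have "emeasure \<Lambda> B * (emeasure \<Lambda> B ^ card (I - A) * (\<integral>\<^sup>+\<mu>. g \<mu> * emeasure \<mu> B ^ card A \<partial>L)) =
      emeasure \<Lambda> B ^ card (insert i I - A) * (\<integral>\<^sup>+\<mu>. g \<mu> * emeasure \<mu> B ^ card A \<partial>L)"
      using insert(1,2) by (simp add: mult.assoc)
    finally show ?thesis .
  next
    case True
    define A' where "A' = A - {i}"
    have A: "A = insert i A'" "i \<notin> A'" and AI: "A' \<subseteq> I" and fA: "finite A'"
      using True insert.prems(1) insert(1,2) by (auto simp: A'_def intro: finite_subset)
    have card: "insert i I - A = I - A'" using A insert(2) by auto
    have "(\<integral>\<^sup>+z. box B I z * (\<integral>\<^sup>+\<mu>. g (add_points A (z(i := x)) \<mu>) \<partial>L) \<partial>PiM I (\<lambda>_. \<Lambda>)) \<le>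
        emeasure \<Lambda> B ^ card (I - A') * (\<integral>\<^sup>+\<mu>. g (add_point x \<mu>) * emeasure \<mu> B ^ card A' \<partial>L)" for x
    proof -
      have "(\<integral>\<^sup>+\<mu>. g (add_points A (z(i := x)) \<mu>) \<partial>L) = (\<integral>\<^sup>+\<mu>. g (add_point x (add_points A' z \<mu>)) \<partial>L)" for z
      proof (intro nn_integral_cong arg_cong[where f=g])
        fix \<mu> assume "\<mu> \<in> space L"
        then have \<mu>: "\<mu> \<in> config_space" by simp
        have "add_points A (z(i := x)) \<mu> = add_point x (add_points A' (z(i := x)) \<mu>)"
          using add_points_insert'[OF fA A(2) \<mu>, of "z(i := x)"] unfolding A(1) by simp
        also have "add_points A' (z(i := x)) \<mu> = add_points A' z \<mu>"
          using fA A(2) \<mu> by (intro add_points_cong) auto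
        finally show "add_points A (z(i := x)) \<mu> = add_point x (add_points A' z \<mu>)" .
      qed
      then show ?thesis
        using insert.IH[OF AI, of "\<lambda>\<nu>. g (add_point x \<nu>)"] by simp
    qed
    then have "(\<integral>\<^sup>+x. indicator B x * (\<integral>\<^sup>+z. box B I z * (\<integral>\<^sup>+\<mu>. g (add_points A (z(i := x)) \<mu>) \<partial>L) \<partial>PiM I (\<lambda>_. \<Lambda>)) \<partial>\<Lambda>) \<le>
        (\<integral>\<^sup>+x. indicator B x * (emeasure \<Lambda> B ^ card (I - A') * (\<integral>\<^sup>+\<mu>. g (add_point x \<mu>) * emeasure \<mu> B ^ card A' \<partial>L)) \<partial>\<Lambda>)"
      by (intro nn_integral_mono mult_left_mono) auto
    also have "\<dots> \<le> (\<integral>\<^sup>+x. emeasure \<Lambda> B ^ card (I - A') * (\<integral>\<^sup>+\<mu>. indicator B x * (g (add_point x \<mu>) * emeasure (add_point x \<mu>) B ^ card A') \<partial>L) \<partial>\<Lambda>)"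
    proof (intro nn_integral_mono)
      fix x
      have "(\<integral>\<^sup>+\<mu>. g (add_point x \<mu>) * emeasure \<mu> B ^ card A' \<partial>L) \<le> (\<integral>\<^sup>+\<mu>. g (add_point x \<mu>) * emeasure (add_point x \<mu>) B ^ card A' \<partial>L)"
        by (intro nn_integral_mono mult_left_mono power_mono) (auto simp: emeasure_add_point)
      then show "indicator B x * (emeasure \<Lambda> B ^ card (I - A') * (\<integral>\<^sup>+\<mu>. g (add_point x \<mu>) * emeasure \<mu> B ^ card A' \<partial>L)) \<le>
          emeasure \<Lambda> B ^ card (I - A') * (\<integral>\<^sup>+\<mu>. indicator B x * (g (add_point x \<mu>) * emeasure (add_point x \<mu>) B ^ card A') \<partial>L)"
        by (cases "x \<in> B") (auto intro: mult_left_mono)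
    qed
    also have "\<dots> = emeasure \<Lambda> B ^ card (I - A') * (\<integral>\<^sup>+x. \<integral>\<^sup>+\<mu>. indicator B x * (g (add_point x \<mu>) * emeasure (add_point x \<mu>) B ^ card A') \<partial>L \<partial>\<Lambda>)"
    proof (rule nn_integral_cmult)
      have "(\<lambda>x. \<integral>\<^sup>+\<mu>. indicator B x * (g (add_point x \<mu>) * emeasure (add_point x \<mu>) B ^ card A') \<partial>L) \<in> borel_measurable borel"
        by (rule measurable_nn_integral_law) measurable
      then show "(\<lambda>x. \<integral>\<^sup>+\<mu>. indicator B x * (g (add_point x \<mu>) * emeasure (add_point x \<mu>) B ^ card A') \<partial>L) \<in> borel_measurable \<Lambda>"
        by (simp only: measurable_cong_sets[OF sets_int refl])
    qed
    also have "(\<integral>\<^sup>+x. \<integral>\<^sup>+\<mu>. indicator B x * (g (add_point x \<mu>) * emeasure (add_point x \<mu>) B ^ card A') \<partial>L \<partial>\<Lambda>) =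
        (\<integral>\<^sup>+\<mu>. \<integral>\<^sup>+x. indicator B x * (g \<mu> * emeasure \<mu> B ^ card A') \<partial>\<mu> \<partial>L)"
      by (rule mecke[symmetric]) measurable
    also have "\<dots> = (\<integral>\<^sup>+\<mu>. g \<mu> * emeasure \<mu> B ^ card A \<partial>L)"
    proof (intro nn_integral_cong)
      fix \<mu> assume "\<mu> \<in> space L"
      then have [simp]: "sets \<mu> = sets borel" by simp
      have "(\<integral>\<^sup>+x. indicator B x * (g \<mu> * emeasure \<mu> B ^ card A') \<partial>\<mu>) = emeasure \<mu> B * (g \<mu> * emeasure \<mu> B ^ card A')"
        by (subst nn_integral_multc) (simp_all add: B borel_measurable_indicator)
      also have "\<dots> = g \<mu> * emeasure \<mu> B ^ card A" unfolding A(1) using A(2) fA by (simp add: mult_ac)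
      finally show "(\<integral>\<^sup>+x. indicator B x * (g \<mu> * emeasure \<mu> B ^ card A') \<partial>\<mu>) = \<dots>" .
    qed
    finally show ?thesis unfolding card .
  qed
  finally show ?case .
qed

text \<open>The bounds for the subsets \<open>A\<close> of \<open>I\<close> add up to a binomial power.\<close>

lemma nn_integral_sum_add_points_le:
  fixes I :: "'i set"
  assumes I: "finite I" and B [measurable]: "B \<in> sets borel"
    and g [measurable]: "g \<in> borel_measurable config_algebra"
  shows "(\<integral>\<^sup>+z. box B I z * (\<Sum>A\<in>Pow I. \<integral>\<^sup>+\<mu>. g (add_points A z \<mu>) \<partial>L) \<partial>PiM I (\<lambda>_. \<Lambda>)) \<le>
    (\<integral>\<^sup>+\<mu>. g \<mu> * (emeasure \<mu> B + emeasure \<Lambda> B) ^ card I \<partial>L)"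
proof -
  have m: "(\<lambda>z. box B I z * (\<integral>\<^sup>+\<mu>. g (add_points A z \<mu>) \<partial>L)) \<in> borel_measurable (PiM I (\<lambda>_. \<Lambda>))" if "A \<in> Pow I" for A
    unfolding measurable_pow_iff using that
    by (intro borel_measurable_times_ennreal box_measurable I B measurable_nn_integral_law
        measurable_compose[OF measurable_add_points_pair[OF I] g]) auto
  have "(\<integral>\<^sup>+z. box B I z * (\<Sum>A\<in>Pow I. \<integral>\<^sup>+\<mu>. g (add_points A z \<mu>) \<partial>L) \<partial>PiM I (\<lambda>_. \<Lambda>)) =
      (\<Sum>A\<in>Pow I. \<integral>\<^sup>+z. box B I z * (\<integral>\<^sup>+\<mu>. g (add_points A z \<mu>) \<partial>L) \<partial>PiM I (\<lambda>_. \<Lambda>))"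
    unfolding sum_distrib_left by (rule nn_integral_sum[OF m])
  also have "\<dots> \<le> (\<Sum>A\<in>Pow I. emeasure \<Lambda> B ^ card (I - A) * (\<integral>\<^sup>+\<mu>. g \<mu> * emeasure \<mu> B ^ card A \<partial>L))"
    by (intro sum_mono nn_integral_add_points_le I B g) auto
  also have "\<dots> = (\<integral>\<^sup>+\<mu>. (\<Sum>A\<in>Pow I. emeasure \<Lambda> B ^ card (I - A) * (g \<mu> * emeasure \<mu> B ^ card A)) \<partial>L)"
    by (subst nn_integral_sum) (auto simp: nn_integral_cmult)
  also have "\<dots> = (\<integral>\<^sup>+\<mu>. g \<mu> * (emeasure \<mu> B + emeasure \<Lambda> B) ^ card I \<partial>L)"
  proof (intro nn_integral_cong)
    fix \<mu>
    have "(emeasure \<mu> B + emeasure \<Lambda> B) ^ card I = (\<Sum>A\<in>Pow I. emeasure \<mu> B ^ card A * emeasure \<Lambda> B ^ card (I - A))"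
      using prod_add[OF I, of "\<lambda>_. emeasure \<mu> B" "\<lambda>_. emeasure \<Lambda> B"] by simp
    then show "(\<Sum>A\<in>Pow I. emeasure \<Lambda> B ^ card (I - A) * (g \<mu> * emeasure \<mu> B ^ card A)) = g \<mu> * (emeasure \<mu> B + emeasure \<Lambda> B) ^ card I"
      by (simp add: sum_distrib_left mult_ac)
  qed
  finally show ?thesis .
qed

text \<open>The function \<open>dmean I H\<close> is \<open>card I!\<close> times the chaos kernel of \<open>H\<close> (with variables indexed by \<open>I\<close>).\<close>

definition dmean :: "'i set \<Rightarrow> ('a measure \<Rightarrow> real) \<Rightarrow> ('i \<Rightarrow> 'a) \<Rightarrow> real" where
  "dmean I H x = (\<integral>\<mu>. acost I H \<mu> x \<partial>L)"

lemma dmean_measurable: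
  assumes "finite I" "H \<in> borel_measurable config_algebra"
  shows "dmean I H \<in> borel_measurable (PiM I (\<lambda>_. borel))"
  unfolding dmean_def[abs_def] by (rule measurable_integral_law[OF measurable_acost_pair[OF assms]])

lemma dmean_abs_le:
  assumes I: "finite I" and H [measurable]: "H \<in> borel_measurable config_algebra" and x: "x \<in> space (PiM I (\<lambda>_. borel))"
  shows "ennreal \<bar>dmean I H x\<bar> \<le> (\<Sum>A\<in>Pow I. \<integral>\<^sup>+\<mu>. ennreal \<bar>H (add_points A x \<mu>)\<bar> \<partial>L)"
proof -
  note m = measurable_acost[OF I H x]
  have "ennreal \<bar>dmean I H x\<bar> \<le> (\<integral>\<^sup>+\<mu>. ennreal \<bar>acost I H \<mu> x\<bar> \<partial>L)"
  proof (cases "integrable L (\<lambda>\<mu>. acost I H \<mu> x)")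
    case True
    then show ?thesis unfolding dmean_def using integral_norm_bound_ennreal[OF True] by simp
  next
    case False
    then show ?thesis unfolding dmean_def by (simp add: not_integrable_integral_eq)
  qed
  also have "\<dots> \<le> (\<integral>\<^sup>+\<mu>. (\<Sum>A\<in>Pow I. ennreal \<bar>H (add_points A x \<mu>)\<bar>) \<partial>L)"
    by (intro nn_integral_mono) (simp add: sum_ennreal acost_abs_le ennreal_leI)
  also have "\<dots> = (\<Sum>A\<in>Pow I. \<integral>\<^sup>+\<mu>. ennreal \<bar>H (add_points A x \<mu>)\<bar> \<partial>L)"
  proof (rule nn_integral_sum)
    fix A assume "A \<in> Pow I"
    then have "(\<lambda>\<mu>. add_points A x \<mu>) \<in> measurable config_algebra config_algebra"
      using I by (intro measurable_add_points) (auto intro: finite_subset)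
    from measurable_compose[OF this H] show "(\<lambda>\<mu>. ennreal \<bar>H (add_points A x \<mu>)\<bar>) \<in> borel_measurable L" by simp
  qed
  finally show ?thesis .
qed

lemma nn_integral_dmean_le:
  assumes I: "finite I" and B [measurable]: "B \<in> sets borel" and H [measurable]: "H \<in> borel_measurable config_algebra"
  shows "(\<integral>\<^sup>+x. box B I x * ennreal \<bar>dmean I H x\<bar> \<partial>PiM I (\<lambda>_. \<Lambda>)) \<le>
    (\<integral>\<^sup>+\<mu>. ennreal \<bar>H \<mu>\<bar> * (emeasure \<mu> B + emeasure \<Lambda> B) ^ card I \<partial>L)"
proof -
  have "(\<integral>\<^sup>+x. box B I x * ennreal \<bar>dmean I H x\<bar> \<partial>PiM I (\<lambda>_. \<Lambda>)) \<le>
      (\<integral>\<^sup>+x. box B I x * (\<Sum>A\<in>Pow I. \<integral>\<^sup>+\<mu>. ennreal \<bar>H (add_points A x \<mu>)\<bar> \<partial>L) \<partial>PiM I (\<lambda>_. \<Lambda>))"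
    using dmean_abs_le[OF I H] by (intro nn_integral_mono mult_left_mono) (auto simp: space_pow)
  also have "\<dots> \<le> (\<integral>\<^sup>+\<mu>. ennreal \<bar>H \<mu>\<bar> * (emeasure \<mu> B + emeasure \<Lambda> B) ^ card I \<partial>L)"
    by (rule nn_integral_sum_add_points_le[OF I B]) measurable
  finally show ?thesis .
qed

text \<open>The exponential series of \<open>\<eta>(B) + \<Lambda>(B)\<close>, and hence, up to the factor \<open>k!\<close>, a bound for its \<open>k\<close>-th power.\<close>

definition bweight :: "nat \<Rightarrow> 'a measure \<Rightarrow> real" where
  "bweight n \<mu> = exp (measure \<mu> (loc_ball n) + measure \<Lambda> (loc_ball n))"

lemma bweight_measurable [measurable]: "bweight n \<in> borel_measurable config_algebra"
  unfolding bweight_def[abs_def] by measurable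

lemma bweight_ge_1: "1 \<le> bweight n \<mu>"
  by (simp add: bweight_def)

lemma power_le_bweight:
  assumes "\<mu> \<in> config_space"
  shows "(emeasure \<mu> (loc_ball n) + emeasure \<Lambda> (loc_ball n)) ^ k \<le> ennreal (fact k * bweight n \<mu>)"
proof -
  have e: "emeasure \<Lambda> (loc_ball n) = ennreal (measure \<Lambda> (loc_ball n))"
    using int_finite[of "loc_ball n"] by (simp add: emeasure_eq_ennreal_measure)
  let ?y = "measure \<mu> (loc_ball n) + measure \<Lambda> (loc_ball n)"
  have "?y ^ k / fact k \<le> exp ?y"
    using sum_le_suminf[OF summable_exp_generic[of ?y], of "{k}"]
    by (simp add: exp_def divide_inverse mult.commute)
  then have "?y ^ k \<le> fact k * bweight n \<mu>" by (simp add: bweight_def field_simps)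
  then have "ennreal (?y ^ k) \<le> ennreal (fact k * bweight n \<mu>)" by (rule ennreal_leI)
  moreover have "emeasure \<mu> (loc_ball n) + emeasure \<Lambda> (loc_ball n) = ennreal ?y"
    using assms by (simp add: count_eq e)
  ultimately show ?thesis by (simp only: ennreal_power[symmetric] add_nonneg_nonneg measure_nonneg)
qed

lemma integrable_bweight_power: "(\<integral>\<^sup>+\<mu>. ennreal (bweight n \<mu> ^ k) \<partial>L) < \<infinity>"
proof -
  have eq: "ennreal (bweight n \<mu> ^ k) = ennreal (exp (real k * measure \<Lambda> (loc_ball n))) * ennreal (exp (real k * measure \<mu> (loc_ball n)))" for \<mu>
    by (simp add: bweight_def ennreal_mult[symmetric] exp_of_nat_mult[symmetric] exp_add[symmetric] distrib_left add.commute)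
  have "(\<integral>\<^sup>+\<mu>. ennreal (bweight n \<mu> ^ k) \<partial>L) = ennreal (exp (real k * measure \<Lambda> (loc_ball n))) * (\<integral>\<^sup>+\<mu>. ennreal (exp (real k * measure \<mu> (loc_ball n))) \<partial>L)"
    unfolding eq by (rule nn_integral_cmult) measurable
  then show ?thesis using exp_moment[of "loc_ball n" "real k"] by (simp add: ennreal_mult_less_top)
qed

text \<open>All kernels of such a functional exist, and its Fock space series against exponential functionals
  converges.  For square integrable \<open>F\<close> the differences \<open>D\<^sup>l\<^sub>z F\<close> are of this kind at almost every \<open>z\<close>, while
  they need not be square integrable.\<close>

definition admissible :: "('a measure \<Rightarrow> real) \<Rightarrow> bool" where
  "admissible H \<longleftrightarrow> H \<in> borel_measurable config_algebra \<and>
     (\<forall>n. (\<integral>\<^sup>+\<mu>. ennreal (\<bar>H \<mu>\<bar> * bweight n \<mu>) \<partial>L) < \<infinity>)"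

end

section \<open>The Fock space representation\<close>

context poisson_law begin

lemma admissible_measurable: "admissible H \<Longrightarrow> H \<in> borel_measurable config_algebra"
  by (simp add: admissible_def)

lemma admissible_finite: "admissible H \<Longrightarrow> (\<integral>\<^sup>+\<mu>. ennreal (\<bar>H \<mu>\<bar> * bweight n \<mu>) \<partial>L) < \<infinity>"
  by (simp add: admissible_def)

lemma admissible_integrable: 
  assumes "admissible H"
  shows "integrable L H"
proof (rule integrableI_bounded)
  show "H \<in> borel_measurable L" unfolding measurable_law_iff by (rule admissible_measurable[OF assms])
  have "(\<integral>\<^sup>+\<mu>. ennreal (norm (H \<mu>)) \<partial>L) \<le> (\<integral>\<^sup>+\<mu>. ennreal (\<bar>H \<mu>\<bar> * bweight 0 \<mu>) \<partial>L)"
    using bweight_ge_1 by (intro nn_integral_mono ennreal_leI) (simp add: mult_le_cancel_left1)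
  also have "\<dots> < \<infinity>" by (rule admissible_finite[OF assms])
  finally show "(\<integral>\<^sup>+\<mu>. ennreal (norm (H \<mu>)) \<partial>L) < \<infinity>" .
qed

lemma admissible_bounded:
  assumes [measurable]: "H \<in> borel_measurable config_algebra" and b: "\<And>\<mu>. \<bar>H \<mu>\<bar> \<le> c"
  shows "admissible H"
  unfolding admissible_def
proof (intro conjI allI assms(1))
  fix n
  have c: "0 \<le> c" using b[of undefined] by (meson abs_ge_zero order_trans)
  have "(\<integral>\<^sup>+\<mu>. ennreal (\<bar>H \<mu>\<bar> * bweight n \<mu>) \<partial>L) \<le> (\<integral>\<^sup>+\<mu>. ennreal c * ennreal (bweight n \<mu> ^ 1) \<partial>L)"
  proof (intro nn_integral_mono)
    fix \<mu>
    have "\<bar>H \<mu>\<bar> * bweight n \<mu> \<le> c * bweight n \<mu>"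
      using b bweight_ge_1[of n \<mu>] by (intro mult_right_mono) auto
    then have "ennreal (\<bar>H \<mu>\<bar> * bweight n \<mu>) \<le> ennreal (c * bweight n \<mu>)" by (rule ennreal_leI)
    also have "\<dots> = ennreal c * ennreal (bweight n \<mu> ^ 1)"
      using c bweight_ge_1[of n \<mu>] by (simp add: ennreal_mult)
    finally show "ennreal (\<bar>H \<mu>\<bar> * bweight n \<mu>) \<le> \<dots>" .
  qed
  also have "\<dots> = ennreal c * (\<integral>\<^sup>+\<mu>. ennreal (bweight n \<mu> ^ 1) \<partial>L)" by (rule nn_integral_cmult) measurable
  also have "\<dots> < \<infinity>" using integrable_bweight_power[of n 1] by (simp add: ennreal_mult_less_top)
  finally show "(\<integral>\<^sup>+\<mu>. ennreal (\<bar>H \<mu>\<bar> * bweight n \<mu>) \<partial>L) < \<infinity>" .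
qed

lemma admissible_alg: "laplace_alg g \<Longrightarrow> admissible g"
  using laplace_alg_bounded[of g] admissible_bounded[of g] laplace_alg_measurable[of g] by blast

lemma admissible_scale:
  assumes H: "admissible H"
  shows "admissible (\<lambda>\<mu>. c * H \<mu>)"
  unfolding admissible_def
proof (intro conjI allI)
  note [measurable] = admissible_measurable[OF H]
  show "(\<lambda>\<mu>. c * H \<mu>) \<in> borel_measurable config_algebra" by measurable
  fix n
  have "(\<integral>\<^sup>+\<mu>. ennreal (\<bar>c * H \<mu>\<bar> * bweight n \<mu>) \<partial>L) = (\<integral>\<^sup>+\<mu>. ennreal \<bar>c\<bar> * ennreal (\<bar>H \<mu>\<bar> * bweight n \<mu>) \<partial>L)"
    by (intro nn_integral_cong) (simp add: abs_mult ennreal_mult' mult.assoc)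
  also have "\<dots> = ennreal \<bar>c\<bar> * (\<integral>\<^sup>+\<mu>. ennreal (\<bar>H \<mu>\<bar> * bweight n \<mu>) \<partial>L)" by (rule nn_integral_cmult) measurable
  also have "\<dots> < \<infinity>" using admissible_finite[OF H, of n] by (simp add: ennreal_mult_less_top)
  finally show "(\<integral>\<^sup>+\<mu>. ennreal (\<bar>c * H \<mu>\<bar> * bweight n \<mu>) \<partial>L) < \<infinity>" .
qed

lemma admissible_add:
  assumes H: "admissible H" and G: "admissible G"
  shows "admissible (\<lambda>\<mu>. H \<mu> + G \<mu>)"
  unfolding admissible_def
proof (intro conjI allI)
  note [measurable] = admissible_measurable[OF H] admissible_measurable[OF G]
  show "(\<lambda>\<mu>. H \<mu> + G \<mu>) \<in> borel_measurable config_algebra" by measurable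
  fix n
  have "(\<integral>\<^sup>+\<mu>. ennreal (\<bar>H \<mu> + G \<mu>\<bar> * bweight n \<mu>) \<partial>L) \<le>
      (\<integral>\<^sup>+\<mu>. ennreal (\<bar>H \<mu>\<bar> * bweight n \<mu>) + ennreal (\<bar>G \<mu>\<bar> * bweight n \<mu>) \<partial>L)"
  proof (intro nn_integral_mono)
    fix \<mu>
    have "\<bar>H \<mu> + G \<mu>\<bar> * bweight n \<mu> \<le> (\<bar>H \<mu>\<bar> + \<bar>G \<mu>\<bar>) * bweight n \<mu>"
      using bweight_ge_1[of n \<mu>] by (intro mult_right_mono abs_triangle_ineq) auto
    then have "ennreal (\<bar>H \<mu> + G \<mu>\<bar> * bweight n \<mu>) \<le> ennreal (\<bar>H \<mu>\<bar> * bweight n \<mu> + \<bar>G \<mu>\<bar> * bweight n \<mu>)"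
      by (intro ennreal_leI) (simp add: distrib_right)
    also have "\<dots> = ennreal (\<bar>H \<mu>\<bar> * bweight n \<mu>) + ennreal (\<bar>G \<mu>\<bar> * bweight n \<mu>)"
      using bweight_ge_1[of n \<mu>] by (intro ennreal_plus) auto
    finally show "ennreal (\<bar>H \<mu> + G \<mu>\<bar> * bweight n \<mu>) \<le> \<dots>" .
  qed
  also have "\<dots> = (\<integral>\<^sup>+\<mu>. ennreal (\<bar>H \<mu>\<bar> * bweight n \<mu>) \<partial>L) + (\<integral>\<^sup>+\<mu>. ennreal (\<bar>G \<mu>\<bar> * bweight n \<mu>) \<partial>L)"
    by (rule nn_integral_add) measurable
  also have "\<dots> < \<infinity>" using admissible_finite[OF H, of n] admissible_finite[OF G, of n] by simp
  finally show "(\<integral>\<^sup>+\<mu>. ennreal (\<bar>H \<mu> + G \<mu>\<bar> * bweight n \<mu>) \<partial>L) < \<infinity>" .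
qed

lemma admissible_diff:
  assumes "admissible H" "admissible G"
  shows "admissible (\<lambda>\<mu>. H \<mu> - G \<mu>)"
  using admissible_add[OF assms(1) admissible_scale[OF assms(2), of "-1"]] by simp

lemma nn_integral_power_le:
  assumes [measurable]: "g \<in> borel_measurable config_algebra"
  shows "(\<integral>\<^sup>+\<mu>. ennreal \<bar>g \<mu>\<bar> * (emeasure \<mu> (loc_ball n) + emeasure \<Lambda> (loc_ball n)) ^ k \<partial>L) \<le>
    ennreal (fact k) * (\<integral>\<^sup>+\<mu>. ennreal (\<bar>g \<mu>\<bar> * bweight n \<mu>) \<partial>L)"
proof -
  have "(\<integral>\<^sup>+\<mu>. ennreal \<bar>g \<mu>\<bar> * (emeasure \<mu> (loc_ball n) + emeasure \<Lambda> (loc_ball n)) ^ k \<partial>L) \<le>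
      (\<integral>\<^sup>+\<mu>. ennreal (fact k) * ennreal (\<bar>g \<mu>\<bar> * bweight n \<mu>) \<partial>L)"
  proof (intro nn_integral_mono)
    fix \<mu> assume "\<mu> \<in> space L"
    then have "ennreal \<bar>g \<mu>\<bar> * (emeasure \<mu> (loc_ball n) + emeasure \<Lambda> (loc_ball n)) ^ k \<le> ennreal \<bar>g \<mu>\<bar> * ennreal (fact k * bweight n \<mu>)"
      by (intro mult_left_mono power_le_bweight) auto
    also have "\<dots> = ennreal (fact k) * ennreal (\<bar>g \<mu>\<bar> * bweight n \<mu>)"
      using bweight_ge_1[of n \<mu>] by (simp add: ennreal_mult[symmetric] mult_ac)
    finally show "ennreal \<bar>g \<mu>\<bar> * (emeasure \<mu> (loc_ball n) + emeasure \<Lambda> (loc_ball n)) ^ k \<le> \<dots>" .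
  qed
  also have "\<dots> = ennreal (fact k) * (\<integral>\<^sup>+\<mu>. ennreal (\<bar>g \<mu>\<bar> * bweight n \<mu>) \<partial>L)" by (rule nn_integral_cmult) measurable
  finally show ?thesis .
qed

text \<open>On each box the sum over all subsets of points has a finite integral, hence is finite almost
  everywhere.\<close>

lemma AE_integrable_add_points:
  fixes I :: "'i set"
  assumes I: "finite I" and H: "admissible H"
  shows "AE x in PiM I (\<lambda>_. \<Lambda>). \<forall>A\<in>Pow I. integrable L (\<lambda>\<mu>. H (add_points A x \<mu>))"
proof -
  note [measurable] = admissible_measurable[OF H]
  let ?f = "\<lambda>n x. box (loc_ball n) I x * (\<Sum>A\<in>Pow I. \<integral>\<^sup>+\<mu>. ennreal \<bar>H (add_points A x \<mu>)\<bar> \<partial>L)"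
  have "AE x in PiM I (\<lambda>_. \<Lambda>). ?f n x \<noteq> \<infinity>" for n
  proof (rule nn_integral_PInf_AE)
    show "?f n \<in> borel_measurable (PiM I (\<lambda>_. \<Lambda>))"
      unfolding measurable_pow_iff
      by (intro borel_measurable_times_ennreal box_measurable I borel_measurable_sum measurable_nn_integral_law loc_ball_borel
          measurable_compose[OF measurable_add_points_pair[OF I], of _ "\<lambda>\<mu>. ennreal \<bar>H \<mu>\<bar>"]) auto
    have "(\<integral>\<^sup>+x. ?f n x \<partial>PiM I (\<lambda>_. \<Lambda>)) \<le> (\<integral>\<^sup>+\<mu>. ennreal \<bar>H \<mu>\<bar> * (emeasure \<mu> (loc_ball n) + emeasure \<Lambda> (loc_ball n)) ^ card I \<partial>L)"
      by (rule nn_integral_sum_add_points_le[OF I]) measurable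
    also have "\<dots> \<le> ennreal (fact (card I)) * (\<integral>\<^sup>+\<mu>. ennreal (\<bar>H \<mu>\<bar> * bweight n \<mu>) \<partial>L)"
      by (rule nn_integral_power_le) measurable
    also have "\<dots> < \<infinity>" using admissible_finite[OF H, of n] by (simp add: ennreal_mult_less_top)
    finally show "(\<integral>\<^sup>+x. ?f n x \<partial>PiM I (\<lambda>_. \<Lambda>)) \<noteq> \<infinity>" by simp
  qed
  then have "AE x in PiM I (\<lambda>_. \<Lambda>). \<forall>n. ?f n x \<noteq> \<infinity>" by (simp add: AE_all_countable)
  then show ?thesis
  proof (rule AE_mp, intro AE_I2 impI ballI)
    fix x A assume x: "x \<in> space (PiM I (\<lambda>_. \<Lambda>))" and fin: "\<forall>n. ?f n x \<noteq> \<infinity>" and A: "A \<in> Pow I"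
    obtain n where "x ` I \<subseteq> loc_ball n"
      using bounded_subset_loc_ball[OF finite_imp_bounded[OF finite_imageI[OF I]]] by blast
    then have "box (loc_ball n) I x = 1" by (auto simp: box_def intro!: prod.neutral)
    with fin have "(\<Sum>A\<in>Pow I. \<integral>\<^sup>+\<mu>. ennreal \<bar>H (add_points A x \<mu>)\<bar> \<partial>L) \<noteq> \<infinity>" by (metis mult_1)
    moreover have "(\<integral>\<^sup>+\<mu>. ennreal \<bar>H (add_points A x \<mu>)\<bar> \<partial>L) \<le> (\<Sum>A\<in>Pow I. \<integral>\<^sup>+\<mu>. ennreal \<bar>H (add_points A x \<mu>)\<bar> \<partial>L)"
      using A I by (intro member_le_sum) auto
    ultimately have "(\<integral>\<^sup>+\<mu>. ennreal \<bar>H (add_points A x \<mu>)\<bar> \<partial>L) \<noteq> \<infinity>"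
      by (metis infinity_ennreal_def top.extremum_unique)
    moreover have "(\<lambda>\<mu>. H (add_points A x \<mu>)) \<in> borel_measurable L"
      unfolding measurable_law_iff using A I x
      by (intro measurable_compose[OF measurable_add_points admissible_measurable[OF H]]) (auto intro: finite_subset)
    ultimately show "integrable L (\<lambda>\<mu>. H (add_points A x \<mu>))"
      by (intro integrableI_bounded) (auto simp: less_top)
  qed
qed

lemma AE_integrable_acost:
  assumes I: "finite I" and H: "admissible H"
  shows "AE x in PiM I (\<lambda>_. \<Lambda>). integrable L (\<lambda>\<mu>. acost I H \<mu> x)"
  using AE_integrable_add_points[OF assms]
  by (rule AE_mp) (auto simp: acost_def intro!: AE_I2 Bochner_Integration.integrable_sum)

lemma dmean_scale: "dmean I (\<lambda>\<mu>. c * H \<mu>) x = c * dmean I H x"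
  by (simp add: dmean_def acost_linear)

lemma dmean_add:
  assumes I: "finite I" and H: "admissible H" and G: "admissible G"
  shows "AE x in PiM I (\<lambda>_. \<Lambda>). dmean I (\<lambda>\<mu>. H \<mu> + G \<mu>) x = dmean I H x + dmean I G x"
  using AE_integrable_acost[OF I H] AE_integrable_acost[OF I G]
  by eventually_elim (simp add: dmean_def acost_linear)

text \<open>Pairing with a bounded kernel of bounded support is continuous for the weighted \<open>L\<^sup>1\<close> norm.\<close>

lemma pairing_bound:
  fixes I :: "'i set"
  assumes I: "finite I" and H [measurable]: "H \<in> borel_measurable config_algebra" and K: "0 \<le> K"
    and \<phi>: "\<And>x. ennreal \<bar>\<phi> x\<bar> \<le> ennreal K * box (loc_ball n) I x"
  shows "(\<integral>\<^sup>+x. ennreal \<bar>dmean I H x * \<phi> x\<bar> \<partial>PiM I (\<lambda>_. \<Lambda>)) \<le>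
    ennreal K * (\<integral>\<^sup>+\<mu>. ennreal \<bar>H \<mu>\<bar> * (emeasure \<mu> (loc_ball n) + emeasure \<Lambda> (loc_ball n)) ^ card I \<partial>L)"
proof -
  have "(\<integral>\<^sup>+x. ennreal \<bar>dmean I H x * \<phi> x\<bar> \<partial>PiM I (\<lambda>_. \<Lambda>)) \<le>
      (\<integral>\<^sup>+x. ennreal K * (box (loc_ball n) I x * ennreal \<bar>dmean I H x\<bar>) \<partial>PiM I (\<lambda>_. \<Lambda>))"
  proof (intro nn_integral_mono)
    fix x
    have "ennreal \<bar>dmean I H x * \<phi> x\<bar> = ennreal \<bar>dmean I H x\<bar> * ennreal \<bar>\<phi> x\<bar>" by (simp add: abs_mult ennreal_mult')
    also have "\<dots> \<le> ennreal \<bar>dmean I H x\<bar> * (ennreal K * box (loc_ball n) I x)" by (intro mult_left_mono \<phi>) auto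
    finally show "ennreal \<bar>dmean I H x * \<phi> x\<bar> \<le> ennreal K * (box (loc_ball n) I x * ennreal \<bar>dmean I H x\<bar>)" by (simp add: mult_ac)
  qed
  also have "\<dots> = ennreal K * (\<integral>\<^sup>+x. box (loc_ball n) I x * ennreal \<bar>dmean I H x\<bar> \<partial>PiM I (\<lambda>_. \<Lambda>))"
  proof (rule nn_integral_cmult)
    have [measurable]: "dmean I H \<in> borel_measurable (PiM I (\<lambda>_. borel))" by (rule dmean_measurable[OF I H])
    show "(\<lambda>x. box (loc_ball n) I x * ennreal \<bar>dmean I H x\<bar>) \<in> borel_measurable (PiM I (\<lambda>_. \<Lambda>))"
      unfolding measurable_pow_iff by (intro borel_measurable_times_ennreal box_measurable I loc_ball_borel) measurable
  qed
  also have "\<dots> \<le> ennreal K * (\<integral>\<^sup>+\<mu>. ennreal \<bar>H \<mu>\<bar> * (emeasure \<mu> (loc_ball n) + emeasure \<Lambda> (loc_ball n)) ^ card I \<partial>L)"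
    by (intro mult_left_mono nn_integral_dmean_le I H loc_ball_borel) auto
  finally show ?thesis .
qed

lemma pairing_bound':
  fixes I :: "'i set"
  assumes I: "finite I" and H: "H \<in> borel_measurable config_algebra" and K: "0 \<le> K"
    and \<phi>: "\<And>x. ennreal \<bar>\<phi> x\<bar> \<le> ennreal K * box (loc_ball n) I x"
  shows "(\<integral>\<^sup>+x. ennreal \<bar>dmean I H x * \<phi> x\<bar> \<partial>PiM I (\<lambda>_. \<Lambda>)) \<le>
    ennreal (K * fact (card I)) * (\<integral>\<^sup>+\<mu>. ennreal (\<bar>H \<mu>\<bar> * bweight n \<mu>) \<partial>L)"
proof -
  have "(\<integral>\<^sup>+x. ennreal \<bar>dmean I H x * \<phi> x\<bar> \<partial>PiM I (\<lambda>_. \<Lambda>)) \<le>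
      ennreal K * (ennreal (fact (card I)) * (\<integral>\<^sup>+\<mu>. ennreal (\<bar>H \<mu>\<bar> * bweight n \<mu>) \<partial>L))"
    by (rule order_trans[OF pairing_bound[OF assms] mult_left_mono[OF nn_integral_power_le[OF H]]]) simp
  then show ?thesis using K by (simp add: ennreal_mult mult.assoc)
qed

lemma pairing_integrable:
  fixes I :: "'i set"
  assumes I: "finite I" and H: "admissible H" and K: "0 \<le> K"
    and \<phi>: "\<And>x. ennreal \<bar>\<phi> x\<bar> \<le> ennreal K * box (loc_ball n) I x"
    and \<phi>m: "\<phi> \<in> borel_measurable (PiM I (\<lambda>_. borel))"
  shows "integrable (PiM I (\<lambda>_. \<Lambda>)) (\<lambda>x. dmean I H x * \<phi> x)"
proof (rule integrableI_bounded)
  note Hm = admissible_measurable[OF H]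
  show "(\<lambda>x. dmean I H x * \<phi> x) \<in> borel_measurable (PiM I (\<lambda>_. \<Lambda>))"
    unfolding measurable_pow_iff by (intro borel_measurable_times dmean_measurable I Hm \<phi>m)
  have "(\<integral>\<^sup>+x. ennreal (norm (dmean I H x * \<phi> x)) \<partial>PiM I (\<lambda>_. \<Lambda>)) \<le>
      ennreal (K * fact (card I)) * (\<integral>\<^sup>+\<mu>. ennreal (\<bar>H \<mu>\<bar> * bweight n \<mu>) \<partial>L)"
    using pairing_bound'[OF I Hm K \<phi>] by simp
  also have "\<dots> < \<infinity>" using admissible_finite[OF H, of n] by (simp add: ennreal_mult_less_top)
  finally show "(\<integral>\<^sup>+x. ennreal (norm (dmean I H x * \<phi> x)) \<partial>PiM I (\<lambda>_. \<Lambda>)) < \<infinity>" .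
qed

text \<open>Up to the factor \<open>\<bbbE> exp(- \<eta>(v))\<close> this is the kernel of the exponential functional of \<open>v\<close>.\<close>

definition lkernel :: "('a \<Rightarrow> real) \<Rightarrow> nat \<Rightarrow> (nat \<Rightarrow> 'a) \<Rightarrow> real" where
  "lkernel v k x = (\<Prod>i<k. exp (- v (x i)) - 1)"

lemma lkernel_measurable: "test_fun v \<Longrightarrow> lkernel v k \<in> borel_measurable (PiM {..<k} (\<lambda>_. borel))"
proof -
  assume "test_fun v"
  note [measurable] = test_fun_measurable[OF this]
  show ?thesis unfolding lkernel_def[abs_def] by measurable
qed

lemma lkernel_bound:
  assumes v: "test_fun v"
  obtains n where "\<And>k x. ennreal \<bar>lkernel v k x\<bar> \<le> ennreal 1 * box (loc_ball n) {..<k} x"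
proof -
  obtain n where n: "{x. v x \<noteq> 0} \<subseteq> loc_ball n"
    using v bounded_subset_loc_ball unfolding test_fun_def by blast
  show ?thesis
  proof (rule that[of n])
    fix k and x :: "nat \<Rightarrow> 'a"
    have "ennreal \<bar>exp (- v y) - 1\<bar> \<le> indicator (loc_ball n) y" for y
    proof (cases "y \<in> loc_ball n")
      case True
      have "\<bar>exp (- v y) - 1\<bar> \<le> 1" using test_fun_nonneg[OF v, of y] by (simp add: abs_if)
      then show ?thesis using True by (simp add: ennreal_le_1)
    next
      case False
      then have "v y = 0" using n by auto
      then show ?thesis by simp
    qed
    then have "(\<Prod>i<k. ennreal \<bar>exp (- v (x i)) - 1\<bar>) \<le> (\<Prod>i<k. indicator (loc_ball n) (x i))"
      by (induction k) (auto intro!: mult_mono)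
    then show "ennreal \<bar>lkernel v k x\<bar> \<le> ennreal 1 * box (loc_ball n) {..<k} x"
      by (simp add: lkernel_def box_def abs_prod prod_ennreal)
  qed
qed

lemma dmean_lexp:
  assumes v: "test_fun v"
  shows "x \<in> space (PiM {..<k} (\<lambda>_. \<Lambda>)) \<Longrightarrow> dmean {..<k} (lexp v) x = lkernel v k x * (\<integral>\<mu>. lexp v \<mu> \<partial>L)"
  unfolding dmean_def lkernel_def
  by (subst integral_mult_right_zero[symmetric], rule Bochner_Integration.integral_cong) (auto simp: acost_lexp[OF _ v])

lemma expectation_lexp_pos: "test_fun v \<Longrightarrow> 0 < (\<integral>\<mu>. lexp v \<mu> \<partial>L)"
  by (simp add: expectation_lexp)

definition pairing :: "('a measure \<Rightarrow> real) \<Rightarrow> ('a \<Rightarrow> real) \<Rightarrow> nat \<Rightarrow> real" where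
  "pairing H v k = (\<integral>x. dmean {..<k} H x * lkernel v k x \<partial>PiM {..<k} (\<lambda>_. \<Lambda>)) / fact k"

lemma pairing_summable_bound:
  assumes v: "test_fun v"
  obtains n where "\<And>H. admissible H \<Longrightarrow> summable (\<lambda>k. \<bar>pairing H v k\<bar>)"
    "\<And>H. admissible H \<Longrightarrow> ennreal (\<Sum>k. \<bar>pairing H v k\<bar>) \<le> (\<integral>\<^sup>+\<mu>. ennreal (\<bar>H \<mu>\<bar> * bweight n \<mu>) \<partial>L)"
proof -
  obtain n where n: "\<And>k x. ennreal \<bar>lkernel v k x\<bar> \<le> ennreal 1 * box (loc_ball n) {..<k} x"
    using lkernel_bound[OF v] by blast
  have *: "(\<Sum>k. ennreal \<bar>pairing H v k\<bar>) \<le> (\<integral>\<^sup>+\<mu>. ennreal (\<bar>H \<mu>\<bar> * bweight n \<mu>) \<partial>L)" if H: "admissible H" for H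
  proof -
    note Hm [measurable] = admissible_measurable[OF H]
    have eL: "emeasure \<Lambda> (loc_ball n) = ennreal (measure \<Lambda> (loc_ball n))"
      using int_finite[of "loc_ball n"] by (simp add: emeasure_eq_ennreal_measure)
    have "ennreal \<bar>pairing H v k\<bar> \<le> (\<integral>\<^sup>+\<mu>. ennreal \<bar>H \<mu>\<bar> * ennreal ((measure \<mu> (loc_ball n) + measure \<Lambda> (loc_ball n)) ^ k / fact k) \<partial>L)" for k
    proof -
      have int: "integrable (PiM {..<k} (\<lambda>_. \<Lambda>)) (\<lambda>x. dmean {..<k} H x * lkernel v k x)"
        by (rule pairing_integrable[OF _ H _ n lkernel_measurable[OF v]]) auto
      have "ennreal \<bar>pairing H v k\<bar> = ennreal (1 / fact k) * ennreal \<bar>\<integral>x. dmean {..<k} H x * lkernel v k x \<partial>PiM {..<k} (\<lambda>_. \<Lambda>)\<bar>"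
        by (simp add: pairing_def ennreal_mult'[symmetric] abs_div)
      also have "ennreal \<bar>\<integral>x. dmean {..<k} H x * lkernel v k x \<partial>PiM {..<k} (\<lambda>_. \<Lambda>)\<bar> \<le>
          (\<integral>\<^sup>+x. ennreal \<bar>dmean {..<k} H x * lkernel v k x\<bar> \<partial>PiM {..<k} (\<lambda>_. \<Lambda>))"
        using integral_norm_bound_ennreal[OF int] by simp
      also have "\<dots> \<le> ennreal 1 * (\<integral>\<^sup>+\<mu>. ennreal \<bar>H \<mu>\<bar> * (emeasure \<mu> (loc_ball n) + emeasure \<Lambda> (loc_ball n)) ^ card {..<k} \<partial>L)"
        by (rule pairing_bound[OF _ Hm _ n]) auto
      also have "ennreal (1 / fact k) * (ennreal 1 * (\<integral>\<^sup>+\<mu>. ennreal \<bar>H \<mu>\<bar> * (emeasure \<mu> (loc_ball n) + emeasure \<Lambda> (loc_ball n)) ^ card {..<k} \<partial>L)) =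
          (\<integral>\<^sup>+\<mu>. ennreal (1 / fact k) * (ennreal \<bar>H \<mu>\<bar> * (emeasure \<mu> (loc_ball n) + emeasure \<Lambda> (loc_ball n)) ^ k) \<partial>L)"
        by (simp add: nn_integral_cmult)
      also have "\<dots> = (\<integral>\<^sup>+\<mu>. ennreal \<bar>H \<mu>\<bar> * ennreal ((measure \<mu> (loc_ball n) + measure \<Lambda> (loc_ball n)) ^ k / fact k) \<partial>L)"
      proof (intro nn_integral_cong)
        fix \<mu> assume "\<mu> \<in> space L"
        then have "emeasure \<mu> (loc_ball n) + emeasure \<Lambda> (loc_ball n) = ennreal (measure \<mu> (loc_ball n) + measure \<Lambda> (loc_ball n))"
          by (simp add: count_eq eL)
        then show "ennreal (1 / fact k) * (ennreal \<bar>H \<mu>\<bar> * (emeasure \<mu> (loc_ball n) + emeasure \<Lambda> (loc_ball n)) ^ k) =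
            ennreal \<bar>H \<mu>\<bar> * ennreal ((measure \<mu> (loc_ball n) + measure \<Lambda> (loc_ball n)) ^ k / fact k)"
          by (simp only: ennreal_power add_nonneg_nonneg measure_nonneg)
            (simp add: ennreal_mult[symmetric] mult_ac divide_inverse)
      qed
      finally show ?thesis by (simp add: mult_left_mono)
    qed
    then have "(\<Sum>k. ennreal \<bar>pairing H v k\<bar>) \<le> (\<Sum>k. \<integral>\<^sup>+\<mu>. ennreal \<bar>H \<mu>\<bar> * ennreal ((measure \<mu> (loc_ball n) + measure \<Lambda> (loc_ball n)) ^ k / fact k) \<partial>L)"
      by (intro suminf_le) auto
    also have "\<dots> = (\<integral>\<^sup>+\<mu>. (\<Sum>k. ennreal \<bar>H \<mu>\<bar> * ennreal ((measure \<mu> (loc_ball n) + measure \<Lambda> (loc_ball n)) ^ k / fact k)) \<partial>L)"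
      by (rule nn_integral_suminf[symmetric]) measurable
    also have "\<dots> = (\<integral>\<^sup>+\<mu>. ennreal (\<bar>H \<mu>\<bar> * bweight n \<mu>) \<partial>L)"
    proof (intro nn_integral_cong)
      fix \<mu> :: "'a measure"
      let ?y = "measure \<mu> (loc_ball n) + measure \<Lambda> (loc_ball n)"
      have "(\<lambda>k. ?y ^ k / fact k) sums exp ?y"
        using exp_converges[of ?y] by (simp add: divide_inverse mult.commute)
      then have "(\<Sum>k. ennreal (?y ^ k / fact k)) = ennreal (bweight n \<mu>)"
        unfolding bweight_def by (intro suminf_ennreal_eq) auto
      then show "(\<Sum>k. ennreal \<bar>H \<mu>\<bar> * ennreal (?y ^ k / fact k)) = ennreal (\<bar>H \<mu>\<bar> * bweight n \<mu>)"
        using bweight_ge_1[of n \<mu>] by (simp add: ennreal_mult)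
    qed
    finally show ?thesis .
  qed
  show ?thesis
  proof (rule that[of n])
    fix H assume H: "admissible H"
    have "(\<Sum>k. ennreal \<bar>pairing H v k\<bar>) < top"
      using le_less_trans[OF *[OF H] admissible_finite[OF H, of n]] by simp
    then show s: "summable (\<lambda>k. \<bar>pairing H v k\<bar>)"
      by (intro summable_suminf_not_top) auto
    show "ennreal (\<Sum>k. \<bar>pairing H v k\<bar>) \<le> (\<integral>\<^sup>+\<mu>. ennreal (\<bar>H \<mu>\<bar> * bweight n \<mu>) \<partial>L)"
      using *[OF H] unfolding suminf_ennreal2[OF abs_ge_zero s] .
  qed
qed

lemma pairing_add:
  assumes v: "test_fun v" and H: "admissible H" and G: "admissible G"
  shows "pairing (\<lambda>\<mu>. H \<mu> + G \<mu>) v k = pairing H v k + pairing G v k"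
proof -
  obtain n where n: "\<And>k x. ennreal \<bar>lkernel v k x\<bar> \<le> ennreal 1 * box (loc_ball n) {..<k} x"
    using lkernel_bound[OF v] by blast
  note int = pairing_integrable[OF _ _ _ n lkernel_measurable[OF v]]
  have "(\<integral>x. dmean {..<k} (\<lambda>\<mu>. H \<mu> + G \<mu>) x * lkernel v k x \<partial>PiM {..<k} (\<lambda>_. \<Lambda>)) =
      (\<integral>x. dmean {..<k} H x * lkernel v k x + dmean {..<k} G x * lkernel v k x \<partial>PiM {..<k} (\<lambda>_. \<Lambda>))"
  proof (rule integral_cong_AE)
    show "AE x in PiM {..<k} (\<lambda>_. \<Lambda>). dmean {..<k} (\<lambda>\<mu>. H \<mu> + G \<mu>) x * lkernel v k x = dmean {..<k} H x * lkernel v k x + dmean {..<k} G x * lkernel v k x"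
      using dmean_add[OF _ H G, of "{..<k}"] by (rule AE_mp[OF _ AE_I2]) (auto simp: distrib_right)
  qed (use int[of k "\<lambda>\<mu>. H \<mu> + G \<mu>"] int[of k H] int[of k G] H G admissible_add[OF H G] in \<open>auto intro: borel_measurable_integrable borel_measurable_add\<close>)
  also have "\<dots> = (\<integral>x. dmean {..<k} H x * lkernel v k x \<partial>PiM {..<k} (\<lambda>_. \<Lambda>)) + (\<integral>x. dmean {..<k} G x * lkernel v k x \<partial>PiM {..<k} (\<lambda>_. \<Lambda>))"
    using int[of k H] int[of k G] H G by (intro Bochner_Integration.integral_add) auto
  finally show ?thesis by (simp add: pairing_def add_divide_distrib)
qed

lemma pairing_scale: "pairing (\<lambda>\<mu>. c * H \<mu>) v k = c * pairing H v k"
  by (simp add: pairing_def dmean_scale mult.assoc)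

lemma integrable_mult_bounded:
  fixes H G :: "'a measure \<Rightarrow> real"
  assumes H: "integrable L H" and G [measurable]: "G \<in> borel_measurable config_algebra" and b: "\<forall>\<mu>. \<bar>G \<mu>\<bar> \<le> b"
  shows "integrable L (\<lambda>\<mu>. H \<mu> * G \<mu>)"
proof (rule Bochner_Integration.integrable_bound)
  show "integrable L (\<lambda>\<mu>. H \<mu> * b)" using H by simp
  show "(\<lambda>\<mu>. H \<mu> * G \<mu>) \<in> borel_measurable L" using borel_measurable_integrable[OF H] by measurable
  show "AE \<mu> in L. norm (H \<mu> * G \<mu>) \<le> norm (H \<mu> * b)"
  proof (rule AE_I2)
    fix \<mu>
    have "\<bar>G \<mu>\<bar> \<le> \<bar>b\<bar>" using b by (meson abs_ge_self order_trans)
    then show "norm (H \<mu> * G \<mu>) \<le> norm (H \<mu> * b)" by (simp add: abs_mult mult_left_mono)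
  qed
qed

lemma integrable_mult_lexp:
  assumes H: "admissible H" and v: "test_fun v"
  shows "integrable L (\<lambda>\<mu>. H \<mu> * lexp v \<mu>)"
  by (rule Bochner_Integration.integrable_bound[OF admissible_integrable[OF H]])
    (use admissible_measurable[OF H] lexp_measurable[OF v] lexp_bounds[of v] in
      \<open>auto simp: abs_mult less_imp_le intro!: mult_left_le\<close>)

text \<open>Pairing with an exponential functional: both sides are explicit for exponential functionals, and
  both are continuous in the weighted \<open>L\<^sup>1\<close> norm, in which exponential functionals are dense.\<close>

lemma pairing_lexp_sums:
  assumes v: "test_fun v" and H: "admissible H"
  shows "(\<lambda>k. pairing H v k * (\<integral>\<mu>. lexp v \<mu> \<partial>L)) sums (\<integral>\<mu>. H \<mu> * lexp v \<mu> \<partial>L)"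
proof -
  define c where "c = (\<integral>\<mu>. lexp v \<mu> \<partial>L)"
  have c0: "0 < c" unfolding c_def by (rule expectation_lexp_pos[OF v])
  have c1: "c \<le> 1"
    unfolding c_def expectation_lexp[OF v] using test_fun_nonneg[OF v]
    by (auto intro!: Bochner_Integration.integral_nonneg)
  obtain n where sm: "\<And>H. admissible H \<Longrightarrow> summable (\<lambda>k. \<bar>pairing H v k\<bar>)"
    and bd: "\<And>H. admissible H \<Longrightarrow> ennreal (\<Sum>k. \<bar>pairing H v k\<bar>) \<le> (\<integral>\<^sup>+\<mu>. ennreal (\<bar>H \<mu>\<bar> * bweight n \<mu>) \<partial>L)"
    using pairing_summable_bound[OF v] by blast
  (* The defect of the identity: linear, zero on the algebra, and bounded by the weighted norm. *)
  define D where "D H = (\<integral>\<mu>. H \<mu> * lexp v \<mu> \<partial>L) - c * (\<Sum>k. pairing H v k)" for H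
  have D_add: "D (\<lambda>\<mu>. H \<mu> + G \<mu>) = D H + D G" if "admissible H" "admissible G" for H G
  proof -
    have "(\<Sum>k. pairing (\<lambda>\<mu>. H \<mu> + G \<mu>) v k) = (\<Sum>k. pairing H v k) + (\<Sum>k. pairing G v k)"
      unfolding pairing_add[OF v that]
      using summable_rabs_cancel[OF sm[OF that(1)]] summable_rabs_cancel[OF sm[OF that(2)]] by (rule suminf_add[symmetric])
    moreover have "(\<integral>\<mu>. (H \<mu> + G \<mu>) * lexp v \<mu> \<partial>L) = (\<integral>\<mu>. H \<mu> * lexp v \<mu> \<partial>L) + (\<integral>\<mu>. G \<mu> * lexp v \<mu> \<partial>L)"
      unfolding distrib_right by (intro Bochner_Integration.integral_add integrable_mult_lexp that v)
    ultimately show ?thesis by (simp add: D_def algebra_simps)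
  qed
  have D_scale: "D (\<lambda>\<mu>. r * H \<mu>) = r * D H" if "admissible H" for H r
  proof -
    have "(\<Sum>k. pairing (\<lambda>\<mu>. r * H \<mu>) v k) = r * (\<Sum>k. pairing H v k)"
      unfolding pairing_scale by (rule suminf_mult[OF summable_rabs_cancel[OF sm[OF that]]])
    then show ?thesis by (simp add: D_def mult.assoc algebra_simps)
  qed
  have D_lexp: "D (lexp w) = 0" if w: "test_fun w" for w
  proof -
    define a where "a = (\<integral>x. (exp (- w x) - 1) * (exp (- v x) - 1) \<partial>\<Lambda>)"
    have iv: "integrable \<Lambda> (\<lambda>x. exp (- v x) - 1)" and iw: "integrable \<Lambda> (\<lambda>x. exp (- w x) - 1)"
      using integrable_test_fun[OF v] integrable_test_fun[OF w]
      by (simp_all add: Bochner_Integration.integrable_minus[OF integrable_test_fun[OF v], simplified]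
          Bochner_Integration.integrable_minus[OF integrable_test_fun[OF w], simplified])
    have ivw: "integrable \<Lambda> (\<lambda>x. (exp (- w x) - 1) * (exp (- v x) - 1))"
    proof (rule Bochner_Integration.integrable_bound[OF iw])
      show "(\<lambda>x. (exp (- w x) - 1) * (exp (- v x) - 1)) \<in> borel_measurable \<Lambda>"
        using iv iw by (auto intro: borel_measurable_integrable)
      have "\<bar>exp (- v x) - 1\<bar> \<le> 1" for x using test_fun_nonneg[OF v, of x] by (simp add: abs_if)
      then show "AE x in \<Lambda>. norm ((exp (- w x) - 1) * (exp (- v x) - 1)) \<le> norm (exp (- w x) - 1)"
        by (intro AE_I2) (simp add: abs_mult mult_left_le)
    qed
    have p: "pairing (lexp w) v k = (\<integral>\<mu>. lexp w \<mu> \<partial>L) * (a ^ k / fact k)" for k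
    proof -
      have "(\<integral>x. dmean {..<k} (lexp w) x * lkernel v k x \<partial>PiM {..<k} (\<lambda>_. \<Lambda>)) =
          (\<integral>x. (\<integral>\<mu>. lexp w \<mu> \<partial>L) * (\<Prod>i<k. (exp (- w (x i)) - 1) * (exp (- v (x i)) - 1)) \<partial>PiM {..<k} (\<lambda>_. \<Lambda>))"
        by (intro Bochner_Integration.integral_cong refl) (simp add: dmean_lexp[OF w] lkernel_def prod.distrib)
      also have "\<dots> = (\<integral>\<mu>. lexp w \<mu> \<partial>L) * (\<Prod>i<k. a)"
        unfolding a_def by (subst integral_mult_right_zero, subst pow.product_integral_prod) (auto simp: ivw)
      finally show ?thesis by (simp add: pairing_def)
    qed
    have "(\<lambda>k. a ^ k / fact k) sums exp a"
      using exp_converges[of a] by (simp add: divide_inverse mult.commute)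
    then have "(\<Sum>k. pairing (lexp w) v k) = (\<integral>\<mu>. lexp w \<mu> \<partial>L) * exp a"
      unfolding p by (intro sums_unique[symmetric] sums_mult)
    moreover have "(\<integral>\<mu>. lexp w \<mu> * lexp v \<mu> \<partial>L) = c * ((\<integral>\<mu>. lexp w \<mu> \<partial>L) * exp a)"
    proof -
      have "(\<integral>\<mu>. lexp w \<mu> * lexp v \<mu> \<partial>L) = (\<integral>\<mu>. lexp (\<lambda>x. w x + v x) \<mu> \<partial>L)"
        by (intro Bochner_Integration.integral_cong refl) (simp add: lexp_add[OF w v])
      also have "\<dots> = exp (- (\<integral>x. 1 - exp (- (w x + v x)) \<partial>\<Lambda>))" by (rule expectation_lexp[OF test_fun_add[OF w v]])
      also have "(\<integral>x. 1 - exp (- (w x + v x)) \<partial>\<Lambda>) =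
          (\<integral>x. (1 - exp (- w x)) + (1 - exp (- v x)) - (exp (- w x) - 1) * (exp (- v x) - 1) \<partial>\<Lambda>)"
        by (intro Bochner_Integration.integral_cong refl) (simp add: exp_add[symmetric] algebra_simps)
      also have "\<dots> = (\<integral>x. 1 - exp (- w x) \<partial>\<Lambda>) + (\<integral>x. 1 - exp (- v x) \<partial>\<Lambda>) - a"
        unfolding a_def using integrable_test_fun[OF v] integrable_test_fun[OF w] ivw
        by (simp only: Bochner_Integration.integral_diff Bochner_Integration.integral_add Bochner_Integration.integrable_add)
      finally show ?thesis
        unfolding c_def expectation_lexp[OF v] expectation_lexp[OF w] by (simp add: exp_add[symmetric] algebra_simps)
    qed
    ultimately show ?thesis by (simp add: D_def)
  qed
  have D_alg: "D g = 0" if "laplace_alg g" for g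
    using that
  proof induction
    case (base w r) then show ?case by (simp add: D_scale D_lexp admissible_alg laplace_alg_lexp)
  next
    case (add f g) then show ?case by (simp add: D_add admissible_alg)
  qed
  have D_bound: "\<bar>D G\<bar> \<le> 2 * e" if G: "admissible G" and e: "(\<integral>\<^sup>+\<mu>. ennreal (\<bar>G \<mu>\<bar> * bweight n \<mu>) \<partial>L) < ennreal e" "0 < e" for G e
  proof -
    have "ennreal (\<Sum>k. \<bar>pairing G v k\<bar>) \<le> ennreal e"
      by (rule less_imp_le[OF le_less_trans[OF bd[OF G] e(1)]])
    then have "(\<Sum>k. \<bar>pairing G v k\<bar>) \<le> e" using e(2) by (simp add: ennreal_le_iff)
    then have 1: "\<bar>\<Sum>k. pairing G v k\<bar> \<le> e" using summable_rabs[OF sm[OF G]] by linarith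
    have "ennreal (norm (\<integral>\<mu>. G \<mu> * lexp v \<mu> \<partial>L)) \<le> (\<integral>\<^sup>+\<mu>. ennreal (norm (G \<mu> * lexp v \<mu>)) \<partial>L)"
      by (rule integral_norm_bound_ennreal[OF integrable_mult_lexp[OF G v]])
    also have "\<dots> \<le> (\<integral>\<^sup>+\<mu>. ennreal (\<bar>G \<mu>\<bar> * bweight n \<mu>) \<partial>L)"
    proof (intro nn_integral_mono ennreal_leI)
      fix \<mu>
      show "norm (G \<mu> * lexp v \<mu>) \<le> \<bar>G \<mu>\<bar> * bweight n \<mu>"
        using lexp_bounds[of v \<mu>] bweight_ge_1[of n \<mu>] by (simp add: abs_mult mult_left_mono)
    qed
    also have "\<dots> \<le> ennreal e" using e(1) by simp
    finally have 2: "\<bar>\<integral>\<mu>. G \<mu> * lexp v \<mu> \<partial>L\<bar> \<le> e" using e(2) by (simp add: ennreal_le_iff)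
    have "\<bar>c * (\<Sum>k. pairing G v k)\<bar> \<le> 1 * e"
      unfolding abs_mult using c0 c1 1 by (intro mult_mono) auto
    with 2 show ?thesis unfolding D_def by linarith
  qed
  interpret W: config_weight L "bweight n" 0
  proof (intro config_weight.intro finite_measure_axioms config_weight_axioms.intro)
    show "(\<integral>\<^sup>+\<mu>. ennreal (bweight n \<mu>) \<partial>L) < \<infinity>" using integrable_bweight_power[of n 1] by simp
    show "0 \<le> bweight n \<mu>" for \<mu> using bweight_ge_1[of n \<mu>] by linarith
  qed auto
  have "\<bar>D H\<bar> \<le> 0 + e" if e: "0 < e" for e
  proof -
    have "W.err H < \<infinity>" using admissible_finite[OF H, of n] by (simp add: W.err_def)
    then obtain g where g: "laplace_alg g" "W.err (\<lambda>\<mu>. H \<mu> - g \<mu>) < ennreal (e / 2)"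
      using W.laplace_alg_dense[OF admissible_measurable[OF H], of "e / 2"] e by auto
    have ad: "admissible (\<lambda>\<mu>. H \<mu> - g \<mu>)" by (rule admissible_diff[OF H admissible_alg[OF g(1)]])
    have "D H = D (\<lambda>\<mu>. (H \<mu> - g \<mu>) + g \<mu>)" by simp
    also have "\<dots> = D (\<lambda>\<mu>. H \<mu> - g \<mu>)" using D_add[OF ad admissible_alg[OF g(1)]] D_alg[OF g(1)] by simp
    also have "\<bar>\<dots>\<bar> \<le> 2 * (e / 2)" using g(2) e by (intro D_bound ad) (auto simp: W.err_def)
    finally show ?thesis by simp
  qed
  then have "\<bar>D H\<bar> \<le> 0" by (rule field_le_epsilon)
  then have "(\<integral>\<mu>. H \<mu> * lexp v \<mu> \<partial>L) = c * (\<Sum>k. pairing H v k)" by (simp add: D_def)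
  moreover have "(\<lambda>k. c * pairing H v k) sums (c * (\<Sum>k. pairing H v k))"
    by (intro sums_mult summable_sums summable_rabs_cancel[OF sm[OF H]])
  ultimately show ?thesis unfolding c_def by (simp add: mult.commute)
qed

text \<open>The pairing formula extends from exponential functionals to the algebra by linearity.\<close>

lemma dmean_pairing_sums:
  assumes "laplace_alg G" and H: "admissible H"
  shows "(\<forall>k::nat. integrable (PiM {..<k} (\<lambda>_. \<Lambda>)) (\<lambda>x. dmean {..<k} H x * dmean {..<k} G x)) \<and>
    (\<lambda>k. (\<integral>x. dmean {..<k} H x * dmean {..<k} G x \<partial>PiM {..<k} (\<lambda>_. \<Lambda>)) / fact k) sums (\<integral>\<mu>. H \<mu> * G \<mu> \<partial>L)"
  using assms(1)
proof induction
  case (base v r)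
  obtain n where n: "\<And>k x. ennreal \<bar>lkernel v k x\<bar> \<le> ennreal 1 * box (loc_ball n) {..<k} x"
    using lkernel_bound[OF base] by blast
  define c where "c = (\<integral>\<mu>. lexp v \<mu> \<partial>L)"
  have eq: "dmean {..<k} H x * dmean {..<k} (\<lambda>\<mu>. r * lexp v \<mu>) x = (r * c) * (dmean {..<k} H x * lkernel v k x)"
    if "x \<in> space (PiM {..<k} (\<lambda>_. \<Lambda>))" for k x
    using that by (simp add: dmean_scale dmean_lexp[OF base] c_def)
  have int: "integrable (PiM {..<k} (\<lambda>_. \<Lambda>)) (\<lambda>x. dmean {..<k} H x * dmean {..<k} (\<lambda>\<mu>. r * lexp v \<mu>) x)" for k :: nat
  proof -
    have "integrable (PiM {..<k} (\<lambda>_. \<Lambda>)) (\<lambda>x. (r * c) * (dmean {..<k} H x * lkernel v k x))"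
      by (intro Bochner_Integration.integrable_mult_right pairing_integrable[OF _ H _ n lkernel_measurable[OF base]]) auto
    also have "?this \<longleftrightarrow> ?thesis"
      by (intro Bochner_Integration.integrable_cong refl) (rule eq[symmetric])
    finally show ?thesis .
  qed
  have "(\<integral>x. dmean {..<k} H x * dmean {..<k} (\<lambda>\<mu>. r * lexp v \<mu>) x \<partial>PiM {..<k} (\<lambda>_. \<Lambda>)) / fact k = r * (pairing H v k * c)" for k
    by (subst Bochner_Integration.integral_cong[OF refl eq]) (auto simp: pairing_def)
  moreover have "(\<integral>\<mu>. H \<mu> * (r * lexp v \<mu>) \<partial>L) = r * (\<integral>\<mu>. H \<mu> * lexp v \<mu> \<partial>L)"
    by (simp add: mult.left_commute)
  ultimately show ?case
    using int sums_mult[OF pairing_lexp_sums[OF base H], of r] by (simp add: c_def)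
next
  case (add f g)
  have ad: "admissible f" "admissible g" using add.hyps by (auto intro: admissible_alg)
  let ?T = "\<lambda>(k::nat) f. dmean {..<k} f"
  let ?M = "\<lambda>k::nat. PiM {..<k} (\<lambda>_. \<Lambda>)"
  have i: "integrable (?M k) (\<lambda>x. ?T k H x * ?T k f x)" "integrable (?M k) (\<lambda>x. ?T k H x * ?T k g x)" for k
    using add.IH by auto
  have m: "?T k G \<in> borel_measurable (?M k)" if "admissible G" for k G
    unfolding measurable_pow_iff by (rule dmean_measurable[OF _ admissible_measurable[OF that]]) simp
  have ae: "AE x in ?M k. ?T k H x * ?T k (\<lambda>\<mu>. f \<mu> + g \<mu>) x = ?T k H x * ?T k f x + ?T k H x * ?T k g x" for k
    using dmean_add[OF _ ad, of "{..<k}"] by (rule AE_mp[OF _ AE_I2]) (auto simp: distrib_left)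
  have mm: "(\<lambda>x. ?T k H x * ?T k (\<lambda>\<mu>. f \<mu> + g \<mu>) x) \<in> borel_measurable (?M k)"
    "(\<lambda>x. ?T k H x * ?T k f x + ?T k H x * ?T k g x) \<in> borel_measurable (?M k)" for k
    by (intro borel_measurable_times borel_measurable_add m H ad admissible_add)+
  have int: "integrable (?M k) (\<lambda>x. ?T k H x * ?T k (\<lambda>\<mu>. f \<mu> + g \<mu>) x)" for k
    using integrable_cong_AE[OF mm ae] i by (auto intro: Bochner_Integration.integrable_add)
  have "(\<integral>x. ?T k H x * ?T k (\<lambda>\<mu>. f \<mu> + g \<mu>) x \<partial>?M k) / fact k =
      (\<integral>x. ?T k H x * ?T k f x \<partial>?M k) / fact k + (\<integral>x. ?T k H x * ?T k g x \<partial>?M k) / fact k" for k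
    using integral_cong_AE[OF mm ae] i by (simp add: add_divide_distrib)
  moreover have "(\<integral>\<mu>. H \<mu> * (f \<mu> + g \<mu>) \<partial>L) = (\<integral>\<mu>. H \<mu> * f \<mu> \<partial>L) + (\<integral>\<mu>. H \<mu> * g \<mu> \<partial>L)"
  proof -
    have "integrable L (\<lambda>\<mu>. H \<mu> * G \<mu>)" if G: "laplace_alg G" for G
      using laplace_alg_bounded[OF G] integrable_mult_bounded[OF admissible_integrable[OF H] laplace_alg_measurable[OF G]] by blast
    then show ?thesis unfolding distrib_left using add.hyps by (intro Bochner_Integration.integral_add) auto
  qed
  ultimately show ?case using int add.IH by (simp add: sums_add)
qed

end

context poisson_law begin

text \<open>The squared Fock space norm of the kernels; the factor is \<open>k! (1/k!)\<^sup>2\<close>, as \<open>dmean\<close> carries a factor \<open>k!\<close>.\<close>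

definition fock_norm2 :: "('a measure \<Rightarrow> real) \<Rightarrow> ennreal" where
  "fock_norm2 H = (\<Sum>k::nat. ennreal (1 / fact k) * (\<integral>\<^sup>+x. ennreal ((dmean {..<k} H x)\<^sup>2) \<partial>PiM {..<k} (\<lambda>_. \<Lambda>)))"

lemma dmean_pow_measurable:
  "admissible H \<Longrightarrow> dmean {..<k::nat} H \<in> borel_measurable (PiM {..<k} (\<lambda>_. \<Lambda>))"
  unfolding measurable_pow_iff by (rule dmean_measurable[OF _ admissible_measurable]) auto

lemma integrable_bounded:
  fixes G :: "'a measure \<Rightarrow> real"
  assumes "G \<in> borel_measurable config_algebra" and "\<forall>\<mu>. \<bar>G \<mu>\<bar> \<le> b"
  shows "integrable L G"
  using integrable_mult_bounded[OF integrable_const[of "1::real"] assms] by simp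

lemma integrable_bounded_square:
  fixes G :: "'a measure \<Rightarrow> real"
  assumes G [measurable]: "G \<in> borel_measurable config_algebra" and b: "\<forall>\<mu>. \<bar>G \<mu>\<bar> \<le> b"
  shows "integrable L (\<lambda>\<mu>. (G \<mu>)\<^sup>2)"
  using integrable_mult_bounded[OF integrable_bounded[OF assms] assms] by (simp add: power2_eq_square)

lemma alg_square_sums:
  assumes g: "laplace_alg g"
  shows "(\<lambda>k. (\<integral>x. (dmean {..<k} g x)\<^sup>2 \<partial>PiM {..<k::nat} (\<lambda>_. \<Lambda>)) / fact k) sums (\<integral>\<mu>. (g \<mu>)\<^sup>2 \<partial>L)"
    and "integrable (PiM {..<k::nat} (\<lambda>_. \<Lambda>)) (\<lambda>x. (dmean {..<k} g x)\<^sup>2)"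
  using dmean_pairing_sums[OF g admissible_alg[OF g]] by (auto simp: power2_eq_square)

text \<open>Duality: \<open>2 \<langle>H, G\<rangle> \<le> \<bar>H\<bar>\<^sup>2 + \<bar>G\<bar>\<^sup>2\<close> in Fock space transfers, by the pairing formula, to
  \<open>2 \<bbbE> H G \<le> \<bar>H\<bar>\<^sup>2 + \<bbbE> G\<^sup>2\<close> for functionals \<open>G\<close> in the algebra, then by density to bounded \<open>G\<close>; truncations of
  \<open>H\<close> itself are admitted as \<open>G\<close>.  If the Fock space
  norm of \<open>H\<close> is finite, then \<open>H\<close> turns out to be square integrable.\<close>

lemma nn_integral_square_le_fock_norm2:
  assumes H: "admissible H"
  shows "(\<integral>\<^sup>+\<mu>. ennreal ((H \<mu>)\<^sup>2) \<partial>L) \<le> fock_norm2 H"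
proof (cases "fock_norm2 H = \<infinity>")
  case False
  note [measurable] = admissible_measurable[OF H]
  note iH = admissible_integrable[OF H]
  define s where "s = enn2real (fock_norm2 H)"
  have s: "fock_norm2 H = ennreal s" "0 \<le> s" using False by (auto simp: s_def less_top)
  let ?M = "\<lambda>k::nat. PiM {..<k} (\<lambda>_. \<Lambda>)"
  let ?T = "\<lambda>(k::nat) f. dmean {..<k} f"
  define a where "a k = (\<integral>x. (?T k H x)\<^sup>2 \<partial>?M k) / fact k" for k
  have a_int: "integrable (?M k) (\<lambda>x. (?T k H x)\<^sup>2)" for k
  proof (rule integrableI_nonneg)
    have "ennreal (1 / fact k) * (\<integral>\<^sup>+x. ennreal ((?T k H x)\<^sup>2) \<partial>?M k) \<le> fock_norm2 H"
      unfolding fock_norm2_def using sum_le_suminf[of "\<lambda>k. ennreal (1 / fact k) * (\<integral>\<^sup>+x. ennreal ((?T k H x)\<^sup>2) \<partial>?M k)" "{k}"] by simp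
    then have "ennreal (1 / fact k) * (\<integral>\<^sup>+x. ennreal ((?T k H x)\<^sup>2) \<partial>?M k) < top" using s by (simp add: le_less_trans)
    then show "(\<integral>\<^sup>+x. ennreal ((?T k H x)\<^sup>2) \<partial>?M k) < \<infinity>" by (auto simp: ennreal_mult_less_top)
  qed (use dmean_pow_measurable[OF H] in auto)
  have a_nn: "ennreal (1 / fact k) * (\<integral>\<^sup>+x. ennreal ((?T k H x)\<^sup>2) \<partial>?M k) = ennreal (a k)" for k
    by (subst nn_integral_eq_integral[OF a_int]) (auto simp: a_def ennreal_mult[symmetric])
  have a0: "0 \<le> a k" for k by (simp add: a_def)
  have as: "a sums s"
  proof -
    have e: "(\<Sum>k. ennreal (a k)) = ennreal s" using s(1) unfolding fock_norm2_def a_nn .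
    then have sm: "summable a" by (intro summable_suminf_not_top a0) simp
    from suminf_ennreal2[OF a0 sm] e have "suminf a = s"
      using s(2) suminf_nonneg[OF sm a0] by simp
    with sm show ?thesis by (simp add: sums_iff)
  qed
  have alg: "(\<integral>\<mu>. 2 * (H \<mu> * g \<mu>) - (g \<mu>)\<^sup>2 \<partial>L) \<le> s" if g: "laplace_alg g" for g
  proof -
    obtain b where b: "\<forall>\<mu>. \<bar>g \<mu>\<bar> \<le> b" using laplace_alg_bounded[OF g] by blast
    have i: "integrable (?M k) (\<lambda>x. ?T k H x * ?T k g x)" for k using dmean_pairing_sums[OF g H] by blast
    have 1: "(\<lambda>k. 2 * ((\<integral>x. ?T k H x * ?T k g x \<partial>?M k) / fact k)) sums (2 * (\<integral>\<mu>. H \<mu> * g \<mu> \<partial>L))"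
      using dmean_pairing_sums[OF g H] by (intro sums_mult) blast
    have 2: "(\<lambda>k. a k + (\<integral>x. (?T k g x)\<^sup>2 \<partial>?M k) / fact k) sums (s + (\<integral>\<mu>. (g \<mu>)\<^sup>2 \<partial>L))"
      by (intro sums_add as alg_square_sums[OF g])
    have "2 * (\<integral>\<mu>. H \<mu> * g \<mu> \<partial>L) \<le> s + (\<integral>\<mu>. (g \<mu>)\<^sup>2 \<partial>L)"
    proof (rule sums_le[OF _ 1 2])
      fix k
      have "2 * (\<integral>x. ?T k H x * ?T k g x \<partial>?M k) = (\<integral>x. 2 * (?T k H x * ?T k g x) \<partial>?M k)" by simp
      also have "\<dots> \<le> (\<integral>x. (?T k H x)\<^sup>2 + (?T k g x)\<^sup>2 \<partial>?M k)"
        by (intro integral_mono Bochner_Integration.integrable_add Bochner_Integration.integrable_mult_right i a_int alg_square_sums(2)[OF g])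
          (use sum_squares_bound in \<open>simp add: mult.assoc\<close>)
      also have "\<dots> = (\<integral>x. (?T k H x)\<^sup>2 \<partial>?M k) + (\<integral>x. (?T k g x)\<^sup>2 \<partial>?M k)"
        by (intro Bochner_Integration.integral_add a_int alg_square_sums(2)[OF g])
      finally have "2 * (\<integral>x. ?T k H x * ?T k g x \<partial>?M k) / fact k \<le> ((\<integral>x. (?T k H x)\<^sup>2 \<partial>?M k) + (\<integral>x. (?T k g x)\<^sup>2 \<partial>?M k)) / fact k"
        by (rule divide_right_mono) simp
      then show "2 * ((\<integral>x. ?T k H x * ?T k g x \<partial>?M k) / fact k) \<le> a k + (\<integral>x. (?T k g x)\<^sup>2 \<partial>?M k) / fact k"
        by (simp add: a_def add_divide_distrib)
    qed
    moreover have "(\<integral>\<mu>. 2 * (H \<mu> * g \<mu>) - (g \<mu>)\<^sup>2 \<partial>L) = 2 * (\<integral>\<mu>. H \<mu> * g \<mu> \<partial>L) - (\<integral>\<mu>. (g \<mu>)\<^sup>2 \<partial>L)"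
      using integrable_mult_bounded[OF iH laplace_alg_measurable[OF g] b] integrable_bounded_square[OF laplace_alg_measurable[OF g] b]
      by simp
    ultimately show ?thesis by simp
  qed
  have bdd: "(\<integral>\<mu>. 2 * (H \<mu> * G \<mu>) - (G \<mu>)\<^sup>2 \<partial>L) \<le> s"
    if G [measurable]: "G \<in> borel_measurable config_algebra" and K: "\<forall>\<mu>. \<bar>G \<mu>\<bar> \<le> K" for G K
  proof (rule field_le_epsilon)
    fix \<epsilon> :: real assume \<epsilon>: "0 < \<epsilon>"
    have K0: "0 \<le> K" using K by (meson abs_ge_zero order_trans)
    (* Replacing G by an approximation g costs at most 2 + 2 K times the error of g, see below. *)
    define e where "e = \<epsilon> / (2 + 2 * K)"
    have e: "0 < e" using \<epsilon> K0 by (simp add: e_def)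
    interpret W: config_weight L "\<lambda>\<mu>. 1 + \<bar>H \<mu>\<bar>" 1
    proof (intro config_weight.intro finite_measure_axioms config_weight_axioms.intro)
      have "integrable L (\<lambda>\<mu>. 1 + \<bar>H \<mu>\<bar>)" using iH by simp
      then show "(\<integral>\<^sup>+\<mu>. ennreal (1 + \<bar>H \<mu>\<bar>) \<partial>L) < \<infinity>" by (simp add: integrable_iff_bounded del: ennreal_plus)
    qed auto
    define w where "w D \<mu> = \<bar>D \<mu>\<bar> * (1 + \<bar>H \<mu>\<bar>) + 1 * (D \<mu>)\<^sup>2" for D \<mu>
    have w_int: "integrable L (w D)" if D [measurable]: "D \<in> borel_measurable config_algebra" and c: "\<forall>\<mu>. \<bar>D \<mu>\<bar> \<le> c" for D c
    proof -
      have "integrable L (\<lambda>\<mu>. (1 + \<bar>H \<mu>\<bar>) * \<bar>D \<mu>\<bar>)"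
        using iH c by (intro integrable_mult_bounded[where b=c]) auto
      then show ?thesis unfolding w_def using integrable_bounded_square[OF D c] by (simp add: mult.commute)
    qed
    have werr: "W.err D = ennreal (\<integral>\<mu>. w D \<mu> \<partial>L)" if D: "D \<in> borel_measurable config_algebra" and c: "\<forall>\<mu>. \<bar>D \<mu>\<bar> \<le> c" for D c
      unfolding W.err_def w_def[symmetric] by (rule nn_integral_eq_integral[OF w_int[OF D c]]) (simp add: w_def)
    obtain g where g: "laplace_alg g" "W.err (\<lambda>\<mu>. G \<mu> - g \<mu>) < ennreal e"
      using W.laplace_alg_dense[OF G _ e] werr[OF G K] by auto
    obtain b where b: "\<forall>\<mu>. \<bar>g \<mu>\<bar> \<le> b" using laplace_alg_bounded[OF g(1)] by blast
    note gm [measurable] = laplace_alg_measurable[OF g(1)]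
    have Db: "\<forall>\<mu>. \<bar>G \<mu> - g \<mu>\<bar> \<le> K + b"
      using K b by (intro allI order_trans[OF abs_triangle_ineq4] add_mono) auto
    have Dm: "(\<lambda>\<mu>. G \<mu> - g \<mu>) \<in> borel_measurable config_algebra" by measurable
    have we: "(\<integral>\<mu>. w (\<lambda>\<mu>. G \<mu> - g \<mu>) \<mu> \<partial>L) \<le> e"
      using g(2) unfolding werr[OF Dm Db] by (metis ennreal_leI linorder_not_le order_less_imp_le)
    have iHG: "integrable L (\<lambda>\<mu>. 2 * (H \<mu> * G \<mu>) - (G \<mu>)\<^sup>2)" "integrable L (\<lambda>\<mu>. 2 * (H \<mu> * g \<mu>) - (g \<mu>)\<^sup>2)"
      using integrable_mult_bounded[OF iH G K] integrable_bounded_square[OF G K]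
        integrable_mult_bounded[OF iH gm b] integrable_bounded_square[OF gm b] by auto
    have "(\<integral>\<mu>. 2 * (H \<mu> * G \<mu>) - (G \<mu>)\<^sup>2 \<partial>L) \<le>
        (\<integral>\<mu>. (2 * (H \<mu> * g \<mu>) - (g \<mu>)\<^sup>2) + (2 + 2 * K) * w (\<lambda>\<mu>. G \<mu> - g \<mu>) \<mu> \<partial>L)"
    proof (intro integral_mono iHG Bochner_Integration.integrable_add Bochner_Integration.integrable_mult_right w_int[OF Dm Db])
      fix \<mu>
      define d where "d = G \<mu> - g \<mu>"
      have "H \<mu> * d \<le> \<bar>d\<bar> * \<bar>H \<mu>\<bar>" by (metis abs_ge_self abs_mult mult.commute)
      moreover have "- (G \<mu> * d) \<le> K * \<bar>d\<bar>"
      proof -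
        have "- (G \<mu> * d) \<le> \<bar>G \<mu>\<bar> * \<bar>d\<bar>" by (metis abs_ge_minus_self abs_mult)
        also have "\<dots> \<le> K * \<bar>d\<bar>" using K by (intro mult_right_mono) auto
        finally show ?thesis .
      qed
      moreover have "0 \<le> K * (\<bar>d\<bar> * \<bar>H \<mu>\<bar>)" "0 \<le> K * d\<^sup>2" "0 \<le> d\<^sup>2" using K0 by auto
      moreover have "2 * (H \<mu> * G \<mu>) - (G \<mu>)\<^sup>2 = (2 * (H \<mu> * g \<mu>) - (g \<mu>)\<^sup>2) + 2 * (H \<mu> * d) - 2 * (G \<mu> * d) + d\<^sup>2"
        unfolding d_def by (simp add: power2_eq_square algebra_simps)
      moreover have "(2 + 2 * K) * w (\<lambda>\<mu>. G \<mu> - g \<mu>) \<mu> =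
          2 * \<bar>d\<bar> + 2 * (\<bar>d\<bar> * \<bar>H \<mu>\<bar>) + 2 * d\<^sup>2 + 2 * (K * \<bar>d\<bar>) + 2 * (K * (\<bar>d\<bar> * \<bar>H \<mu>\<bar>)) + 2 * (K * d\<^sup>2)"
        unfolding w_def d_def[symmetric] by (simp add: algebra_simps)
      ultimately show "2 * (H \<mu> * G \<mu>) - (G \<mu>)\<^sup>2 \<le> (2 * (H \<mu> * g \<mu>) - (g \<mu>)\<^sup>2) + (2 + 2 * K) * w (\<lambda>\<mu>. G \<mu> - g \<mu>) \<mu>"
        by (smt (verit))
    qed
    also have "\<dots> = (\<integral>\<mu>. 2 * (H \<mu> * g \<mu>) - (g \<mu>)\<^sup>2 \<partial>L) + (2 + 2 * K) * (\<integral>\<mu>. w (\<lambda>\<mu>. G \<mu> - g \<mu>) \<mu> \<partial>L)"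
      using iHG(2) w_int[OF Dm Db] by (subst Bochner_Integration.integral_add) auto
    also have "\<dots> \<le> s + (2 + 2 * K) * e"
      using K0 we by (intro add_mono alg g mult_left_mono) auto
    also have "(2 + 2 * K) * e = \<epsilon>" using K0 by (simp add: e_def)
    finally show "(\<integral>\<mu>. 2 * (H \<mu> * G \<mu>) - (G \<mu>)\<^sup>2 \<partial>L) \<le> s + \<epsilon>" .
  qed
  define G where "G K \<mu> = (if \<bar>H \<mu>\<bar> \<le> real K then H \<mu> else 0)" for K :: nat and \<mu>
  have G [measurable]: "G K \<in> borel_measurable config_algebra" for K unfolding G_def by measurable
  have Gb: "\<forall>\<mu>. \<bar>G K \<mu>\<bar> \<le> real K" for K by (simp add: G_def)
  have "(\<integral>\<^sup>+\<mu>. ennreal ((H \<mu>)\<^sup>2) \<partial>L) = (\<integral>\<^sup>+\<mu>. (SUP K. ennreal ((G K \<mu>)\<^sup>2)) \<partial>L)"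
  proof (intro nn_integral_cong antisym)
    fix \<mu>
    obtain K :: nat where "\<bar>H \<mu>\<bar> \<le> real K" using real_arch_simple by blast
    then have "ennreal ((H \<mu>)\<^sup>2) = ennreal ((G K \<mu>)\<^sup>2)" by (simp add: G_def)
    then show "ennreal ((H \<mu>)\<^sup>2) \<le> (SUP K. ennreal ((G K \<mu>)\<^sup>2))" by (intro SUP_upper2[of K]) auto
    show "(SUP K. ennreal ((G K \<mu>)\<^sup>2)) \<le> ennreal ((H \<mu>)\<^sup>2)" by (intro SUP_least ennreal_leI) (simp add: G_def)
  qed
  also have "\<dots> = (SUP K. \<integral>\<^sup>+\<mu>. ennreal ((G K \<mu>)\<^sup>2) \<partial>L)"
    by (intro nn_integral_monotone_convergence_SUP) (auto simp: incseq_def le_fun_def G_def intro!: ennreal_leI)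
  also have "\<dots> \<le> ennreal s"
  proof (intro SUP_least)
    fix K
    have "(\<integral>\<^sup>+\<mu>. ennreal ((G K \<mu>)\<^sup>2) \<partial>L) = ennreal (\<integral>\<mu>. (G K \<mu>)\<^sup>2 \<partial>L)"
      by (rule nn_integral_eq_integral[OF integrable_bounded_square[OF G Gb]]) simp
    also have "(\<integral>\<mu>. (G K \<mu>)\<^sup>2 \<partial>L) = (\<integral>\<mu>. 2 * (H \<mu> * G K \<mu>) - (G K \<mu>)\<^sup>2 \<partial>L)"
      by (intro Bochner_Integration.integral_cong) (auto simp: G_def power2_eq_square)
    also have "\<dots> \<le> s" by (rule bdd[OF G Gb])
    finally show "(\<integral>\<^sup>+\<mu>. ennreal ((G K \<mu>)\<^sup>2) \<partial>L) \<le> ennreal s" by (simp add: ennreal_leI)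
  qed
  finally show ?thesis unfolding s(1) .
qed simp

text \<open>The converse is the same duality with the roles exchanged: the test kernels are truncations of the
  kernels of \<open>H\<close>.\<close>

lemma fock_norm2_le_nn_integral_square:
  assumes H: "admissible H" and L2: "(\<integral>\<^sup>+\<mu>. ennreal ((H \<mu>)\<^sup>2) \<partial>L) < \<infinity>"
  shows "fock_norm2 H \<le> (\<integral>\<^sup>+\<mu>. ennreal ((H \<mu>)\<^sup>2) \<partial>L)"
proof -
  note Hm [measurable] = admissible_measurable[OF H]
  note iH = admissible_integrable[OF H]
  let ?M = "\<lambda>k::nat. PiM {..<k} (\<lambda>_. \<Lambda>)"
  let ?T = "\<lambda>(k::nat) f. dmean {..<k} f"
  have iH2: "integrable L (\<lambda>\<mu>. (H \<mu>)\<^sup>2)" using L2 by (intro integrableI_nonneg) auto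
  define E where "E = (\<integral>\<mu>. (H \<mu>)\<^sup>2 \<partial>L)"
  have E: "(\<integral>\<^sup>+\<mu>. ennreal ((H \<mu>)\<^sup>2) \<partial>L) = ennreal E"
    unfolding E_def by (rule nn_integral_eq_integral[OF iH2]) simp
  (* The kernels of H, cut off at height N and restricted to the ball of radius N. *)
  define \<phi> where "\<phi> k N x = (if \<bar>?T k H x\<bar> \<le> real N \<and> (\<forall>i<k. x i \<in> loc_ball N) then ?T k H x else 0)" for k N x
  have \<phi>_box: "ennreal \<bar>\<phi> k N x\<bar> \<le> ennreal (real N) * box (loc_ball N) {..<k} x" for k N x
  proof (cases "\<forall>i<k. x i \<in> loc_ball N")
    case True
    then have "box (loc_ball N) {..<k} x = 1" by (auto simp: box_def intro!: prod.neutral)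
    then show ?thesis by (auto simp: \<phi>_def intro: ennreal_leI)
  qed (auto simp: \<phi>_def)
  have \<phi>_m: "\<phi> k N \<in> borel_measurable (PiM {..<k} (\<lambda>_. borel))" for k N
  proof -
    have [measurable]: "?T k H \<in> borel_measurable (PiM {..<k} (\<lambda>_. borel))" by (rule dmean_measurable[OF _ Hm]) simp
    have eq: "(\<forall>i<k. x i \<in> loc_ball N) = (\<forall>i\<in>{..<k}. x i \<in> loc_ball N)" for x by auto
    show ?thesis unfolding \<phi>_def[abs_def] eq by measurable
  qed
  have T\<phi>: "?T k H x * \<phi> k N x = (\<phi> k N x)\<^sup>2" for k N x by (simp add: \<phi>_def power2_eq_square)
  have pint: "integrable (?M k) (\<lambda>x. ?T k G x * \<phi> k N x)" if "admissible G" for G k N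
    by (rule pairing_integrable[OF _ that _ \<phi>_box \<phi>_m]) auto
  have \<phi>_int: "integrable (?M k) (\<lambda>x. (\<phi> k N x)\<^sup>2)" for k N
    using pint[OF H, of k N] by (simp add: T\<phi>)
  define s where "s n N = (\<Sum>k<n. (\<integral>x. (\<phi> k N x)\<^sup>2 \<partial>?M k) / fact k)" for n N
  have sE: "s n N \<le> E" for n N
  proof (rule field_le_epsilon)
    fix \<epsilon> :: real assume \<epsilon>: "0 < \<epsilon>"
    (* Each of the n pairings with a truncated kernel costs N e, and the second moment of g costs 2 e. *)
    define e where "e = \<epsilon> / (2 * real n * real N + 2)"
    have pos: "0 < 2 * real n * real N + 2" by (simp add: add_nonneg_pos)
    have e: "0 < e" using \<epsilon> pos by (simp add: e_def)
    interpret W: config_weight L "\<lambda>\<mu>. bweight N \<mu> + \<bar>H \<mu>\<bar>" 1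
    proof (intro config_weight.intro finite_measure_axioms config_weight_axioms.intro)
      have "(\<integral>\<^sup>+\<mu>. ennreal (bweight N \<mu> + \<bar>H \<mu>\<bar>) \<partial>L) = (\<integral>\<^sup>+\<mu>. ennreal (bweight N \<mu> ^ 1) + ennreal (norm (H \<mu>)) \<partial>L)"
        using order_trans[OF zero_le_one bweight_ge_1[of N]] by (intro nn_integral_cong) simp
      also have "\<dots> = (\<integral>\<^sup>+\<mu>. ennreal (bweight N \<mu> ^ 1) \<partial>L) + (\<integral>\<^sup>+\<mu>. ennreal (norm (H \<mu>)) \<partial>L)"
        by (rule nn_integral_add) auto
      also have "\<dots> < \<infinity>" using integrable_bweight_power[of N 1] iH by (simp add: integrable_iff_bounded)
      finally show "(\<integral>\<^sup>+\<mu>. ennreal (bweight N \<mu> + \<bar>H \<mu>\<bar>) \<partial>L) < \<infinity>" .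
      show "0 \<le> bweight N \<mu> + \<bar>H \<mu>\<bar>" for \<mu> using bweight_ge_1[of N \<mu>] by linarith
    qed auto
    have b1: "1 \<le> bweight N \<mu>" for \<mu> by (rule bweight_ge_1)
    have "W.err H = (\<integral>\<^sup>+\<mu>. ennreal (\<bar>H \<mu>\<bar> * bweight N \<mu>) + 2 * ennreal ((H \<mu>)\<^sup>2) \<partial>L)"
      unfolding W.err_def
    proof (intro nn_integral_cong)
      fix \<mu>
      have "\<bar>H \<mu>\<bar> * (bweight N \<mu> + \<bar>H \<mu>\<bar>) + 1 * (H \<mu>)\<^sup>2 = \<bar>H \<mu>\<bar> * bweight N \<mu> + 2 * (H \<mu>)\<^sup>2"
        by (simp add: distrib_left power2_eq_square abs_mult[symmetric])
      then show "ennreal (\<bar>H \<mu>\<bar> * (bweight N \<mu> + \<bar>H \<mu>\<bar>) + 1 * (H \<mu>)\<^sup>2) = ennreal (\<bar>H \<mu>\<bar> * bweight N \<mu>) + 2 * ennreal ((H \<mu>)\<^sup>2)"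
        using b1[of \<mu>] by (simp add: ennreal_mult)
    qed
    also have "\<dots> = (\<integral>\<^sup>+\<mu>. ennreal (\<bar>H \<mu>\<bar> * bweight N \<mu>) \<partial>L) + 2 * ennreal E"
      unfolding E[symmetric] by (simp add: nn_integral_add nn_integral_cmult)
    also have "\<dots> < \<infinity>" using admissible_finite[OF H, of N] by (simp add: ennreal_mult_less_top)
    finally obtain g where g: "laplace_alg g" "W.err (\<lambda>\<mu>. H \<mu> - g \<mu>) < ennreal e"
      using W.laplace_alg_dense[OF Hm _ e] by auto
    note gm [measurable] = laplace_alg_measurable[OF g(1)]
    obtain b where b: "\<forall>\<mu>. \<bar>g \<mu>\<bar> \<le> b" using laplace_alg_bounded[OF g(1)] by blast
    define D where "D \<mu> = H \<mu> - g \<mu>" for \<mu>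
    have D: "admissible D" unfolding D_def by (rule admissible_diff[OF H admissible_alg[OF g(1)]])
    note [measurable] = admissible_measurable[OF D]
    define w where "w \<mu> = \<bar>D \<mu>\<bar> * (bweight N \<mu> + \<bar>H \<mu>\<bar>) + 1 * (D \<mu>)\<^sup>2" for \<mu>
    have w0: "0 \<le> w \<mu>" for \<mu> using b1[of \<mu>] by (simp add: w_def)
    have wn: "(\<integral>\<^sup>+\<mu>. ennreal (w \<mu>) \<partial>L) < ennreal e" using g(2) by (simp add: W.err_def w_def D_def)
    have wi: "integrable L w" 
      by (rule integrableI_nonneg) (use w0 wn in \<open>auto simp: w_def[abs_def] intro: less_trans\<close>)
    have we: "(\<integral>\<mu>. w \<mu> \<partial>L) \<le> e"
      using wn e nn_integral_eq_integral[OF wi] w0 by (simp add: ennreal_less_iff)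
    have Eg: "(\<integral>\<mu>. (g \<mu>)\<^sup>2 \<partial>L) \<le> E + 2 * e"
    proof -
      have "(\<integral>\<mu>. (g \<mu>)\<^sup>2 \<partial>L) \<le> (\<integral>\<mu>. (H \<mu>)\<^sup>2 + 2 * w \<mu> \<partial>L)"
      proof (intro integral_mono Bochner_Integration.integrable_add iH2 Bochner_Integration.integrable_mult_right wi integrable_bounded_square[OF gm b])
        fix \<mu>
        have "(g \<mu>)\<^sup>2 = (H \<mu>)\<^sup>2 - 2 * (D \<mu> * H \<mu>) + (D \<mu>)\<^sup>2" unfolding D_def by (simp add: power2_eq_square algebra_simps)
        moreover have "- (D \<mu> * H \<mu>) \<le> \<bar>D \<mu>\<bar> * \<bar>H \<mu>\<bar>" by (metis abs_ge_minus_self abs_mult)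
        moreover have "w \<mu> = \<bar>D \<mu>\<bar> * bweight N \<mu> + \<bar>D \<mu>\<bar> * \<bar>H \<mu>\<bar> + (D \<mu>)\<^sup>2" by (simp add: w_def distrib_left)
        moreover have "0 \<le> \<bar>D \<mu>\<bar> * bweight N \<mu>" using b1[of \<mu>] by simp
        moreover have "0 \<le> (D \<mu>)\<^sup>2" by simp
        ultimately show "(g \<mu>)\<^sup>2 \<le> (H \<mu>)\<^sup>2 + 2 * w \<mu>" by linarith
      qed
      also have "\<dots> = E + 2 * (\<integral>\<mu>. w \<mu> \<partial>L)" unfolding E_def using iH2 wi by simp
      finally show ?thesis using we by linarith
    qed
    have Db: "(\<integral>\<^sup>+\<mu>. ennreal (\<bar>D \<mu>\<bar> * bweight N \<mu>) \<partial>L) \<le> ennreal e"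
    proof -
      have "(\<integral>\<^sup>+\<mu>. ennreal (\<bar>D \<mu>\<bar> * bweight N \<mu>) \<partial>L) \<le> (\<integral>\<^sup>+\<mu>. ennreal (w \<mu>) \<partial>L)"
        by (intro nn_integral_mono ennreal_leI) (simp add: w_def distrib_left)
      then show ?thesis using wn by simp
    qed
    have pD: "\<bar>\<integral>x. ?T k D x * \<phi> k N x \<partial>?M k\<bar> / fact k \<le> real N * e" for k
    proof -
      have "ennreal (norm (\<integral>x. ?T k D x * \<phi> k N x \<partial>?M k)) \<le> (\<integral>\<^sup>+x. ennreal (norm (?T k D x * \<phi> k N x)) \<partial>?M k)"
        by (rule integral_norm_bound_ennreal[OF pint[OF D]])
      also have "\<dots> \<le> ennreal (real N * fact (card {..<k})) * (\<integral>\<^sup>+\<mu>. ennreal (\<bar>D \<mu>\<bar> * bweight N \<mu>) \<partial>L)"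
        unfolding real_norm_def by (rule pairing_bound'[OF _ _ _ \<phi>_box]) auto
      also have "\<dots> \<le> ennreal (real N * fact k) * ennreal e" using Db by (intro mult_mono) auto
      also have "\<dots> = ennreal (real N * fact k * e)" using e by (simp add: ennreal_mult)
      finally have "\<bar>\<integral>x. ?T k D x * \<phi> k N x \<partial>?M k\<bar> \<le> real N * fact k * e" using e by (simp add: ennreal_le_iff)
      then show ?thesis by (simp add: field_simps)
    qed
    have split: "(\<integral>x. (\<phi> k N x)\<^sup>2 \<partial>?M k) = (\<integral>x. ?T k g x * \<phi> k N x \<partial>?M k) + (\<integral>x. ?T k D x * \<phi> k N x \<partial>?M k)" for k
    proof -
      have "AE x in ?M k. ?T k (\<lambda>\<mu>. g \<mu> + D \<mu>) x = ?T k g x + ?T k D x"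
        by (rule dmean_add[OF _ admissible_alg[OF g(1)] D]) simp
      then have ae: "AE x in ?M k. (\<phi> k N x)\<^sup>2 = ?T k g x * \<phi> k N x + ?T k D x * \<phi> k N x"
        by (rule AE_mp) (auto intro!: AE_I2 simp: D_def T\<phi>[symmetric] distrib_right)
      have "(\<integral>x. (\<phi> k N x)\<^sup>2 \<partial>?M k) = (\<integral>x. ?T k g x * \<phi> k N x + ?T k D x * \<phi> k N x \<partial>?M k)"
        by (rule integral_cong_AE[OF _ _ ae])
          (use \<phi>_int pint[OF D] pint[OF admissible_alg[OF g(1)]] in \<open>auto intro!: borel_measurable_integrable Bochner_Integration.integrable_add\<close>)
      then show ?thesis using pint[OF D] pint[OF admissible_alg[OF g(1)]] by simp
    qed
    have gk: "2 * (\<integral>x. ?T k g x * \<phi> k N x \<partial>?M k) \<le> (\<integral>x. (?T k g x)\<^sup>2 \<partial>?M k) + (\<integral>x. (\<phi> k N x)\<^sup>2 \<partial>?M k)" for k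
    proof -
      have "(\<integral>x. 2 * (?T k g x * \<phi> k N x) \<partial>?M k) \<le> (\<integral>x. (?T k g x)\<^sup>2 + (\<phi> k N x)\<^sup>2 \<partial>?M k)"
        by (intro integral_mono Bochner_Integration.integrable_add Bochner_Integration.integrable_mult_right
            \<phi>_int pint admissible_alg g alg_square_sums(2))
          (use sum_squares_bound in \<open>simp add: mult.assoc\<close>)
      then show ?thesis using \<phi>_int alg_square_sums(2)[OF g(1)] by simp
    qed
    have "2 * s n N = (\<Sum>k<n. 2 * (\<integral>x. ?T k g x * \<phi> k N x \<partial>?M k) / fact k + 2 * ((\<integral>x. ?T k D x * \<phi> k N x \<partial>?M k) / fact k))"
      unfolding s_def sum_distrib_left split by (simp add: add_divide_distrib distrib_left)
    also have "\<dots> \<le> (\<Sum>k<n. ((\<integral>x. (?T k g x)\<^sup>2 \<partial>?M k) + (\<integral>x. (\<phi> k N x)\<^sup>2 \<partial>?M k)) / fact k + 2 * (real N * e))"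
    proof (intro sum_mono add_mono divide_right_mono gk mult_left_mono)
      fix k
      have "(\<integral>x. ?T k D x * \<phi> k N x \<partial>?M k) / fact k \<le> \<bar>\<integral>x. ?T k D x * \<phi> k N x \<partial>?M k\<bar> / fact k"
        by (intro divide_right_mono) auto
      then show "(\<integral>x. ?T k D x * \<phi> k N x \<partial>?M k) / fact k \<le> real N * e" using pD[of k] by linarith
    qed auto
    also have "\<dots> = (\<Sum>k<n. (\<integral>x. (?T k g x)\<^sup>2 \<partial>?M k) / fact k) + s n N + real n * (2 * (real N * e))"
      unfolding s_def by (simp add: sum.distrib add_divide_distrib)
    also have "(\<Sum>k<n. (\<integral>x. (?T k g x)\<^sup>2 \<partial>?M k) / fact k) \<le> (\<integral>\<mu>. (g \<mu>)\<^sup>2 \<partial>L)"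
      using alg_square_sums(1)[OF g(1)] by (intro sum_le_suminf[of _ "{..<n}", THEN order_trans]) (auto simp: sums_iff)
    finally have "s n N \<le> E + 2 * e + real n * (2 * (real N * e))" using Eg by linarith
    also have "\<dots> = E + (2 * real n * real N + 2) * e" by (simp add: algebra_simps)
    also have "(2 * real n * real N + 2) * e = \<epsilon>" using pos by (simp add: e_def)
    finally show "s n N \<le> E + \<epsilon>" .
  qed
  have \<phi>_nn: "(\<integral>\<^sup>+x. ennreal ((\<phi> k N x)\<^sup>2) \<partial>?M k) = ennreal (\<integral>x. (\<phi> k N x)\<^sup>2 \<partial>?M k)" for k N
    by (rule nn_integral_eq_integral[OF \<phi>_int]) simp
  have lim: "(\<lambda>N. \<integral>\<^sup>+x. ennreal ((\<phi> k N x)\<^sup>2) \<partial>?M k) \<longlonglongrightarrow> (\<integral>\<^sup>+x. ennreal ((?T k H x)\<^sup>2) \<partial>?M k)" for k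
  proof -
    have mono: "(\<phi> k M x)\<^sup>2 \<le> (\<phi> k N x)\<^sup>2" if "M \<le> N" for M N x
      using loc_ball_mono[OF that] that by (auto simp: \<phi>_def)
    have "(\<integral>\<^sup>+x. ennreal ((?T k H x)\<^sup>2) \<partial>?M k) = (\<integral>\<^sup>+x. (SUP N. ennreal ((\<phi> k N x)\<^sup>2)) \<partial>?M k)"
    proof (intro nn_integral_cong antisym)
      fix x
      obtain N1 :: nat where N1: "\<bar>?T k H x\<bar> \<le> real N1" using real_arch_simple by blast
      obtain N2 where N2: "x ` {..<k} \<subseteq> loc_ball N2"
        using bounded_subset_loc_ball[OF finite_imp_bounded[OF finite_imageI[OF finite_lessThan]]] by blast
      have "\<phi> k (max N1 N2) x = ?T k H x"
        using N1 N2 loc_ball_mono[of N2 "max N1 N2"] by (auto simp: \<phi>_def)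
      then show "ennreal ((?T k H x)\<^sup>2) \<le> (SUP N. ennreal ((\<phi> k N x)\<^sup>2))"
        by (intro SUP_upper2[of "max N1 N2"]) auto
      show "(SUP N. ennreal ((\<phi> k N x)\<^sup>2)) \<le> ennreal ((?T k H x)\<^sup>2)"
        by (intro SUP_least ennreal_leI) (simp add: \<phi>_def)
    qed
    also have "\<dots> = (SUP N. \<integral>\<^sup>+x. ennreal ((\<phi> k N x)\<^sup>2) \<partial>?M k)"
      by (intro nn_integral_monotone_convergence_SUP)
        (use \<phi>_m mono in \<open>auto simp: incseq_def le_fun_def measurable_pow_iff intro!: ennreal_leI\<close>)
    finally show ?thesis
      using mono by (simp only:) (intro LIMSEQ_SUP, auto simp: incseq_def intro!: nn_integral_mono ennreal_leI)
  qed
  show ?thesis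
    unfolding fock_norm2_def suminf_eq_SUP
  proof (intro SUP_least)
    fix n
    have "(\<lambda>N. \<Sum>k<n. ennreal (1 / fact k) * (\<integral>\<^sup>+x. ennreal ((\<phi> k N x)\<^sup>2) \<partial>?M k)) \<longlonglongrightarrow>
        (\<Sum>k<n. ennreal (1 / fact k) * (\<integral>\<^sup>+x. ennreal ((?T k H x)\<^sup>2) \<partial>?M k))"
      by (intro tendsto_sum ennreal_tendsto_cmult lim) auto
    moreover have "(\<Sum>k<n. ennreal (1 / fact k) * (\<integral>\<^sup>+x. ennreal ((\<phi> k N x)\<^sup>2) \<partial>?M k)) \<le> ennreal E" for N
    proof -
      have "(\<Sum>k<n. ennreal (1 / fact k) * (\<integral>\<^sup>+x. ennreal ((\<phi> k N x)\<^sup>2) \<partial>?M k)) = ennreal (s n N)"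
        unfolding s_def \<phi>_nn by (subst sum_ennreal[symmetric]) (auto simp: ennreal_mult[symmetric] intro!: sum.cong)
      then show ?thesis using sE by (simp add: ennreal_leI)
    qed
    ultimately show "(\<Sum>k<n. ennreal (1 / fact k) * (\<integral>\<^sup>+x. ennreal ((?T k H x)\<^sup>2) \<partial>?M k)) \<le> (\<integral>\<^sup>+\<mu>. ennreal ((H \<mu>)\<^sup>2) \<partial>L)"
      unfolding E by (intro LIMSEQ_le_const2) auto
  qed
qed

text \<open>An identity in \<open>[0, \<infinity>]\<close>: both sides are finite or both are infinite.\<close>

theorem fock_isometry:
  assumes H: "admissible H"
  shows "(\<integral>\<^sup>+\<mu>. ennreal ((H \<mu>)\<^sup>2) \<partial>L) = fock_norm2 H"
proof (cases "(\<integral>\<^sup>+\<mu>. ennreal ((H \<mu>)\<^sup>2) \<partial>L) < \<infinity>")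
  case True
  then show ?thesis
    by (intro antisym nn_integral_square_le_fock_norm2 fock_norm2_le_nn_integral_square H)
next
  case False
  then have "(\<integral>\<^sup>+\<mu>. ennreal ((H \<mu>)\<^sup>2) \<partial>L) = top" by (metis infinity_ennreal_def top.not_eq_extremum)
  then show ?thesis using nn_integral_square_le_fock_norm2[OF H] by (simp add: top_unique)
qed

text \<open>Adding points only increases the weight, and by the Mecke equation the sum over all sets of added
  points is controlled by \<open>\<bbbE>[\<bar>F\<bar> exp(2 \<eta>(B))]\<close> up to a constant.  This is finite, because both factors are
  square integrable.\<close>

lemma AE_admissible_acost:
  fixes I :: "'i set"
  assumes I: "finite I" and F [measurable]: "F \<in> borel_measurable config_algebra"
    and L2: "(\<integral>\<^sup>+\<mu>. ennreal ((F \<mu>)\<^sup>2) \<partial>L) < \<infinity>"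
  shows "AE z in PiM I (\<lambda>_. \<Lambda>). admissible (\<lambda>\<mu>. acost I F \<mu> z)"
proof -
  define g where "g n \<mu> = \<bar>F \<mu>\<bar> * bweight n \<mu>" for n \<mu>
  have g0: "0 \<le> g n \<mu>" for n \<mu> using bweight_ge_1[of n \<mu>] by (simp add: g_def)
  have gm [measurable]: "g n \<in> borel_measurable config_algebra" for n unfolding g_def[abs_def] by measurable
  let ?f = "\<lambda>n x. box (loc_ball n) I x * (\<Sum>A\<in>Pow I. \<integral>\<^sup>+\<mu>. ennreal (g n (add_points A x \<mu>)) \<partial>L)"
  have "AE x in PiM I (\<lambda>_. \<Lambda>). ?f n x \<noteq> \<infinity>" for n
  proof (rule nn_integral_PInf_AE)
    show "?f n \<in> borel_measurable (PiM I (\<lambda>_. \<Lambda>))"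
      unfolding measurable_pow_iff
      by (intro borel_measurable_times_ennreal box_measurable I borel_measurable_sum measurable_nn_integral_law loc_ball_borel
          measurable_compose[OF measurable_add_points_pair[OF I], of _ "\<lambda>\<mu>. ennreal (g n \<mu>)"]) auto
    have "(\<integral>\<^sup>+x. ?f n x \<partial>PiM I (\<lambda>_. \<Lambda>)) \<le> (\<integral>\<^sup>+\<mu>. ennreal (g n \<mu>) * (emeasure \<mu> (loc_ball n) + emeasure \<Lambda> (loc_ball n)) ^ card I \<partial>L)"
      by (rule nn_integral_sum_add_points_le[OF I]) measurable
    also have "\<dots> \<le> ennreal (fact (card I)) * (\<integral>\<^sup>+\<mu>. ennreal (g n \<mu> * bweight n \<mu>) \<partial>L)"
      using nn_integral_power_le[OF gm, of n n "card I"] g0 by simp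
    also have "(\<integral>\<^sup>+\<mu>. ennreal (g n \<mu> * bweight n \<mu>) \<partial>L) \<le> (\<integral>\<^sup>+\<mu>. ennreal ((F \<mu>)\<^sup>2) + ennreal (bweight n \<mu> ^ 4) \<partial>L)"
    proof (intro nn_integral_mono)
      fix \<mu>
      define t where "t = \<bar>F \<mu>\<bar> * (bweight n \<mu>)\<^sup>2"
      have "2 * t \<le> \<bar>F \<mu>\<bar>\<^sup>2 + ((bweight n \<mu>)\<^sup>2)\<^sup>2"
        using sum_squares_bound[of "\<bar>F \<mu>\<bar>" "(bweight n \<mu>)\<^sup>2"] by (simp add: t_def mult.assoc)
      moreover have "0 \<le> t" by (simp add: t_def)
      moreover have "((bweight n \<mu>)\<^sup>2)\<^sup>2 = bweight n \<mu> ^ 4" by (simp flip: power_mult)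
      moreover have "g n \<mu> * bweight n \<mu> = t" by (simp add: g_def t_def power2_eq_square mult.assoc)
      ultimately have "g n \<mu> * bweight n \<mu> \<le> (F \<mu>)\<^sup>2 + bweight n \<mu> ^ 4"
        by simp
      then have "ennreal (g n \<mu> * bweight n \<mu>) \<le> ennreal ((F \<mu>)\<^sup>2 + bweight n \<mu> ^ 4)" by (rule ennreal_leI)
      then show "ennreal (g n \<mu> * bweight n \<mu>) \<le> ennreal ((F \<mu>)\<^sup>2) + ennreal (bweight n \<mu> ^ 4)"
        by (subst ennreal_plus[symmetric]) auto
    qed
    also have "\<dots> = (\<integral>\<^sup>+\<mu>. ennreal ((F \<mu>)\<^sup>2) \<partial>L) + (\<integral>\<^sup>+\<mu>. ennreal (bweight n \<mu> ^ 4) \<partial>L)"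
      by (rule nn_integral_add) auto
    finally have "(\<integral>\<^sup>+x. ?f n x \<partial>PiM I (\<lambda>_. \<Lambda>)) \<le>
        ennreal (fact (card I)) * ((\<integral>\<^sup>+\<mu>. ennreal ((F \<mu>)\<^sup>2) \<partial>L) + (\<integral>\<^sup>+\<mu>. ennreal (bweight n \<mu> ^ 4) \<partial>L))"
      by (simp add: mult_left_mono)
    also have "\<dots> < \<infinity>" using L2 integrable_bweight_power[of n 4] by (simp add: ennreal_mult_less_top)
    finally show "(\<integral>\<^sup>+x. ?f n x \<partial>PiM I (\<lambda>_. \<Lambda>)) \<noteq> \<infinity>" by simp
  qed
  then have "AE x in PiM I (\<lambda>_. \<Lambda>). \<forall>n. ?f n x \<noteq> \<infinity>" by (simp add: AE_all_countable)
  then show ?thesis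
  proof (rule AE_mp, intro AE_I2 impI)
    fix x assume "x \<in> space (PiM I (\<lambda>_. \<Lambda>))" and fin: "\<forall>n. ?f n x \<noteq> \<infinity>"
    then have x: "x \<in> space (PiM I (\<lambda>_. borel))" by (simp add: space_pow)
    obtain n0 where n0: "x ` I \<subseteq> loc_ball n0"
      using bounded_subset_loc_ball[OF finite_imp_bounded[OF finite_imageI[OF I]]] by blast
    have add_m: "(\<lambda>\<mu>. add_points A x \<mu>) \<in> measurable config_algebra config_algebra" if "A \<in> Pow I" for A
      using that I by (intro measurable_add_points) (auto intro: finite_subset)
    show "admissible (\<lambda>\<mu>. acost I F \<mu> x)"
      unfolding admissible_def
    proof (intro conjI allI measurable_acost I F x)
      fix n
      define m where "m = max n n0"
      have "x ` I \<subseteq> loc_ball m" using n0 loc_ball_mono[of n0 m] by (auto simp: m_def)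
      then have "box (loc_ball m) I x = 1" by (auto simp: box_def intro!: prod.neutral)
      with fin have sum_fin: "(\<Sum>A\<in>Pow I. \<integral>\<^sup>+\<mu>. ennreal (g m (add_points A x \<mu>)) \<partial>L) \<noteq> \<infinity>" by (metis mult_1)
      have "(\<integral>\<^sup>+\<mu>. ennreal (\<bar>acost I F \<mu> x\<bar> * bweight n \<mu>) \<partial>L) \<le> (\<integral>\<^sup>+\<mu>. (\<Sum>A\<in>Pow I. ennreal (g m (add_points A x \<mu>))) \<partial>L)"
      proof (intro nn_integral_mono)
        fix \<mu> assume "\<mu> \<in> space L"
        then have \<mu>: "\<mu> \<in> config_space" by simp
        have bw: "bweight n \<mu> \<le> bweight m (add_points A x \<mu>)" if A: "A \<in> Pow I" for A
        proof -
          have fA: "finite A" using A I finite_subset by auto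
          have sub: "loc_ball n \<subseteq> loc_ball m" by (intro loc_ball_mono) (simp add: m_def)
          have "emeasure \<mu> (loc_ball n) \<le> emeasure \<mu> (loc_ball m)" using sub \<mu> by (intro emeasure_mono) auto
          also have "\<dots> \<le> emeasure (add_points A x \<mu>) (loc_ball m)" using \<mu> fA by (simp add: emeasure_add_points)
          finally have 1: "measure \<mu> (loc_ball n) \<le> measure (add_points A x \<mu>) (loc_ball m)"
            using \<mu> fA by (simp add: count_eq)
          have "emeasure \<Lambda> (loc_ball n) \<le> emeasure \<Lambda> (loc_ball m)" using sub by (intro emeasure_mono) auto
          then have 2: "measure \<Lambda> (loc_ball n) \<le> measure \<Lambda> (loc_ball m)"
            using int_finite[of "loc_ball m"] unfolding measure_def by (intro enn2real_mono) auto
          show ?thesis using 1 2 by (simp add: bweight_def)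
        qed
        have "\<bar>acost I F \<mu> x\<bar> * bweight n \<mu> \<le> (\<Sum>A\<in>Pow I. \<bar>F (add_points A x \<mu>)\<bar>) * bweight n \<mu>"
          using bweight_ge_1[of n \<mu>] by (intro mult_right_mono acost_abs_le) auto
        also have "\<dots> \<le> (\<Sum>A\<in>Pow I. g m (add_points A x \<mu>))"
          unfolding sum_distrib_right g_def by (intro sum_mono mult_left_mono bw) auto
        finally show "ennreal (\<bar>acost I F \<mu> x\<bar> * bweight n \<mu>) \<le> (\<Sum>A\<in>Pow I. ennreal (g m (add_points A x \<mu>)))"
          using g0 by (simp add: sum_ennreal ennreal_leI)
      qed
      also have "\<dots> = (\<Sum>A\<in>Pow I. \<integral>\<^sup>+\<mu>. ennreal (g m (add_points A x \<mu>)) \<partial>L)"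
        by (rule nn_integral_sum) (use measurable_compose[OF add_m gm] in \<open>auto simp: measurable_law_iff\<close>)
      also have "\<dots> < \<infinity>" using sum_fin by (simp add: less_top)
      finally show "(\<integral>\<^sup>+\<mu>. ennreal (\<bar>acost I F \<mu> x\<bar> * bweight n \<mu>) \<partial>L) < \<infinity>" .
    qed
  qed
qed

end

lemma acost_fun_cong:
  "finite I \<Longrightarrow> \<mu> \<in> config_space \<Longrightarrow> (\<And>\<nu>. \<nu> \<in> config_space \<Longrightarrow> f \<nu> = g \<nu>) \<Longrightarrow> acost I f \<mu> x = acost I g \<mu> x"
  unfolding acost_def by (intro sum.cong refl arg_cong2[where f="(*)"]) (meson PowD add_points_config finite_subset)

definition concat_tuple :: "nat \<Rightarrow> nat \<Rightarrow> (nat \<Rightarrow> 'a) \<Rightarrow> (nat \<Rightarrow> 'a) \<Rightarrow> nat \<Rightarrow> 'a" where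
  "concat_tuple l k z y = (\<lambda>i\<in>{..<l + k}. if i < l then z i else y (i - l))"

lemma acost_concat:
  assumes \<mu>: "\<mu> \<in> config_space"
  shows "acost {..<l + k} F \<mu> (concat_tuple l k z y) = acost {..<k} (\<lambda>\<nu>. acost {..<l} F \<nu> z) \<mu> y"
proof -
  let ?c = "concat_tuple l k z y"
  have Un: "{..<l + k} = {..<l} \<union> {l..<l + k}" and disj: "{..<l} \<inter> {l..<l + k} = {}" by auto
  have "acost {..<l + k} F \<mu> ?c = acost {l..<l + k} (\<lambda>\<nu>. acost {..<l} F \<nu> ?c) \<mu> ?c"
    unfolding Un by (rule acost_Un[OF _ _ disj \<mu>]) auto
  also have "\<dots> = acost {l..<l + k} (\<lambda>\<nu>. acost {..<l} F \<nu> z) \<mu> ?c"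
    using \<mu> by (intro acost_fun_cong acost_cong) (auto simp: concat_tuple_def)
  also have "{l..<l + k} = (\<lambda>i. i + l) ` {..<k}"
  proof (intro equalityI subsetI)
    fix i assume "i \<in> {l..<l + k}"
    then have "i = (i - l) + l" "i - l \<in> {..<k}" by auto
    then show "i \<in> (\<lambda>i. i + l) ` {..<k}" by (rule image_eqI)
  qed auto
  also have "acost ((\<lambda>i. i + l) ` {..<k}) (\<lambda>\<nu>. acost {..<l} F \<nu> z) \<mu> ?c = acost {..<k} (\<lambda>\<nu>. acost {..<l} F \<nu> z) \<mu> (?c \<circ> (\<lambda>i. i + l))"
    using \<mu> by (intro acost_reindex) auto
  also have "\<dots> = acost {..<k} (\<lambda>\<nu>. acost {..<l} F \<nu> z) \<mu> y"
    using \<mu> by (intro acost_cong) (auto simp: concat_tuple_def)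
  finally show ?thesis .
qed

context poisson_law begin

text \<open>The kernels of \<open>D\<^sup>l\<^sub>z F\<close> are those of \<open>F\<close> with the first \<open>l\<close> variables fixed at \<open>z\<close>.\<close>

theorem fock_acost:
  assumes F: "F \<in> borel_measurable config_algebra"
    and L2: "(\<integral>\<^sup>+\<mu>. ennreal ((F \<mu>)\<^sup>2) \<partial>L) < \<infinity>"
  shows "AE z in PiM {..<l} (\<lambda>_. \<Lambda>). (\<integral>\<^sup>+\<mu>. ennreal ((acost {..<l} F \<mu> z)\<^sup>2) \<partial>L) =
    (\<Sum>k. ennreal (1 / fact k) * (\<integral>\<^sup>+y. ennreal ((dmean {..<l + k} F (concat_tuple l k z y))\<^sup>2) \<partial>PiM {..<k} (\<lambda>_. \<Lambda>)))"
  using AE_admissible_acost[OF finite_lessThan F L2, of l]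
proof (rule AE_mp, intro AE_I2 impI)
  fix z assume "admissible (\<lambda>\<mu>. acost {..<l} F \<mu> z)"
  from fock_isometry[OF this]
  have "(\<integral>\<^sup>+\<mu>. ennreal ((acost {..<l} F \<mu> z)\<^sup>2) \<partial>L) = fock_norm2 (\<lambda>\<mu>. acost {..<l} F \<mu> z)" .
  moreover have "dmean {..<k} (\<lambda>\<mu>. acost {..<l} F \<mu> z) y = dmean {..<l + k} F (concat_tuple l k z y)" for k y
    unfolding dmean_def by (intro Bochner_Integration.integral_cong) (auto simp: acost_concat)
  ultimately show "(\<integral>\<^sup>+\<mu>. ennreal ((acost {..<l} F \<mu> z)\<^sup>2) \<partial>L) =
    (\<Sum>k. ennreal (1 / fact k) * (\<integral>\<^sup>+y. ennreal ((dmean {..<l + k} F (concat_tuple l k z y))\<^sup>2) \<partial>PiM {..<k} (\<lambda>_. \<Lambda>)))"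
    by (simp add: fock_norm2_def)
qed

end

section \<open>Subtracting points\<close>

lemma sub_cost_add_point:
  assumes "\<mu> \<in> config_space"
  shows "sub_cost x F (add_point x \<mu>) = F (add_point x \<mu>) - F \<mu>"
  using remove_add_point[OF assms, of x] by (simp add: sub_cost_def)

text \<open>The operator that acts first removes the last of the added points and leaves the others alone, so it
  is an add-one cost of the configuration without that point.\<close>

lemma sub_cost_iter_add_points:
  assumes "\<mu> \<in> config_space"
  shows "sub_cost_iter l z F (add_points {..<l} z \<mu>) = acost {..<l} F \<mu> z"
  using assms
proof (induction l arbitrary: F \<mu>)
  case (Suc l)
  let ?\<mu> = "add_point (z l) \<mu>"
  have \<mu>: "?\<mu> \<in> config_space" using Suc.prems by simp
  have "sub_cost_iter (Suc l) z F (add_points {..<Suc l} z \<mu>) =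
      sub_cost_iter l z (sub_cost (z l) F) (add_points {..<l} z ?\<mu>)"
    using Suc.prems by (simp add: lessThan_Suc add_points_insert)
  also have "\<dots> = acost {..<l} (sub_cost (z l) F) ?\<mu> z" by (rule Suc.IH[OF \<mu>])
  also have "\<dots> = acost {..<l} F ?\<mu> z - acost {..<l} F \<mu> z"
    unfolding acost_def sum_subtractf[symmetric] right_diff_distrib[symmetric]
  proof (intro sum.cong refl arg_cong2[where f="(*)"])
    fix A assume "A \<in> Pow {..<l}"
    then have "finite A" using finite_subset by auto
    then show "sub_cost (z l) F (add_points A z ?\<mu>) = F (add_points A z ?\<mu>) - F (add_points A z \<mu>)"
      using Suc.prems by (simp add: add_points_add_point sub_cost_add_point)
  qed
  also have "\<dots> = acost {..<Suc l} F \<mu> z"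
    using Suc.prems by (simp add: lessThan_Suc acost_insert)
  finally show ?case .
qed simp

text \<open>Whether \<open>\<mu>\<close> charges \<open>x\<close> is jointly measurable in \<open>\<mu>\<close> and \<open>x\<close>, since \<open>\<mu>{x}\<close> is the integral of the
  indicator of the diagonal.\<close>

lemma measurable_sub_cost:
  fixes p :: "'k \<Rightarrow> 'a::polish_space"
  assumes p [measurable]: "p \<in> measurable K borel"
    and G [measurable]: "(\<lambda>q. G (fst q) (snd q)) \<in> borel_measurable (K \<Otimes>\<^sub>M config_algebra)"
  shows "(\<lambda>q. sub_cost (p (fst q)) (G (fst q)) (snd q)) \<in> borel_measurable (K \<Otimes>\<^sub>M config_algebra)"
proof -
  let ?M = "K \<Otimes>\<^sub>M config_algebra :: ('k \<times> 'a measure) measure"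
  define e where "e q = emeasure (snd q) {p (fst q)}" for q :: "'k \<times> 'a measure"
  have cfg: "q \<in> space ?M \<Longrightarrow> snd q \<in> config_space" for q by (auto simp: space_pair_measure)
  have e [measurable]: "e \<in> borel_measurable ?M"
  proof -
    have "(\<lambda>q. \<integral>\<^sup>+y. indicator {y. y = p (fst q)} y \<partial>snd q) \<in> borel_measurable ?M"
    proof (rule measurable_nn_integral_config)
      have "{w \<in> space (?M \<Otimes>\<^sub>M borel). snd w = p (fst (fst w))} \<in> sets (?M \<Otimes>\<^sub>M borel)"
        by (rule measurable_equality_set) measurable
      then have "(indicator {w \<in> space (?M \<Otimes>\<^sub>M borel). snd w = p (fst (fst w))} :: _ \<Rightarrow> ennreal) \<in> borel_measurable (?M \<Otimes>\<^sub>M borel)"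
        by (rule borel_measurable_indicator)
      then show "(\<lambda>(q, y). indicator {y. y = p (fst q)} y :: ennreal) \<in> borel_measurable (?M \<Otimes>\<^sub>M borel)"
        by (rule measurable_cong[THEN iffD1, rotated]) (auto simp: indicator_def)
    qed measurable
    then show ?thesis
      by (rule measurable_cong[THEN iffD1, rotated]) (auto simp: e_def cfg)
  qed
  (* Without the case distinction the difference of measures could leave the space of configurations. *)
  define R where "R q = (if e q > 0 then diff_measure (snd q) (return borel (p (fst q))) else snd q)" for q
  have R [measurable]: "R \<in> measurable ?M config_algebra"
  proof (rule measurable_configI)
    fix q assume "q \<in> space ?M"
    from cfg[OF this] show "R q \<in> config_space" by (simp add: R_def e_def remove_point_config)
  next
    fix B :: "'a set" assume [measurable]: "B \<in> sets borel"
    have "(\<lambda>q. if e q > 0 then emeasure (snd q) B - indicator B (p (fst q)) else emeasure (snd q) B) \<in> borel_measurable ?M"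
      by measurable
    then show "(\<lambda>q. emeasure (R q) B) \<in> borel_measurable ?M"
      by (rule measurable_cong[THEN iffD1, rotated]) (auto simp: R_def e_def cfg emeasure_remove_point)
  qed
  have GR: "(\<lambda>q. G (fst q) (R q)) \<in> borel_measurable ?M"
    using measurable_compose[OF measurable_Pair[OF measurable_fst R] G] by simp
  have "(\<lambda>q. (G (fst q) (snd q) - G (fst q) (R q)) * (if e q > 0 then 1 else 0)) \<in> borel_measurable ?M"
    by (intro borel_measurable_times borel_measurable_diff G GR) measurable
  then show ?thesis
    by (rule measurable_cong[THEN iffD1, rotated]) (simp add: sub_cost_def R_def e_def)
qed

lemma measurable_sub_cost_iter:
  fixes z :: "'k \<Rightarrow> nat \<Rightarrow> 'a::polish_space"
  assumes "\<And>i. i < l \<Longrightarrow> (\<lambda>k. z k i) \<in> measurable K borel"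
    and "(\<lambda>q. G (fst q) (snd q)) \<in> borel_measurable (K \<Otimes>\<^sub>M config_algebra)"
  shows "(\<lambda>q. sub_cost_iter l (z (fst q)) (G (fst q)) (snd q)) \<in> borel_measurable (K \<Otimes>\<^sub>M config_algebra)"
  using assms
proof (induction l arbitrary: G)
  case (Suc l)
  have "(\<lambda>q. sub_cost (z (fst q) l) (G (fst q)) (snd q)) \<in> borel_measurable (K \<Otimes>\<^sub>M config_algebra)"
    by (rule measurable_sub_cost[of "\<lambda>k. z k l" K G]) (use Suc.prems in auto)
  with Suc.IH[of "\<lambda>k. sub_cost (z k l) (G k)"] Suc.prems(1) show ?case by simp
qed simp

lemma nn_integral_factorial_measure:
  assumes \<mu>: "\<mu> \<in> config_space" and f: "f \<in> borel_measurable (PiM {..<l} (\<lambda>_. borel))"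
  shows "(\<integral>\<^sup>+z. f z \<partial>factorial_measure l \<mu>) = (\<integral>\<^sup>+z. indicator {z. inj_on z {..<l}} z * f z \<partial>PiM {..<l} (\<lambda>_. \<mu>))"
  unfolding factorial_measure_def
  using f borel_measurable_indicator_inj[of "{..<l}", where 'a='a] sets_PiM_config[OF \<mu>, of "{..<l}"]
  by (intro nn_integral_density) (auto cong: measurable_cong_sets)

section \<open>Reindexing and concatenating tuples\<close>

context poisson_law begin

lemma nn_integral_pow_permute:
  fixes \<pi> :: "'i \<Rightarrow> 'i"
  assumes I: "finite I" and \<pi>: "bij_betw \<pi> I I" and f: "f \<in> borel_measurable (PiM I (\<lambda>_. borel))"
  shows "(\<integral>\<^sup>+x. f (\<lambda>i\<in>I. x (\<pi> i)) \<partial>PiM I (\<lambda>_. \<Lambda>)) = (\<integral>\<^sup>+x. f x \<partial>PiM I (\<lambda>_. \<Lambda>))"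
proof -
  let ?M = "PiM I (\<lambda>_. \<Lambda>)"
  have \<pi>I: "i \<in> I \<Longrightarrow> \<pi> i \<in> I" for i using \<pi> by (auto simp: bij_betw_def)
  have m: "(\<lambda>x. \<lambda>i\<in>I. x (\<pi> i)) \<in> measurable ?M ?M"
    by (intro measurable_restrict measurable_component_singleton \<pi>I)
  define \<rho> where "\<rho> = the_inv_into I \<pi>"
  have \<rho>: "bij_betw \<rho> I I" unfolding \<rho>_def by (rule bij_betw_the_inv_into[OF \<pi>])
  have \<rho>I: "j \<in> I \<Longrightarrow> \<rho> j \<in> I" for j using \<rho> by (auto simp: bij_betw_def)
  have \<rho>\<pi>: "i \<in> I \<Longrightarrow> \<rho> (\<pi> i) = i" for i unfolding \<rho>_def using \<pi> by (auto simp: bij_betw_def the_inv_into_f_f)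
  have \<pi>\<rho>: "i \<in> I \<Longrightarrow> \<pi> (\<rho> i) = i" for i unfolding \<rho>_def using \<pi> by (auto simp: bij_betw_def f_the_inv_into_f)
  have "distr ?M ?M (\<lambda>x. \<lambda>i\<in>I. x (\<pi> i)) = ?M"
  proof (rule pow.PiM_eqI[OF I])
    fix A :: "'i \<Rightarrow> 'a set" assume A: "\<And>i. i \<in> I \<Longrightarrow> A i \<in> sets \<Lambda>"
    have "emeasure (distr ?M ?M (\<lambda>x. \<lambda>i\<in>I. x (\<pi> i))) (Pi\<^sub>E I A) = emeasure ?M ((\<lambda>x. \<lambda>i\<in>I. x (\<pi> i)) -` Pi\<^sub>E I A \<inter> space ?M)"
      using I A by (intro emeasure_distr m sets_PiM_I_finite)
    also have "(\<lambda>x. \<lambda>i\<in>I. x (\<pi> i)) -` Pi\<^sub>E I A \<inter> space ?M = Pi\<^sub>E I (\<lambda>j. A (\<rho> j))"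
    proof (intro set_eqI iffI)
      fix x assume x: "x \<in> (\<lambda>x. \<lambda>i\<in>I. x (\<pi> i)) -` Pi\<^sub>E I A \<inter> space ?M"
      then have "x (\<pi> i) \<in> A i" if "i \<in> I" for i using that by (auto simp: PiE_iff)
      from this[OF \<rho>I] x show "x \<in> Pi\<^sub>E I (\<lambda>j. A (\<rho> j))" by (auto simp: PiE_iff space_PiM \<pi>\<rho>)
    next
      fix x assume x: "x \<in> Pi\<^sub>E I (\<lambda>j. A (\<rho> j))"
      then have "x (\<pi> i) \<in> A i" if "i \<in> I" for i using \<pi>I[OF that] \<rho>\<pi>[OF that] by (metis PiE_mem)
      with x show "x \<in> (\<lambda>x. \<lambda>i\<in>I. x (\<pi> i)) -` Pi\<^sub>E I A \<inter> space ?M" by (auto simp: space_PiM PiE_iff)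
    qed
    also have "emeasure ?M (Pi\<^sub>E I (\<lambda>j. A (\<rho> j))) = (\<Prod>j\<in>I. emeasure \<Lambda> (A (\<rho> j)))"
      using A \<rho>I by (intro pow.emeasure_PiM I) auto
    also have "\<dots> = (\<Prod>i\<in>I. emeasure \<Lambda> (A i))" by (rule prod.reindex_bij_betw[OF \<rho>])
    finally show "emeasure (distr ?M ?M (\<lambda>x. \<lambda>i\<in>I. x (\<pi> i))) (Pi\<^sub>E I A) = (\<Prod>i\<in>I. emeasure \<Lambda> (A i))" .
  qed simp
  then have "(\<integral>\<^sup>+x. f x \<partial>?M) = (\<integral>\<^sup>+x. f x \<partial>distr ?M ?M (\<lambda>x. \<lambda>i\<in>I. x (\<pi> i)))" by simp
  also have "\<dots> = (\<integral>\<^sup>+x. f (\<lambda>i\<in>I. x (\<pi> i)) \<partial>?M)"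
    using f by (intro nn_integral_distr m) (simp add: measurable_pow_iff)
  finally show ?thesis ..
qed

lemma concat_tuple_measurable:
  "(\<lambda>p. concat_tuple l k (fst p) (snd p)) \<in> measurable (PiM {..<l} (\<lambda>_. N) \<Otimes>\<^sub>M PiM {..<k} (\<lambda>_. N)) (PiM {..<l + k} (\<lambda>_. N))"
  unfolding concat_tuple_def
proof (rule measurable_restrict)
  fix i assume "i \<in> {..<l + k}"
  then have "i < l \<or> (\<not> i < l \<and> i - l < k)" by auto
  then show "(\<lambda>p. if i < l then fst p i else snd p (i - l)) \<in> measurable (PiM {..<l} (\<lambda>_. N) \<Otimes>\<^sub>M PiM {..<k} (\<lambda>_. N)) N"
    by (auto intro: measurable_compose[OF measurable_fst measurable_component_singleton]
        measurable_compose[OF measurable_snd measurable_component_singleton])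
qed

lemma nn_integral_pow_concat:
  assumes f: "f \<in> borel_measurable (PiM {..<l + k} (\<lambda>_. borel))"
  shows "(\<integral>\<^sup>+x. f x \<partial>PiM {..<l + k} (\<lambda>_. \<Lambda>)) =
    (\<integral>\<^sup>+z. \<integral>\<^sup>+y. f (concat_tuple l k z y) \<partial>PiM {..<k} (\<lambda>_. \<Lambda>) \<partial>PiM {..<l} (\<lambda>_. \<Lambda>))"
proof -
  let ?Z = "PiM {..<l} (\<lambda>_. \<Lambda>)" and ?Y = "PiM {..<k} (\<lambda>_. \<Lambda>)" and ?M = "PiM {..<l + k} (\<lambda>_. \<Lambda>)"
  let ?c = "\<lambda>p. concat_tuple l k (fst p) (snd p)"
  interpret Y: sigma_finite_measure ?Y by (rule pow.sigma_finite) simp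
  note m = concat_tuple_measurable[of l k \<Lambda>]
  have "distr (?Z \<Otimes>\<^sub>M ?Y) ?M ?c = ?M"
  proof (rule pow.PiM_eqI)
    fix A :: "nat \<Rightarrow> 'a set" assume A: "\<And>i. i \<in> {..<l + k} \<Longrightarrow> A i \<in> sets \<Lambda>"
    have "emeasure (distr (?Z \<Otimes>\<^sub>M ?Y) ?M ?c) (Pi\<^sub>E {..<l + k} A) = emeasure (?Z \<Otimes>\<^sub>M ?Y) (?c -` Pi\<^sub>E {..<l + k} A \<inter> space (?Z \<Otimes>\<^sub>M ?Y))"
      using A by (intro emeasure_distr m sets_PiM_I_finite) auto
    also have "?c -` Pi\<^sub>E {..<l + k} A \<inter> space (?Z \<Otimes>\<^sub>M ?Y) = Pi\<^sub>E {..<l} A \<times> Pi\<^sub>E {..<k} (\<lambda>i. A (l + i))"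
    proof (intro set_eqI iffI)
      fix p assume p: "p \<in> ?c -` Pi\<^sub>E {..<l + k} A \<inter> space (?Z \<Otimes>\<^sub>M ?Y)"
      then have c: "\<And>i. i < l + k \<Longrightarrow> ?c p i \<in> A i" by (auto simp: PiE_iff)
      have "fst p i \<in> A i" if "i < l" for i using c[of i] that by (simp add: concat_tuple_def)
      moreover have "snd p i \<in> A (l + i)" if "i < k" for i using c[of "l + i"] that by (simp add: concat_tuple_def)
      ultimately show "p \<in> Pi\<^sub>E {..<l} A \<times> Pi\<^sub>E {..<k} (\<lambda>i. A (l + i))"
        using p by (auto simp: space_pair_measure space_PiM PiE_iff)
    next
      fix p assume p: "p \<in> Pi\<^sub>E {..<l} A \<times> Pi\<^sub>E {..<k} (\<lambda>i. A (l + i))"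
      obtain z y where zy: "p = (z, y)" by force
      have "?c p i \<in> A i" if "i < l + k" for i
      proof (cases "i < l")
        case True then show ?thesis using p that by (auto simp: zy concat_tuple_def PiE_iff)
      next
        case False
        then have "i - l < k" "l + (i - l) = i" using that by auto
        then have "y (i - l) \<in> A i" using p zy by (metis PiE_mem lessThan_iff mem_Sigma_iff)
        then show ?thesis using False that by (simp add: zy concat_tuple_def)
      qed
      then show "p \<in> ?c -` Pi\<^sub>E {..<l + k} A \<inter> space (?Z \<Otimes>\<^sub>M ?Y)"
        using p by (auto simp: space_pair_measure space_PiM PiE_iff concat_tuple_def)
    qed
    also have "emeasure (?Z \<Otimes>\<^sub>M ?Y) (Pi\<^sub>E {..<l} A \<times> Pi\<^sub>E {..<k} (\<lambda>i. A (l + i))) =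
        emeasure ?Z (Pi\<^sub>E {..<l} A) * emeasure ?Y (Pi\<^sub>E {..<k} (\<lambda>i. A (l + i)))"
      using A by (intro Y.emeasure_pair_measure_Times sets_PiM_I_finite) auto
    also have "\<dots> = (\<Prod>i<l. emeasure \<Lambda> (A i)) * (\<Prod>i<k. emeasure \<Lambda> (A (l + i)))"
      using A by (intro arg_cong2[where f="(*)"] pow.emeasure_PiM) auto
    also have "\<dots> = (\<Prod>i<l + k. emeasure \<Lambda> (A i))" by (induction k) (auto simp: mult.assoc[symmetric])
    finally show "emeasure (distr (?Z \<Otimes>\<^sub>M ?Y) ?M ?c) (Pi\<^sub>E {..<l + k} A) = (\<Prod>i\<in>{..<l + k}. emeasure \<Lambda> (A i))" .
  qed auto
  then have "(\<integral>\<^sup>+x. f x \<partial>?M) = (\<integral>\<^sup>+x. f x \<partial>distr (?Z \<Otimes>\<^sub>M ?Y) ?M ?c)" by simp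
  also have "\<dots> = (\<integral>\<^sup>+p. f (?c p) \<partial>(?Z \<Otimes>\<^sub>M ?Y))"
    using f by (intro nn_integral_distr m) (simp add: measurable_pow_iff)
  also have "\<dots> = (\<integral>\<^sup>+z. \<integral>\<^sup>+y. f (concat_tuple l k z y) \<partial>?Y \<partial>?Z)"
  proof -
    have "(\<lambda>p. f (?c p)) \<in> borel_measurable (?Z \<Otimes>\<^sub>M ?Y)"
      using f by (intro measurable_compose[OF m]) (simp add: measurable_pow_iff)
    from Y.nn_integral_fst[OF this] show ?thesis by simp
  qed
  finally show ?thesis .
qed

lemma dmean_permute:
  assumes I: "finite I" and \<pi>: "bij_betw \<pi> I I"
  shows "dmean I F (\<lambda>i\<in>I. x (\<pi> i)) = dmean I F x"
proof -
  have "acost I F \<mu> (\<lambda>i\<in>I. x (\<pi> i)) = acost I F \<mu> x" if "\<mu> \<in> config_space" for \<mu>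
  proof -
    have "acost I F \<mu> (\<lambda>i\<in>I. x (\<pi> i)) = acost I F \<mu> (x \<circ> \<pi>)" using I that by (intro acost_cong) auto
    also have "\<dots> = acost (\<pi> ` I) F \<mu> x" using \<pi> I that by (intro acost_reindex[symmetric]) (auto simp: bij_betw_def)
    finally show ?thesis using \<pi> by (simp add: bij_betw_def)
  qed
  then show ?thesis unfolding dmean_def by (intro Bochner_Integration.integral_cong) auto
qed

end

lemma injection_extends_to_permutation:
  fixes \<phi> :: "nat \<Rightarrow> nat"
  assumes \<phi>: "\<phi> \<in> {..<l} \<rightarrow> {..<k}" and inj: "inj_on \<phi> {..<l}"
  obtains \<pi> where "bij_betw \<pi> {..<k} {..<k}" and "\<And>i. i < l \<Longrightarrow> \<pi> i = \<phi> i" and "l \<le> k"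
proof -
  have sub: "\<phi> ` {..<l} \<subseteq> {..<k}" using \<phi> by auto
  have lk: "l \<le> k" using card_inj_on_le[OF inj sub] by simp
  have "card {l..<k} = card ({..<k} - \<phi> ` {..<l})"
    using sub by (subst card_Diff_subset) (auto simp: card_image[OF inj])
  then obtain \<beta> where \<beta>: "bij_betw \<beta> {l..<k} ({..<k} - \<phi> ` {..<l})"
    using finite_same_card_bij[of "{l..<k}" "{..<k} - \<phi> ` {..<l}"] by auto
  have "bij_betw (\<lambda>i. if i \<in> {..<l} then \<phi> i else \<beta> i) ({..<l} \<union> {l..<k}) (\<phi> ` {..<l} \<union> ({..<k} - \<phi> ` {..<l}))"
    by (rule bij_betw_disjoint_Un[OF inj_on_imp_bij_betw[OF inj] \<beta>]) auto
  also have "{..<l} \<union> {l..<k} = {..<k}" using lk by auto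
  also have "\<phi> ` {..<l} \<union> ({..<k} - \<phi> ` {..<l}) = {..<k}" using sub by auto
  finally show ?thesis by (rule that) (use lk in auto)
qed

lemma card_injections:
  "card {\<phi> \<in> {..<l::nat} \<rightarrow>\<^sub>E {..<k::nat}. inj_on \<phi> {..<l}} = (if l \<le> k then fact k div fact (k - l) else 0)"
proof (cases "l \<le> k")
  case True
  have "card {\<phi> \<in> {..<l} \<rightarrow>\<^sub>E {..<k}. inj_on \<phi> {..<l}} = (\<Prod>i<l. k - i)"
    using card_inj_on_subset_funcset[of "{..<l}" "{..<k}" "{..<l}"] by (simp add: lessThan_atLeast0)
  also have "fact k = (\<Prod>i<l. k - i) * fact (k - l)"
    using True
  proof (induction l)
    case (Suc l)
    then have "fact (k - l) = (k - l) * (fact (k - Suc l) :: nat)"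
      by (metis Suc_diff_Suc Suc_le_lessD fact_Suc of_nat_id)
    with Suc show ?case by (simp add: mult.assoc)
  qed simp
  then have "(\<Prod>i<l. k - i) = fact k div fact (k - l)" by simp
  finally show ?thesis using True by simp
next
  case False
  have "{\<phi> \<in> {..<l} \<rightarrow>\<^sub>E {..<k}. inj_on \<phi> {..<l}} = {}"
    using False injection_extends_to_permutation[of _ l k] by (auto simp: PiE_def)
  then show ?thesis using False by (simp only: card.empty if_False)
qed

text \<open>Both sides come from measures that count, on a product set, the index tuples whose points lie in it.\<close>

lemma nn_integral_PiM_dirac_sum:
  fixes x :: "'j \<Rightarrow> 'a::polish_space"
  assumes I: "finite I" and J: "finite J" and f: "f \<in> borel_measurable (PiM I (\<lambda>_. borel))"
  shows "(\<integral>\<^sup>+z. f z \<partial>PiM I (\<lambda>_. dirac_sum J x)) = (\<Sum>\<phi>\<in>I \<rightarrow>\<^sub>E J. f (\<lambda>i\<in>I. x (\<phi> i)))"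
proof -
  let ?d = "dirac_sum J x" and ?M = "PiM I (\<lambda>_. borel :: 'a measure)"
  let ?t = "\<lambda>\<phi>. \<lambda>i\<in>I. x (\<phi> i)"
  interpret product_sigma_finite "\<lambda>_. ?d" by (rule product_sigma_finite_config) (simp add: J)
  have fin: "finite (I \<rightarrow>\<^sub>E J)" using I J by (intro finite_PiE) auto
  have m: "?t \<in> measurable (count_space (I \<rightarrow>\<^sub>E J)) ?M" by (auto simp: space_PiM)
  have "distr (count_space (I \<rightarrow>\<^sub>E J)) ?M ?t = PiM I (\<lambda>_. ?d)"
  proof (rule PiM_eqI[OF I])
    show "sets (distr (count_space (I \<rightarrow>\<^sub>E J)) ?M ?t) = sets (PiM I (\<lambda>_. ?d))"
      using sets_PiM_config[of ?d I] J by simp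
    fix A :: "'b \<Rightarrow> 'a set" assume A: "\<And>i. i \<in> I \<Longrightarrow> A i \<in> sets ?d"
    have "emeasure (distr (count_space (I \<rightarrow>\<^sub>E J)) ?M ?t) (Pi\<^sub>E I A) =
        emeasure (count_space (I \<rightarrow>\<^sub>E J)) (?t -` Pi\<^sub>E I A \<inter> (I \<rightarrow>\<^sub>E J))"
      using A I by (subst emeasure_distr[OF m]) (auto intro!: sets_PiM_I_finite)
    also have "?t -` Pi\<^sub>E I A \<inter> (I \<rightarrow>\<^sub>E J) = Pi\<^sub>E I (\<lambda>i. {j\<in>J. x j \<in> A i})" by (auto simp: PiE_iff)
    also have "emeasure (count_space (I \<rightarrow>\<^sub>E J)) (Pi\<^sub>E I (\<lambda>i. {j\<in>J. x j \<in> A i})) = of_nat (card (Pi\<^sub>E I (\<lambda>i. {j\<in>J. x j \<in> A i})))"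
      using I J by (intro emeasure_count_space_finite finite_PiE) (auto simp: PiE_iff)
    also have "\<dots> = (\<Prod>i\<in>I. of_nat (card {j\<in>J. x j \<in> A i}))" by (simp add: card_PiE[OF I])
    also have "\<dots> = (\<Prod>i\<in>I. emeasure ?d (A i))"
    proof (intro prod.cong refl)
      fix i assume "i \<in> I"
      then have "A i \<in> sets borel" using A by simp
      then have "emeasure ?d (A i) = of_nat (card (x -` A i \<inter> J))"
        using J by (simp add: dirac_sum_def emeasure_distr emeasure_count_space_finite)
      also have "x -` A i \<inter> J = {j\<in>J. x j \<in> A i}" by auto
      finally show "of_nat (card {j\<in>J. x j \<in> A i}) = emeasure ?d (A i)" ..
    qed
    finally show "emeasure (distr (count_space (I \<rightarrow>\<^sub>E J)) ?M ?t) (Pi\<^sub>E I A) = (\<Prod>i\<in>I. emeasure ?d (A i))" .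
  qed
  then have "(\<integral>\<^sup>+z. f z \<partial>PiM I (\<lambda>_. ?d)) = (\<integral>\<^sup>+z. f z \<partial>distr (count_space (I \<rightarrow>\<^sub>E J)) ?M ?t)" by simp
  also have "\<dots> = (\<integral>\<^sup>+\<phi>. f (?t \<phi>) \<partial>count_space (I \<rightarrow>\<^sub>E J))" by (subst nn_integral_distr[OF m]) (simp_all add: f)
  also have "\<dots> = (\<Sum>\<phi>\<in>I \<rightarrow>\<^sub>E J. f (?t \<phi>))" by (rule nn_integral_count_space_finite[OF fin])
  finally show ?thesis .
qed

section \<open>The three expressions in terms of the Poisson process\<close>

context diffuse_poisson_law begin

lemma campbell:
  assumes g: "g \<in> borel_measurable (PiM {..<l::nat} (\<lambda>_. borel))"
  shows "(\<integral>\<^sup>+\<nu>. \<integral>\<^sup>+z. g z \<partial>factorial_measure l \<nu> \<partial>L) = (\<integral>\<^sup>+z. g z \<partial>PiM {..<l} (\<lambda>_. \<Lambda>))"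
proof -
  have "(\<integral>\<^sup>+\<nu>. \<integral>\<^sup>+z. g z \<partial>factorial_measure l \<nu> \<partial>L) =
      (\<integral>\<^sup>+\<nu>. \<integral>\<^sup>+z. indicator {z. inj_on z {..<l}} z * g z \<partial>PiM {..<l} (\<lambda>_. \<nu>) \<partial>L)"
    by (intro nn_integral_cong nn_integral_factorial_measure g) simp
  also have "\<dots> = (\<integral>\<^sup>+z. \<integral>\<^sup>+\<mu>. g z \<partial>L \<partial>PiM {..<l} (\<lambda>_. \<Lambda>))"
    using mecke_multi[of "{..<l}" "\<lambda>z \<mu>. g z"] g by simp
  finally show ?thesis by (simp add: emeasure_space_1[simplified])
qed

lemma sub_cost_second_moment:
  assumes F: "F \<in> borel_measurable config_algebra" and g: "g \<in> borel_measurable (PiM {..<l::nat} (\<lambda>_. borel))"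
  shows "(\<integral>\<^sup>+\<mu>. \<integral>\<^sup>+z. g z * ennreal ((sub_cost_iter l z F \<mu>)\<^sup>2) \<partial>factorial_measure l \<mu> \<partial>L) =
    (\<integral>\<^sup>+z. g z * (\<integral>\<^sup>+\<mu>. ennreal ((acost {..<l} F \<mu> z)\<^sup>2) \<partial>L) \<partial>PiM {..<l} (\<lambda>_. \<Lambda>))"
proof -
  let ?B = "PiM {..<l} (\<lambda>_. borel :: 'a measure)"
  have s: "(\<lambda>q. sub_cost_iter l (fst q) F (snd q)) \<in> borel_measurable (?B \<Otimes>\<^sub>M config_algebra)"
    by (rule measurable_sub_cost_iter[where z="\<lambda>z. z" and G="\<lambda>_. F"])
      (use F in \<open>auto intro: measurable_component_singleton\<close>)
  have m: "(\<lambda>(z, \<mu>). g z * ennreal ((sub_cost_iter l z F \<mu>)\<^sup>2)) \<in> borel_measurable (?B \<Otimes>\<^sub>M config_algebra)"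
    unfolding split_beta'
    by (intro borel_measurable_times_ennreal measurable_compose[OF measurable_fst g]
        measurable_compose[OF borel_measurable_power[OF s] measurable_ennreal])
  have "(\<integral>\<^sup>+\<mu>. \<integral>\<^sup>+z. g z * ennreal ((sub_cost_iter l z F \<mu>)\<^sup>2) \<partial>factorial_measure l \<mu> \<partial>L) =
      (\<integral>\<^sup>+\<mu>. \<integral>\<^sup>+z. indicator {z. inj_on z {..<l}} z * (g z * ennreal ((sub_cost_iter l z F \<mu>)\<^sup>2)) \<partial>PiM {..<l} (\<lambda>_. \<mu>) \<partial>L)"
    by (intro nn_integral_cong nn_integral_factorial_measure)
      (use measurable_Pair1[OF m] in simp_all)
  also have "\<dots> = (\<integral>\<^sup>+z. \<integral>\<^sup>+\<mu>. g z * ennreal ((sub_cost_iter l z F (add_points {..<l} z \<mu>))\<^sup>2) \<partial>L \<partial>PiM {..<l} (\<lambda>_. \<Lambda>))"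
    by (rule mecke_multi[OF _ m]) simp
  also have "\<dots> = (\<integral>\<^sup>+z. g z * (\<integral>\<^sup>+\<mu>. ennreal ((acost {..<l} F \<mu> z)\<^sup>2) \<partial>L) \<partial>PiM {..<l} (\<lambda>_. \<Lambda>))"
  proof (intro nn_integral_cong)
    fix z assume "z \<in> space (PiM {..<l} (\<lambda>_. \<Lambda>))"
    then have z: "z \<in> space ?B" by (simp add: space_pow)
    have "(\<integral>\<^sup>+\<mu>. g z * ennreal ((sub_cost_iter l z F (add_points {..<l} z \<mu>))\<^sup>2) \<partial>L) =
        (\<integral>\<^sup>+\<mu>. g z * ennreal ((acost {..<l} F \<mu> z)\<^sup>2) \<partial>L)"
      by (intro nn_integral_cong) (simp add: sub_cost_iter_add_points)
    also have "\<dots> = g z * (\<integral>\<^sup>+\<mu>. ennreal ((acost {..<l} F \<mu> z)\<^sup>2) \<partial>L)"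
      using measurable_acost[OF finite_lessThan F z] by (intro nn_integral_cmult) (simp add: measurable_law_iff)
    finally show "(\<integral>\<^sup>+\<mu>. g z * ennreal ((sub_cost_iter l z F (add_points {..<l} z \<mu>))\<^sup>2) \<partial>L) = \<dots>" .
  qed
  finally show ?thesis .
qed

lemma measurable_acost_square:
  assumes F: "F \<in> borel_measurable config_algebra" and g: "g \<in> borel_measurable (PiM {..<l::nat} (\<lambda>_. borel))"
  shows "(\<lambda>(z, \<mu>). g z * ennreal ((acost {..<l} F \<mu> z)\<^sup>2)) \<in> borel_measurable (PiM {..<l} (\<lambda>_. borel) \<Otimes>\<^sub>M config_algebra)"
proof -
  have "(\<lambda>p. (acost {..<l} F (snd p) (fst p))\<^sup>2) \<in> borel_measurable (PiM {..<l} (\<lambda>_. borel) \<Otimes>\<^sub>M config_algebra)"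
    by (intro borel_measurable_power measurable_acost_pair finite_lessThan F)
  from measurable_compose[OF this measurable_ennreal] show ?thesis
    unfolding split_beta' by (intro borel_measurable_times_ennreal measurable_compose[OF measurable_fst g])
qed

lemma add_cost_second_moment:
  assumes F: "F \<in> borel_measurable config_algebra" and g: "g \<in> borel_measurable (PiM {..<l::nat} (\<lambda>_. borel))"
  shows "(\<integral>\<^sup>+\<mu>. \<integral>\<^sup>+z. g z * ennreal ((acost {..<l} F \<mu> z)\<^sup>2) \<partial>PiM {..<l} (\<lambda>_. \<Lambda>) \<partial>L) =
    (\<integral>\<^sup>+z. g z * (\<integral>\<^sup>+\<mu>. ennreal ((acost {..<l} F \<mu> z)\<^sup>2) \<partial>L) \<partial>PiM {..<l} (\<lambda>_. \<Lambda>))"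
proof -
  interpret Z: sigma_finite_measure "PiM {..<l} (\<lambda>_. \<Lambda>)" by (rule pow.sigma_finite) simp
  interpret ZL: pair_sigma_finite "PiM {..<l} (\<lambda>_. \<Lambda>)" L ..
  have eq: "sets (PiM {..<l} (\<lambda>_. \<Lambda>) \<Otimes>\<^sub>M L) = sets (PiM {..<l} (\<lambda>_. borel) \<Otimes>\<^sub>M config_algebra)"
    by (intro sets_pair_measure_cong sets_pow sets_law)
  then have "(\<lambda>(z, \<mu>). g z * ennreal ((acost {..<l} F \<mu> z)\<^sup>2)) \<in> borel_measurable (PiM {..<l} (\<lambda>_. \<Lambda>) \<Otimes>\<^sub>M L)"
    using measurable_acost_square[OF assms] by (simp only: measurable_cong_sets[OF eq refl])
  from ZL.Fubini'[OF this]
  have "(\<integral>\<^sup>+\<mu>. \<integral>\<^sup>+z. g z * ennreal ((acost {..<l} F \<mu> z)\<^sup>2) \<partial>PiM {..<l} (\<lambda>_. \<Lambda>) \<partial>L) =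
      (\<integral>\<^sup>+z. \<integral>\<^sup>+\<mu>. g z * ennreal ((acost {..<l} F \<mu> z)\<^sup>2) \<partial>L \<partial>PiM {..<l} (\<lambda>_. \<Lambda>))" .
  also have "\<dots> = (\<integral>\<^sup>+z. g z * (\<integral>\<^sup>+\<mu>. ennreal ((acost {..<l} F \<mu> z)\<^sup>2) \<partial>L) \<partial>PiM {..<l} (\<lambda>_. \<Lambda>))"
  proof (intro nn_integral_cong nn_integral_cmult)
    fix z assume "z \<in> space (PiM {..<l} (\<lambda>_. \<Lambda>))"
    then show "(\<lambda>\<mu>. ennreal ((acost {..<l} F \<mu> z)\<^sup>2)) \<in> borel_measurable L"
      using measurable_acost[OF finite_lessThan F, of z l] by (simp add: measurable_law_iff space_pow)
  qed
  finally show ?thesis .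
qed

end

section \<open>The spectral side\<close>

context poisson_law begin

lemma dmean_square_measurable:
  "F \<in> borel_measurable config_algebra \<Longrightarrow>
    (\<lambda>x. ennreal ((dmean {..<k::nat} F x)\<^sup>2)) \<in> borel_measurable (PiM {..<k} (\<lambda>_. borel))"
  by (intro measurable_compose[OF borel_measurable_power[OF dmean_measurable] measurable_ennreal]) auto

text \<open>For \<open>l \<le> k\<close> and up to the factor \<open>1 / (k! \<bbbE>[F\<^sup>2])\<close> this is the mean of \<open>g\<close> at the first \<open>l\<close> points of the
  spectral process on the event that it has \<open>k\<close> points.\<close>

definition spectral_mass :: "('a measure \<Rightarrow> real) \<Rightarrow> nat \<Rightarrow> ((nat \<Rightarrow> 'a) \<Rightarrow> ennreal) \<Rightarrow> nat \<Rightarrow> ennreal" where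
  "spectral_mass F l g k =
     (\<integral>\<^sup>+x. g (restrict x {..<l}) * ennreal ((dmean {..<k} F x)\<^sup>2) \<partial>PiM {..<k} (\<lambda>_. \<Lambda>))"

text \<open>The Fock space representation of \<open>D\<^sup>l\<^sub>z F\<close>, integrated over \<open>z\<close>, with the two groups of variables joined.\<close>

lemma second_moment_eq_spectral_mass:
  assumes F: "F \<in> borel_measurable config_algebra" and L2: "(\<integral>\<^sup>+\<mu>. ennreal ((F \<mu>)\<^sup>2) \<partial>L) < \<infinity>"
    and g: "g \<in> borel_measurable (PiM {..<l::nat} (\<lambda>_. borel))"
  shows "(\<integral>\<^sup>+z. g z * (\<integral>\<^sup>+\<mu>. ennreal ((acost {..<l} F \<mu> z)\<^sup>2) \<partial>L) \<partial>PiM {..<l} (\<lambda>_. \<Lambda>)) =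
    (\<Sum>k. ennreal (1 / fact k) * spectral_mass F l g (l + k))"
proof -
  let ?Z = "PiM {..<l} (\<lambda>_. \<Lambda>)" and ?Y = "\<lambda>k. PiM {..<k} (\<lambda>_. \<Lambda>)"
  let ?D = "\<lambda>k z y. ennreal ((dmean {..<l + k} F (concat_tuple l k z y))\<^sup>2)"
  have gm: "g \<in> borel_measurable ?Z" using g by (simp only: measurable_pow_iff)
  have Dm: "(\<lambda>p. ?D k (fst p) (snd p)) \<in> borel_measurable (?Z \<Otimes>\<^sub>M ?Y k)" for k
    by (rule measurable_compose[OF concat_tuple_measurable[of l k \<Lambda>]])
      (use dmean_square_measurable[OF F] in \<open>simp only: measurable_pow_iff\<close>)
  have Ym: "(\<lambda>z. \<integral>\<^sup>+y. ?D k z y \<partial>?Y k) \<in> borel_measurable ?Z" for k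
  proof -
    interpret Y: sigma_finite_measure "?Y k" by (rule pow.sigma_finite) simp
    show ?thesis using Dm[of k] by (intro Y.borel_measurable_nn_integral) (simp add: split_beta')
  qed
  have "(\<integral>\<^sup>+z. g z * (\<integral>\<^sup>+\<mu>. ennreal ((acost {..<l} F \<mu> z)\<^sup>2) \<partial>L) \<partial>?Z) =
      (\<integral>\<^sup>+z. (\<Sum>k. ennreal (1 / fact k) * (g z * (\<integral>\<^sup>+y. ?D k z y \<partial>?Y k))) \<partial>?Z)"
  proof (rule nn_integral_cong_AE, rule AE_mp[OF fock_acost[OF F L2, of l]], intro AE_I2 impI)
    fix z
    assume "(\<integral>\<^sup>+\<mu>. ennreal ((acost {..<l} F \<mu> z)\<^sup>2) \<partial>L) = (\<Sum>k. ennreal (1 / fact k) * (\<integral>\<^sup>+y. ?D k z y \<partial>?Y k))"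
    then have "g z * (\<integral>\<^sup>+\<mu>. ennreal ((acost {..<l} F \<mu> z)\<^sup>2) \<partial>L) = (\<Sum>k. g z * (ennreal (1 / fact k) * (\<integral>\<^sup>+y. ?D k z y \<partial>?Y k)))"
      by (simp only: ennreal_suminf_cmult)
    then show "g z * (\<integral>\<^sup>+\<mu>. ennreal ((acost {..<l} F \<mu> z)\<^sup>2) \<partial>L) = (\<Sum>k. ennreal (1 / fact k) * (g z * (\<integral>\<^sup>+y. ?D k z y \<partial>?Y k)))"
      by (simp only: mult.left_commute)
  qed
  also have "\<dots> = (\<Sum>k. \<integral>\<^sup>+z. ennreal (1 / fact k) * (g z * (\<integral>\<^sup>+y. ?D k z y \<partial>?Y k)) \<partial>?Z)"
    by (intro nn_integral_suminf borel_measurable_times_ennreal gm Ym) auto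
  also have "\<dots> = (\<Sum>k. ennreal (1 / fact k) * (\<integral>\<^sup>+z. g z * (\<integral>\<^sup>+y. ?D k z y \<partial>?Y k) \<partial>?Z))"
    by (intro suminf_cong nn_integral_cmult borel_measurable_times_ennreal gm Ym)
  also have "\<dots> = (\<Sum>k. ennreal (1 / fact k) * spectral_mass F l g (l + k))"
  proof (intro suminf_cong arg_cong2[where f="(*)"] refl)
    fix k
    have "(\<lambda>x. g (restrict x {..<l}) * ennreal ((dmean {..<l + k} F x)\<^sup>2)) \<in> borel_measurable (PiM {..<l + k} (\<lambda>_. borel))"
      by (intro borel_measurable_times_ennreal dmean_square_measurable F measurable_compose[OF measurable_restrict_subset g]) auto
    then have "spectral_mass F l g (l + k) = (\<integral>\<^sup>+z. \<integral>\<^sup>+y. g (restrict (concat_tuple l k z y) {..<l}) * ?D k z y \<partial>?Y k \<partial>?Z)"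
      unfolding spectral_mass_def by (rule nn_integral_pow_concat)
    also have "\<dots> = (\<integral>\<^sup>+z. g z * (\<integral>\<^sup>+y. ?D k z y \<partial>?Y k) \<partial>?Z)"
    proof (intro nn_integral_cong)
      fix z assume z: "z \<in> space ?Z"
      have "restrict (concat_tuple l k z y) {..<l} = z" for y
        using z by (auto simp: concat_tuple_def space_PiM PiE_iff extensional_def fun_eq_iff)
      moreover have "(\<lambda>y. ?D k z y) \<in> borel_measurable (?Y k)"
        using measurable_Pair2[OF Dm z] by simp
      ultimately show "(\<integral>\<^sup>+y. g (restrict (concat_tuple l k z y) {..<l}) * ?D k z y \<partial>?Y k) = g z * (\<integral>\<^sup>+y. ?D k z y \<partial>?Y k)"
        by (simp add: nn_integral_cmult)
    qed
    finally show "(\<integral>\<^sup>+z. g z * (\<integral>\<^sup>+y. ?D k z y \<partial>?Y k) \<partial>?Z) = spectral_mass F l g (l + k)" ..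
  qed
  finally show ?thesis .
qed

end

text \<open>The integral of \<open>g\<close> with respect to the factorial measure of the \<open>k\<close> points \<open>x\<close>, as a finite sum.\<close>

definition tuple_sum :: "nat \<Rightarrow> ((nat \<Rightarrow> 'a) \<Rightarrow> ennreal) \<Rightarrow> nat \<Rightarrow> (nat \<Rightarrow> 'a) \<Rightarrow> ennreal" where
  "tuple_sum l g k x = (\<Sum>\<phi>\<in>{..<l} \<rightarrow>\<^sub>E {..<k}. indicator {z. inj_on z {..<l}} (\<lambda>i\<in>{..<l}. x (\<phi> i)) * g (\<lambda>i\<in>{..<l}. x (\<phi> i)))"

lemma tuple_sum_measurable:
  assumes g: "g \<in> borel_measurable (PiM {..<l} (\<lambda>_. borel :: 'a::polish_space measure))"
  shows "tuple_sum l g k \<in> borel_measurable (PiM {..<k} (\<lambda>_. borel))"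
  unfolding tuple_sum_def[abs_def]
proof (rule borel_measurable_sum)
  fix \<phi> assume "\<phi> \<in> {..<l} \<rightarrow>\<^sub>E {..<k}"
  then have r: "(\<lambda>x. \<lambda>i\<in>{..<l}. x (\<phi> i)) \<in> measurable (PiM {..<k} (\<lambda>_. borel)) (PiM {..<l} (\<lambda>_. borel :: 'a measure))"
    by (intro measurable_restrict measurable_component_singleton) auto
  show "(\<lambda>x. indicator {z. inj_on z {..<l}} (\<lambda>i\<in>{..<l}. x (\<phi> i)) * g (\<lambda>i\<in>{..<l}. x (\<phi> i))) \<in> borel_measurable (PiM {..<k} (\<lambda>_. borel))"
    by (intro borel_measurable_times_ennreal measurable_compose[OF r] borel_measurable_indicator_inj g) simp
qed

lemma nn_integral_factorial_dirac_sum: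
  fixes x :: "nat \<Rightarrow> 'a::polish_space"
  assumes g: "g \<in> borel_measurable (PiM {..<l::nat} (\<lambda>_. borel))"
  shows "(\<integral>\<^sup>+z. g z \<partial>factorial_measure l (dirac_sum {..<k} x)) = tuple_sum l g k x"
  unfolding tuple_sum_def
  by (subst nn_integral_factorial_measure[OF _ g], simp, subst nn_integral_PiM_dirac_sum)
    (auto intro!: borel_measurable_times_ennreal borel_measurable_indicator_inj g)

lemma tuple_sum_zero: "1 \<le> l \<Longrightarrow> tuple_sum l g 0 x = 0"
  unfolding tuple_sum_def by (subst PiE_eq_empty_iff[THEN iffD2]) (auto intro: exI[of _ 0])

context diffuse_poisson_law begin

text \<open>By symmetry every injective choice of \<open>l\<close> of the \<open>k\<close> points contributes the same mass; choices with
  repetitions hit the diagonal, which is a null set.\<close>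

lemma nn_integral_tuple_sum:
  assumes F: "F \<in> borel_measurable config_algebra" and g: "g \<in> borel_measurable (PiM {..<l::nat} (\<lambda>_. borel))"
  shows "(\<integral>\<^sup>+x. ennreal ((dmean {..<k} F x)\<^sup>2) * tuple_sum l g k x \<partial>PiM {..<k} (\<lambda>_. \<Lambda>)) =
    (if l \<le> k then ennreal (fact k / fact (k - l)) * spectral_mass F l g k else 0)"
proof -
  let ?M = "PiM {..<k} (\<lambda>_. \<Lambda>)"
  let ?S = "{..<l} \<rightarrow>\<^sub>E {..<k}"
  let ?I = "{\<phi> \<in> ?S. inj_on \<phi> {..<l}}"
  let ?r = "\<lambda>\<phi> x. \<lambda>i\<in>{..<l}. x (\<phi> i)"
  define t where "t \<phi> x = ennreal ((dmean {..<k} F x)\<^sup>2) * (indicator {z. inj_on z {..<l}} (?r \<phi> x) * g (?r \<phi> x))" for \<phi> x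
  have fin: "finite ?S" by (intro finite_PiE) auto
  have tm: "t \<phi> \<in> borel_measurable ?M" if "\<phi> \<in> ?S" for \<phi>
  proof -
    have r: "?r \<phi> \<in> measurable (PiM {..<k} (\<lambda>_. borel)) (PiM {..<l} (\<lambda>_. borel :: 'a measure))"
      using that by (intro measurable_restrict measurable_component_singleton) auto
    show ?thesis
      unfolding t_def[abs_def] measurable_pow_iff
      by (intro borel_measurable_times_ennreal measurable_compose[OF r] borel_measurable_indicator_inj g dmean_square_measurable F) simp
  qed
  have "(\<integral>\<^sup>+x. ennreal ((dmean {..<k} F x)\<^sup>2) * tuple_sum l g k x \<partial>?M) = (\<integral>\<^sup>+x. (\<Sum>\<phi>\<in>?S. t \<phi> x) \<partial>?M)"
    by (simp add: tuple_sum_def t_def sum_distrib_left)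
  also have "\<dots> = (\<Sum>\<phi>\<in>?S. \<integral>\<^sup>+x. t \<phi> x \<partial>?M)" by (rule nn_integral_sum[OF tm])
  also have "\<dots> = (\<Sum>\<phi>\<in>?I. \<integral>\<^sup>+x. t \<phi> x \<partial>?M)"
  proof (intro sum.mono_neutral_right fin ballI)
    fix \<phi> assume \<phi>: "\<phi> \<in> ?S - ?I"
    then obtain i j where "i < l" "j < l" "i \<noteq> j" "\<phi> i = \<phi> j" by (auto simp: inj_on_def)
    then have "?r \<phi> x i = ?r \<phi> x j" for x :: "nat \<Rightarrow> 'a" by simp
    then have "\<not> inj_on (?r \<phi> x) {..<l}" for x :: "nat \<Rightarrow> 'a"
      using \<open>i < l\<close> \<open>j < l\<close> \<open>i \<noteq> j\<close> by (metis inj_onD lessThan_iff)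
    then have "?r \<phi> x \<notin> {z. inj_on z {..<l}}" for x :: "nat \<Rightarrow> 'a" by blast
    then have "indicator {z. inj_on z {..<l}} (?r \<phi> x) = (0::ennreal)" for x :: "nat \<Rightarrow> 'a"
      by (rule indicator_simps(2))
    then show "(\<integral>\<^sup>+x. t \<phi> x \<partial>?M) = 0" by (simp add: t_def)
  qed auto
  also have "\<dots> = (\<Sum>\<phi>\<in>?I. spectral_mass F l g k)"
  proof (intro sum.cong refl)
    fix \<phi> assume \<phi>: "\<phi> \<in> ?I"
    obtain \<pi> where \<pi>: "bij_betw \<pi> {..<k} {..<k}" "\<And>i. i < l \<Longrightarrow> \<pi> i = \<phi> i" and lk: "l \<le> k"
      using injection_extends_to_permutation[of \<phi> l k] \<phi> by (auto simp: PiE_def)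
    have "(\<integral>\<^sup>+x. t \<phi> x \<partial>?M) = (\<integral>\<^sup>+x. g (?r \<phi> x) * ennreal ((dmean {..<k} F x)\<^sup>2) \<partial>?M)"
    proof (rule nn_integral_cong_AE)
      show "AE x in ?M. t \<phi> x = g (?r \<phi> x) * ennreal ((dmean {..<k} F x)\<^sup>2)"
        using AE_inj_on[OF finite_lessThan[of k]]
      proof (rule AE_mp, intro AE_I2 impI)
        fix x :: "nat \<Rightarrow> 'a" assume x: "inj_on x {..<k}"
        have "inj_on (?r \<phi> x) {..<l}"
          using \<phi> x by (auto simp: inj_on_def PiE_iff)
        then show "t \<phi> x = g (?r \<phi> x) * ennreal ((dmean {..<k} F x)\<^sup>2)" by (simp add: t_def mult.commute)
      qed
    qed
    also have "\<dots> = (\<integral>\<^sup>+x. g (restrict (\<lambda>i\<in>{..<k}. x (\<pi> i)) {..<l}) * ennreal ((dmean {..<k} F (\<lambda>i\<in>{..<k}. x (\<pi> i)))\<^sup>2) \<partial>?M)"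
    proof (intro nn_integral_cong arg_cong2[where f="(*)"])
      fix x :: "nat \<Rightarrow> 'a"
      have "?r \<phi> x = restrict (\<lambda>i\<in>{..<k}. x (\<pi> i)) {..<l}" using \<pi>(2) lk by (auto simp: fun_eq_iff)
      then show "g (?r \<phi> x) = g (restrict (\<lambda>i\<in>{..<k}. x (\<pi> i)) {..<l})" by simp
    qed (simp add: dmean_permute[OF _ \<pi>(1)])
    also have "\<dots> = spectral_mass F l g k"
      unfolding spectral_mass_def
      by (rule nn_integral_pow_permute[OF _ \<pi>(1), of "\<lambda>x. g (restrict x {..<l}) * ennreal ((dmean {..<k} F x)\<^sup>2)"])
        (use lk in \<open>auto intro!: borel_measurable_times_ennreal dmean_square_measurable F measurable_compose[OF measurable_restrict_subset g]\<close>)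
    finally show "(\<integral>\<^sup>+x. t \<phi> x \<partial>?M) = spectral_mass F l g k" .
  qed
  also have "\<dots> = (if l \<le> k then ennreal (fact k / fact (k - l)) * spectral_mass F l g k else 0)"
  proof -
    have "of_nat (fact k div fact (k - l)) = ennreal (fact k / fact (k - l))" if "l \<le> k"
    proof -
      have "fact (k - l) dvd (fact k :: nat)" by (rule fact_dvd) simp
      then have "real (fact k div fact (k - l)) = fact k / fact (k - l)" by (simp add: real_of_nat_div)
      then show ?thesis by (simp add: ennreal_of_nat_eq_real_of_nat)
    qed
    then show ?thesis by (simp add: card_injections)
  qed
  finally show ?thesis .
qed

end

text \<open>On the event \<open>N = k\<close> independence makes the law of \<open>X\<^sub>k\<close> its full law, scaled by the probability of the
  event.\<close>

lemma nn_integral_mixture: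
  fixes N :: "'v \<Rightarrow> nat" and X :: "nat \<Rightarrow> 'v \<Rightarrow> nat \<Rightarrow> 'a::polish_space"
  assumes "prob_space Q"
    and N: "N \<in> measurable Q (count_space UNIV)"
    and X: "\<And>k. 1 \<le> k \<Longrightarrow> X k \<in> measurable Q (PiM {..<k} (\<lambda>_. borel))"
    and ind: "prob_space.indep_set Q
          (sets (vimage_algebra (space Q) N (count_space UNIV)))
          (sets (vimage_algebra (space Q) (\<lambda>\<omega>. \<lambda>k\<in>{1..}. X k \<omega>)
             (PiM {1..} (\<lambda>k. PiM {..<k} (\<lambda>_. borel)))))"
    and \<psi>: "\<And>k. \<psi> k \<in> borel_measurable (PiM {..<k} (\<lambda>_. borel))" and \<psi>0: "\<And>x. \<psi> 0 x = 0"
  shows "(\<integral>\<^sup>+\<omega>. \<psi> (N \<omega>) (X (N \<omega>) \<omega>) \<partial>Q) =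
    (\<Sum>k. emeasure Q {\<omega>\<in>space Q. N \<omega> = k} * (\<integral>\<^sup>+\<omega>. \<psi> k (X k \<omega>) \<partial>Q))"
proof -
  interpret Q: prob_space Q by fact
  note [measurable] = N
  let ?E = "\<lambda>k. {\<omega>\<in>space Q. N \<omega> = k}"
  have E [measurable]: "?E k \<in> sets Q" for k by measurable
  have fam: "(\<lambda>\<omega>. \<lambda>k\<in>{1..}. X k \<omega>) \<in> measurable Q (PiM {1..} (\<lambda>k. PiM {..<k} (\<lambda>_. borel)))"
    using X by (intro measurable_restrict) auto
  have \<psi>X: "(\<lambda>\<omega>. indicator (?E k) \<omega> * \<psi> k (X k \<omega>)) \<in> borel_measurable Q" for k
  proof (cases "k = 0")
    case False
    then show ?thesis
      by (intro borel_measurable_times_ennreal measurable_compose[OF X \<psi>]) auto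
  qed (simp add: \<psi>0)
  have "(\<integral>\<^sup>+\<omega>. \<psi> (N \<omega>) (X (N \<omega>) \<omega>) \<partial>Q) = (\<integral>\<^sup>+\<omega>. (\<Sum>k. indicator (?E k) \<omega> * \<psi> k (X k \<omega>)) \<partial>Q)"
  proof (intro nn_integral_cong)
    fix \<omega> assume w: "\<omega> \<in> space Q"
    have "(\<Sum>k. indicator (?E k) \<omega> * \<psi> k (X k \<omega>)) = (\<Sum>k\<in>{N \<omega>}. indicator (?E k) \<omega> * \<psi> k (X k \<omega>))"
      by (rule suminf_finite) auto
    then show "\<psi> (N \<omega>) (X (N \<omega>) \<omega>) = (\<Sum>k. indicator (?E k) \<omega> * \<psi> k (X k \<omega>))" using w by simp
  qed
  also have "\<dots> = (\<Sum>k. \<integral>\<^sup>+\<omega>. indicator (?E k) \<omega> * \<psi> k (X k \<omega>) \<partial>Q)" by (rule nn_integral_suminf[OF \<psi>X])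
  also have "\<dots> = (\<Sum>k. emeasure Q (?E k) * (\<integral>\<^sup>+\<omega>. \<psi> k (X k \<omega>) \<partial>Q))"
  proof (intro suminf_cong)
    fix k
    show "(\<integral>\<^sup>+\<omega>. indicator (?E k) \<omega> * \<psi> k (X k \<omega>) \<partial>Q) = emeasure Q (?E k) * (\<integral>\<^sup>+\<omega>. \<psi> k (X k \<omega>) \<partial>Q)"
    proof (cases "k = 0")
      case False
      then have k: "1 \<le> k" by simp
      let ?B = "PiM {..<k} (\<lambda>_. borel :: 'a measure)"
      note Xk [measurable] = X[OF k]
      have "distr (density Q (indicator (?E k))) ?B (X k) = scale_measure (emeasure Q (?E k)) (distr Q ?B (X k))"
      proof (rule measure_eqI)
        fix A assume "A \<in> sets (distr (density Q (indicator (?E k))) ?B (X k))"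
        then have A [measurable]: "A \<in> sets ?B" by simp
        let ?XA = "X k -` A \<inter> space Q"
        have XA: "?XA \<in> sets Q" by measurable
        have "?E k \<in> sets (vimage_algebra (space Q) N (count_space UNIV))"
          using in_vimage_algebra[of "{k}" "count_space UNIV" N "space Q"] by (simp add: vimage_def Int_def conj_commute)
        moreover have "?XA \<in> sets (vimage_algebra (space Q) (\<lambda>\<omega>. \<lambda>k\<in>{1..}. X k \<omega>) (PiM {1..} (\<lambda>k. PiM {..<k} (\<lambda>_. borel))))"
        proof -
          let ?P = "PiM {1..} (\<lambda>k. PiM {..<k} (\<lambda>_. borel :: 'a measure))"
          have "(\<lambda>f. f k) -` A \<inter> space ?P \<in> sets ?P"
            by (rule measurable_sets[OF measurable_component_singleton[of k "{1..}" "\<lambda>k. PiM {..<k} (\<lambda>_. borel)"] A]) (use k in simp)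
          from in_vimage_algebra[OF this, of "\<lambda>\<omega>. \<lambda>k\<in>{1..}. X k \<omega>" "space Q"]
          have "(\<lambda>\<omega>. \<lambda>k\<in>{1..}. X k \<omega>) -` ((\<lambda>f. f k) -` A \<inter> space ?P) \<inter> space Q \<in> sets (vimage_algebra (space Q) (\<lambda>\<omega>. \<lambda>k\<in>{1..}. X k \<omega>) ?P)" .
          also have "(\<lambda>\<omega>. \<lambda>k\<in>{1..}. X k \<omega>) -` ((\<lambda>f. f k) -` A \<inter> space ?P) \<inter> space Q = ?XA"
            using k measurable_space[OF fam] by auto
          finally show ?thesis .
        qed
        ultimately have "Q.prob (?E k \<inter> ?XA) = Q.prob (?E k) * Q.prob ?XA" by (rule Q.indep_setD[OF ind])
        then have i: "emeasure Q (?E k \<inter> ?XA) = emeasure Q (?E k) * emeasure Q ?XA"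
          by (simp add: Q.emeasure_eq_measure ennreal_mult)
        have "emeasure (distr (density Q (indicator (?E k))) ?B (X k)) A = emeasure (density Q (indicator (?E k))) ?XA"
          by (subst emeasure_distr) auto
        also have "\<dots> = (\<integral>\<^sup>+\<omega>. indicator (?E k) \<omega> * indicator ?XA \<omega> \<partial>Q)"
          by (rule emeasure_density[OF borel_measurable_indicator[OF E] XA])
        also have "\<dots> = (\<integral>\<^sup>+\<omega>. indicator (?E k \<inter> ?XA) \<omega> \<partial>Q)"
          by (simp only: indicator_inter_arith)
        also have "\<dots> = emeasure Q (?E k \<inter> ?XA)"
          by (rule nn_integral_indicator[OF sets.Int[OF E XA]])
        also have "\<dots> = emeasure Q (?E k) * emeasure Q ?XA" by (rule i)
        finally show "emeasure (distr (density Q (indicator (?E k))) ?B (X k)) A = emeasure (scale_measure (emeasure Q (?E k)) (distr Q ?B (X k))) A"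
          by (simp add: emeasure_distr)
      qed simp
      then have "(\<integral>\<^sup>+x. \<psi> k x \<partial>distr (density Q (indicator (?E k))) ?B (X k)) =
          (\<integral>\<^sup>+x. \<psi> k x \<partial>scale_measure (emeasure Q (?E k)) (distr Q ?B (X k)))" by simp
      moreover have "(\<integral>\<^sup>+x. \<psi> k x \<partial>distr (density Q (indicator (?E k))) ?B (X k)) = (\<integral>\<^sup>+\<omega>. indicator (?E k) \<omega> * \<psi> k (X k \<omega>) \<partial>Q)"
        using \<psi>[of k] by (subst nn_integral_distr) (auto simp: nn_integral_density)
      moreover have "(\<integral>\<^sup>+x. \<psi> k x \<partial>scale_measure (emeasure Q (?E k)) (distr Q ?B (X k))) = emeasure Q (?E k) * (\<integral>\<^sup>+\<omega>. \<psi> k (X k \<omega>) \<partial>Q)"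
        using \<psi>[of k] by (subst nn_integral_scale_measure) (auto simp: nn_integral_distr)
      ultimately show ?thesis by simp
    qed (simp add: \<psi>0)
  qed
  finally show ?thesis .
qed

section \<open>Factorial moments of the spectral point process\<close>

theorem proposition2p4:
  fixes P :: "'w measure" and Q :: "'v measure"
    and \<eta> \<eta>\<^sub>0 :: "'w \<Rightarrow> 'a::polish_space measure"
    and \<gamma> :: "'v \<Rightarrow> 'a measure"
    and \<Lambda> :: "'a measure"
    and F :: "'a measure \<Rightarrow> real"
    and C :: "'a set"
    and h :: "(nat \<Rightarrow> 'a) \<Rightarrow> real"
    and m l :: nat
  assumes "poisson_process P \<eta> \<Lambda>" and "locally_finite \<Lambda>" and "non_atomic \<Lambda>"
    and "independent_copy P \<eta> \<eta>\<^sub>0"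
    and "F \<in> borel_measurable config_algebra"
    and "0 < (\<integral>\<^sup>+\<omega>. ennreal ((F (\<eta> \<omega>))\<^sup>2) \<partial>P)"
    and "(\<integral>\<^sup>+\<omega>. ennreal ((F (\<eta> \<omega>))\<^sup>2) \<partial>P) < \<infinity>"
    and "spectral_point_process P \<eta> \<Lambda> F Q \<gamma>"
    and "1 \<le> m" and "C \<in> sets borel"
    and "(\<integral>\<^sup>+x\<in>pow_set m C. (\<integral>\<^sup>+\<omega>. ennreal ((add_cost m F (\<eta> \<omega>) x)\<^sup>2) \<partial>P) \<partial>pow_measure m \<Lambda>) < \<infinity>"
    and "1 \<le> l" and "l \<le> m"
    and "h \<in> borel_measurable (restrict_space (pow_measure l borel) (pow_set l C))"
    and "\<And>z. z \<in> pow_set l C \<Longrightarrow> 0 \<le> h z"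
    and "bounded (h ` pow_set l C)"
  shows
    "(\<integral>\<^sup>+\<omega>. ennreal ((F (\<eta> \<omega>))\<^sup>2) \<partial>P) *
       (\<integral>\<^sup>+\<omega>. (\<integral>\<^sup>+z\<in>pow_set l C. ennreal (h z) \<partial>factorial_measure l (\<gamma> \<omega>)) \<partial>Q)
     = (\<integral>\<^sup>+\<omega>. (\<integral>\<^sup>+z\<in>pow_set l C. ennreal (h z * (sub_cost_iter l z F (\<eta> \<omega>))\<^sup>2)
          \<partial>factorial_measure l (\<eta> \<omega>)) \<partial>P) \<and>
    (\<integral>\<^sup>+\<omega>. (\<integral>\<^sup>+z\<in>pow_set l C. ennreal (h z * (sub_cost_iter l z F (\<eta> \<omega>))\<^sup>2)
          \<partial>factorial_measure l (\<eta> \<omega>)) \<partial>P)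
     = (\<integral>\<^sup>+\<omega>. (\<integral>\<^sup>+z\<in>pow_set l C. ennreal (h z * (add_cost l F (\<eta> \<omega>) z)\<^sup>2)
          \<partial>pow_measure l \<Lambda>) \<partial>P) \<and>
    (\<integral>\<^sup>+\<omega>. (\<integral>\<^sup>+z\<in>pow_set l C. ennreal (h z * (add_cost l F (\<eta> \<omega>) z)\<^sup>2)
          \<partial>pow_measure l \<Lambda>) \<partial>P)
     = (\<integral>\<^sup>+\<omega>. (\<integral>\<^sup>+z\<in>pow_set l C. ennreal (h z * (add_cost l F (\<eta> \<omega>) z)\<^sup>2)
          \<partial>factorial_measure l (\<eta>\<^sub>0 \<omega>)) \<partial>P)"
proof -
  note pp = assms(1) and F = assms(5) and spp = assms(8) and l1 = assms(12) and h = assms(14) and h0 = assms(15)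
  interpret P: prob_space P using pp by (simp add: poisson_process_def)
  have \<eta> [measurable]: "\<eta> \<in> measurable P config_algebra" using pp by (simp add: poisson_process_def)
  define L where "L = distr P config_algebra \<eta>"
  interpret diffuse_poisson_law L \<Lambda>
    unfolding L_def
  proof (intro diffuse_poisson_law.intro diffuse_poisson_law_axioms.intro poisson_law_of_process[OF pp assms(2)])
    show "emeasure \<Lambda> {x} = 0" for x using assms(3) by (simp add: non_atomic_def)
  qed
  let ?B = "PiM {..<l} (\<lambda>_. borel :: 'a measure)"
  have C [measurable]: "pow_set l C \<in> sets ?B" using assms(10) by (intro sets_PiM_I_finite) auto
  (* The function h, extended by zero. *)
  define g where "g z = ennreal (h z) * indicator (pow_set l C) z" for z
  have g: "g \<in> borel_measurable ?B"
  proof -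
    have "(\<lambda>z. indicator (pow_set l C) z *\<^sub>R h z) \<in> borel_measurable ?B"
      using h C sets.Int[OF C sets.top] by (subst (asm) borel_measurable_restrict_space_iff) auto
    then have "(\<lambda>z. ennreal (indicator (pow_set l C) z *\<^sub>R h z)) \<in> borel_measurable ?B" by measurable
    then show ?thesis
      by (rule measurable_cong[THEN iffD1, rotated]) (auto simp: g_def split: split_indicator)
  qed
  have gh: "ennreal (h z * r\<^sup>2) * indicator (pow_set l C) z = g z * ennreal (r\<^sup>2)" for z and r :: real
    using h0[of z] by (cases "z \<in> pow_set l C") (auto simp: g_def ennreal_mult)
  have cfg: "\<omega> \<in> space P \<Longrightarrow> \<eta> \<omega> \<in> config_space" for \<omega> using measurable_space[OF \<eta>] by simp
  have to_L: "(\<integral>\<^sup>+\<omega>. f (\<eta> \<omega>) \<partial>P) = (\<integral>\<^sup>+\<mu>. f \<mu> \<partial>L)" if "f \<in> borel_measurable config_algebra" for f :: "'a measure \<Rightarrow> ennreal"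
    unfolding L_def using that by (intro nn_integral_distr[symmetric]) auto
  define E2 where "E2 = (\<integral>\<^sup>+\<mu>. ennreal ((F \<mu>)\<^sup>2) \<partial>L)"
  have E2: "(\<integral>\<^sup>+\<omega>. ennreal ((F (\<eta> \<omega>))\<^sup>2) \<partial>P) = E2"
    unfolding E2_def by (intro to_L measurable_compose[OF borel_measurable_power[OF F] measurable_ennreal])
  have E2_pos: "0 < E2" "E2 < \<infinity>" using assms(6,7) unfolding E2 by auto
  (* The common value of the four expressions. *)
  define R where "R = (\<integral>\<^sup>+z. g z * (\<integral>\<^sup>+\<mu>. ennreal ((acost {..<l} F \<mu> z)\<^sup>2) \<partial>L) \<partial>PiM {..<l} (\<lambda>_. \<Lambda>))"

  have sub: "(\<integral>\<^sup>+\<omega>. (\<integral>\<^sup>+z\<in>pow_set l C. ennreal (h z * (sub_cost_iter l z F (\<eta> \<omega>))\<^sup>2) \<partial>factorial_measure l (\<eta> \<omega>)) \<partial>P) = R"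
  proof -
    let ?f = "\<lambda>\<mu>. \<integral>\<^sup>+z. g z * ennreal ((sub_cost_iter l z F \<mu>)\<^sup>2) \<partial>factorial_measure l \<mu>"
    have s: "(\<lambda>q. sub_cost_iter l (fst q) F (snd q)) \<in> borel_measurable (?B \<Otimes>\<^sub>M config_algebra)"
      by (rule measurable_sub_cost_iter[where z="\<lambda>z. z" and G="\<lambda>_. F"])
        (use F in \<open>auto intro: measurable_component_singleton\<close>)
    have m: "(\<lambda>(z, \<mu>). g z * ennreal ((sub_cost_iter l z F \<mu>)\<^sup>2)) \<in> borel_measurable (?B \<Otimes>\<^sub>M config_algebra)"
      unfolding split_beta'
      by (intro borel_measurable_times_ennreal measurable_compose[OF measurable_fst g]
          measurable_compose[OF borel_measurable_power[OF s] measurable_ennreal])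
    have "(\<lambda>\<mu>. \<integral>\<^sup>+z. indicator {z. inj_on z {..<l}} z * (g z * ennreal ((sub_cost_iter l z F \<mu>)\<^sup>2)) \<partial>PiM {..<l} (\<lambda>_. \<mu>)) \<in> borel_measurable config_algebra"
    proof (rule measurable_nn_integral_PiM_config)
      have "(\<lambda>p. (\<lambda>(z, \<mu>). g z * ennreal ((sub_cost_iter l z F \<mu>)\<^sup>2)) (snd p, fst p)) \<in> borel_measurable (config_algebra \<Otimes>\<^sub>M ?B)"
        by (rule measurable_compose[OF measurable_Pair[OF measurable_snd measurable_fst] m])
      then have "(\<lambda>p. g (snd p) * ennreal ((sub_cost_iter l (snd p) F (fst p))\<^sup>2)) \<in> borel_measurable (config_algebra \<Otimes>\<^sub>M ?B)"
        by simp
      from borel_measurable_times_ennreal[OF measurable_compose[OF measurable_snd borel_measurable_indicator_inj[OF finite_lessThan]] this]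
      show "(\<lambda>(\<mu>, z). indicator {z. inj_on z {..<l}} z * (g z * ennreal ((sub_cost_iter l z F \<mu>)\<^sup>2))) \<in> borel_measurable (config_algebra \<Otimes>\<^sub>M ?B)"
        by (simp only: split_beta')
    qed auto
    then have fm: "?f \<in> borel_measurable config_algebra"
      by (rule measurable_cong[THEN iffD1, rotated])
        (use measurable_Pair1[OF m] in \<open>simp add: nn_integral_factorial_measure\<close>)
    have "(\<integral>\<^sup>+\<omega>. (\<integral>\<^sup>+z\<in>pow_set l C. ennreal (h z * (sub_cost_iter l z F (\<eta> \<omega>))\<^sup>2) \<partial>factorial_measure l (\<eta> \<omega>)) \<partial>P) = (\<integral>\<^sup>+\<omega>. ?f (\<eta> \<omega>) \<partial>P)"
      by (simp only: gh)
    also have "\<dots> = (\<integral>\<^sup>+\<mu>. ?f \<mu> \<partial>L)" by (rule to_L[OF fm])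
    also have "\<dots> = R" unfolding R_def by (rule sub_cost_second_moment[OF F g])
    finally show ?thesis .
  qed

  have m2: "(\<lambda>(z, \<mu>). g z * ennreal ((acost {..<l} F \<mu> z)\<^sup>2)) \<in> borel_measurable (?B \<Otimes>\<^sub>M config_algebra)"
    by (rule measurable_acost_square[OF F g])
  have m2': "(\<lambda>(\<mu>, z). g z * ennreal ((acost {..<l} F \<mu> z)\<^sup>2)) \<in> borel_measurable (config_algebra \<Otimes>\<^sub>M ?B)"
    using measurable_compose[OF measurable_Pair[OF measurable_snd measurable_fst] m2] by (simp add: split_beta')
  have add: "(\<integral>\<^sup>+\<omega>. (\<integral>\<^sup>+z\<in>pow_set l C. ennreal (h z * (add_cost l F (\<eta> \<omega>) z)\<^sup>2) \<partial>pow_measure l \<Lambda>) \<partial>P) = R"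
  proof -
    interpret Z: sigma_finite_measure "PiM {..<l} (\<lambda>_. \<Lambda>)" by (rule pow.sigma_finite) simp
    have eq: "sets (config_algebra \<Otimes>\<^sub>M PiM {..<l} (\<lambda>_. \<Lambda>)) = sets (config_algebra \<Otimes>\<^sub>M ?B)"
      by (intro sets_pair_measure_cong sets_pow refl)
    then have "(\<lambda>(\<mu>, z). g z * ennreal ((acost {..<l} F \<mu> z)\<^sup>2)) \<in> borel_measurable (config_algebra \<Otimes>\<^sub>M PiM {..<l} (\<lambda>_. \<Lambda>))"
      using m2' by (simp only: measurable_cong_sets[OF eq refl])
    then have fm: "(\<lambda>\<mu>. \<integral>\<^sup>+z. g z * ennreal ((acost {..<l} F \<mu> z)\<^sup>2) \<partial>PiM {..<l} (\<lambda>_. \<Lambda>)) \<in> borel_measurable config_algebra"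
      by (rule Z.borel_measurable_nn_integral)
    show ?thesis
      unfolding add_cost_eq gh to_L[OF fm] R_def by (rule add_cost_second_moment[OF F g])
  qed

  have copy: "(\<integral>\<^sup>+\<omega>. (\<integral>\<^sup>+z\<in>pow_set l C. ennreal (h z * (add_cost l F (\<eta> \<omega>) z)\<^sup>2) \<partial>factorial_measure l (\<eta>\<^sub>0 \<omega>)) \<partial>P) = R"
  proof -
    let ?f = "\<lambda>\<mu> \<nu>. \<integral>\<^sup>+z. g z * ennreal ((acost {..<l} F \<mu> z)\<^sup>2) \<partial>factorial_measure l \<nu>"
    have iv: "P.indep_var config_algebra \<eta> config_algebra \<eta>\<^sub>0" and law0: "distr P config_algebra \<eta>\<^sub>0 = L"
      using assms(4) unfolding independent_copy_def L_def by blast+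
    have \<eta>0 [measurable]: "\<eta>\<^sub>0 \<in> measurable P config_algebra" by (rule P.indep_var_rv2[OF iv])
    have "distr P config_algebra \<eta> \<Otimes>\<^sub>M distr P config_algebra \<eta>\<^sub>0 =
        distr P (config_algebra \<Otimes>\<^sub>M config_algebra) (\<lambda>\<omega>. (\<eta> \<omega>, \<eta>\<^sub>0 \<omega>))"
      using iv unfolding P.indep_var_distribution_eq by blast
    then have joint: "distr P (config_algebra \<Otimes>\<^sub>M config_algebra) (\<lambda>\<omega>. (\<eta> \<omega>, \<eta>\<^sub>0 \<omega>)) = L \<Otimes>\<^sub>M L"
      unfolding law0 L_def[symmetric] by (rule sym)
    have "(\<lambda>p. \<integral>\<^sup>+z. indicator {z. inj_on z {..<l}} z * (g z * ennreal ((acost {..<l} F (fst p) z)\<^sup>2)) \<partial>PiM {..<l} (\<lambda>_. snd p)) \<in> borel_measurable (config_algebra \<Otimes>\<^sub>M config_algebra)"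
    proof (rule measurable_nn_integral_PiM_config)
      have "(\<lambda>p. (\<lambda>(\<mu>, z). g z * ennreal ((acost {..<l} F \<mu> z)\<^sup>2)) (fst (fst p), snd p)) \<in> borel_measurable ((config_algebra \<Otimes>\<^sub>M config_algebra) \<Otimes>\<^sub>M ?B)"
        by (rule measurable_compose[OF measurable_Pair[OF measurable_compose[OF measurable_fst measurable_fst] measurable_snd] m2'])
      then have "(\<lambda>p. g (snd p) * ennreal ((acost {..<l} F (fst (fst p)) (snd p))\<^sup>2)) \<in> borel_measurable ((config_algebra \<Otimes>\<^sub>M config_algebra) \<Otimes>\<^sub>M ?B)"
        by simp
      from borel_measurable_times_ennreal[OF measurable_compose[OF measurable_snd borel_measurable_indicator_inj[OF finite_lessThan]] this]
      show "(\<lambda>(p, z). indicator {z. inj_on z {..<l}} z * (g z * ennreal ((acost {..<l} F (fst p) z)\<^sup>2))) \<in> borel_measurable ((config_algebra \<Otimes>\<^sub>M config_algebra) \<Otimes>\<^sub>M ?B)"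
        by (simp only: split_beta')
    qed auto
    then have fm: "(\<lambda>p. ?f (fst p) (snd p)) \<in> borel_measurable (config_algebra \<Otimes>\<^sub>M config_algebra)"
      by (rule measurable_cong[THEN iffD1, rotated])
        (use measurable_Pair2[OF m2'] in \<open>auto simp: space_pair_measure nn_integral_factorial_measure\<close>)
    have "(\<integral>\<^sup>+\<omega>. (\<integral>\<^sup>+z\<in>pow_set l C. ennreal (h z * (add_cost l F (\<eta> \<omega>) z)\<^sup>2) \<partial>factorial_measure l (\<eta>\<^sub>0 \<omega>)) \<partial>P) = (\<integral>\<^sup>+\<omega>. ?f (\<eta> \<omega>) (\<eta>\<^sub>0 \<omega>) \<partial>P)"
      by (simp only: gh add_cost_eq)
    also have "\<dots> = (\<integral>\<^sup>+p. ?f (fst p) (snd p) \<partial>(L \<Otimes>\<^sub>M L))"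
      unfolding joint[symmetric] using fm by (subst nn_integral_distr) auto
    also have "\<dots> = (\<integral>\<^sup>+\<mu>. \<integral>\<^sup>+\<nu>. ?f \<mu> \<nu> \<partial>L \<partial>L)"
    proof -
      have eq: "sets (L \<Otimes>\<^sub>M L) = sets (config_algebra \<Otimes>\<^sub>M config_algebra)" by (intro sets_pair_measure_cong sets_law)
      then have "(\<lambda>p. ?f (fst p) (snd p)) \<in> borel_measurable (L \<Otimes>\<^sub>M L)"
        using fm by (simp only: measurable_cong_sets[OF eq refl])
      from nn_integral_fst[OF this] show ?thesis by simp
    qed
    also have "\<dots> = (\<integral>\<^sup>+\<mu>. \<integral>\<^sup>+z. g z * ennreal ((acost {..<l} F \<mu> z)\<^sup>2) \<partial>PiM {..<l} (\<lambda>_. \<Lambda>) \<partial>L)"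
      by (intro nn_integral_cong campbell) (use measurable_Pair2[OF m2'] in simp)
    also have "\<dots> = R" unfolding R_def by (rule add_cost_second_moment[OF F g])
    finally show ?thesis .
  qed

  have spectral: "E2 * (\<integral>\<^sup>+\<omega>. (\<integral>\<^sup>+z\<in>pow_set l C. ennreal (h z) \<partial>factorial_measure l (\<gamma> \<omega>)) \<partial>Q) = R"
  proof -
    let ?K = "kernel_norm2 P \<eta> \<Lambda> F" and ?u = "chaos_kernel P \<eta> F"
    from spp obtain N X where Q: "prob_space Q" and N: "N \<in> measurable Q (count_space UNIV)"
      and Nk: "\<And>k. emeasure Q {\<omega>\<in>space Q. N \<omega> = k} = fact k * ?K k / E2"
      and X: "\<And>k. 1 \<le> k \<Longrightarrow> X k \<in> measurable Q (pow_measure k borel)"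
      and dist: "\<And>k. 1 \<le> k \<Longrightarrow> ?K k \<noteq> 0 \<Longrightarrow> distributed Q (pow_measure k \<Lambda>) (X k) (\<lambda>x. ennreal ((?u k x)\<^sup>2) / ?K k)"
      and ind: "prob_space.indep_set Q
          (sets (vimage_algebra (space Q) N (count_space UNIV)))
          (sets (vimage_algebra (space Q) (\<lambda>\<omega>. \<lambda>k\<in>{1..}. X k \<omega>) (PiM {1..} (\<lambda>k. pow_measure k borel))))"
      and \<gamma>: "\<And>\<omega>. \<omega> \<in> space Q \<Longrightarrow> \<gamma> \<omega> = dirac_sum {..<N \<omega>} (X (N \<omega>) \<omega>)"
      unfolding spectral_point_process_def E2 by blast
    interpret Q: prob_space Q by fact
    have u: "?u k x = dmean {..<k} F x / fact k" if "x \<in> space (pow_measure k \<Lambda>)" for k x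
    proof -
      have "(\<integral>\<omega>. acost {..<k} F (\<eta> \<omega>) x \<partial>P) = dmean {..<k} F x"
        unfolding dmean_def unfolding L_def
        by (rule integral_distr[symmetric]) (use measurable_acost[OF finite_lessThan F, of x k] that in \<open>auto simp: space_pow\<close>)
      then show ?thesis by (simp add: chaos_kernel_def add_cost_eq)
    qed
    have u2: "ennreal ((?u k x)\<^sup>2) = ennreal (1 / (fact k)\<^sup>2) * ennreal ((dmean {..<k} F x)\<^sup>2)" if "x \<in> space (pow_measure k \<Lambda>)" for k x
      by (simp add: u[OF that] power_divide ennreal_mult[symmetric])
    have u2m: "(\<lambda>x. ennreal ((?u k x)\<^sup>2)) \<in> borel_measurable (pow_measure k \<Lambda>)" for k
    proof -
      have "(\<lambda>x. ennreal (1 / (fact k)\<^sup>2) * ennreal ((dmean {..<k} F x)\<^sup>2)) \<in> borel_measurable (pow_measure k \<Lambda>)"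
        unfolding measurable_pow_iff by (intro borel_measurable_times_ennreal dmean_square_measurable F) auto
      then show ?thesis by (rule measurable_cong[THEN iffD1, rotated]) (simp add: u2)
    qed
    have tm: "tuple_sum l g k \<in> borel_measurable (pow_measure k \<Lambda>)" for k
      using tuple_sum_measurable[OF g] by (simp only: measurable_pow_iff)
    let ?t = "\<lambda>k. \<integral>\<^sup>+x. ennreal ((?u k x)\<^sup>2) * tuple_sum l g k x \<partial>pow_measure k \<Lambda>"
    have "(\<integral>\<^sup>+\<omega>. (\<integral>\<^sup>+z\<in>pow_set l C. ennreal (h z) \<partial>factorial_measure l (\<gamma> \<omega>)) \<partial>Q) =
        (\<integral>\<^sup>+\<omega>. tuple_sum l g (N \<omega>) (X (N \<omega>) \<omega>) \<partial>Q)"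
      by (intro nn_integral_cong) (simp add: \<gamma> nn_integral_factorial_dirac_sum[OF g] g_def[symmetric])
    also have "\<dots> = (\<Sum>k. emeasure Q {\<omega>\<in>space Q. N \<omega> = k} * (\<integral>\<^sup>+\<omega>. tuple_sum l g k (X k \<omega>) \<partial>Q))"
      by (rule nn_integral_mixture[OF Q N X ind tuple_sum_measurable[OF g] tuple_sum_zero[OF l1]])
    finally have "E2 * (\<integral>\<^sup>+\<omega>. (\<integral>\<^sup>+z\<in>pow_set l C. ennreal (h z) \<partial>factorial_measure l (\<gamma> \<omega>)) \<partial>Q) =
        (\<Sum>k. E2 * (emeasure Q {\<omega>\<in>space Q. N \<omega> = k} * (\<integral>\<^sup>+\<omega>. tuple_sum l g k (X k \<omega>) \<partial>Q)))"
      by simp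
    also have "\<dots> = (\<Sum>k. fact k * ?t k)"
    proof (intro suminf_cong)
      fix k
      show "E2 * (emeasure Q {\<omega>\<in>space Q. N \<omega> = k} * (\<integral>\<^sup>+\<omega>. tuple_sum l g k (X k \<omega>) \<partial>Q)) = fact k * ?t k"
      proof (cases "k = 0")
        case True then show ?thesis by (simp add: tuple_sum_zero[OF l1])
      next
        case k: False
        show ?thesis
        proof (cases "?K k = 0")
          case True
          then have "AE x in pow_measure k \<Lambda>. ennreal ((?u k x)\<^sup>2) = 0"
            unfolding kernel_norm2_def using u2m nn_integral_0_iff_AE by blast
          then have "AE x in pow_measure k \<Lambda>. ennreal ((?u k x)\<^sup>2) * tuple_sum l g k x = 0"
            by (rule AE_mp) (auto intro!: AE_I2)
          then have "?t k = (\<integral>\<^sup>+x. 0 \<partial>pow_measure k \<Lambda>)" by (rule nn_integral_cong_AE)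
          then show ?thesis using True by (simp add: Nk)
        next
          case K0: False
          (* Otherwise the event N = k would have infinite probability. *)
          have K_fin: "?K k \<noteq> top"
          proof
            assume "?K k = top"
            then have "emeasure Q {\<omega>\<in>space Q. N \<omega> = k} = top"
              unfolding Nk using E2_pos by (simp add: ennreal_mult_top ennreal_top_divide)
            then show False using Q.emeasure_finite[of "{\<omega>\<in>space Q. N \<omega> = k}"] by simp
          qed
          have "(\<integral>\<^sup>+\<omega>. tuple_sum l g k (X k \<omega>) \<partial>Q) = (\<integral>\<^sup>+x. ennreal ((?u k x)\<^sup>2) / ?K k * tuple_sum l g k x \<partial>pow_measure k \<Lambda>)"
            using k K0 by (intro distributed_nn_integral[symmetric] dist tm) auto
          also have "\<dots> = (\<integral>\<^sup>+x. (ennreal ((?u k x)\<^sup>2) * tuple_sum l g k x) * inverse (?K k) \<partial>pow_measure k \<Lambda>)"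
            by (intro nn_integral_cong) (simp add: divide_ennreal_def mult_ac)
          also have "\<dots> = ?t k * inverse (?K k)"
            by (intro nn_integral_multc borel_measurable_times_ennreal u2m tm)
          finally have "E2 * (emeasure Q {\<omega>\<in>space Q. N \<omega> = k} * (\<integral>\<^sup>+\<omega>. tuple_sum l g k (X k \<omega>) \<partial>Q)) =
              (E2 / E2) * (?K k / ?K k) * (fact k * ?t k)"
            unfolding Nk by (simp add: divide_ennreal_def mult_ac)
          moreover have "E2 / E2 = 1" "?K k / ?K k = 1"
            using E2_pos K0 K_fin by (auto intro!: ennreal_divide_self simp: less_top)
          ultimately show ?thesis by simp
        qed
      qed
    qed
    also have "\<dots> = (\<Sum>k. if l \<le> k then ennreal (1 / fact (k - l)) * spectral_mass F l g k else 0)"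
    proof (intro suminf_cong)
      fix k
      have "?t k = (\<integral>\<^sup>+x. ennreal (1 / (fact k)\<^sup>2) * (ennreal ((dmean {..<k} F x)\<^sup>2) * tuple_sum l g k x) \<partial>pow_measure k \<Lambda>)"
        by (intro nn_integral_cong) (simp add: u2 mult.assoc)
      also have "\<dots> = ennreal (1 / (fact k)\<^sup>2) * (\<integral>\<^sup>+x. ennreal ((dmean {..<k} F x)\<^sup>2) * tuple_sum l g k x \<partial>pow_measure k \<Lambda>)"
        using dmean_square_measurable[OF F, of k]
        by (intro nn_integral_cmult borel_measurable_times_ennreal tm) (simp only: measurable_pow_iff)
      also have "\<dots> = ennreal (1 / (fact k)\<^sup>2) * (if l \<le> k then ennreal (fact k / fact (k - l)) * spectral_mass F l g k else 0)"
        by (simp only: nn_integral_tuple_sum[OF F g])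
      moreover have fact_eq: "(fact k :: ennreal) = ennreal (fact k)"
        by (metis ennreal_of_nat_eq_real_of_nat of_nat_fact)
      ultimately have "fact k * ?t k = (if l \<le> k then (ennreal (fact k) * ennreal (1 / (fact k)\<^sup>2) * ennreal (fact k / fact (k - l))) * spectral_mass F l g k else 0)"
        unfolding fact_eq by (simp add: mult.assoc)
      also have "ennreal (fact k) * ennreal (1 / (fact k)\<^sup>2) * ennreal (fact k / fact (k - l)) = ennreal (1 / fact (k - l))"
        by (simp add: ennreal_mult[symmetric] power2_eq_square)
      finally show "fact k * ?t k = (if l \<le> k then ennreal (1 / fact (k - l)) * spectral_mass F l g k else 0)" .
    qed
    also have "\<dots> = (\<Sum>k. ennreal (1 / fact k) * spectral_mass F l g (l + k))"
      using suminf_offset[OF summableI, of "\<lambda>k. if l \<le> k then ennreal (1 / fact (k - l)) * spectral_mass F l g k else 0" l]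
      by (simp add: add.commute)
    also have "\<dots> = R"
      unfolding R_def using E2_pos by (intro second_moment_eq_spectral_mass[symmetric] F g) (simp add: E2_def)
    finally show ?thesis .
  qed
  show ?thesis unfolding E2 spectral sub add copy by simp
qed

end
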